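(* Let $\mathcal{H}$ be a complex separable Hilbert space and let $\mathrm{Gr}(\mathcal{H})$ be the Grassmannian of all closed subspaces of $\mathcal{H}$, with its Banach manifold structure given by the charts $\phi_V:\Omega_V\to L(V,V^\perp)$, $V\in\mathrm{Gr}(\mathcal{H})$. Then a precotangent bundle $T_*\mathrm{Gr}(\mathcal{H})\subset T^*\mathrm{Gr}(\mathcal{H})$ exists, and it is given locally, for every $V\in\mathrm{Gr}(\mathcal{H})$, by $$T_*\mathrm{Gr}(\mathcal{H})_{|\Omega_V}=(T\phi_V)^*\big(L^1(V^\perp,V)\big),$$ i.e. for every $U\in\Omega_V$ the fiber of $T_*\mathrm{Gr}(\mathcal{H})$ over $U$ is the set of functionals on $T_U\mathrm{Gr}(\mathcal{H})$ of the form $\tilde v\mapsto \mathrm{Tr}\big(\mu\, T_U\phi_V(\tilde v)\big)$ with $\mu\in L^1(V^\perp,V)$.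
   Context: Precotangent bundle: for a smooth Banach manifold $M$, a precotangent bundle $T_*M$ is a Banach subbundle of the cotangent bundle $T^*M$ such that $({T_*}_pM)^*=T_pM$ for every $p\in M$; the identification is the one given by the canonical pairing, i.e. the evaluation map $T_pM\to({T_*}_pM)^*$, $v\mapsto(\mu\mapsto\mu(v))$, is an isomorphism of Banach spaces. Here a Banach subbundle of a Banach vector bundle $E\to M$ is a subset that around each point, in a suitable local trivialization $E_{|U}\cong U\times Y$ of $E$, corresponds to $U\times Z$ for a closed subspace $Z\subset Y$ (the subspace $Z$ is not required to be complemented). Notation: $L(X,Y)$ is the Banach space of bounded linear operators $X\to Y$, and $L^1(X,Y)$ is the Banach space of trace-class operators between Hilbert spaces. For a closed subspace $V\subset\mathcal{H}$, $P_V$ is the orthogonal projector onto $V$ and $(P_V)^\perp=P_{V^\perp}=1-P_V$. Manifold structure of $\mathrm{Gr}(\mathcal{H})$: for $V\in\mathrm{Gr}(\mathcal{H})$ put $\Omega_V=\{W\in\mathrm{Gr}(\mathcal{H})\mid V\oplus W^\perp=\mathcal{H}\}$ and define the chart $\phi_V:\Omega_V\to L(V,V^\perp)$ by $\phi_V(W)=(P_V)^\perp P_WP_V(P_VP_WP_V)^{-1}$, where the inverse is that of $P_VP_WP_V$ regarded as an operator on $V$. The inverse chart sends $A\in L(V,V^\perp)$ to its graph $\{v+Av\mid v\in V\}\subset V\oplus V^\perp=\mathcal{H}$. For $U\in\Omega_V$, the tangent map $T_U\phi_V$ identifies $T_U\mathrm{Gr}(\mathcal{H})$ with $L(V,V^\perp)$.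 The space $L^1(V^\perp,V)$ is regarded as a subspace of $L(V,V^\perp)^*$ via the trace pairing $\langle\mu;v\rangle=\mathrm{Tr}(\mu v)$. *)

theory Defs
  imports "HOL-Analysis.Analysis" "HOL-Library.Function_Algebras"
begin

section \<open>Complex vector spaces and complex Hilbert spaces\<close>

class complex_vector = real_vector +
  fixes scaleC :: "complex \<Rightarrow> 'a \<Rightarrow> 'a" (infixr \<open>*\<^sub>C\<close> 75)
  assumes scaleC_add_right: "a *\<^sub>C (x + y) = a *\<^sub>C x + a *\<^sub>C y"
    and scaleC_add_left: "(a + b) *\<^sub>C x = a *\<^sub>C x + b *\<^sub>C x"
    and scaleC_scaleC: "a *\<^sub>C (b *\<^sub>C x) = (a * b) *\<^sub>C x"
    and scaleC_one: "1 *\<^sub>C x = x"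
    and scaleR_conv_scaleC: "r *\<^sub>R x = complex_of_real r *\<^sub>C x"

text \<open>The inner product is linear in the second argument.\<close>

class complex_hilbert = complex_vector + real_normed_vector + complete_space +
  fixes cinner :: "'a \<Rightarrow> 'a \<Rightarrow> complex"
  assumes cinner_commute: "cinner y x = cnj (cinner x y)"
    and cinner_add_right: "cinner x (y + z) = cinner x y + cinner x z"
    and cinner_scaleC_right: "cinner x (a *\<^sub>C y) = a * cinner x y"
    and cinner_self: "cinner x x = complex_of_real ((norm x)\<^sup>2)"

instantiation complex :: complex_hilbert
begin

definition scaleC_complex :: "complex \<Rightarrow> complex \<Rightarrow> complex"
  where "scaleC_complex a x = a * x"

definition cinner_complex :: "complex \<Rightarrow> complex \<Rightarrow> complex"
  where "cinner_complex x y = cnj x * y"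

instance
proof
  fix x :: complex
  show "cinner x x = complex_of_real ((norm x)\<^sup>2)"
    unfolding cinner_complex_def by (metis complex_norm_square mult.commute)
qed (simp_all add: scaleC_complex_def cinner_complex_def algebra_simps scaleR_conv_of_real)

end

instantiation "fun" :: (type, complex_vector) complex_vector
begin

definition scaleR_fun :: "real \<Rightarrow> ('a \<Rightarrow> 'b) \<Rightarrow> 'a \<Rightarrow> 'b"
  where "scaleR_fun r f = (\<lambda>x. r *\<^sub>R f x)"

definition scaleC_fun :: "complex \<Rightarrow> ('a \<Rightarrow> 'b) \<Rightarrow> 'a \<Rightarrow> 'b"
  where "scaleC_fun c f = (\<lambda>x. c *\<^sub>C f x)"

instance
  by standard
    (simp_all add: scaleR_fun_def scaleC_fun_def fun_eq_iff scaleR_add_right scaleR_add_left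
      scaleC_add_right scaleC_add_left scaleC_scaleC scaleC_one scaleR_conv_scaleC)

end

definition csubspace :: "'v::complex_vector set \<Rightarrow> bool"
  where "csubspace V \<longleftrightarrow>
    0 \<in> V \<and> (\<forall>x\<in>V. \<forall>y\<in>V. x + y \<in> V) \<and> (\<forall>c. \<forall>x\<in>V. c *\<^sub>C x \<in> V)"


section \<open>Complex Banach spaces as sets of vectors with a norm\<close>

text \<open>The model spaces of the Grassmannian vary from chart to chart, and they, their duals and the
  spaces of operators between them all have to be available as sets rather than types. A normed
  space is therefore a set of vectors of some complex vector space together with a norm that is
  meaningful on that set only. Maps defined on a subspace are total functions that vanish
  outside it.\<close>

record 'v nspace =
  vecs :: "'v set"
  nrm :: "'v \<Rightarrow> real"

definition banach_space :: "'v::complex_vector nspace \<Rightarrow> bool"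
  where "banach_space X \<longleftrightarrow>
    csubspace (vecs X) \<and>
    (\<forall>x\<in>vecs X. 0 \<le> nrm X x \<and> (nrm X x = 0 \<longleftrightarrow> x = 0)) \<and>
    (\<forall>x\<in>vecs X. \<forall>y\<in>vecs X. nrm X (x + y) \<le> nrm X x + nrm X y) \<and>
    (\<forall>c. \<forall>x\<in>vecs X. nrm X (c *\<^sub>C x) = cmod c * nrm X x) \<and>
    (\<forall>s. (\<forall>n. s n \<in> vecs X) \<and>
        (\<forall>e>0. \<exists>N::nat. \<forall>m\<ge>N. \<forall>n\<ge>N. nrm X (s m - s n) < e) \<longrightarrow>
      (\<exists>x\<in>vecs X. (\<lambda>n. nrm X (s n - x)) \<longlonglongrightarrow> 0))"

definition open_in :: "'v::complex_vector nspace \<Rightarrow> 'v set \<Rightarrow> bool"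
  where "open_in X U \<longleftrightarrow>
    U \<subseteq> vecs X \<and> (\<forall>x\<in>U. \<exists>e>0. \<forall>y\<in>vecs X. nrm X (y - x) < e \<longrightarrow> y \<in> U)"

definition closed_subspace :: "'v::complex_vector nspace \<Rightarrow> 'v set \<Rightarrow> bool"
  where "closed_subspace X Z \<longleftrightarrow> Z \<subseteq> vecs X \<and> csubspace Z \<and> open_in X (vecs X - Z)"

definition restrict_nspace :: "'v nspace \<Rightarrow> 'v set \<Rightarrow> 'v nspace"
  where "restrict_nspace X Z = \<lparr>vecs = Z, nrm = nrm X\<rparr>"

definition linear_on :: "'v::complex_vector set \<Rightarrow> ('v \<Rightarrow> 'w::complex_vector) \<Rightarrow> bool"
  where "linear_on V T \<longleftrightarrow>
    (\<forall>x\<in>V. \<forall>y\<in>V. T (x + y) = T x + T y) \<and> (\<forall>c. \<forall>x\<in>V. T (c *\<^sub>C x) = c *\<^sub>C T x)"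

definition bounded_linear_map ::
    "'v::complex_vector nspace \<Rightarrow> 'w::complex_vector nspace \<Rightarrow> ('v \<Rightarrow> 'w) \<Rightarrow> bool"
  where "bounded_linear_map X Y T \<longleftrightarrow>
    T ` vecs X \<subseteq> vecs Y \<and> linear_on (vecs X) T \<and>
    (\<exists>K. \<forall>x\<in>vecs X. nrm Y (T x) \<le> K * nrm X x)"

definition banach_iso ::
    "'v::complex_vector nspace \<Rightarrow> 'w::complex_vector nspace \<Rightarrow> ('v \<Rightarrow> 'w) \<Rightarrow> bool"
  where "banach_iso X Y T \<longleftrightarrow>
    bij_betw T (vecs X) (vecs Y) \<and> bounded_linear_map X Y T \<and>
    bounded_linear_map Y X (inv_into (vecs X) T)"

definition zero_outside :: "'v set \<Rightarrow> ('v \<Rightarrow> 'w::zero) \<Rightarrow> 'v \<Rightarrow> 'w"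
  where "zero_outside V T = (\<lambda>x. if x \<in> V then T x else 0)"

text \<open>The space \<open>L(X,Y)\<close> with the operator norm.\<close>

definition operators ::
    "'v::complex_vector nspace \<Rightarrow> 'w::complex_vector nspace \<Rightarrow> ('v \<Rightarrow> 'w) nspace"
  where "operators X Y =
    \<lparr>vecs = {T. bounded_linear_map X Y T \<and> (\<forall>x. x \<notin> vecs X \<longrightarrow> T x = 0)},
     nrm = (\<lambda>T. Sup {nrm Y (T x) | x. x \<in> vecs X \<and> nrm X x \<le> 1})\<rparr>"

definition dual :: "'v::complex_vector nspace \<Rightarrow> ('v \<Rightarrow> complex) nspace"
  where "dual X = operators X \<lparr>vecs = UNIV, nrm = cmod\<rparr>"


section \<open>Smooth maps between Banach spaces\<close>

text \<open>\<open>T\<close> is the complex Frechet derivative at \<open>x\<close> of \<open>f : U \<rightarrow> Y\<close>, where \<open>U\<close> is open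
  in \<open>X\<close>.\<close>

definition has_fderiv ::
    "'v::complex_vector nspace \<Rightarrow> 'v set \<Rightarrow> 'w::complex_vector nspace \<Rightarrow>
     ('v \<Rightarrow> 'w) \<Rightarrow> ('v \<Rightarrow> 'w) \<Rightarrow> 'v \<Rightarrow> bool"
  where "has_fderiv X U Y f T x \<longleftrightarrow>
    T \<in> vecs (operators X Y) \<and>
    (\<forall>e>0. \<exists>d>0. \<forall>y\<in>U. nrm X (y - x) < d \<longrightarrow>
      nrm Y (f y - f x - T (y - x)) \<le> e * nrm X (y - x))"

text \<open>Bounded \<open>k\<close>-linear maps, taking their arguments as a list of length \<open>k\<close>. They are used to
  express derivatives of all orders, which have different types when they are written as
  iterated operators in \<open>L(X,L(X,\<dots>))\<close>.\<close>

definition multilinear_maps ::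
    "nat \<Rightarrow> 'v::complex_vector nspace \<Rightarrow> 'w::complex_vector nspace \<Rightarrow> ('v list \<Rightarrow> 'w) nspace"
  where "multilinear_maps k X Y =
    \<lparr>vecs = {T.
       (\<forall>vs. length vs = k \<and> set vs \<subseteq> vecs X \<longrightarrow> T vs \<in> vecs Y) \<and>
       (\<forall>vs. \<not> (length vs = k \<and> set vs \<subseteq> vecs X) \<longrightarrow> T vs = 0) \<and>
       (\<forall>us ws. length us + 1 + length ws = k \<and> set us \<subseteq> vecs X \<and> set ws \<subseteq> vecs X \<longrightarrow>
         linear_on (vecs X) (\<lambda>v. T (us @ v # ws))) \<and>
       (\<exists>K. \<forall>vs. length vs = k \<and> set vs \<subseteq> vecs X \<longrightarrow>
         nrm Y (T vs) \<le> K * prod_list (map (nrm X) vs))},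
     nrm = (\<lambda>T. Sup {nrm Y (T vs) | vs.
       length vs = k \<and> set vs \<subseteq> vecs X \<and> (\<forall>v\<in>set vs. nrm X v \<le> 1)})\<rparr>"

text \<open>\<open>D k x\<close> is the \<open>k\<close>-th derivative of \<open>f\<close> at \<open>x\<close>.\<close>

definition smooth_on ::
    "'v::complex_vector nspace \<Rightarrow> 'v set \<Rightarrow> 'w::complex_vector nspace \<Rightarrow> ('v \<Rightarrow> 'w) \<Rightarrow> bool"
  where "smooth_on X U Y f \<longleftrightarrow>
    (\<exists>D :: nat \<Rightarrow> 'v \<Rightarrow> 'v list \<Rightarrow> 'w. \<forall>x\<in>U.
      D 0 x [] = f x \<and>
      (\<forall>k. D k x \<in> vecs (multilinear_maps k X Y) \<and>
        has_fderiv X U (multilinear_maps k X Y) (D k) (\<lambda>h vs. D (Suc k) x (h # vs)) x))"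


section \<open>Banach manifolds, tangent spaces, vector bundles\<close>

text \<open>Charts are indexed by \<open>index M\<close>; the chart \<open>chart M i\<close> is defined on \<open>domain M i\<close> and takes
  values in the Banach space \<open>model M i\<close>.\<close>

record ('i, 'p, 'v) manifold =
  index :: "'i set"
  domain :: "'i \<Rightarrow> 'p set"
  chart :: "'i \<Rightarrow> 'p \<Rightarrow> 'v"
  model :: "'i \<Rightarrow> 'v nspace"

definition points :: "('i, 'p, 'v) manifold \<Rightarrow> 'p set"
  where "points M = (\<Union>i\<in>index M. domain M i)"

definition charts_at :: "('i, 'p, 'v) manifold \<Rightarrow> 'p \<Rightarrow> 'i set"
  where "charts_at M p = {i \<in> index M. p \<in> domain M i}"

definition inv_chart :: "('i, 'p, 'v) manifold \<Rightarrow> 'i \<Rightarrow> 'v \<Rightarrow> 'p"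
  where "inv_chart M i = inv_into (domain M i) (chart M i)"

definition transition :: "('i, 'p, 'v) manifold \<Rightarrow> 'i \<Rightarrow> 'i \<Rightarrow> 'v \<Rightarrow> 'v"
  where "transition M i j = (\<lambda>x. chart M j (inv_chart M i x))"

definition banach_manifold :: "('i, 'p, 'v::complex_vector) manifold \<Rightarrow> bool"
  where "banach_manifold M \<longleftrightarrow>
    (\<forall>i\<in>index M. banach_space (model M i) \<and> inj_on (chart M i) (domain M i)) \<and>
    (\<forall>i\<in>index M. \<forall>j\<in>index M.
      open_in (model M i) (chart M i ` (domain M i \<inter> domain M j)) \<and>
      smooth_on (model M i) (chart M i ` (domain M i \<inter> domain M j)) (model M j)
        (transition M i j))"

definition manifold_open :: "('i, 'p, 'v::complex_vector) manifold \<Rightarrow> 'p set \<Rightarrow> bool"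
  where "manifold_open M U \<longleftrightarrow>
    U \<subseteq> points M \<and> (\<forall>i\<in>index M. open_in (model M i) (chart M i ` (U \<inter> domain M i)))"

definition smooth_map ::
    "('i, 'p, 'v::complex_vector) manifold \<Rightarrow> 'p set \<Rightarrow> 'w::complex_vector nspace \<Rightarrow>
     ('p \<Rightarrow> 'w) \<Rightarrow> bool"
  where "smooth_map M U Y f \<longleftrightarrow>
    (\<forall>i\<in>index M. smooth_on (model M i) (chart M i ` (U \<inter> domain M i)) Y
      (\<lambda>x. f (inv_chart M i x)))"

text \<open>A tangent vector at \<open>p\<close> is an equivalence class of pairs \<open>(i,v)\<close>, where \<open>i\<close> is a chart around
  \<open>p\<close> and \<open>v\<close> a vector of its model space, and \<open>(i,v)\<close> and \<open>(j,w)\<close> are equivalent if the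
  derivative of the transition map takes \<open>v\<close> to \<open>w\<close>. Such a class contains exactly one pair
  \<open>(i,v)\<close> for every chart \<open>i\<close> around \<open>p\<close>, and it is represented here by the function \<open>\<xi>\<close>
  sending \<open>i\<close> to \<open>v\<close>, which makes the vector space operations pointwise. The tangent map at \<open>p\<close>
  of the chart \<open>i\<close> is evaluation at \<open>i\<close>.\<close>

definition tangent_vectors ::
    "('i, 'p, 'v::complex_vector) manifold \<Rightarrow> 'p \<Rightarrow> ('i \<Rightarrow> 'v) set"
  where "tangent_vectors M p =
    {\<xi>. (\<forall>i. i \<notin> charts_at M p \<longrightarrow> \<xi> i = 0) \<and>
      (\<forall>i\<in>charts_at M p. \<xi> i \<in> vecs (model M i)) \<and>
      (\<forall>i\<in>charts_at M p. \<forall>j\<in>charts_at M p. \<exists>T.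
        has_fderiv (model M i) (chart M i ` (domain M i \<inter> domain M j)) (model M j)
          (transition M i j) T (chart M i p) \<and>
        \<xi> j = T (\<xi> i))}"

definition tangent_chart :: "'i \<Rightarrow> ('i \<Rightarrow> 'v) \<Rightarrow> 'v"
  where "tangent_chart i \<xi> = \<xi> i"

text \<open>The tangent space has no preferred norm. Each chart around \<open>p\<close> induces one, and all of these
  are equivalent.\<close>

definition tangent_space ::
    "('i, 'p, 'v::complex_vector) manifold \<Rightarrow> 'i \<Rightarrow> 'p \<Rightarrow> ('i \<Rightarrow> 'v) nspace"
  where "tangent_space M i p =
    \<lparr>vecs = tangent_vectors M p, nrm = (\<lambda>\<xi>. nrm (model M i) (tangent_chart i \<xi>))\<rparr>"

definition cotangent_vectors ::
    "('i, 'p, 'v::complex_vector) manifold \<Rightarrow> 'p \<Rightarrow> (('i \<Rightarrow> 'v) \<Rightarrow> complex) set"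
  where "cotangent_vectors M p = (\<Union>i\<in>charts_at M p. vecs (dual (tangent_space M i p)))"

record ('k, 'p, 'f, 'y) vector_bundle =
  fibre :: "'p \<Rightarrow> 'f set"
  bindex :: "'k set"
  bdomain :: "'k \<Rightarrow> 'p set"
  bmodel :: "'k \<Rightarrow> 'y nspace"
  triv :: "'k \<Rightarrow> 'p \<Rightarrow> 'f \<Rightarrow> 'y"

definition total_space ::
    "('i, 'p, 'v) manifold \<Rightarrow> ('k, 'p, 'f, 'y) vector_bundle \<Rightarrow> ('p \<times> 'f) set"
  where "total_space M E = Sigma (points M) (fibre E)"

text \<open>The map \<open>\<psi>' \<circ> \<psi>\<^sup>-\<^sup>1\<close> from the typical fibre \<open>Y\<close> of \<open>\<psi>\<close> to that of \<open>\<psi>'\<close>, over a point with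
  fibre \<open>F\<close>.\<close>

definition fibre_transition ::
    "'f set \<Rightarrow> 'y nspace \<Rightarrow> ('f \<Rightarrow> 'y) \<Rightarrow> ('f \<Rightarrow> 'z::zero) \<Rightarrow> 'y \<Rightarrow> 'z"
  where "fibre_transition F Y \<psi> \<psi>' = zero_outside (vecs Y) (\<lambda>y. \<psi>' (inv_into F \<psi> y))"

definition local_trivialization ::
    "('i, 'p, 'v::complex_vector) manifold \<Rightarrow>
     ('k, 'p, 'f::complex_vector, 'y::complex_vector) vector_bundle \<Rightarrow>
     'p set \<Rightarrow> 'y nspace \<Rightarrow> ('p \<Rightarrow> 'f \<Rightarrow> 'y) \<Rightarrow> bool"
  where "local_trivialization M E U Y \<psi> \<longleftrightarrow>
    manifold_open M U \<and> banach_space Y \<and>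
    (\<forall>q\<in>U. bij_betw (\<psi> q) (fibre E q) (vecs Y) \<and> linear_on (fibre E q) (\<psi> q)) \<and>
    (\<forall>k\<in>bindex E.
      smooth_map M (U \<inter> bdomain E k) (operators (bmodel E k) Y)
        (\<lambda>q. fibre_transition (fibre E q) (bmodel E k) (triv E k q) (\<psi> q)) \<and>
      smooth_map M (U \<inter> bdomain E k) (operators Y (bmodel E k))
        (\<lambda>q. fibre_transition (fibre E q) Y (\<psi> q) (triv E k q)))"

definition banach_vector_bundle ::
    "('i, 'p, 'v::complex_vector) manifold \<Rightarrow>
     ('k, 'p, 'f::complex_vector, 'y::complex_vector) vector_bundle \<Rightarrow> bool"
  where "banach_vector_bundle M E \<longleftrightarrow>
    banach_manifold M \<and>
    (\<forall>p\<in>points M. csubspace (fibre E p)) \<and>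
    (\<Union>k\<in>bindex E. bdomain E k) = points M \<and>
    (\<forall>k\<in>bindex E. local_trivialization M E (bdomain E k) (bmodel E k) (triv E k))"

definition banach_subbundle ::
    "('i, 'p, 'v::complex_vector) manifold \<Rightarrow>
     ('k, 'p, 'f::complex_vector, 'y::complex_vector) vector_bundle \<Rightarrow> ('p \<times> 'f) set \<Rightarrow> bool"
  where "banach_subbundle M E S \<longleftrightarrow>
    banach_vector_bundle M E \<and>
    S \<subseteq> total_space M E \<and>
    (\<forall>p\<in>points M. \<exists>U Y \<psi> Z.
      p \<in> U \<and> local_trivialization M E U Y \<psi> \<and> closed_subspace Y Z \<and>
      (\<forall>q\<in>U. \<psi> q ` (S `` {q}) = Z))"

text \<open>Over the domain of a chart \<open>i\<close>, the cotangent bundle is trivialized by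
  \<open>f \<mapsto> f \<circ> (T\<^sub>p\<phi>\<^sub>i)\<^sup>-\<^sup>1\<close>.\<close>

definition cotangent_bundle ::
    "('i, 'p, 'v::complex_vector) manifold \<Rightarrow>
     ('i, 'p, ('i \<Rightarrow> 'v) \<Rightarrow> complex, 'v \<Rightarrow> complex) vector_bundle"
  where "cotangent_bundle M =
    \<lparr>fibre = cotangent_vectors M,
     bindex = index M,
     bdomain = domain M,
     bmodel = (\<lambda>i. dual (model M i)),
     triv = (\<lambda>i p f. zero_outside (vecs (model M i))
       (\<lambda>v. f (inv_into (tangent_vectors M p) (tangent_chart i) v)))\<rparr>"

definition evaluation :: "('x \<Rightarrow> complex) set \<Rightarrow> 'x \<Rightarrow> ('x \<Rightarrow> complex) \<Rightarrow> complex"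
  where "evaluation F v = zero_outside F (\<lambda>\<mu>. \<mu> v)"

definition precotangent_bundle ::
    "('i, 'p, 'v::complex_vector) manifold \<Rightarrow> ('p \<times> (('i \<Rightarrow> 'v) \<Rightarrow> complex)) set \<Rightarrow> bool"
  where "precotangent_bundle M S \<longleftrightarrow>
    banach_subbundle M (cotangent_bundle M) S \<and>
    (\<forall>p\<in>points M. \<forall>i\<in>charts_at M p.
      banach_iso (tangent_space M i p)
        (dual (restrict_nspace (dual (tangent_space M i p)) (S `` {p})))
        (evaluation (S `` {p})))"


section \<open>Trace-class operators between closed subspaces of a Hilbert space\<close>

definition subspace_nspace :: "'h::complex_hilbert set \<Rightarrow> 'h nspace"
  where "subspace_nspace V = \<lparr>vecs = V, nrm = norm\<rparr>"

abbreviation bounded_ops ::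
    "'h::complex_hilbert set \<Rightarrow> 'h set \<Rightarrow> ('h \<Rightarrow> 'h) nspace"
  where "bounded_ops V W \<equiv> operators (subspace_nspace V) (subspace_nspace W)"

definition orthonormal_basis :: "'h::complex_hilbert set \<Rightarrow> 'h set \<Rightarrow> bool"
  where "orthonormal_basis V B \<longleftrightarrow>
    B \<subseteq> V \<and> (\<forall>e\<in>B. \<forall>e'\<in>B. cinner e e' = (if e = e' then 1 else 0)) \<and>
    (\<forall>x\<in>V. (\<forall>e\<in>B. cinner e x = 0) \<longrightarrow> x = 0)"

text \<open>\<open>S\<close> is the positive square root \<open>\<bar>T\<bar>\<close> of \<open>T\<^sup>* T\<close>, for \<open>T\<close> defined on \<open>V\<close>.\<close>

definition is_absolute_value :: "'h::complex_hilbert set \<Rightarrow> ('h \<Rightarrow> 'h) \<Rightarrow> ('h \<Rightarrow> 'h) \<Rightarrow> bool"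
  where "is_absolute_value V T S \<longleftrightarrow>
    S \<in> vecs (bounded_ops V V) \<and>
    (\<forall>x\<in>V. cinner x (S x) \<in> \<real>\<^sub>\<ge>\<^sub>0) \<and>
    (\<forall>x\<in>V. \<forall>y\<in>V. cinner y (S (S x)) = cinner (T y) (T x))"

text \<open>\<open>L\<^sup>1(V,W)\<close>: the operators \<open>T\<close> for which the trace of \<open>\<bar>T\<bar>\<close> is finite.\<close>

definition trace_class :: "'h::complex_hilbert set \<Rightarrow> 'h set \<Rightarrow> ('h \<Rightarrow> 'h) set"
  where "trace_class V W =
    {T \<in> vecs (bounded_ops V W).
      \<exists>S B. is_absolute_value V T S \<and> orthonormal_basis V B \<and>
        (\<lambda>e. cinner e (S e)) summable_on B}"

text \<open>The trace of a trace-class operator on \<open>V\<close>; the choice of the basis is irrelevant.\<close>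

definition op_trace :: "'h::complex_hilbert set \<Rightarrow> ('h \<Rightarrow> 'h) \<Rightarrow> complex"
  where "op_trace V T = (\<Sum>\<^sub>\<infinity>e\<in>(SOME B. orthonormal_basis V B). cinner e (T e))"


section \<open>The Grassmannian\<close>

definition Gr :: "'h::complex_hilbert set set"
  where "Gr = {V. csubspace V \<and> closed V}"

definition orth :: "'h::complex_hilbert set \<Rightarrow> 'h set"
  where "orth V = {x. \<forall>y\<in>V. cinner y x = 0}"

definition proj :: "'h::complex_hilbert set \<Rightarrow> 'h \<Rightarrow> 'h"
  where "proj V x = (THE y. y \<in> V \<and> x - y \<in> orth V)"

definition Gr_domain :: "'h::complex_hilbert set \<Rightarrow> 'h set set"
  where "Gr_domain V =
    {W \<in> Gr. V \<inter> orth W = {0} \<and> {v + w | v w. v \<in> V \<and> w \<in> orth W} = UNIV}"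

definition Gr_chart :: "'h::complex_hilbert set \<Rightarrow> 'h set \<Rightarrow> 'h \<Rightarrow> 'h"
  where "Gr_chart V W =
    zero_outside V (\<lambda>x. (proj (orth V) \<circ> proj W \<circ> proj V)
      (inv_into V (proj V \<circ> proj W \<circ> proj V) x))"

definition Gr_manifold :: "('h::complex_hilbert set, 'h set, 'h \<Rightarrow> 'h) manifold"
  where "Gr_manifold =
    \<lparr>index = Gr, domain = Gr_domain, chart = Gr_chart,
     model = (\<lambda>V. bounded_ops V (orth V))\<rparr>"

end

theory Submission
  imports Defs
begin

text \<open>Over the chart at \<open>V\<close>, tangent vectors are operators \<open>A \<in> L(V,V\<^sup>\<bottom>)\<close>, and the fibre of the
  precotangent bundle consists of the nuclear functionals \<open>A \<mapsto> \<Sum>i. \<langle>a i, A (b i)\<rangle>\<close> with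
  \<open>\<Sum>i. \<parallel>a i\<parallel> \<parallel>b i\<parallel> < \<infinity>\<close>. The derivative at \<open>U\<close> of the transition map from \<open>V\<close> to \<open>V'\<close> has the form
  \<open>A \<mapsto> X \<circ> A \<circ> G\<close>, where \<open>G : V' \<rightarrow> V\<close> lifts a vector to \<open>U\<close> and projects it to \<open>V\<close>, and
  \<open>X : V\<^sup>\<bottom> \<rightarrow> V'\<^sup>\<bottom>\<close> is the projection along \<open>U\<close>. Pulling back along such a map replaces \<open>a i\<close> by
  \<open>X\<^sup>* (a i)\<close> and \<open>b i\<close> by \<open>G (b i)\<close>, so that the fibre does not depend on the chart.

  The nuclear functionals are identified with \<open>L\<^sup>1(V\<^sup>\<bottom>,V)\<close> by the polar decomposition. They form a closed
  subspace of \<open>L(V,V\<^sup>\<bottom>)\<^sup>*\<close>: they are the bounded functionals recovered from their values on the operators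
  of rank one by summation over an orthonormal basis of \<open>V\<close>. A functional on this subspace is, on the
  functionals \<open>A \<mapsto> \<langle>a, A b\<rangle>\<close>, a bounded sesquilinear form in \<open>a\<close> and \<open>b\<close>, hence it is given by an
  operator, which yields \<open>L\<^sup>1(V\<^sup>\<bottom>,V)\<^sup>* = L(V,V\<^sup>\<bottom>)\<close>.

  Since \<open>X\<close> and \<open>G\<close> depend on \<open>U\<close> through the inverse of a projection, whose derivative is a product of
  such inverses, all maps are smooth by induction on the order of differentiability.\<close>

section \<open>Hilbert space geometry\<close>

text \<open>Nuclear series describe the fibre because composition on either side acts on them term
  by term; the trace, which presupposes a basis, enters only in \<open>predual_trace\<close>.

  Closedness rests on a norm-decreasing projection onto the nuclear functionals: a bounded
  functional is replaced by the nuclear one with the same values on operators of rank one. This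
  discards the functionals that vanish on all such operators, which are invisible to the trace.

  A chart domain is given by an algebraic complement condition, which has to become an estimate:
  uniform boundedness shows that the orthogonal projection from \<open>W\<close> to \<open>V\<close>
  is bounded below. Its inverse is the source of both \<open>X\<close> and \<open>G\<close>.

  The increment of \<open>G\<close> has an exact formula with a factor \<open>G\<close> at the moved
  point. It gives a bound near the base point, then differentiability, and the derivative is
  quadratic in \<open>G\<close>, which closes the induction on the order. As
  \<open>smooth_on\<close> asks for one family of derivatives of all orders, the finite jets are
  joined by uniqueness of derivatives.\<close>

instance complex_hilbert \<subseteq> banach ..

lemma scaleC_zero_left [simp]: "0 *\<^sub>C x = 0"
  using scaleR_conv_scaleC[of 0 x] by simp

lemma scaleC_zero_right [simp]: "a *\<^sub>C 0 = 0"
  using scaleC_add_right[of a 0 0] by simp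

lemma scaleC_minus1 [simp]: "(-1) *\<^sub>C x = - x"
  using scaleR_conv_scaleC[of "-1" x] by simp

lemma scaleC_minus_right: "a *\<^sub>C (- x) = - (a *\<^sub>C x)"
  using scaleC_add_right[of a x "-x"] by (simp add: eq_neg_iff_add_eq_0 add.commute)

lemma scaleC_diff_right: "a *\<^sub>C (x - y) = a *\<^sub>C x - a *\<^sub>C y"
  using scaleC_add_right[of a x "-y"] by (simp add: scaleC_minus_right)

lemma scaleC_sum_right: "a *\<^sub>C (\<Sum>i\<in>I. f i) = (\<Sum>i\<in>I. a *\<^sub>C f i)"
  by (induction I rule: infinite_finite_induct) (auto simp: scaleC_add_right)

lemma scaleC_complex [simp]: "a *\<^sub>C (b::complex) = a * b"
  by (simp add: scaleC_complex_def)

section \<open>Norm and inner product\<close>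

lemma cinner_add_left: "cinner (x + y) z = cinner x z + cinner y z"
  by (metis cinner_add_right cinner_commute complex_cnj_add)

lemma cinner_scaleC_left: "cinner (a *\<^sub>C x) y = cnj a * cinner x y"
  by (metis cinner_scaleC_right cinner_commute complex_cnj_mult)

lemma cinner_scaleR_left: "cinner (r *\<^sub>R x) y = r *\<^sub>R cinner x y"
  by (simp add: scaleR_conv_scaleC cinner_scaleC_left scaleR_conv_of_real)

lemma cinner_scaleR_right: "cinner x (r *\<^sub>R y) = r *\<^sub>R cinner x y"
  by (simp add: scaleR_conv_scaleC cinner_scaleC_right scaleR_conv_of_real)

lemma cinner_zero_left [simp]: "cinner 0 x = 0"
  using cinner_add_left[of 0 0 x] by simp

lemma cinner_zero_right [simp]: "cinner x 0 = 0"
  using cinner_add_right[of x 0 0] by simp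

text \<open>Only real homogeneity is built into the norm; complex homogeneity is forced by
  sesquilinearity through \<open>cinner_self\<close>.\<close>

lemma norm_scaleC: "norm (a *\<^sub>C (x::'h::complex_hilbert)) = cmod a * norm x"
proof -
  have "complex_of_real ((norm (a *\<^sub>C x))\<^sup>2) = cnj a * a * complex_of_real ((norm x)\<^sup>2)"
    by (metis cinner_self cinner_scaleC_left cinner_scaleC_right mult.assoc mult.left_commute)
  also have "\<dots> = complex_of_real ((cmod a * norm x)\<^sup>2)"
    by (metis complex_norm_square mult.commute of_real_mult power_mult_distrib)
  finally have "(norm (a *\<^sub>C x))\<^sup>2 = (cmod a * norm x)\<^sup>2"
    using of_real_eq_iff by blast
  then show ?thesis by (simp add: power2_eq_iff_nonneg)
qed

lemma norm_add_square: "(norm (x + y))\<^sup>2 = (norm x)\<^sup>2 + 2 * Re (cinner x y) + (norm y)\<^sup>2"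
proof -
  have "complex_of_real ((norm (x + y))\<^sup>2) = cinner (x + y) (x + y)" by (rule cinner_self[symmetric])
  also have "\<dots> = cinner x x + cinner x y + cnj (cinner x y) + cinner y y"
    by (simp add: cinner_add_left cinner_add_right cinner_commute[of y x])
  finally have "Re (complex_of_real ((norm (x + y))\<^sup>2))
      = Re (complex_of_real ((norm x)\<^sup>2) + cinner x y + cnj (cinner x y) + complex_of_real ((norm y)\<^sup>2))"
    by (simp only: cinner_self)
  then show ?thesis by simp
qed

lemma cinner_minus_right: "cinner x (- y) = - cinner x y"
  using cinner_add_right[of x y "-y"] by (simp add: eq_neg_iff_add_eq_0 add.commute)

lemma norm_diff_square: "(norm (x - y))\<^sup>2 = (norm x)\<^sup>2 - 2 * Re (cinner x y) + (norm y)\<^sup>2"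
  using norm_add_square[of x "-y"] by (simp add: cinner_minus_right)

lemma parallelogram: "(norm (x + y))\<^sup>2 + (norm (x - y))\<^sup>2 = 2 * (norm x)\<^sup>2 + 2 * (norm (y::'h::complex_hilbert))\<^sup>2"
  by (simp add: norm_add_square norm_diff_square)

text \<open>The norm is part of the class, so its triangle inequality is available from the start;
  squaring it gives Cauchy-Schwarz for real parts, in reverse of the usual order.\<close>

lemma Re_cinner_le: "Re (cinner x y) \<le> norm x * norm y"
proof -
  have "(norm (x + y))\<^sup>2 \<le> (norm x + norm y)\<^sup>2"
    by (simp add: norm_triangle_ineq power_mono)
  then show ?thesis by (simp add: norm_add_square power2_sum)
qed

lemma cauchy_schwarz: "cmod (cinner x y) \<le> norm x * norm y"
proof (cases "cinner x y = 0")
  case False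
  \<comment> \<open>A unimodular factor that rotates the inner product onto its absolute value and
    so reduces the claim to real parts.\<close>
  define u where "u = cnj (cinner x y) / cmod (cinner x y)"
  have "cnj (cinner x y) * cinner x y = complex_of_real (cmod (cinner x y)) * complex_of_real (cmod (cinner x y))"
    by (metis complex_norm_square power2_eq_square of_real_mult mult.commute)
  then have "u * cinner x y = cmod (cinner x y)"
    using False by (simp add: u_def)
  moreover have "cmod u = 1" using False by (simp add: u_def norm_divide)
  moreover have "Re (cinner x (u *\<^sub>C y)) \<le> norm x * norm (u *\<^sub>C y)" by (rule Re_cinner_le)
  ultimately show ?thesis by (simp add: cinner_scaleC_right norm_scaleC)
qed simp

lemma bounded_bilinear_cinner: "bounded_bilinear (cinner :: 'h::complex_hilbert \<Rightarrow> 'h \<Rightarrow> complex)"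
proof
  show "\<exists>K. \<forall>a b. cmod (cinner (a::'h) b) \<le> norm a * norm b * K"
    using cauchy_schwarz by (intro exI[of _ 1]) auto
qed (auto simp: cinner_add_left cinner_add_right cinner_scaleR_left cinner_scaleR_right)

interpretation cinner: bounded_bilinear "cinner :: 'h::complex_hilbert \<Rightarrow> 'h \<Rightarrow> complex"
  by (rule bounded_bilinear_cinner)

lemma cinner_eq_norm: "Re (cinner x x) = (norm x)\<^sup>2"
  by (simp add: cinner_self)

lemma cinner_eq_0_swap: "cinner x y = 0 \<longleftrightarrow> cinner y x = 0"
  by (metis cinner_commute complex_cnj_zero)

lemma cinner_eqI: "(\<And>z. cinner z x = cinner z y) \<Longrightarrow> x = (y::'h::complex_hilbert)"
  by (metis cinner_eq_norm cinner.diff_right diff_self eq_iff_diff_eq_0 norm_eq_zero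
      zero_complex.simps(1) zero_eq_power2)

lemma norm_leI_cinner:
  assumes "\<And>z. norm z \<le> 1 \<Longrightarrow> cmod (cinner z x) \<le> K"
  shows "norm x \<le> K"
proof (cases "x = 0")
  case True
  then show ?thesis using assms[of 0] by simp
next
  case False
  have "cmod (cinner (x /\<^sub>R norm x) x) \<le> K" using False by (intro assms) simp
  moreover have "cinner (x /\<^sub>R norm x) x = complex_of_real (norm x)"
    using False by (simp add: cinner_scaleR_left cinner_self scaleR_conv_of_real power2_eq_square)
  ultimately show ?thesis by simp
qed

section \<open>Bounded complex-linear maps between whole Hilbert spaces\<close>

definition bclin :: "('h::complex_hilbert \<Rightarrow> 'k::complex_hilbert) \<Rightarrow> bool"
  where "bclin T \<longleftrightarrow> bounded_linear T \<and> (\<forall>c x. T (c *\<^sub>C x) = c *\<^sub>C T x)"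

lemma bclinI:
  assumes "\<And>x y. T (x + y) = T x + T y" "\<And>c x. T (c *\<^sub>C x) = c *\<^sub>C T x"
    "\<And>x. norm (T x) \<le> K * norm x"
  shows "bclin T"
  unfolding bclin_def using assms
  by (auto simp: scaleR_conv_scaleC mult.commute intro!: bounded_linear_intro[where K = K])

lemma bclin_bounded_linear: "bclin T \<Longrightarrow> bounded_linear T"
  and bclin_scaleC: "bclin T \<Longrightarrow> T (c *\<^sub>C x) = c *\<^sub>C T x"
  by (auto simp: bclin_def)

lemma bclin_add: "bclin T \<Longrightarrow> T (x + y) = T x + T y"
  and bclin_diff: "bclin T \<Longrightarrow> T (x - y) = T x - T y"
  and bclin_zero: "bclin T \<Longrightarrow> T 0 = 0"
  and bclin_minus: "bclin T \<Longrightarrow> T (- x) = - T x"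
  and bclin_sum: "bclin T \<Longrightarrow> T (\<Sum>i\<in>I. f i) = (\<Sum>i\<in>I. T (f i))"
  by (simp_all add: bclin_def bounded_linear.linear linear_add linear_diff linear_0 linear_neg linear_sum)

lemma bclin_bound: "bclin T \<Longrightarrow> \<exists>K\<ge>0. \<forall>x. norm (T x) \<le> K * norm x"
  using bounded_linear.nonneg_bounded[OF bclin_bounded_linear, of T] by (auto simp: mult.commute)

lemma bclin_compose: "bclin S \<Longrightarrow> bclin T \<Longrightarrow> bclin (\<lambda>x. S (T x))"
  unfolding bclin_def using bounded_linear_compose by auto

lemma bclin_id: "bclin (\<lambda>x. x)"
  by (simp add: bclin_def)

lemma bclin_minus_op: "bclin S \<Longrightarrow> bclin T \<Longrightarrow> bclin (\<lambda>x. S x - T x)"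
  by (auto simp: bclin_def bounded_linear_sub scaleC_diff_right)

lemma bclin_cinner_right: "bclin (cinner x)"
  by (simp add: bclin_def cinner.bounded_linear_right cinner_scaleC_right)

subsection \<open>Closed subspaces and projections\<close>

lemma csubspaceD:
  assumes "csubspace V"
  shows "0 \<in> V" "x \<in> V \<Longrightarrow> y \<in> V \<Longrightarrow> x + y \<in> V" "x \<in> V \<Longrightarrow> c *\<^sub>C x \<in> V"
    "x \<in> V \<Longrightarrow> r *\<^sub>R x \<in> V" "x \<in> V \<Longrightarrow> - x \<in> V" "x \<in> V \<Longrightarrow> y \<in> V \<Longrightarrow> x - y \<in> V"
proof -
  show *: "0 \<in> V" "x \<in> V \<Longrightarrow> y \<in> V \<Longrightarrow> x + y \<in> V" "\<And>x c. x \<in> V \<Longrightarrow> c *\<^sub>C x \<in> V" for x y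
    using assms by (auto simp: csubspace_def)
  then show "x \<in> V \<Longrightarrow> r *\<^sub>R x \<in> V" and **: "\<And>x. x \<in> V \<Longrightarrow> - x \<in> V"
    by (auto simp: scaleR_conv_scaleC) (metis scaleC_minus1 *(3))
  show "x \<in> V \<Longrightarrow> y \<in> V \<Longrightarrow> x - y \<in> V" using *(2)[of x "-y"] ** by simp
qed

lemma csubspace_sum:
  assumes "csubspace V" "\<And>i. i \<in> I \<Longrightarrow> f i \<in> V"
  shows "(\<Sum>i\<in>I. f i) \<in> V"
  using assms(2) by (induction I rule: infinite_finite_induct) (auto intro: csubspaceD[OF assms(1)])

lemma Gr_csubspace: "V \<in> Gr \<Longrightarrow> csubspace V" and Gr_closed: "V \<in> Gr \<Longrightarrow> closed V"
  by (auto simp: Gr_def)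

lemmas GrD = csubspaceD[OF Gr_csubspace]

lemma UNIV_Gr [simp]: "UNIV \<in> Gr"
  by (simp add: Gr_def csubspace_def)

lemma orthI: "(\<And>y. y \<in> V \<Longrightarrow> cinner y x = 0) \<Longrightarrow> x \<in> orth V"
  and orthD: "x \<in> orth V \<Longrightarrow> y \<in> V \<Longrightarrow> cinner y x = 0"
  and orthD2: "x \<in> orth V \<Longrightarrow> y \<in> V \<Longrightarrow> cinner x y = 0"
  by (auto simp: orth_def cinner_eq_0_swap[of x y])

lemma closed_zeros_bclin: "bclin T \<Longrightarrow> closed {x. T x = 0}"
  by (intro closed_Collect_eq linear_continuous_on bclin_bounded_linear continuous_on_const)

lemma orth_Gr: "orth V \<in> Gr"
proof -
  have "orth V = (\<Inter>y\<in>V. {x. cinner y x = 0})" by (auto simp: orth_def)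
  then have "closed (orth V)" by (simp add: closed_INT closed_zeros_bclin[OF bclin_cinner_right])
  then show ?thesis
    by (auto simp: Gr_def csubspace_def orth_def cinner_add_right cinner_scaleC_right)
qed

text \<open>A minimizing sequence is Cauchy by the parallelogram law, and its limit stays in the
  closed set \<open>V\<close>.\<close>

lemma nearest_point:
  assumes "V \<in> Gr"
  shows "\<exists>y\<in>V. \<forall>z\<in>V. norm (x - y) \<le> norm (x - (z::'h::complex_hilbert))"
proof -
  define d where "d = (INF z\<in>V. (norm (x - z))\<^sup>2)"
  have bdd: "bdd_below ((\<lambda>z. (norm (x - z))\<^sup>2) ` V)" by (auto intro!: bdd_belowI[of _ 0])
  have d_le: "d \<le> (norm (x - z))\<^sup>2" if "z \<in> V" for z
    using cINF_lower[OF bdd that] by (simp add: d_def)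
  have "\<exists>z\<in>V. (norm (x - z))\<^sup>2 < d + 1 / Suc n" for n
  proof (rule ccontr)
    assume "\<not> ?thesis"
    then have "\<And>z. z \<in> V \<Longrightarrow> d + 1 / Suc n \<le> (norm (x - z))\<^sup>2" by force
    then have "d + 1 / Suc n \<le> (INF z\<in>V. (norm (x - z))\<^sup>2)"
      using GrD(1)[OF assms] by (intro cINF_greatest) auto
    then have "1 / real (Suc n) \<le> 0" by (simp add: d_def)
    then show False by simp
  qed
  then obtain s where sV: "\<And>n. s n \<in> V" and s: "\<And>n. (norm (x - s n))\<^sup>2 < d + 1 / Suc n" by metis
  have close: "(norm (s m - s n))\<^sup>2 < 2 / Suc m + 2 / Suc n" for m n
  proof -
    \<comment> \<open>The midpoint lies in \<open>V\<close>, so its squared distance to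
      \<open>x\<close> is at least \<open>d\<close>. The parallelogram law then bounds the distance
      of \<open>s m\<close> and \<open>s n\<close> by their excesses over \<open>d\<close>.\<close>
    have mid: "(1/2) *\<^sub>R (s m + s n) \<in> V" using GrD(2,4)[OF assms] sV by blast
    have "(x - s m) + (x - s n) = 2 *\<^sub>R (x - (1/2) *\<^sub>R (s m + s n))"
      by (simp add: algebra_simps scaleR_2)
    then have "(norm ((x - s m) + (x - s n)))\<^sup>2 = 4 * (norm (x - (1/2) *\<^sub>R (s m + s n)))\<^sup>2"
      by (simp add: power_mult_distrib)
    moreover have "(x - s m) - (x - s n) = - (s m - s n)" by simp
    ultimately have "4 * (norm (x - (1/2) *\<^sub>R (s m + s n)))\<^sup>2 + (norm (s m - s n))\<^sup>2
        = 2 * (norm (x - s m))\<^sup>2 + 2 * (norm (x - s n))\<^sup>2"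
      using parallelogram[of "x - s m" "x - s n"] by (metis norm_minus_cancel)
    then show ?thesis using d_le[OF mid] s[of m] s[of n] by argo
  qed
  have "Cauchy s"
  proof (rule CauchyI)
    fix e :: real assume e: "0 < e"
    obtain N :: nat where N: "4 / e\<^sup>2 < N" using reals_Archimedean2 by blast
    have "norm (s m - s n) < e" if mn: "m \<ge> N" "n \<ge> N" for m n
    proof -
      have "2 / Suc m \<le> 2 / Suc N" "2 / Suc n \<le> 2 / Suc N" using mn by (auto intro!: divide_left_mono)
      then have "(norm (s m - s n))\<^sup>2 < 4 / Suc N" using close[of m n] by simp
      also have "\<dots> < e\<^sup>2"
      proof -
        have "4 < e\<^sup>2 * N" using N e by (simp add: field_simps)
        also have "\<dots> \<le> e\<^sup>2 * Suc N" by (intro mult_left_mono) auto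
        finally show ?thesis by (simp add: field_simps)
      qed
      finally show ?thesis using e by (simp add: power_less_imp_less_base)
    qed
    then show "\<exists>M. \<forall>m\<ge>M. \<forall>n\<ge>M. norm (s m - s n) < e" by blast
  qed
  then obtain y where y: "s \<longlonglongrightarrow> y" using convergent_eq_Cauchy by blast
  have "y \<in> V" using Gr_closed[OF assms] sV y by (auto simp: closed_sequential_limits)
  have "(\<lambda>n. (norm (x - s n))\<^sup>2) \<longlonglongrightarrow> (norm (x - y))\<^sup>2"
    by (intro tendsto_intros y)
  moreover have "(\<lambda>n. d + 1 / Suc n) \<longlonglongrightarrow> d + 0"
    by (intro tendsto_add tendsto_const LIMSEQ_Suc[OF lim_1_over_n])
  ultimately have "(norm (x - y))\<^sup>2 \<le> d + 0"
    by (rule LIMSEQ_le) (auto intro!: less_imp_le s simp del: of_nat_Suc)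
  then have "norm (x - y) \<le> norm (x - z)" if "z \<in> V" for z
    using d_le[OF that] by - (rule power2_le_imp_le, linarith, simp)
  then show ?thesis using \<open>y \<in> V\<close> by blast
qed

lemma orth_decomposition:
  assumes "V \<in> Gr"
  shows "\<exists>y\<in>V. x - y \<in> orth V"
proof -
  obtain y where y: "y \<in> V" and min: "\<And>z. z \<in> V \<Longrightarrow> norm (x - y) \<le> norm (x - z)"
    using nearest_point[OF assms] by blast
  have "cinner z (x - y) = 0" if z: "z \<in> V" for z
  proof (cases "z = 0")
    case False
    \<comment> \<open>\<open>c *\<^sub>C z\<close> is the component of \<open>x - y\<close> along
      \<open>z\<close>; adding it to \<open>y\<close> would shorten the distance to \<open>x\<close>
      unless it is zero.\<close>
    define c where "c = cinner z (x - y) / (norm z)\<^sup>2"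
    have "y + c *\<^sub>C z \<in> V" using GrD(2,3)[OF assms] y z by blast
    from min[OF this] have "(norm (x - y))\<^sup>2 \<le> (norm ((x - y) - c *\<^sub>C z))\<^sup>2"
      by (simp add: algebra_simps power_mono)
    also have "\<dots> = (norm (x - y))\<^sup>2 - 2 * Re (c * cinner (x - y) z) + (cmod c * norm z)\<^sup>2"
      by (simp add: norm_diff_square cinner_scaleC_right norm_scaleC)
    also have "c * cinner (x - y) z = (cmod (cinner z (x - y)))\<^sup>2 / (norm z)\<^sup>2"
      using cinner_commute[of "x - y" z] by (simp add: c_def complex_norm_square[symmetric])
    also have "(cmod c * norm z)\<^sup>2 = (cmod (cinner z (x - y)))\<^sup>2 / (norm z)\<^sup>2"
      using False by (simp add: c_def norm_divide power_mult_distrib power_divide power2_eq_square norm_mult)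
    finally have "(cmod (cinner z (x - y)))\<^sup>2 / (norm z)\<^sup>2 \<le> 0"
      by (simp flip: of_real_power of_real_divide)
    then show ?thesis using False by (simp add: divide_le_0_iff)
  qed simp
  then show ?thesis using y by (auto intro: orthI)
qed

lemma orth_Int: "x \<in> V \<Longrightarrow> x \<in> orth V \<Longrightarrow> x = 0"
  by (metis orthD cinner_eq_norm norm_eq_zero zero_complex.simps(1) zero_eq_power2)

lemma proj_eqI:
  assumes "V \<in> Gr" "y \<in> V" "x - y \<in> orth V"
  shows "proj V x = y"
  unfolding proj_def
proof (rule the_equality)
  fix z assume z: "z \<in> V \<and> x - z \<in> orth V"
  have "(x - y) - (x - z) \<in> orth V" using GrD(6)[OF orth_Gr] assms z by blast
  moreover have "z - y \<in> V" using GrD(6)[OF assms(1)] assms z by blast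
  ultimately show "z = y" using orth_Int[of "z - y" V] by simp
qed (use assms in blast)

lemma proj_in: "V \<in> Gr \<Longrightarrow> proj V x \<in> V"
  and proj_diff_in: "V \<in> Gr \<Longrightarrow> x - proj V x \<in> orth V"
  using orth_decomposition[of V x] by (auto simp: proj_eqI)

lemma proj_id: "V \<in> Gr \<Longrightarrow> x \<in> V \<Longrightarrow> proj V x = x"
  by (rule proj_eqI) (simp_all add: GrD(1)[OF orth_Gr])

lemma proj_zero: "V \<in> Gr \<Longrightarrow> x \<in> orth V \<Longrightarrow> proj V x = 0"
  by (rule proj_eqI) (simp_all add: GrD(1))

lemma proj_cinner: "V \<in> Gr \<Longrightarrow> y \<in> V \<Longrightarrow> cinner y (proj V x) = cinner y x"
  using orthD[OF proj_diff_in, of V y x] by (simp add: cinner.diff_right)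

lemma proj_cinner_left: "V \<in> Gr \<Longrightarrow> y \<in> V \<Longrightarrow> cinner (proj V x) y = cinner x y"
  using orthD2[OF proj_diff_in, of V y x] by (simp add: cinner.diff_left)

lemma norm_proj_le: "V \<in> Gr \<Longrightarrow> norm (proj V x) \<le> norm x"
proof -
  assume V: "V \<in> Gr"
  have "(norm x)\<^sup>2 = (norm (proj V x))\<^sup>2 + (norm (x - proj V x))\<^sup>2"
    using norm_add_square[of "proj V x" "x - proj V x"] orthD[OF proj_diff_in[OF V, of x] proj_in[OF V, of x]]
    by simp
  then show ?thesis by - (rule power2_le_imp_le, auto)
qed

lemma bclin_proj: "V \<in> Gr \<Longrightarrow> bclin (proj V)"
proof (rule bclinI)
  assume V: "V \<in> Gr"
  show "proj V (x + y) = proj V x + proj V y" for x y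
    using GrD(2)[OF orth_Gr proj_diff_in[OF V, of x] proj_diff_in[OF V, of y]]
    by (intro proj_eqI V GrD(2)[OF V] proj_in) (simp add: algebra_simps)
  show "proj V (c *\<^sub>C x) = c *\<^sub>C proj V x" for c x
    using GrD(3)[OF orth_Gr proj_diff_in[OF V, of x], of c]
    by (intro proj_eqI V GrD(3)[OF V] proj_in) (simp add: scaleC_diff_right)
  show "norm (proj V x) \<le> 1 * norm x" for x using norm_proj_le[OF V] by simp
qed

lemma orth_orth: "V \<in> Gr \<Longrightarrow> orth (orth V) = V"
proof (intro equalityI subsetI)
  fix x assume V: "V \<in> Gr" and x: "x \<in> orth (orth V)"
  have "proj V x \<in> orth (orth V)" by (rule orthI) (rule orthD2[OF _ proj_in[OF V]])
  with x have "x - proj V x \<in> orth (orth V)" by (rule GrD(6)[OF orth_Gr])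
  with proj_diff_in[OF V] have "x - proj V x = 0" by (rule orth_Int)
  then show "x \<in> V" using proj_in[OF V, of x] by simp
qed (auto intro!: orthI dest: orthD2)

lemma proj_orth: "V \<in> Gr \<Longrightarrow> proj (orth V) x = x - proj V x"
  by (rule proj_eqI[OF orth_Gr]) (simp_all add: proj_diff_in proj_in orth_orth)

lemma Gr_eqI_zero: "V \<in> Gr \<Longrightarrow> M \<in> Gr \<Longrightarrow> M \<subseteq> V \<Longrightarrow> (\<And>x. x \<in> V \<Longrightarrow> x \<in> orth M \<Longrightarrow> x = 0) \<Longrightarrow> M = V"
  by (metis GrD(6) proj_diff_in proj_in eq_iff_diff_eq_0 subsetD subsetI subset_antisym)

subsection \<open>Riesz representation, adjoints, uniform boundedness\<close>

lemma riesz: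
  assumes "bclin (f :: 'h::complex_hilbert \<Rightarrow> complex)"
  shows "\<exists>z. \<forall>x. f x = cinner z x"
proof (cases "\<forall>x. f x = 0")
  case True
  then show ?thesis by (intro exI[of _ 0]) simp
next
  case False
  define K where "K = {x. f x = 0}"
  have K: "K \<in> Gr" unfolding Gr_def K_def
    using closed_zeros_bclin[OF assms] assms
    by (auto simp: csubspace_def bclin_zero bclin_add bclin_scaleC)
  obtain x0 where x0: "f x0 \<noteq> 0" using False by blast
  \<comment> \<open>The kernel has codimension one, so every vector is a multiple of this
    \<open>u\<close> modulo the kernel, and a multiple of \<open>u\<close> represents
    \<open>f\<close>.\<close>
  define u where "u = x0 - proj K x0"
  have u: "u \<in> orth K" unfolding u_def by (rule proj_diff_in[OF K])
  have fu: "f u \<noteq> 0" using proj_in[OF K, of x0] x0 by (simp add: u_def bclin_diff[OF assms] K_def)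
  then have nu: "norm u \<noteq> 0" using bclin_zero[OF assms] by auto
  define z where "z = cnj (f u / (norm u)\<^sup>2) *\<^sub>C u"
  have "f x = cinner z x" for x
  proof -
    have "x - (f x / f u) *\<^sub>C u \<in> K"
      using fu by (simp add: K_def bclin_diff[OF assms] bclin_scaleC[OF assms])
    from orthD2[OF u this] have "cinner u x = (f x / f u) * (norm u)\<^sup>2"
      by (simp add: cinner.diff_right cinner_scaleC_right cinner_self)
    then show ?thesis using fu nu by (simp add: z_def cinner_scaleC_left)
  qed
  then show ?thesis by blast
qed

text \<open>Three kinds of operators are produced from bounded forms in this way: adjoints, the
  operator behind a bounded functional on rank one operators, and the operator representing a
  functional on the predual.\<close>

lemma riesz_sesquilinear:
  fixes g :: "'h::complex_hilbert \<Rightarrow> 'k::complex_hilbert \<Rightarrow> complex"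
  assumes add: "\<And>x y z. g (x + y) z = g x z + g y z" "\<And>x y z. g x (y + z) = g x y + g x z"
    and scale: "\<And>c x z. g (c *\<^sub>C x) z = cnj c * g x z" "\<And>c x z. g x (c *\<^sub>C z) = c * g x z"
    and bound: "\<And>x z. cmod (g x z) \<le> K * norm x * norm z" and K: "K \<ge> 0"
  shows "\<exists>T. bclin T \<and> (\<forall>x z. cinner x (T z) = g x z) \<and> (\<forall>z. norm (T z) \<le> K * norm z)"
proof -
  have "\<exists>w. \<forall>x. cnj (g x z) = cinner w x" for z
    by (intro riesz bclinI[where K = "K * norm z"])
      (use bound[of _ z] in \<open>simp_all add: add scale mult.commute mult.left_commute\<close>)
  then obtain T where T: "\<And>z x. cnj (g x z) = cinner (T z) x" by metis
  have T': "cinner x (T z) = g x z" for x z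
    using T[of x z] cinner_commute[of x "T z"] by (metis complex_cnj_cnj)
  have bd: "norm (T z) \<le> K * norm z" for z
  proof (rule norm_leI_cinner)
    fix y :: 'h assume y: "norm y \<le> 1"
    have "cmod (cinner y (T z)) \<le> K * norm y * norm z" by (simp add: T' bound)
    also have "\<dots> \<le> K * 1 * norm z" using y K by (intro mult_right_mono mult_left_mono) auto
    finally show "cmod (cinner y (T z)) \<le> K * norm z" by simp
  qed
  have "bclin T"
    by (rule bclinI[OF _ _ bd]; rule cinner_eqI)
      (simp_all add: T' add scale cinner_add_right cinner_scaleC_right)
  then show ?thesis using T' bd by blast
qed

lemma adjoint_exists:
  fixes T :: "'h::complex_hilbert \<Rightarrow> 'k::complex_hilbert"
  assumes "bclin T"
  shows "\<exists>T'. bclin T' \<and> (\<forall>x y. cinner (T' x) y = cinner x (T y))"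
proof -
  obtain K where K: "K \<ge> 0" "\<And>x. norm (T x) \<le> K * norm x" using bclin_bound[OF assms] by blast
  have "cmod (cinner (T x) z) \<le> K * norm x * norm z" for x z
    using cauchy_schwarz[of "T x" z] K(2)[of x] by (meson mult_right_mono norm_ge_zero order_trans)
  then have "\<exists>T'. bclin T' \<and> (\<forall>x z. cinner x (T' z) = cinner (T x) z) \<and> (\<forall>z. norm (T' z) \<le> K * norm z)"
    by (intro riesz_sesquilinear K(1))
      (simp_all add: bclin_add[OF assms] bclin_scaleC[OF assms] cinner_add_left cinner_add_right
        cinner_scaleC_left cinner_scaleC_right)
  then obtain T' where "bclin T'" "\<And>x z. cinner x (T' z) = cinner (T x) z" by blast
  then show ?thesis by (metis cinner_commute)
qed

definition adj :: "('h::complex_hilbert \<Rightarrow> 'k::complex_hilbert) \<Rightarrow> 'k \<Rightarrow> 'h"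
  where "adj T = (SOME T'. bclin T' \<and> (\<forall>x y. cinner (T' x) y = cinner x (T y)))"

lemma bclin_adj: "bclin T \<Longrightarrow> bclin (adj T)"
  and cinner_adj_left: "bclin T \<Longrightarrow> cinner (adj T x) y = cinner x (T y)"
  using someI_ex[OF adjoint_exists[of T]] by (auto simp: adj_def)

lemma cinner_adj_right: "bclin T \<Longrightarrow> cinner x (adj T y) = cinner (T x) y"
  by (metis cinner_adj_left cinner_commute)

text \<open>The gliding hump argument, with \<open>x = \<Sum>n. \<plusminus> 3\<^sup>-\<^sup>n y\<^sub>n / \<parallel>y\<^sub>n\<parallel>\<close>.\<close>

lemma uniform_boundedness:
  fixes Y :: "'h::complex_hilbert set"
  assumes "\<And>x. \<exists>K. \<forall>y\<in>Y. cmod (cinner y x) \<le> K"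
  shows "\<exists>K. \<forall>y\<in>Y. norm y \<le> K"
proof (rule ccontr)
  assume "\<not> ?thesis"
  then have "\<exists>y\<in>Y. norm y > 4 ^ n" for n :: nat by (meson not_le)
  then obtain y where yY: "\<And>n. y n \<in> Y" and y: "\<And>n. norm (y n) > 4 ^ n" by metis
  define u where "u n = ((1/3) ^ n / norm (y n)) *\<^sub>R y n" for n
  have ny: "norm (y n) > 0" for n using y[of n] by (smt (verit) zero_less_power)
  have nu: "norm (u n) = (1/3) ^ n" for n using ny[of n] by (simp add: u_def)
  have yu: "cinner (y n) (u n) = complex_of_real ((1/3) ^ n * norm (y n))" for n
    using ny[of n] by (simp add: u_def cinner_scaleR_right cinner_self scaleR_conv_of_real power2_eq_square)
  \<comment> \<open>The sign is chosen so that \<open>s (Suc n)\<close> has a large inner product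
    with \<open>y n\<close>: the two candidates differ by \<open>2 *\<^sub>R u n\<close>, so at
    least one of them qualifies.\<close>
  define s where "s = rec_nat 0 (\<lambda>n x. if cmod (cinner (y n) (x + u n)) \<ge> (1/3) ^ n * norm (y n)
      then x + u n else x - u n)"
  have s0: "s 0 = 0" and sS: "s (Suc n) = (if cmod (cinner (y n) (s n + u n)) \<ge> (1/3) ^ n * norm (y n)
      then s n + u n else s n - u n)" for n by (auto simp: s_def)
  have big: "cmod (cinner (y n) (s (Suc n))) \<ge> (1/3) ^ n * norm (y n)" for n
  proof -
    have "2 * ((1/3) ^ n * norm (y n)) = cmod (cinner (y n) (s n + u n) - cinner (y n) (s n - u n))"
      using ny[of n] by (simp add: cinner.add_right cinner.diff_right yu norm_mult norm_power)
    also have "\<dots> \<le> cmod (cinner (y n) (s n + u n)) + cmod (cinner (y n) (s n - u n))"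
      by (rule norm_triangle_ineq4)
    finally show ?thesis by (auto simp: sS)
  qed
  have step: "norm (s (Suc n) - s n) \<le> (1/3) ^ n" for n by (auto simp: sS nu)
  have tail: "norm (s (n + k) - s n) \<le> (3/2) * ((1/3) ^ n - (1/3) ^ (n + k))" for n k
  proof (induction k)
    case (Suc k)
    have "norm (s (n + Suc k) - s n) \<le> norm (s (Suc (n + k)) - s (n + k)) + norm (s (n + k) - s n)"
      using norm_triangle_ineq[of "s (Suc (n + k)) - s (n + k)" "s (n + k) - s n"] by simp
    also have "\<dots> \<le> (1/3) ^ (n + k) + (3/2) * ((1/3) ^ n - (1/3) ^ (n + k))"
      using step[of "n + k"] Suc by linarith
    finally show ?case by (simp add: algebra_simps)
  qed simp
  have tail': "norm (s m - s n) \<le> (3/2) * (1/3) ^ n" if "m \<ge> n" for m n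
    using tail[of n "m - n"] that
    by simp (smt (verit) zero_le_power divide_nonneg_nonneg)
  have "Cauchy s"
  proof (rule metric_CauchyI)
    fix e :: real assume "e > 0"
    then obtain N where N: "(1/3::real) ^ N < e / 3" using real_arch_pow_inv[of "e/3" "1/3"] by auto
    have "dist (s m) (s n) < e" if "m \<ge> N" "n \<ge> N" for m n
    proof -
      have "norm (s m - s n) \<le> norm (s m - s N) + norm (s n - s N)"
        using norm_triangle_ineq4[of "s m - s N" "s n - s N"] by simp
      then show ?thesis using tail'[OF that(1)] tail'[OF that(2)] N by (simp add: dist_norm)
    qed
    then show "\<exists>M. \<forall>m\<ge>M. \<forall>n\<ge>M. dist (s m) (s n) < e" by blast
  qed
  then obtain x where x: "s \<longlonglongrightarrow> x" using convergent_eq_Cauchy by blast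
  have lim: "norm (x - s n) \<le> (3/2) * (1/3) ^ n" for n
  proof (rule LIMSEQ_le_const2)
    show "(\<lambda>m. norm (s m - s n)) \<longlonglongrightarrow> norm (x - s n)" by (intro tendsto_intros x)
  qed (use tail' in blast)
  \<comment> \<open>The tail after \<open>s (Suc n)\<close> has norm at most half of
    \<open>(1/3) ^ n\<close>, so it destroys at most half of the gain in \<open>big\<close>. What is
    left grows because \<open>4 ^ n\<close> beats \<open>3 ^ n\<close>.\<close>
  have grow: "(1/2) * (4/3) ^ n \<le> cmod (cinner (y n) x)" for n
  proof -
    have "cmod (cinner (y n) (x - s (Suc n))) \<le> norm (y n) * ((3/2) * (1/3) ^ Suc n)"
      using cauchy_schwarz[of "y n" "x - s (Suc n)"] lim[of "Suc n"]
      by (meson mult_left_mono norm_ge_zero order_trans)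
    moreover have "cmod (cinner (y n) (s (Suc n))) \<le> cmod (cinner (y n) x) + cmod (cinner (y n) (x - s (Suc n)))"
      using norm_triangle_ineq4[of "cinner (y n) x" "cinner (y n) (x - s (Suc n))"]
      by (simp add: cinner.diff_right)
    ultimately have "(1/2) * ((1/3) ^ n * norm (y n)) \<le> cmod (cinner (y n) x)"
      using big[of n] by (simp add: algebra_simps)
    moreover have "(1/3) ^ n * 4 ^ n \<le> (1/3) ^ n * norm (y n)"
      using y[of n] by (intro mult_left_mono) auto
    ultimately show ?thesis by (simp add: power_mult_distrib[symmetric])
  qed
  obtain K where K: "\<forall>z\<in>Y. cmod (cinner z x) \<le> K" using assms by blast
  obtain n where "2 * K < (4/3::real) ^ n" using real_arch_pow[of "4/3" "2 * K"] by auto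
  then show False using grow[of n] K yY[of n] by force
qed

subsection \<open>Orthonormal families\<close>

definition orthonormal :: "'h::complex_hilbert set \<Rightarrow> bool"
  where "orthonormal B \<longleftrightarrow> (\<forall>e\<in>B. \<forall>e'\<in>B. cinner e e' = (if e = e' then 1 else 0))"

lemma orthonormal_subset: "orthonormal B \<Longrightarrow> F \<subseteq> B \<Longrightarrow> orthonormal F"
  unfolding orthonormal_def by blast

lemma cinner_on_sum:
  assumes "orthonormal F" "finite F" "e \<in> F"
  shows "cinner e (\<Sum>f\<in>F. c f *\<^sub>C f) = c e"
proof -
  have "cinner e (\<Sum>f\<in>F. c f *\<^sub>C f) = (\<Sum>f\<in>F. if e = f then c f else 0)"
    unfolding cinner.sum_right
    by (intro sum.cong) (use assms in \<open>auto simp: cinner_scaleC_right orthonormal_def\<close>)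
  then show ?thesis using assms by simp
qed

lemma norm_on_sum:
  assumes "orthonormal F" "finite F"
  shows "(norm (\<Sum>e\<in>F. c e *\<^sub>C e))\<^sup>2 = (\<Sum>e\<in>F. (cmod (c e))\<^sup>2)"
proof -
  have "cinner (\<Sum>e\<in>F. c e *\<^sub>C e) (\<Sum>e\<in>F. c e *\<^sub>C e) = (\<Sum>e\<in>F. cnj (c e) * c e)"
    by (subst cinner.sum_left) (simp add: cinner_scaleC_left cinner_on_sum[OF assms])
  then have "complex_of_real ((norm (\<Sum>e\<in>F. c e *\<^sub>C e))\<^sup>2) = complex_of_real (\<Sum>e\<in>F. (cmod (c e))\<^sup>2)"
    by (simp add: cinner_self complex_norm_square[symmetric] mult.commute flip: of_real_power)
  then show ?thesis using of_real_eq_iff by blast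
qed

lemma norm_remainder:
  assumes "orthonormal F" "finite F"
  shows "(norm (x - (\<Sum>e\<in>F. cinner e x *\<^sub>C e)))\<^sup>2 = (norm x)\<^sup>2 - (\<Sum>e\<in>F. (cmod (cinner e x))\<^sup>2)"
proof -
  have "cinner x (\<Sum>e\<in>F. cinner e x *\<^sub>C e) = (\<Sum>e\<in>F. cinner e x * cnj (cinner e x))"
    unfolding cinner.sum_right
    by (intro sum.cong refl) (simp add: cinner_scaleC_right cinner_commute[of x])
  also have "\<dots> = complex_of_real (\<Sum>e\<in>F. (cmod (cinner e x))\<^sup>2)"
    by (simp add: complex_norm_square[symmetric] flip: of_real_power)
  finally show ?thesis using norm_on_sum[OF assms] by (simp add: norm_diff_square)
qed

lemma bessel:
  assumes "orthonormal F" "finite F"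
  shows "(\<Sum>e\<in>F. (cmod (cinner e x))\<^sup>2) \<le> (norm x)\<^sup>2"
  using norm_remainder[OF assms, of x] by (smt (verit) zero_le_power2)

lemma bessel_product:
  assumes "orthonormal F" "finite F"
  shows "(\<Sum>e\<in>F. cmod (cinner e x) * cmod (cinner e y)) \<le> norm x * norm y"
proof -
  have "(\<Sum>e\<in>F. cmod (cinner e x) * cmod (cinner e y))
      \<le> L2_set (\<lambda>e. cmod (cinner e x)) F * L2_set (\<lambda>e. cmod (cinner e y)) F"
    using L2_set_mult_ineq[of "\<lambda>e. cmod (cinner e x)" "\<lambda>e. cmod (cinner e y)" F] by simp
  also have "\<dots> \<le> norm x * norm y"
    unfolding L2_set_def using bessel[OF assms]
    by (intro mult_mono) (auto intro!: real_le_lsqrt sum_nonneg)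
  finally show ?thesis .
qed

lemma orthonormal_basis_exists:
  assumes "V \<in> Gr"
  shows "\<exists>B. orthonormal_basis V B"
proof -
  let ?A = "{B. B \<subseteq> V \<and> orthonormal B}"
  have "\<forall>C\<in>chains ?A. \<Union>C \<in> ?A"
  proof
    fix C assume C: "C \<in> chains ?A"
    have "orthonormal (\<Union>C)" unfolding orthonormal_def
    proof (intro ballI)
      fix e e' assume "e \<in> \<Union>C" "e' \<in> \<Union>C"
      then obtain X Y where XY: "X \<in> C" "e \<in> X" "Y \<in> C" "e' \<in> Y" by blast
      then have "X \<subseteq> Y \<or> Y \<subseteq> X" using C by (auto simp: chains_def chain_subset_def)
      moreover have "orthonormal X" "orthonormal Y" using C XY by (auto simp: chains_def)
      ultimately show "cinner e e' = (if e = e' then 1 else 0)"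
        using XY unfolding orthonormal_def by blast
    qed
    then show "\<Union>C \<in> ?A" using C by (auto simp: chains_def)
  qed
  from Zorn_Lemma[OF this] obtain B where B: "B \<subseteq> V" "orthonormal B"
    and max: "\<And>X. X \<subseteq> V \<Longrightarrow> orthonormal X \<Longrightarrow> B \<subseteq> X \<Longrightarrow> X = B" by auto
  have "x = 0" if x: "x \<in> V" "\<forall>e\<in>B. cinner e x = 0" for x
  proof (rule ccontr)
    assume "x \<noteq> 0"
    define u where "u = x /\<^sub>R norm x"
    have u: "cinner u u = 1" "u \<in> V" "\<And>e. e \<in> B \<Longrightarrow> cinner e u = 0"
      using \<open>x \<noteq> 0\<close> x GrD(4)[OF assms] by (auto simp: u_def cinner_self cinner_scaleR_right)
    have u': "cinner u e = 0" if "e \<in> B" for e using u(3)[OF that] cinner_eq_0_swap by blast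
    have uB: "u \<notin> B" using u(1) u(3)[of u] by auto
    have "cinner e e' = (if e = e' then 1 else 0)" if "e \<in> insert u B" "e' \<in> insert u B" for e e'
      using that u(1) u(3)[of e] u'[of e'] uB B(2) unfolding orthonormal_def by (elim insertE) auto
    then have "orthonormal (insert u B)" unfolding orthonormal_def by blast
    then have "insert u B = B" using max[of "insert u B"] B(1) u(2) by blast
    then show False using uB by blast
  qed
  then have "B \<subseteq> V \<and> orthonormal B \<and> (\<forall>x\<in>V. (\<forall>e\<in>B. cinner e x = 0) \<longrightarrow> x = 0)"
    using B by blast
  then show ?thesis unfolding orthonormal_basis_def orthonormal_def by (rule exI)
qed

lemma orthonormal_basisD:
  assumes "orthonormal_basis V B"
  shows "B \<subseteq> V" "orthonormal B" "x \<in> V \<Longrightarrow> \<forall>e\<in>B. cinner e x = 0 \<Longrightarrow> x = 0"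
proof -
  have "B \<subseteq> V \<and> orthonormal B \<and> (\<forall>x\<in>V. (\<forall>e\<in>B. cinner e x = 0) \<longrightarrow> x = 0)"
    using assms unfolding orthonormal_basis_def orthonormal_def by assumption
  then show "B \<subseteq> V" "orthonormal B" "x \<in> V \<Longrightarrow> \<forall>e\<in>B. cinner e x = 0 \<Longrightarrow> x = 0"
    by blast+
qed

text \<open>The vectors approximable by their finite Fourier sums form a closed subspace
  \<open>M\<close> of \<open>V\<close> that contains \<open>B\<close>. A vector of \<open>V\<close>
  orthogonal to \<open>M\<close> is orthogonal to \<open>B\<close>, hence zero, so
  \<open>M = V\<close>.\<close>

lemma basis_expansion:
  assumes V: "V \<in> Gr" and B: "orthonormal_basis V B" and x: "x \<in> V"
  shows "((\<lambda>e. cinner e x *\<^sub>C e) has_sum x) B"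
proof -
  note on = orthonormal_basisD(2)[OF B]
  define R where "R F x = x - (\<Sum>e\<in>F. cinner e x *\<^sub>C e)" for F and x :: 'a
  have Radd: "R F (x + y) = R F x + R F y" for F x y
    by (simp add: R_def cinner_add_right scaleC_add_left sum.distrib)
  have Rscale: "R F (c *\<^sub>C x) = c *\<^sub>C R F x" for F c x
    by (simp add: R_def cinner_scaleC_right scaleC_diff_right scaleC_sum_right scaleC_scaleC)
  \<comment> \<open>One good finite set controls all larger ones, which turns approximability into
    convergence along the net of finite subsets.\<close>
  have Rmono: "norm (R F' x) \<le> norm (R F x)" if "F \<subseteq> F'" "finite F'" "F' \<subseteq> B" for F F' x
  proof (rule power2_le_imp_le)
    have "(\<Sum>e\<in>F. (cmod (cinner e x))\<^sup>2) \<le> (\<Sum>e\<in>F'. (cmod (cinner e x))\<^sup>2)"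
      using that by (intro sum_mono2) auto
    then show "(norm (R F' x))\<^sup>2 \<le> (norm (R F x))\<^sup>2"
      using norm_remainder[of F x] norm_remainder[of F' x] that on orthonormal_subset[OF on]
      by (simp add: R_def finite_subset)
  qed simp
  have Rle: "norm (R F x) \<le> norm x" if "finite F" "F \<subseteq> B" for F x
    using Rmono[of "{}" F x] that by (simp add: R_def)
  define M where "M = {x\<in>V. \<forall>e>0. \<exists>F\<subseteq>B. finite F \<and> norm (R F x) < e}"
  have "csubspace M" unfolding csubspace_def
  proof (intro conjI ballI allI)
    show "0 \<in> M" using GrD(1)[OF V] by (auto simp: M_def R_def intro!: exI[of _ "{}"])
  next
    fix x y assume xy: "x \<in> M" "y \<in> M"
    have "\<exists>F\<subseteq>B. finite F \<and> norm (R F (x + y)) < e" if "e > 0" for e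
    proof -
      have "e / 2 > 0" using that by simp
      then obtain F1 F2 where F: "F1 \<subseteq> B" "finite F1" "norm (R F1 x) < e/2" "F2 \<subseteq> B" "finite F2" "norm (R F2 y) < e/2"
        using xy unfolding M_def by blast
      have "norm (R (F1 \<union> F2) (x + y)) \<le> norm (R F1 x) + norm (R F2 y)"
        unfolding Radd using Rmono[of F1 "F1 \<union> F2" x] Rmono[of F2 "F1 \<union> F2" y] F
        by (intro order_trans[OF norm_triangle_ineq] add_mono) auto
      then show ?thesis using F by (intro exI[of _ "F1 \<union> F2"]) auto
    qed
    then show "x + y \<in> M" using xy GrD(2)[OF V] by (auto simp: M_def)
  next
    fix c x assume x: "x \<in> M"
    have "\<exists>F\<subseteq>B. finite F \<and> norm (R F (c *\<^sub>C x)) < e" if "e > 0" for e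
    proof -
      have "e / (cmod c + 1) > 0" using that by (simp add: add_nonneg_pos)
      then obtain F where F: "F \<subseteq> B" "finite F" "norm (R F x) < e / (cmod c + 1)"
        using x unfolding M_def by blast
      have "(cmod c + 1) * norm (R F x) < e"
        using F(3) by (simp add: pos_less_divide_eq add_nonneg_pos mult.commute)
      then have "cmod c * norm (R F x) < e" by (simp add: distrib_right) (smt (verit) norm_ge_zero)
      then show ?thesis using F by (auto simp: Rscale norm_scaleC)
    qed
    then show "c *\<^sub>C x \<in> M" using x GrD(3)[OF V] by (auto simp: M_def)
  qed
  moreover have "closed M" unfolding closed_sequential_limits
  proof (intro allI impI)
    fix s l assume s: "(\<forall>n. s n \<in> M) \<and> s \<longlonglongrightarrow> l"
    have "l \<in> V" using s Gr_closed[OF V] by (auto simp: M_def closed_sequential_limits)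
    moreover have "\<exists>F\<subseteq>B. finite F \<and> norm (R F l) < e" if "e > 0" for e
    proof -
      obtain n where n: "norm (s n - l) < e/2" using s \<open>e > 0\<close> by (meson LIMSEQ_D half_gt_zero order_refl)
      have "e / 2 > 0" "s n \<in> M" using that s by auto
      then obtain F where F: "F \<subseteq> B" "finite F" "norm (R F (s n)) < e/2"
        unfolding M_def by blast
      have "R F l = R F (s n) + R F (l - s n)" by (simp flip: Radd)
      then have "norm (R F l) \<le> norm (R F (s n)) + norm (l - s n)"
        using Rle[OF F(2,1), of "l - s n"] norm_triangle_ineq[of "R F (s n)" "R F (l - s n)"] by simp
      then show ?thesis using F n by (intro exI[of _ F]) (auto simp: norm_minus_commute)
    qed
    ultimately show "l \<in> M" by (auto simp: M_def)
  qed
  ultimately have MGr: "M \<in> Gr" by (simp add: Gr_def)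
  have "e \<in> M" if "e \<in> B" for e
  proof -
    have "R {e} e = 0" using on that by (simp add: R_def orthonormal_def scaleC_one)
    then show ?thesis using that orthonormal_basisD(1)[OF B] by (auto simp: M_def intro!: exI[of _ "{e}"])
  qed
  then have "x = 0" if "x \<in> V" "x \<in> orth M" for x
    using orthonormal_basisD(3)[OF B that(1)] orthD[OF that(2)] by blast
  then have "M = V" by (intro Gr_eqI_zero V MGr) (auto simp: M_def)
  then have xM: "x \<in> M" using x by simp
  show ?thesis unfolding has_sum_def tendsto_iff eventually_finite_subsets_at_top
  proof (intro allI impI)
    fix e :: real assume "e > 0"
    then obtain F where F: "F \<subseteq> B" "finite F" "norm (R F x) < e" using xM unfolding M_def by blast
    have "dist (\<Sum>e\<in>F'. cinner e x *\<^sub>C e) x < e" if "finite F'" "F \<subseteq> F'" "F' \<subseteq> B" for F'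
      using Rmono[of F F' x] that F(3) by (simp add: R_def dist_norm norm_minus_commute)
    then show "\<exists>X. finite X \<and> X \<subseteq> B \<and> (\<forall>Y. finite Y \<and> X \<subseteq> Y \<and> Y \<subseteq> B \<longrightarrow> dist (\<Sum>e\<in>Y. cinner e x *\<^sub>C e) x < e)"
      using F by blast
  qed
qed

lemma parseval:
  assumes V: "V \<in> Gr" and B: "orthonormal_basis V B" and x: "x \<in> V"
  shows "((\<lambda>e. cinner y e * cinner e x) has_sum cinner y x) B"
proof -
  have "((\<lambda>e. cinner y (cinner e x *\<^sub>C e)) has_sum cinner y x) B"
    by (rule has_sum_bounded_linear[OF cinner.bounded_linear_right basis_expansion[OF assms]])
  then show ?thesis by (simp add: cinner_scaleC_right mult.commute)
qed


section \<open>Calculus in normed spaces given as sets\<close>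

text \<open>Completeness is split off because the calculus uses norms only, and spaces of
  multilinear maps and restricted duals enter merely as normed spaces.\<close>

definition normed_space :: "'v::complex_vector nspace \<Rightarrow> bool"
  where "normed_space X \<longleftrightarrow>
    csubspace (vecs X) \<and>
    (\<forall>x\<in>vecs X. 0 \<le> nrm X x \<and> (nrm X x = 0 \<longleftrightarrow> x = 0)) \<and>
    (\<forall>x\<in>vecs X. \<forall>y\<in>vecs X. nrm X (x + y) \<le> nrm X x + nrm X y) \<and>
    (\<forall>c. \<forall>x\<in>vecs X. nrm X (c *\<^sub>C x) = cmod c * nrm X x)"

lemma banach_normed: "banach_space X \<Longrightarrow> normed_space X"
  by (simp add: banach_space_def normed_space_def)

lemma nsD:
  assumes "normed_space X"
  shows nsD_sub: "csubspace (vecs X)"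
    and nsD_0: "0 \<in> vecs X"
    and nsD_add: "x \<in> vecs X \<Longrightarrow> y \<in> vecs X \<Longrightarrow> x + y \<in> vecs X"
    and nsD_diff: "x \<in> vecs X \<Longrightarrow> y \<in> vecs X \<Longrightarrow> x - y \<in> vecs X"
    and nsD_scale: "x \<in> vecs X \<Longrightarrow> c *\<^sub>C x \<in> vecs X"
    and nsD_nonneg: "x \<in> vecs X \<Longrightarrow> 0 \<le> nrm X x"
    and nsD_zero_iff: "x \<in> vecs X \<Longrightarrow> nrm X x = 0 \<longleftrightarrow> x = 0"
    and nsD_nrm0: "nrm X 0 = 0"
    and nsD_tri: "x \<in> vecs X \<Longrightarrow> y \<in> vecs X \<Longrightarrow> nrm X (x + y) \<le> nrm X x + nrm X y"
    and nsD_nscale: "x \<in> vecs X \<Longrightarrow> nrm X (c *\<^sub>C x) = cmod c * nrm X x"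
proof -
  show sub: "csubspace (vecs X)" using assms by (simp add: normed_space_def)
  show "0 \<in> vecs X" by (rule csubspaceD(1)[OF sub])
  then show "nrm X 0 = 0" using assms by (simp add: normed_space_def)
  show "x \<in> vecs X \<Longrightarrow> y \<in> vecs X \<Longrightarrow> x + y \<in> vecs X" by (rule csubspaceD(2)[OF sub])
  show "x \<in> vecs X \<Longrightarrow> y \<in> vecs X \<Longrightarrow> x - y \<in> vecs X" by (rule csubspaceD(6)[OF sub])
  show "x \<in> vecs X \<Longrightarrow> c *\<^sub>C x \<in> vecs X" by (rule csubspaceD(3)[OF sub])
qed (use assms in \<open>auto simp: normed_space_def\<close>)

lemma nrm_minus: "normed_space X \<Longrightarrow> x \<in> vecs X \<Longrightarrow> nrm X (- x) = nrm X x"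
  using nsD_nscale[of X x "-1"] by simp

lemma nrm_minus_commute: "normed_space X \<Longrightarrow> x \<in> vecs X \<Longrightarrow> y \<in> vecs X \<Longrightarrow> nrm X (x - y) = nrm X (y - x)"
  using nrm_minus[of X "x - y"] nsD_diff by fastforce

lemma nrm_tri_diff: "normed_space X \<Longrightarrow> x \<in> vecs X \<Longrightarrow> y \<in> vecs X \<Longrightarrow> nrm X (x - y) \<le> nrm X x + nrm X y"
  using nsD_tri[of X x "-y"] nrm_minus[of X y] csubspaceD(5)[OF nsD_sub] by fastforce

lemma sum_list_vecs: "normed_space X \<Longrightarrow> (\<And>p. p \<in> set ps \<Longrightarrow> t p \<in> vecs X) \<Longrightarrow> (\<Sum>p\<leftarrow>ps. t p) \<in> vecs X"
  by (induction ps) (auto intro: nsD_0 nsD_add)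

lemma nrm_sum_list:
  "normed_space X \<Longrightarrow> (\<And>p. p \<in> set ps \<Longrightarrow> t p \<in> vecs X) \<Longrightarrow> (\<And>p. p \<in> set ps \<Longrightarrow> nrm X (t p) \<le> C) \<Longrightarrow>
    nrm X (\<Sum>p\<leftarrow>ps. t p) \<le> real (length ps) * (C::real)"
proof (induction ps)
  case (Cons p ps)
  have "nrm X (t p + (\<Sum>p\<leftarrow>ps. t p)) \<le> nrm X (t p) + nrm X (\<Sum>p\<leftarrow>ps. t p)"
    using Cons.prems by (intro nsD_tri sum_list_vecs) auto
  also have "\<dots> \<le> C + real (length ps) * C" using Cons by (intro add_mono) auto
  finally show ?case by (simp add: algebra_simps)
qed (simp add: nsD_nrm0)

subsection \<open>Operators\<close>

lemma operators_vecs: "vecs (operators X Y) = {T. bounded_linear_map X Y T \<and> (\<forall>x. x \<notin> vecs X \<longrightarrow> T x = 0)}"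
  and operators_nrm: "nrm (operators X Y) T = Sup {nrm Y (T x) | x. x \<in> vecs X \<and> nrm X x \<le> 1}"
  by (simp_all add: operators_def)

lemma operatorsI:
  assumes "\<And>x. x \<in> vecs X \<Longrightarrow> T x \<in> vecs Y"
    "\<And>x y. x \<in> vecs X \<Longrightarrow> y \<in> vecs X \<Longrightarrow> T (x + y) = T x + T y"
    "\<And>c x. x \<in> vecs X \<Longrightarrow> T (c *\<^sub>C x) = c *\<^sub>C T x"
    "\<And>x. x \<in> vecs X \<Longrightarrow> nrm Y (T x) \<le> K * nrm X x"
    "\<And>x. x \<notin> vecs X \<Longrightarrow> T x = 0"
  shows "T \<in> vecs (operators X Y)"
  unfolding operators_vecs bounded_linear_map_def linear_on_def
  using assms(1-3,5) by (auto intro!: exI[of _ K] assms(4))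

lemma opD:
  assumes "T \<in> vecs (operators X Y)"
  shows op_in: "x \<in> vecs X \<Longrightarrow> T x \<in> vecs Y"
    and op_add: "x \<in> vecs X \<Longrightarrow> y \<in> vecs X \<Longrightarrow> T (x + y) = T x + T y"
    and op_scale: "x \<in> vecs X \<Longrightarrow> T (c *\<^sub>C x) = c *\<^sub>C T x"
    and op_outside: "x \<notin> vecs X \<Longrightarrow> T x = 0"
    and op_bdd: "\<exists>K. \<forall>x\<in>vecs X. nrm Y (T x) \<le> K * nrm X x"
  using assms by (auto simp: operators_vecs bounded_linear_map_def linear_on_def)

lemma op_zero: "normed_space X \<Longrightarrow> T \<in> vecs (operators X Y) \<Longrightarrow> T 0 = 0"
  using op_scale[of T X Y 0 0] nsD_0[of X] by simp

lemma op_diff: "normed_space X \<Longrightarrow> T \<in> vecs (operators X Y) \<Longrightarrow> x \<in> vecs X \<Longrightarrow> y \<in> vecs X \<Longrightarrow>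
    T (x - y) = T x - T y"
  using op_add[of T X Y x "-y"] op_scale[of T X Y y "-1"] csubspaceD(5)[OF nsD_sub, of X y] by simp

lemma op_vecs_cong: "T \<in> vecs (operators X Y) \<Longrightarrow> S \<in> vecs (operators X Y) \<Longrightarrow>
    (\<And>x. x \<in> vecs X \<Longrightarrow> T x = S x) \<Longrightarrow> T = S"
  by (rule ext) (metis op_outside)

lemma op_norm_bdd:
  assumes X: "normed_space X" and Y: "normed_space Y" and T: "T \<in> vecs (operators X Y)"
  shows "bdd_above {nrm Y (T x) | x. x \<in> vecs X \<and> nrm X x \<le> 1}"
proof -
  obtain K where K: "\<forall>x\<in>vecs X. nrm Y (T x) \<le> K * nrm X x" using op_bdd[OF T] by blast
  have "nrm Y (T x) \<le> \<bar>K\<bar>" if "x \<in> vecs X" "nrm X x \<le> 1" for x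
  proof -
    have "nrm Y (T x) \<le> \<bar>K\<bar> * nrm X x"
      using K that nsD_nonneg[OF X that(1)] by (metis abs_ge_self mult_right_mono order_trans)
    also have "\<dots> \<le> \<bar>K\<bar> * 1" using that by (intro mult_left_mono) auto
    finally show ?thesis by simp
  qed
  then show ?thesis by (auto simp: bdd_above_def)
qed

lemma op_bound:
  assumes X: "normed_space X" and Y: "normed_space Y" and T: "T \<in> vecs (operators X Y)" and x: "x \<in> vecs X"
  shows "nrm Y (T x) \<le> nrm (operators X Y) T * nrm X x"
proof (cases "x = 0")
  case True
  then show ?thesis using op_zero[OF X T] nsD_nrm0[OF X] nsD_nrm0[OF Y] by simp
next
  case False
  then have pos: "nrm X x > 0" using nsD_nonneg[OF X x] nsD_zero_iff[OF X x] by linarith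
  define u where "u = complex_of_real (inverse (nrm X x)) *\<^sub>C x"
  have u: "u \<in> vecs X" "nrm X u \<le> 1"
    using pos by (auto simp: u_def nsD_scale[OF X x] nsD_nscale[OF X x] norm_inverse)
  have "nrm Y (T u) \<le> nrm (operators X Y) T"
    unfolding operators_nrm using u by (intro cSup_upper op_norm_bdd[OF X Y T]) blast
  moreover have "nrm Y (T u) = inverse (nrm X x) * nrm Y (T x)"
    using pos by (simp add: u_def op_scale[OF T x] nsD_nscale[OF Y op_in[OF T x]] norm_inverse)
  ultimately show ?thesis using pos by (simp add: field_simps)
qed

lemma op_norm_le:
  assumes X: "normed_space X" and K: "K \<ge> 0" and b: "\<And>x. x \<in> vecs X \<Longrightarrow> nrm Y (T x) \<le> K * nrm X x"
  shows "nrm (operators X Y) T \<le> K"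
  unfolding operators_nrm
proof (rule cSup_least)
  show "{nrm Y (T x) | x. x \<in> vecs X \<and> nrm X x \<le> 1} \<noteq> {}" using nsD_0[OF X] nsD_nrm0[OF X] by force
  fix r assume "r \<in> {nrm Y (T x) | x. x \<in> vecs X \<and> nrm X x \<le> 1}"
  then obtain x where x: "x \<in> vecs X" "nrm X x \<le> 1" "r = nrm Y (T x)" by blast
  have "r \<le> K * nrm X x" using b x by simp
  also have "\<dots> \<le> K * 1" using x K by (intro mult_left_mono) auto
  finally show "r \<le> K" by simp
qed

lemma op_norm_nonneg:
  assumes X: "normed_space X" and Y: "normed_space Y" and T: "T \<in> vecs (operators X Y)"
  shows "0 \<le> nrm (operators X Y) T"
proof -
  have "nrm Y (T 0) \<le> nrm (operators X Y) T"
    unfolding operators_nrm using nsD_0[OF X] nsD_nrm0[OF X]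
    by (intro cSup_upper op_norm_bdd[OF X Y T]) force
  then show ?thesis using op_zero[OF X T] nsD_nrm0[OF Y] by simp
qed

lemma operators_csubspace:
  assumes X: "normed_space X" and Y: "normed_space Y"
  shows "csubspace (vecs (operators X Y))"
  unfolding csubspace_def
proof (intro conjI ballI allI)
  show "0 \<in> vecs (operators X Y)" by (rule operatorsI[where K = 0]) (simp_all add: nsD_0[OF Y] nsD_nrm0[OF Y])
next
  fix S T assume S: "S \<in> vecs (operators X Y)" and T: "T \<in> vecs (operators X Y)"
  have "nrm Y (S x + T x) \<le> (nrm (operators X Y) S + nrm (operators X Y) T) * nrm X x" if "x \<in> vecs X" for x
    using nsD_tri[OF Y op_in[OF S that] op_in[OF T that]] op_bound[OF X Y S that] op_bound[OF X Y T that]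
    by (simp add: distrib_right)
  then show "S + T \<in> vecs (operators X Y)"
    by (intro operatorsI) (simp_all add: op_add[OF S] op_add[OF T] op_scale[OF S] op_scale[OF T]
      op_outside[OF S] op_outside[OF T] op_in[OF S] op_in[OF T] nsD_add[OF Y] scaleC_add_right)
next
  fix c T assume T: "T \<in> vecs (operators X Y)"
  have "nrm Y (c *\<^sub>C T x) \<le> (cmod c * nrm (operators X Y) T) * nrm X x" if "x \<in> vecs X" for x
    using op_bound[OF X Y T that] by (simp add: nsD_nscale[OF Y op_in[OF T that]] mult_left_mono mult.assoc)
  then show "c *\<^sub>C T \<in> vecs (operators X Y)"
    by (intro operatorsI[where K = "cmod c * nrm (operators X Y) T"]) (simp_all add: scaleC_fun_def op_add[OF T] op_scale[OF T]
      op_outside[OF T] op_in[OF T] nsD_scale[OF Y] scaleC_add_right scaleC_scaleC mult.commute)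
qed

lemma normed_operators:
  assumes X: "normed_space X" and Y: "normed_space Y"
  shows "normed_space (operators X Y)"
  unfolding normed_space_def
proof (intro conjI ballI allI)
  let ?N = "nrm (operators X Y)"
  show "csubspace (vecs (operators X Y))" by (rule operators_csubspace[OF assms])
  fix T assume T: "T \<in> vecs (operators X Y)"
  show nn: "0 \<le> ?N T" by (rule op_norm_nonneg[OF X Y T])
  show "?N T = 0 \<longleftrightarrow> T = 0"
  proof
    assume "?N T = 0"
    then have "T x = 0" if "x \<in> vecs X" for x
      using op_bound[OF X Y T that] nsD_nonneg[OF Y op_in[OF T that]] nsD_zero_iff[OF Y op_in[OF T that]] by simp
    then show "T = 0" using op_outside[OF T] by (auto simp: fun_eq_iff)
  next
    assume "T = 0"
    then have "?N T \<le> 0" by (intro op_norm_le[OF X]) (simp_all add: nsD_nrm0[OF Y])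
    then show "?N T = 0" using nn by simp
  qed
  show "?N (T + S) \<le> ?N T + ?N S" if S: "S \<in> vecs (operators X Y)" for S
  proof (rule op_norm_le[OF X])
    show "0 \<le> ?N T + ?N S" using nn op_norm_nonneg[OF X Y S] by simp
    show "nrm Y ((T + S) x) \<le> (?N T + ?N S) * nrm X x" if "x \<in> vecs X" for x
      using nsD_tri[OF Y op_in[OF T that] op_in[OF S that]] op_bound[OF X Y S that] op_bound[OF X Y T that]
      by (simp add: distrib_right)
  qed
  have le: "?N (c *\<^sub>C S) \<le> cmod c * ?N S" if S: "S \<in> vecs (operators X Y)" for c S
  proof (rule op_norm_le[OF X])
    show "0 \<le> cmod c * ?N S" using op_norm_nonneg[OF X Y S] by simp
    show "nrm Y ((c *\<^sub>C S) x) \<le> cmod c * ?N S * nrm X x" if "x \<in> vecs X" for x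
      using op_bound[OF X Y S that]
      by (simp add: scaleC_fun_def nsD_nscale[OF Y op_in[OF S that]] mult_left_mono mult.assoc)
  qed
  show "?N (c *\<^sub>C T) = cmod c * ?N T" for c
  proof (cases "c = 0")
    case False
    have "?N (inverse c *\<^sub>C (c *\<^sub>C T)) \<le> cmod (inverse c) * ?N (c *\<^sub>C T)"
      by (rule le[OF csubspaceD(3)[OF operators_csubspace[OF X Y] T]])
    then have "cmod c * ?N T \<le> ?N (c *\<^sub>C T)"
      using False by (simp add: scaleC_scaleC scaleC_one norm_inverse inverse_eq_divide norm_divide pos_le_divide_eq mult.commute)
    then show ?thesis using le[OF T, of c] by simp
  qed (use le[OF T, of 0] op_norm_nonneg[OF X Y csubspaceD(1)[OF operators_csubspace[OF X Y]]] in simp)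
qed

lemma banach_operators:
  assumes X: "normed_space X" and Y: "banach_space Y"
  shows "banach_space (operators X Y)"
proof -
  note Yn = banach_normed[OF Y]
  note N = normed_operators[OF X Yn]
  let ?N = "nrm (operators X Y)"
  have "\<exists>T\<in>vecs (operators X Y). (\<lambda>n. ?N (s n - T)) \<longlonglongrightarrow> 0"
    if s: "\<And>n. s n \<in> vecs (operators X Y)"
      and C: "\<forall>e>0. \<exists>K::nat. \<forall>m\<ge>K. \<forall>n\<ge>K. ?N (s m - s n) < e" for s
  proof -
    have diff: "nrm Y (s m x - s n x) \<le> ?N (s m - s n) * nrm X x" if "x \<in> vecs X" for m n x
      using op_bound[OF X Yn nsD_diff[OF N s s] that, of m n] by simp
    have "\<exists>y\<in>vecs Y. (\<lambda>n. nrm Y (s n x - y)) \<longlonglongrightarrow> 0" if x: "x \<in> vecs X" for x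
    proof -
      have "\<exists>K. \<forall>m\<ge>K. \<forall>n\<ge>K. nrm Y (s m x - s n x) < e" if e: "e > 0" for e
      proof -
        \<comment> \<open>The summand 1 keeps the denominator positive for
          \<open>x = 0\<close>.\<close>
        have "e / (nrm X x + 1) > 0" using e nsD_nonneg[OF X x] by simp
        then obtain K where K: "\<forall>m\<ge>K. \<forall>n\<ge>K. ?N (s m - s n) < e / (nrm X x + 1)" using C by blast
        have "nrm Y (s m x - s n x) < e" if "m \<ge> K" "n \<ge> K" for m n
        proof -
          have "nrm Y (s m x - s n x) \<le> ?N (s m - s n) * (nrm X x + 1)"
            using diff[OF x, of m n] op_norm_nonneg[OF X Yn nsD_diff[OF N s s], of m n]
            by (simp add: distrib_left)
          also have "\<dots> < e" using K that nsD_nonneg[OF X x] by (simp add: pos_less_divide_eq)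
          finally show ?thesis .
        qed
        then show ?thesis by blast
      qed
      then show ?thesis using Y op_in[OF s x] unfolding banach_space_def by auto
    qed
    then obtain L where L: "\<And>x. x \<in> vecs X \<Longrightarrow> L x \<in> vecs Y"
      and lim: "\<And>x. x \<in> vecs X \<Longrightarrow> (\<lambda>n. nrm Y (s n x - L x)) \<longlonglongrightarrow> 0" by metis
    define T where "T = zero_outside (vecs X) L"
    have TL: "T x = L x" if "x \<in> vecs X" for x using that by (simp add: T_def zero_outside_def)
    \<comment> \<open>Convergence is expressed by \<open>nrm Y\<close> and not by a topology on the
      type, so uniqueness of limits is derived from the triangle inequality.\<close>
    have uniq: "y = z" if yz: "y \<in> vecs Y" "z \<in> vecs Y" "\<And>n. t n \<in> vecs Y"
      and ly: "(\<lambda>n. nrm Y (t n - y)) \<longlonglongrightarrow> 0" and lz: "(\<lambda>n. nrm Y (t n - z)) \<longlonglongrightarrow> 0" for y z t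
    proof -
      have "nrm Y (y - z) \<le> nrm Y (t n - y) + nrm Y (t n - z)" for n
        using nrm_tri_diff[OF Yn nsD_diff[OF Yn yz(3) yz(2)] nsD_diff[OF Yn yz(3) yz(1)], of n n] by simp
      then have "nrm Y (y - z) \<le> 0 + 0"
        by (intro LIMSEQ_le_const[OF tendsto_add[OF ly lz]]) auto
      then show ?thesis
        using nsD_nonneg[OF Yn nsD_diff[OF Yn yz(1,2)]] nsD_zero_iff[OF Yn nsD_diff[OF Yn yz(1,2)]] by simp
    qed
    \<comment> \<open>Let \<open>m\<close> tend to infinity in the Cauchy estimate. With
      \<open>e = 1\<close> this makes \<open>T\<close> bounded, with small \<open>e\<close> it gives
      convergence in operator norm.\<close>
    have Tdiff: "nrm Y (s n x - T x) \<le> e * nrm X x" if x: "x \<in> vecs X" and K: "\<forall>m\<ge>K. \<forall>n\<ge>K. ?N (s m - s n) < e" "n \<ge> K" for n x e K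
    proof -
      have "nrm Y (s n x - L x) \<le> e * nrm X x + nrm Y (s m x - L x)" if "m \<ge> K" for m
      proof -
        have "nrm Y (s n x - L x) \<le> nrm Y (s n x - s m x) + nrm Y (s m x - L x)"
          using nsD_tri[OF Yn nsD_diff[OF Yn op_in[OF s x] op_in[OF s x]] nsD_diff[OF Yn op_in[OF s x] L[OF x]], of n m m]
          by simp
        moreover have "?N (s n - s m) * nrm X x \<le> e * nrm X x"
          using K that nsD_nonneg[OF X x] by (intro mult_right_mono) (auto intro: less_imp_le)
        ultimately show ?thesis using diff[OF x, of n m] by linarith
      qed
      then have "nrm Y (s n x - L x) \<le> e * nrm X x + 0"
        by (intro LIMSEQ_le_const[OF tendsto_add[OF tendsto_const lim[OF x]]]) auto
      then show ?thesis by (simp add: TL[OF x])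
    qed
    obtain K1 where K1: "\<forall>m\<ge>K1. \<forall>n\<ge>K1. ?N (s m - s n) < 1" using C by (meson zero_less_one)
    have Tin: "T \<in> vecs (operators X Y)"
    proof (rule operatorsI)
      fix x y assume x: "x \<in> vecs X" and y: "y \<in> vecs X"
      have "L (x + y) = L x + L y"
      proof (rule uniq[where t = "\<lambda>n. s n (x + y)"])
        have le: "nrm Y (s n (x + y) - (L x + L y)) \<le> nrm Y (s n x - L x) + nrm Y (s n y - L y)" for n
          using nsD_tri[OF Yn nsD_diff[OF Yn op_in[OF s x] L[OF x]] nsD_diff[OF Yn op_in[OF s y] L[OF y]], of n n]
          by (simp add: op_add[OF s x y] algebra_simps)
        have ge: "0 \<le> nrm Y (s n (x + y) - (L x + L y))" for n
          using op_in[OF s nsD_add[OF X x y]] nsD_add[OF Yn L[OF x] L[OF y]] by (intro nsD_nonneg[OF Yn] nsD_diff[OF Yn])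
        show "(\<lambda>n. nrm Y (s n (x + y) - (L x + L y))) \<longlonglongrightarrow> 0"
          using tendsto_add[OF lim[OF x] lim[OF y]] le ge
          by - (rule tendsto_sandwich[of "\<lambda>_. 0" _ _ "\<lambda>n. nrm Y (s n x - L x) + nrm Y (s n y - L y)"], auto)
      qed (use L x y lim nsD_add[OF X] nsD_add[OF Yn] op_in[OF s] in auto)
      then show "T (x + y) = T x + T y" using x y nsD_add[OF X x y] by (simp add: TL)
    next
      fix c x assume x: "x \<in> vecs X"
      have "L (c *\<^sub>C x) = c *\<^sub>C L x"
      proof (rule uniq[where t = "\<lambda>n. s n (c *\<^sub>C x)"])
        have "nrm Y (s n (c *\<^sub>C x) - c *\<^sub>C L x) = cmod c * nrm Y (s n x - L x)" for n
          using nsD_nscale[OF Yn nsD_diff[OF Yn op_in[OF s x] L[OF x]], of c n]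
          by (simp add: op_scale[OF s x] scaleC_diff_right)
        then show "(\<lambda>n. nrm Y (s n (c *\<^sub>C x) - c *\<^sub>C L x)) \<longlonglongrightarrow> 0"
          using tendsto_mult[OF tendsto_const lim[OF x], of "cmod c"] by simp
      qed (use L x lim nsD_scale[OF X] nsD_scale[OF Yn] op_in[OF s] in auto)
      then show "T (c *\<^sub>C x) = c *\<^sub>C T x" using x nsD_scale[OF X x] by (simp add: TL)
    next
      fix x assume x: "x \<in> vecs X"
      have "nrm Y (T x) \<le> nrm Y (s K1 x) + nrm Y (s K1 x - T x)"
        using nrm_tri_diff[OF Yn op_in[OF s x] nsD_diff[OF Yn op_in[OF s x] L[OF x]], of K1 K1] TL[OF x] by simp
      also have "\<dots> \<le> ?N (s K1) * nrm X x + 1 * nrm X x"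
        by (intro add_mono op_bound[OF X Yn s x] Tdiff[OF x K1]) simp
      finally show "nrm Y (T x) \<le> (?N (s K1) + 1) * nrm X x" by (simp add: distrib_right)
    qed (auto simp: TL L, simp add: T_def zero_outside_def)
    have "(\<lambda>n. ?N (s n - T)) \<longlonglongrightarrow> 0"
    proof (rule LIMSEQ_I)
      fix r :: real assume r: "0 < r"
      then obtain K where K: "\<forall>m\<ge>K. \<forall>n\<ge>K. ?N (s m - s n) < r / 2" using C by (meson half_gt_zero)
      have "?N (s n - T) \<le> r / 2" if "n \<ge> K" for n
        using r Tdiff[OF _ K that] by (intro op_norm_le[OF X]) auto
      then show "\<exists>no. \<forall>n\<ge>no. norm (?N (s n - T) - 0) < r"
        using r op_norm_nonneg[OF X Yn nsD_diff[OF N s Tin]] by (intro exI[of _ K]) force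
    qed
    then show ?thesis using Tin by blast
  qed
  then show ?thesis using N unfolding banach_space_def normed_space_def by auto
qed

lemma operators_compose:
  assumes X: "normed_space X" and Y: "normed_space Y" and Z: "normed_space Z"
    and T: "T \<in> vecs (operators Y Z)" and S: "S \<in> vecs (operators X Y)"
  shows "T \<circ> S \<in> vecs (operators X Z)"
    and "nrm (operators X Z) (T \<circ> S) \<le> nrm (operators Y Z) T * nrm (operators X Y) S"
proof -
  have b: "nrm Z (T (S x)) \<le> (nrm (operators Y Z) T * nrm (operators X Y) S) * nrm X x" if "x \<in> vecs X" for x
    using op_bound[OF Y Z T op_in[OF S that]]
      mult_left_mono[OF op_bound[OF X Y S that] op_norm_nonneg[OF Y Z T]] by simp
  then show "T \<circ> S \<in> vecs (operators X Z)"
    by (intro operatorsI) (auto simp: op_in[OF T] op_in[OF S] op_add[OF S] op_add[OF T] op_scale[OF S]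
        op_scale[OF T] op_outside[OF S] op_zero[OF Y T])
  show "nrm (operators X Z) (T \<circ> S) \<le> nrm (operators Y Z) T * nrm (operators X Y) S"
    using b by (intro op_norm_le[OF X] mult_nonneg_nonneg op_norm_nonneg[OF Y Z T] op_norm_nonneg[OF X Y S]) auto
qed

section \<open>Scalars, duals and closed subspaces as Banach spaces\<close>

lemma subspace_nspace_simps [simp]: "vecs (subspace_nspace V) = V" "nrm (subspace_nspace V) = norm"
  by (simp_all add: subspace_nspace_def)

lemma complex_nspace: "banach_space \<lparr>vecs = UNIV, nrm = cmod\<rparr>"
  unfolding banach_space_def
proof (intro conjI allI impI)
  fix s :: "nat \<Rightarrow> complex" assume "(\<forall>n. s n \<in> vecs \<lparr>vecs = UNIV, nrm = cmod\<rparr>) \<and>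
    (\<forall>e>0. \<exists>N. \<forall>m\<ge>N. \<forall>n\<ge>N. nrm \<lparr>vecs = UNIV, nrm = cmod\<rparr> (s m - s n) < e)"
  then have "Cauchy s" by (auto simp: Cauchy_def dist_norm)
  then obtain l where "s \<longlonglongrightarrow> l" using convergent_eq_Cauchy by blast
  then have "(\<lambda>n. cmod (s n - l)) \<longlonglongrightarrow> 0" by (simp add: LIM_zero_iff tendsto_norm_zero_iff)
  then show "\<exists>x\<in>vecs \<lparr>vecs = UNIV, nrm = cmod\<rparr>. (\<lambda>n. nrm \<lparr>vecs = UNIV, nrm = cmod\<rparr> (s n - x)) \<longlonglongrightarrow> 0"
    by auto
qed (auto simp: csubspace_def norm_triangle_ineq norm_mult)

lemmas complex_normed = banach_normed[OF complex_nspace]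

lemma dual_banach: "normed_space X \<Longrightarrow> banach_space (dual X)"
  unfolding dual_def by (rule banach_operators[OF _ complex_nspace])

lemmas dual_normed = banach_normed[OF dual_banach]

lemma subspace_banach:
  assumes "V \<in> Gr"
  shows "banach_space (subspace_nspace V)"
  unfolding banach_space_def
proof (intro conjI allI impI)
  show "csubspace (vecs (subspace_nspace V))" using Gr_csubspace[OF assms] by (simp add: subspace_nspace_def)
  fix s :: "nat \<Rightarrow> 'a" assume s: "(\<forall>n. s n \<in> vecs (subspace_nspace V)) \<and>
    (\<forall>e>0. \<exists>N. \<forall>m\<ge>N. \<forall>n\<ge>N. nrm (subspace_nspace V) (s m - s n) < e)"
  then have "Cauchy s" by (auto simp: Cauchy_def dist_norm subspace_nspace_def)
  then obtain l where l: "s \<longlonglongrightarrow> l" using convergent_eq_Cauchy by blast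
  then have "l \<in> V" using s Gr_closed[OF assms] by (auto simp: subspace_nspace_def closed_sequential_limits)
  moreover have "(\<lambda>n. norm (s n - l)) \<longlonglongrightarrow> 0" using l by (simp add: LIM_zero_iff tendsto_norm_zero_iff)
  ultimately show "\<exists>x\<in>vecs (subspace_nspace V). (\<lambda>n. nrm (subspace_nspace V) (s n - x)) \<longlonglongrightarrow> 0"
    by (auto simp: subspace_nspace_def)
qed (auto simp: subspace_nspace_def norm_triangle_ineq norm_scaleC)

lemmas subspace_normed = banach_normed[OF subspace_banach]


subsection \<open>Multilinear maps\<close>

abbreviation pnorm :: "'v nspace \<Rightarrow> 'v list \<Rightarrow> real"
  where "pnorm X vs \<equiv> prod_list (map (nrm X) vs)"

abbreviation tuple_in :: "nat \<Rightarrow> 'v nspace \<Rightarrow> 'v list \<Rightarrow> bool"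
  where "tuple_in k X vs \<equiv> length vs = k \<and> set vs \<subseteq> vecs X"

lemma pnorm_nonneg: "normed_space X \<Longrightarrow> set vs \<subseteq> vecs X \<Longrightarrow> 0 \<le> pnorm X vs"
  by (induction vs) (auto intro!: mult_nonneg_nonneg nsD_nonneg)

lemma ml_vecs: "vecs (multilinear_maps k X Y) = {T.
       (\<forall>vs. tuple_in k X vs \<longrightarrow> T vs \<in> vecs Y) \<and>
       (\<forall>vs. \<not> (tuple_in k X vs) \<longrightarrow> T vs = 0) \<and>
       (\<forall>us ws. length us + 1 + length ws = k \<and> set us \<subseteq> vecs X \<and> set ws \<subseteq> vecs X \<longrightarrow>
         linear_on (vecs X) (\<lambda>v. T (us @ v # ws))) \<and>
       (\<exists>K. \<forall>vs. tuple_in k X vs \<longrightarrow> nrm Y (T vs) \<le> K * pnorm X vs)}"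
  and ml_nrm: "nrm (multilinear_maps k X Y) T = Sup {nrm Y (T vs) | vs.
       length vs = k \<and> set vs \<subseteq> vecs X \<and> (\<forall>v\<in>set vs. nrm X v \<le> 1)}"
  by (simp_all add: multilinear_maps_def)

lemma mlI:
  assumes "\<And>vs. tuple_in k X vs \<Longrightarrow> T vs \<in> vecs Y"
    "\<And>vs. \<not> tuple_in k X vs \<Longrightarrow> T vs = 0"
    "\<And>us ws. length us + 1 + length ws = k \<Longrightarrow> set us \<subseteq> vecs X \<Longrightarrow> set ws \<subseteq> vecs X \<Longrightarrow>
         linear_on (vecs X) (\<lambda>v. T (us @ v # ws))"
    "\<And>vs. tuple_in k X vs \<Longrightarrow> nrm Y (T vs) \<le> K * pnorm X vs"
  shows "T \<in> vecs (multilinear_maps k X Y)"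
  unfolding ml_vecs using assms by blast

lemma mlD:
  assumes "T \<in> vecs (multilinear_maps k X Y)"
  shows ml_in: "tuple_in k X vs \<Longrightarrow> T vs \<in> vecs Y"
    and ml_outside: "\<not> tuple_in k X vs \<Longrightarrow> T vs = 0"
    and ml_linear: "length us + 1 + length ws = k \<Longrightarrow> set us \<subseteq> vecs X \<Longrightarrow> set ws \<subseteq> vecs X \<Longrightarrow>
         linear_on (vecs X) (\<lambda>v. T (us @ v # ws))"
    and ml_bdd: "\<exists>K. \<forall>vs. tuple_in k X vs \<longrightarrow> nrm Y (T vs) \<le> K * pnorm X vs"
  using assms unfolding ml_vecs by blast+

lemma ml_norm_le:
  assumes X: "normed_space X" and K: "K \<ge> 0"
    and b: "\<And>vs. tuple_in k X vs \<Longrightarrow> nrm Y (T vs) \<le> K * pnorm X vs"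
  shows "nrm (multilinear_maps k X Y) T \<le> K"
  unfolding ml_nrm
proof (rule cSup_least)
  have "nrm Y (T (replicate k 0)) \<in> {nrm Y (T vs) | vs.
      length vs = k \<and> set vs \<subseteq> vecs X \<and> (\<forall>v\<in>set vs. nrm X v \<le> 1)}"
    using nsD_0[OF X] nsD_nrm0[OF X] by (auto intro!: exI[of _ "replicate k 0"])
  then show "{nrm Y (T vs) | vs. length vs = k \<and> set vs \<subseteq> vecs X \<and> (\<forall>v\<in>set vs. nrm X v \<le> 1)} \<noteq> {}"
    by blast
  fix r assume "r \<in> {nrm Y (T vs) | vs. length vs = k \<and> set vs \<subseteq> vecs X \<and> (\<forall>v\<in>set vs. nrm X v \<le> 1)}"
  then obtain vs where vs: "length vs = k" "set vs \<subseteq> vecs X" "\<forall>v\<in>set vs. nrm X v \<le> 1" "r = nrm Y (T vs)"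
    by blast
  have "pnorm X vs \<le> 1" using vs(2,3)
  proof (induction vs)
    case (Cons v vs)
    then have "nrm X v * pnorm X vs \<le> 1 * 1"
      using nsD_nonneg[OF X] pnorm_nonneg[OF X] by (intro mult_mono) auto
    then show ?case by simp
  qed simp
  then have "K * pnorm X vs \<le> K * 1" using K by (intro mult_left_mono)
  then show "r \<le> K" using b[of vs] vs by simp
qed

text \<open>The prefix \<open>us\<close> is there for the induction: each argument moves into it
  once it has been scaled.\<close>

lemma ml_scale_all:
  assumes "T \<in> vecs (multilinear_maps (length us + length vs) X Y)"
    and "normed_space X" "set us \<subseteq> vecs X" "set vs \<subseteq> vecs X"
  shows "T (us @ map (\<lambda>v. c v *\<^sub>C v) vs) = prod_list (map c vs) *\<^sub>C T (us @ vs)"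
  using assms
proof (induction vs arbitrary: us)
  case (Cons v vs)
  have len: "length us + length (v # vs) = length (us @ [c v *\<^sub>C v]) + length vs" by simp
  have "set (map (\<lambda>v. c v *\<^sub>C v) vs) \<subseteq> vecs X" using Cons.prems by (auto intro: nsD_scale)
  have "T (us @ map (\<lambda>v. c v *\<^sub>C v) (v # vs)) = T ((us @ [c v *\<^sub>C v]) @ map (\<lambda>v. c v *\<^sub>C v) vs)" by simp
  also have "\<dots> = prod_list (map c vs) *\<^sub>C T ((us @ [c v *\<^sub>C v]) @ vs)"
    by (intro Cons.IH) (use Cons.prems len nsD_scale[OF Cons.prems(2)] in auto)
  also have "T ((us @ [c v *\<^sub>C v]) @ vs) = c v *\<^sub>C T (us @ v # vs)"
    using ml_linear[OF Cons.prems(1), of us vs] Cons.prems by (simp add: linear_on_def)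
  finally show ?case by (simp add: scaleC_scaleC mult.commute)
qed (simp add: scaleC_one)

lemma ml_bound:
  assumes X: "normed_space X" and Y: "normed_space Y" and T: "T \<in> vecs (multilinear_maps k X Y)"
    and vs: "tuple_in k X vs"
  shows "nrm Y (T vs) \<le> nrm (multilinear_maps k X Y) T * pnorm X vs"
proof -
  obtain K where K: "\<And>vs. tuple_in k X vs \<Longrightarrow> nrm Y (T vs) \<le> K * pnorm X vs" using ml_bdd[OF T] by blast
  have bdd: "bdd_above {nrm Y (T vs) | vs. length vs = k \<and> set vs \<subseteq> vecs X \<and> (\<forall>v\<in>set vs. nrm X v \<le> 1)}"
  proof (rule bdd_aboveI[of _ "\<bar>K\<bar>"])
    fix r assume "r \<in> {nrm Y (T vs) | vs. length vs = k \<and> set vs \<subseteq> vecs X \<and> (\<forall>v\<in>set vs. nrm X v \<le> 1)}"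
    then obtain vs where vs: "length vs = k" "set vs \<subseteq> vecs X" "\<forall>v\<in>set vs. nrm X v \<le> 1" "r = nrm Y (T vs)"
      by blast
    have p: "0 \<le> pnorm X vs \<and> pnorm X vs \<le> 1" using vs(2,3)
    proof (induction vs)
      case (Cons v vs)
      then have "nrm X v * pnorm X vs \<le> 1 * 1"
        using nsD_nonneg[OF X] pnorm_nonneg[OF X] by (intro mult_mono) auto
      then show ?case using Cons nsD_nonneg[OF X, of v] by simp
    qed simp
    have "K * pnorm X vs \<le> \<bar>K\<bar> * 1" using p by (intro mult_mono) auto
    then show "r \<le> \<bar>K\<bar>" using K[of vs] vs by simp
  qed
  show ?thesis
  proof (cases "\<exists>v\<in>set vs. nrm X v = 0")
    case True
    \<comment> \<open>An argument of norm zero cannot be normalized, but here the unspecified bound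
      \<open>K\<close> already forces the value to have norm at most zero.\<close>
    then have "pnorm X vs = 0" by (induction vs) auto
    then show ?thesis using K[OF vs] by simp
  next
    case False
    then have pos: "nrm X v > 0" if "v \<in> set vs" for v
      using that vs nsD_nonneg[OF X, of v] by (metis less_eq_real_def subsetD)
    define c where "c v = complex_of_real (inverse (nrm X v))" for v
    have cv: "c v *\<^sub>C v \<in> vecs X" "nrm X (c v *\<^sub>C v) = 1" if "v \<in> set vs" for v
      using pos[OF that] that vs nsD_nscale[OF X, of v "c v"] nsD_scale[OF X, of v "c v"]
      by (auto simp: c_def norm_inverse)
    have Pc: "prod_list (map c vs) = complex_of_real (inverse (pnorm X vs))"
      by (induction vs) (simp_all add: c_def)
    have Ppos: "pnorm X vs > 0" using pos by (induction vs) auto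
    have "nrm Y (T (map (\<lambda>v. c v *\<^sub>C v) vs)) \<le> nrm (multilinear_maps k X Y) T"
      unfolding ml_nrm using vs cv by (intro cSup_upper bdd) fastforce
    moreover have "T (map (\<lambda>v. c v *\<^sub>C v) vs) = prod_list (map c vs) *\<^sub>C T vs"
      using ml_scale_all[of T "[]" vs X Y c] T vs X by simp
    ultimately have "cmod (prod_list (map c vs)) * nrm Y (T vs) \<le> nrm (multilinear_maps k X Y) T"
      using nsD_nscale[OF Y ml_in[OF T vs]] by simp
    then show ?thesis unfolding Pc norm_of_real using Ppos by (simp add: field_simps)
  qed
qed

lemma ml_norm_nonneg:
  assumes X: "normed_space X" and Y: "normed_space Y" and T: "T \<in> vecs (multilinear_maps k X Y)"
  shows "0 \<le> nrm (multilinear_maps k X Y) T"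
proof -
  have "bdd_above {nrm Y (T vs) | vs. length vs = k \<and> set vs \<subseteq> vecs X \<and> (\<forall>v\<in>set vs. nrm X v \<le> 1)}"
  proof (rule bdd_aboveI[of _ "\<bar>nrm (multilinear_maps k X Y) T\<bar>"])
    fix r assume "r \<in> {nrm Y (T vs) | vs. length vs = k \<and> set vs \<subseteq> vecs X \<and> (\<forall>v\<in>set vs. nrm X v \<le> 1)}"
    then obtain vs where vs: "length vs = k" "set vs \<subseteq> vecs X" "\<forall>v\<in>set vs. nrm X v \<le> 1" "r = nrm Y (T vs)"
      by blast
    have p: "0 \<le> pnorm X vs \<and> pnorm X vs \<le> 1" using vs(2,3)
    proof (induction vs)
      case (Cons v vs)
      then have "nrm X v * pnorm X vs \<le> 1 * 1"
        using nsD_nonneg[OF X] pnorm_nonneg[OF X] by (intro mult_mono) auto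
      then show ?case using Cons nsD_nonneg[OF X, of v] by simp
    qed simp
    have "nrm (multilinear_maps k X Y) T * pnorm X vs \<le> \<bar>nrm (multilinear_maps k X Y) T\<bar> * 1"
      using p by (intro mult_mono) auto
    then show "r \<le> \<bar>nrm (multilinear_maps k X Y) T\<bar>" using ml_bound[OF X Y T, of vs] vs by simp
  qed
  moreover have "tuple_in k X (replicate k 0)" using nsD_0[OF X] by auto
  ultimately have "nrm Y (T (replicate k 0)) \<le> nrm (multilinear_maps k X Y) T"
    unfolding ml_nrm using nsD_0[OF X] nsD_nrm0[OF X]
    by (intro cSup_upper) (auto intro!: exI[of _ "replicate k 0"])
  then show ?thesis using nsD_nonneg[OF Y ml_in[OF T \<open>tuple_in k X (replicate k 0)\<close>]] by linarith
qed

lemma ml_lincomb: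
  assumes X: "normed_space X" and Y: "normed_space Y"
    and S: "S \<in> vecs (multilinear_maps k X Y)" and T: "T \<in> vecs (multilinear_maps k X Y)"
  shows "S + T \<in> vecs (multilinear_maps k X Y)" and "c *\<^sub>C T \<in> vecs (multilinear_maps k X Y)"
proof -
  let ?N = "nrm (multilinear_maps k X Y)"
  have "nrm Y (S vs + T vs) \<le> (?N S + ?N T) * pnorm X vs" if vs: "tuple_in k X vs" for vs
    using nsD_tri[OF Y ml_in[OF S vs] ml_in[OF T vs]] ml_bound[OF X Y S vs] ml_bound[OF X Y T vs]
    by (simp add: distrib_right)
  moreover have "linear_on (vecs X) (\<lambda>v. S (us @ v # ws) + T (us @ v # ws))"
    if "length us + 1 + length ws = k" "set us \<subseteq> vecs X" "set ws \<subseteq> vecs X" for us ws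
    using ml_linear[OF S that] ml_linear[OF T that] by (auto simp: linear_on_def scaleC_add_right)
  ultimately show "S + T \<in> vecs (multilinear_maps k X Y)"
    by (intro mlI[where K = "?N S + ?N T"])
      (use ml_outside[OF S] ml_outside[OF T] nsD_add[OF Y ml_in[OF S] ml_in[OF T]] in auto)
  have "nrm Y (c *\<^sub>C T vs) \<le> (cmod c * ?N T) * pnorm X vs" if vs: "tuple_in k X vs" for vs
    using ml_bound[OF X Y T vs] nsD_nscale[OF Y ml_in[OF T vs]] by (simp add: mult_left_mono mult.assoc)
  moreover have "linear_on (vecs X) (\<lambda>v. c *\<^sub>C T (us @ v # ws))"
    if "length us + 1 + length ws = k" "set us \<subseteq> vecs X" "set ws \<subseteq> vecs X" for us ws
    using ml_linear[OF T that] by (auto simp: linear_on_def scaleC_add_right scaleC_scaleC mult.commute)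
  ultimately show "c *\<^sub>C T \<in> vecs (multilinear_maps k X Y)"
    by (intro mlI[where K = "cmod c * ?N T"])
      (use ml_outside[OF T] nsD_scale[OF Y ml_in[OF T]] in \<open>auto simp: scaleC_fun_def\<close>)
qed

lemma ml_zero: "normed_space Y \<Longrightarrow> (\<lambda>_. 0) \<in> vecs (multilinear_maps k X Y)"
  by (rule mlI[where K = 0]) (auto simp: nsD_0 nsD_nrm0 linear_on_def)

lemma normed_ml:
  assumes X: "normed_space X" and Y: "normed_space Y"
  shows "normed_space (multilinear_maps k X Y)"
  unfolding normed_space_def
proof (intro conjI ballI allI)
  let ?M = "multilinear_maps k X Y" let ?N = "nrm ?M"
  show "csubspace (vecs ?M)"
    unfolding csubspace_def using ml_lincomb[OF X Y] ml_zero[OF Y] by (auto simp: zero_fun_def)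
  fix T assume T: "T \<in> vecs ?M"
  show nn: "0 \<le> ?N T" by (rule ml_norm_nonneg[OF X Y T])
  show "?N T = 0 \<longleftrightarrow> T = 0"
  proof
    assume 0: "?N T = 0"
    have "T vs = 0" for vs
    proof (cases "tuple_in k X vs")
      case True
      then show ?thesis
        using ml_bound[OF X Y T True] 0 nsD_nonneg[OF Y ml_in[OF T True]] nsD_zero_iff[OF Y ml_in[OF T True]] by simp
    qed (rule ml_outside[OF T])
    then show "T = 0" by (auto simp: fun_eq_iff)
  next
    assume "T = 0"
    then have "?N T \<le> 0" by (intro ml_norm_le[OF X]) (simp_all add: nsD_nrm0[OF Y])
    then show "?N T = 0" using nn by simp
  qed
  show "?N (T + S) \<le> ?N T + ?N S" if S: "S \<in> vecs ?M" for S
  proof (rule ml_norm_le[OF X])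
    show "0 \<le> ?N T + ?N S" using nn ml_norm_nonneg[OF X Y S] by simp
    show "nrm Y ((T + S) vs) \<le> (?N T + ?N S) * pnorm X vs" if vs: "tuple_in k X vs" for vs
      using nsD_tri[OF Y ml_in[OF T vs] ml_in[OF S vs]] ml_bound[OF X Y S vs] ml_bound[OF X Y T vs]
      by (simp add: distrib_right)
  qed
  have le: "?N (c *\<^sub>C S) \<le> cmod c * ?N S" if S: "S \<in> vecs ?M" for c S
  proof (rule ml_norm_le[OF X])
    show "0 \<le> cmod c * ?N S" using ml_norm_nonneg[OF X Y S] by simp
    show "nrm Y ((c *\<^sub>C S) vs) \<le> cmod c * ?N S * pnorm X vs" if vs: "tuple_in k X vs" for vs
      using ml_bound[OF X Y S vs]
      by (simp add: scaleC_fun_def nsD_nscale[OF Y ml_in[OF S vs]] mult_left_mono mult.assoc)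
  qed
  show "?N (c *\<^sub>C T) = cmod c * ?N T" for c
  proof (cases "c = 0")
    case False
    have "?N (inverse c *\<^sub>C (c *\<^sub>C T)) \<le> cmod (inverse c) * ?N (c *\<^sub>C T)"
      by (rule le[OF ml_lincomb(2)[OF X Y T T]])
    then have "cmod c * ?N T \<le> ?N (c *\<^sub>C T)"
      using False by (simp add: scaleC_scaleC scaleC_one norm_inverse inverse_eq_divide norm_divide pos_le_divide_eq mult.commute)
    then show ?thesis using le[OF T, of c] by simp
  qed (use le[OF T, of 0] ml_norm_nonneg[OF X Y ml_lincomb(2)[OF X Y T T, of 0]] in simp)
qed

text \<open>Links two forms of a derivative: \<open>smooth_on\<close> differentiates a map into
  \<open>k\<close>-linear maps, so the derivative is an operator whose values are
  \<open>k\<close>-linear, while jets store it as a map of \<open>Suc k\<close> arguments, the new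
  direction first.\<close>

lemma ml_curry:
  assumes X: "normed_space X" and Y: "normed_space Y" and T: "T \<in> vecs (multilinear_maps (Suc k) X Y)"
  shows "(\<lambda>h vs. T (h # vs)) \<in> vecs (operators X (multilinear_maps k X Y))"
proof -
  let ?N = "nrm (multilinear_maps (Suc k) X Y) T"
  have N0: "?N \<ge> 0" by (rule ml_norm_nonneg[OF X Y T])
  have b: "nrm Y (T (h # vs)) \<le> (?N * nrm X h) * pnorm X vs" if "h \<in> vecs X" "tuple_in k X vs" for h vs
    using ml_bound[OF X Y T, of "h # vs"] that by simp
  have lin: "linear_on (vecs X) (\<lambda>v. T (h # us @ v # ws))"
    if "h \<in> vecs X" "length us + 1 + length ws = k" "set us \<subseteq> vecs X" "set ws \<subseteq> vecs X" for h us ws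
    using ml_linear[OF T, of "h # us" ws] that by simp
  have hl: "linear_on (vecs X) (\<lambda>h. T (h # vs))" if "tuple_in k X vs" for vs
    using ml_linear[OF T, of "[]" vs] that by simp
  have out: "T (h # vs) = 0" if "\<not> (h \<in> vecs X \<and> tuple_in k X vs)" for h vs
    using that by (intro ml_outside[OF T]) auto
  show ?thesis
  proof (rule operatorsI)
    fix h assume h: "h \<in> vecs X"
    show "(\<lambda>vs. T (h # vs)) \<in> vecs (multilinear_maps k X Y)"
      by (rule mlI[OF _ _ _ b[OF h]]) (use h lin out ml_in[OF T] in auto)
    show "nrm (multilinear_maps k X Y) (\<lambda>vs. T (h # vs)) \<le> ?N * nrm X h"
      using N0 nsD_nonneg[OF X h] b[OF h] by (intro ml_norm_le[OF X] mult_nonneg_nonneg)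
    show "(\<lambda>vs. T ((c *\<^sub>C h) # vs)) = c *\<^sub>C (\<lambda>vs. T (h # vs))" for c
      unfolding scaleC_fun_def
      by (rule ext) (metis h hl out linear_on_def scaleC_zero_right)
    fix g assume g: "g \<in> vecs X"
    show "(\<lambda>vs. T ((h + g) # vs)) = (\<lambda>vs. T (h # vs)) + (\<lambda>vs. T (g # vs))"
    proof (rule ext)
      fix vs show "T ((h + g) # vs) = ((\<lambda>vs. T (h # vs)) + (\<lambda>vs. T (g # vs))) vs"
        using hl[of vs] out[of _ vs] h g by (cases "tuple_in k X vs") (auto simp: linear_on_def)
    qed
  qed (use out in \<open>auto simp: fun_eq_iff\<close>)
qed

subsection \<open>Derivatives and their uniqueness\<close>

lemma has_fderivD:
  assumes "has_fderiv X U Y f T x"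
  shows "T \<in> vecs (operators X Y)"
    and "e > 0 \<Longrightarrow> \<exists>d>0. \<forall>y\<in>U. nrm X (y - x) < d \<longrightarrow> nrm Y (f y - f x - T (y - x)) \<le> e * nrm X (y - x)"
  using assms by (auto simp: has_fderiv_def)

lemma has_fderiv_unique:
  assumes X: "normed_space X" and Y: "normed_space Y" and U: "open_in X U" and x: "x \<in> U"
    and f: "\<And>y. y \<in> U \<Longrightarrow> f y \<in> vecs Y"
    and S: "has_fderiv X U Y f S x" and T: "has_fderiv X U Y f T x"
  shows "S = T"
proof (rule op_vecs_cong[OF has_fderivD(1)[OF S] has_fderivD(1)[OF T]])
  note S1 = has_fderivD(1)[OF S] and T1 = has_fderivD(1)[OF T]
  fix h assume h: "h \<in> vecs X"
  have xX: "x \<in> vecs X" using U x by (auto simp: open_in_def)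
  obtain r where r: "r > 0" "\<forall>y\<in>vecs X. nrm X (y - x) < r \<longrightarrow> y \<in> U" using U x unfolding open_in_def by blast
  have dY: "S h - T h \<in> vecs Y" by (intro nsD_diff[OF Y] op_in[OF S1 h] op_in[OF T1 h])
  have "nrm Y (S h - T h) \<le> 2 * e * nrm X h" if e: "e > 0" for e
  proof -
    obtain d1 where d1: "d1 > 0" "\<forall>y\<in>U. nrm X (y - x) < d1 \<longrightarrow> nrm Y (f y - f x - S (y - x)) \<le> e * nrm X (y - x)"
      using has_fderivD(2)[OF S e] by blast
    obtain d2 where d2: "d2 > 0" "\<forall>y\<in>U. nrm X (y - x) < d2 \<longrightarrow> nrm Y (f y - f x - T (y - x)) \<le> e * nrm X (y - x)"
      using has_fderivD(2)[OF T e] by blast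
    \<comment> \<open>Scaling \<open>h\<close> by \<open>t\<close> brings \<open>x + t h\<close>
      within all three radii; the summand 1 covers \<open>h = 0\<close>.\<close>
    define t where "t = min r (min d1 d2) / (nrm X h + 1)"
    have hn: "nrm X h \<ge> 0" by (rule nsD_nonneg[OF X h])
    have t: "t > 0" using r d1 d2 hn by (simp add: t_def)
    have "t * nrm X h < t * (nrm X h + 1)" using t by simp
    also have "\<dots> = min r (min d1 d2)" using hn by (simp add: t_def)
    finally have small: "t * nrm X h < min r (min d1 d2)" .
    define k where "k = complex_of_real t *\<^sub>C h"
    have k: "k \<in> vecs X" "nrm X k = t * nrm X h" using t h by (simp_all add: k_def nsD_scale[OF X] nsD_nscale[OF X])
    define y where "y = x + k"
    have yx: "y - x = k" by (simp add: y_def)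
    have yU: "y \<in> U" using r small k nsD_add[OF X xX k(1)] by (simp add: y_def)
    have a: "nrm Y (f y - f x - S k) \<le> e * nrm X k" using d1 yU small k yx by auto
    have b: "nrm Y (f y - f x - T k) \<le> e * nrm X k" using d2 yU small k yx by auto
    have fd: "f y - f x \<in> vecs Y" by (intro nsD_diff[OF Y] f yU x)
    have "S k - T k = (f y - f x - T k) - (f y - f x - S k)" by simp
    then have "nrm Y (S k - T k) \<le> 2 * e * nrm X k"
      using nrm_tri_diff[OF Y nsD_diff[OF Y fd op_in[OF T1 k(1)]] nsD_diff[OF Y fd op_in[OF S1 k(1)]]] a b by simp
    moreover have "S k - T k = complex_of_real t *\<^sub>C (S h - T h)"
      by (simp add: k_def op_scale[OF S1 h] op_scale[OF T1 h] scaleC_diff_right)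
    ultimately have "t * nrm Y (S h - T h) \<le> t * (2 * e * nrm X h)"
      using t by (simp add: nsD_nscale[OF Y dY] k(2) mult.commute mult.left_commute)
    then show ?thesis using t by simp
  qed
  note le = this
  have "nrm Y (S h - T h) \<le> 0"
  proof (rule field_le_epsilon)
    fix e :: real assume e: "e > 0"
    have hn: "nrm X h \<ge> 0" by (rule nsD_nonneg[OF X h])
    define q where "q = e / (nrm X h + 1)"
    have "nrm Y (S h - T h) \<le> 2 * (q / 2) * nrm X h" using e hn by (intro le) (simp add: q_def)
    also have "\<dots> = q * nrm X h" by simp
    also have "\<dots> = e * (nrm X h / (nrm X h + 1))" by (simp add: q_def)
    also have "\<dots> \<le> e * 1" using e hn by (intro mult_left_mono) auto
    finally show "nrm Y (S h - T h) \<le> 0 + e" by simp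
  qed
  then show "S h = T h" using nsD_nonneg[OF Y dY] nsD_zero_iff[OF Y dY] by simp
qed

text \<open>Differentiability of \<open>F\<close> with the norm of multilinear maps unfolded into an
  estimate for every tuple of arguments. Estimates of derivatives can then be made in
  \<open>Y\<close> itself.\<close>

definition taylor1 where "taylor1 X U Y k F F' x \<longleftrightarrow>
  (\<forall>e>0. \<exists>d>0. \<forall>y\<in>U. nrm X (y - x) < d \<longrightarrow> (\<forall>vs. tuple_in k X vs \<longrightarrow>
     nrm Y (F y vs - F x vs - F' ((y - x) # vs)) \<le> e * nrm X (y - x) * pnorm X vs))"

lemma has_fderiv_taylor1:
  assumes X: "normed_space X" and Y: "normed_space Y" and U: "U \<subseteq> vecs X" and x: "x \<in> U"
    and F: "\<And>y. y \<in> U \<Longrightarrow> F y \<in> vecs (multilinear_maps k X Y)"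
    and F': "F' \<in> vecs (multilinear_maps (Suc k) X Y)"
  shows "has_fderiv X U (multilinear_maps k X Y) F (\<lambda>h vs. F' (h # vs)) x \<longleftrightarrow> taylor1 X U Y k F F' x"
proof -
  note C = ml_curry[OF X Y F']
  have "nrm (multilinear_maps k X Y) (F y - F x - (\<lambda>vs. F' ((y - x) # vs))) \<le> e * nrm X (y - x) \<longleftrightarrow>
      (\<forall>vs. tuple_in k X vs \<longrightarrow> nrm Y (F y vs - F x vs - F' ((y - x) # vs)) \<le> e * nrm X (y - x) * pnorm X vs)"
    (is "?l \<longleftrightarrow> ?r") if y: "y \<in> U" and e: "e > 0" for y e
  proof
    have yx: "y - x \<in> vecs X" using y x U by (intro nsD_diff[OF X]) auto
    have M: "F y - F x - (\<lambda>vs. F' ((y - x) # vs)) \<in> vecs (multilinear_maps k X Y)"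
      using op_in[OF C yx] F[OF y] F[OF x] by (intro nsD_diff[OF normed_ml[OF X Y]])
    show ?r if ?l
    proof (intro allI impI)
      fix vs assume vs: "tuple_in k X vs"
      have "nrm Y (F y vs - F x vs - F' ((y - x) # vs))
          \<le> nrm (multilinear_maps k X Y) (F y - F x - (\<lambda>vs. F' ((y - x) # vs))) * pnorm X vs"
        using ml_bound[OF X Y M vs] by simp
      also have "\<dots> \<le> e * nrm X (y - x) * pnorm X vs"
        using that vs pnorm_nonneg[OF X] by (intro mult_right_mono) auto
      finally show "nrm Y (F y vs - F x vs - F' ((y - x) # vs)) \<le> e * nrm X (y - x) * pnorm X vs" .
    qed
    show ?l if ?r
      using that e nsD_nonneg[OF X yx] by (intro ml_norm_le[OF X]) auto
  qed
  then show ?thesis unfolding has_fderiv_def taylor1_def using C by auto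
qed


subsection \<open>Jets of finite order\<close>

text \<open>Multilinearity is demanded in every order but differentiability only below
  \<open>n\<close>, so the family may be continued arbitrarily, for instance by zero, beyond the
  order of interest.\<close>

definition jet ::
    "nat \<Rightarrow> 'v::complex_vector nspace \<Rightarrow> 'v set \<Rightarrow> 'w::complex_vector nspace \<Rightarrow> ('v \<Rightarrow> 'w) \<Rightarrow>
     (nat \<Rightarrow> 'v \<Rightarrow> 'v list \<Rightarrow> 'w) \<Rightarrow> bool"
  where "jet n X U Y f D \<longleftrightarrow> (\<forall>x\<in>U. D 0 x [] = f x \<and>
    (\<forall>k. D k x \<in> vecs (multilinear_maps k X Y)) \<and>
    (\<forall>k<n. has_fderiv X U (multilinear_maps k X Y) (D k) (\<lambda>h vs. D (Suc k) x (h # vs)) x))"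

text \<open>For \<open>n = 0\<close> this only says that \<open>f\<close> takes values in \<open>Y\<close>; continuity is not required.\<close>

definition Cn :: "nat \<Rightarrow> 'v::complex_vector nspace \<Rightarrow> 'v set \<Rightarrow> 'w::complex_vector nspace \<Rightarrow> ('v \<Rightarrow> 'w) \<Rightarrow> bool"
  where "Cn n X U Y f \<longleftrightarrow> (\<exists>D. jet n X U Y f D)"

lemma jetI:
  assumes "normed_space X" "normed_space Y" "U \<subseteq> vecs X"
    and "\<And>x. x \<in> U \<Longrightarrow> D 0 x [] = f x" "\<And>k x. x \<in> U \<Longrightarrow> D k x \<in> vecs (multilinear_maps k X Y)"
    and "\<And>k x. k < n \<Longrightarrow> x \<in> U \<Longrightarrow> taylor1 X U Y k (D k) (D (Suc k) x) x"
  shows "jet n X U Y f D"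
  unfolding jet_def
proof (intro ballI conjI allI impI)
  fix x k assume x: "x \<in> U" and k: "k < n"
  show "has_fderiv X U (multilinear_maps k X Y) (D k) (\<lambda>h vs. D (Suc k) x (h # vs)) x"
    using has_fderiv_taylor1[OF assms(1-3) x assms(5) assms(5)[OF x]] assms(6)[OF k x] by simp
qed (use assms in auto)

lemma jetD:
  assumes "jet n X U Y f D" "x \<in> U"
  shows "D 0 x [] = f x" "D k x \<in> vecs (multilinear_maps k X Y)"
  using assms by (auto simp: jet_def)

lemma jet_taylor1:
  assumes "normed_space X" "normed_space Y" "U \<subseteq> vecs X" "jet n X U Y f D" "x \<in> U" "k < n"
  shows "taylor1 X U Y k (D k) (D (Suc k) x) x"
  using has_fderiv_taylor1[OF assms(1-3,5), of "D k" k "D (Suc k) x"] assms(4-6) by (auto simp: jet_def)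

lemma Cn_cong:
  assumes "Cn n X U Y f" "\<And>x. x \<in> U \<Longrightarrow> f x = g x"
  shows "Cn n X U Y g"
  using assms unfolding Cn_def jet_def by metis

lemma Cn_in:
  assumes "Cn n X U Y f" "x \<in> U"
  shows "f x \<in> vecs Y"
proof -
  obtain D where D: "jet n X U Y f D" using assms by (auto simp: Cn_def)
  then show ?thesis using ml_in[OF jetD(2)[OF D assms(2), of 0], of "[]"] jetD(1)[OF D assms(2)] by simp
qed

lemma ml_0I: "normed_space Y \<Longrightarrow> y \<in> vecs Y \<Longrightarrow> (\<lambda>vs. if vs = [] then y else 0) \<in> vecs (multilinear_maps 0 X Y)"
  by (rule mlI[where K = "nrm Y y"]) auto

lemma Cn_0:
  assumes "normed_space Y" "\<And>x. x \<in> U \<Longrightarrow> f x \<in> vecs Y"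
  shows "Cn 0 X U Y f"
  unfolding Cn_def jet_def
  by (rule exI[of _ "\<lambda>k x. if k = 0 then (\<lambda>vs. if vs = [] then f x else 0) else (\<lambda>_. 0)"])
    (auto simp: ml_0I assms ml_zero)

lemma Cn_affine:
  assumes X: "normed_space X" and Y: "normed_space Y" and U: "U \<subseteq> vecs X"
    and c: "c \<in> vecs Y" and L: "L \<in> vecs (operators X Y)"
  shows "Cn n X U Y (\<lambda>x. c + L x)"
proof -
  define D where "D k x = (if k = 0 then (\<lambda>vs. if vs = [] then c + L x else 0)
    else if k = 1 then (\<lambda>vs. if tuple_in 1 X vs then L (hd vs) else 0) else (\<lambda>_. 0))" for k :: nat and x
  have "jet n X U Y (\<lambda>x. c + L x) D"
  proof (rule jetI[OF X Y U])
    fix x assume x: "x \<in> U"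
    then have xX: "x \<in> vecs X" using U by auto
    show "D 0 x [] = c + L x" by (simp add: D_def)
    have "(\<lambda>vs. if tuple_in 1 X vs then L (hd vs) else 0) \<in> vecs (multilinear_maps 1 X Y)"
    proof (rule mlI)
      fix vs assume "tuple_in 1 X vs"
      then obtain v where v: "vs = [v]" "v \<in> vecs X" by (cases vs) auto
      show "(if tuple_in 1 X vs then L (hd vs) else 0) \<in> vecs Y" using v by (simp add: op_in[OF L])
      show "nrm Y (if tuple_in 1 X vs then L (hd vs) else 0) \<le> nrm (operators X Y) L * pnorm X vs"
        using v op_bound[OF X Y L] by simp
    next
      fix us ws :: "'a list" assume "length us + 1 + length ws = 1"
      then show "linear_on (vecs X) (\<lambda>v. if tuple_in 1 X (us @ v # ws) then L (hd (us @ v # ws)) else 0)"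
        by (auto simp: linear_on_def op_add[OF L] op_scale[OF L] nsD_add[OF X] nsD_scale[OF X])
    qed auto
    then show "D k x \<in> vecs (multilinear_maps k X Y)" for k
      by (simp add: D_def ml_0I[OF Y nsD_add[OF Y c op_in[OF L xX]]] ml_zero[OF Y])
    show "taylor1 X U Y k (D k) (D (Suc k) x) x" for k
      unfolding taylor1_def
    proof (intro allI impI)
      fix e :: real assume e: "e > 0"
      have "nrm Y (D k y vs - D k x vs - D (Suc k) x ((y - x) # vs)) \<le> e * nrm X (y - x) * pnorm X vs"
        if y: "y \<in> U" and vs: "tuple_in k X vs" for y vs
      proof -
        have yX: "y \<in> vecs X" "y - x \<in> vecs X" using y U nsD_diff[OF X _ xX] by auto
        have "D k y vs - D k x vs - D (Suc k) x ((y - x) # vs) = 0"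
          using vs yX op_diff[OF X L yX(1) xX] by (auto simp: D_def)
        then show ?thesis
          using e vs nsD_nonneg[OF X yX(2)] pnorm_nonneg[OF X, of vs] by (simp add: nsD_nrm0[OF Y])
      qed
      then show "\<exists>d>0. \<forall>y\<in>U. nrm X (y - x) < d \<longrightarrow> (\<forall>vs. tuple_in k X vs \<longrightarrow>
          nrm Y (D k y vs - D k x vs - D (Suc k) x ((y - x) # vs)) \<le> e * nrm X (y - x) * pnorm X vs)"
        by (intro exI[of _ 1]) auto
    qed
  qed
  then show ?thesis by (auto simp: Cn_def)
qed

lemma Cn_const:
  assumes "normed_space X" "normed_space Y" "U \<subseteq> vecs X" "c \<in> vecs Y"
  shows "Cn n X U Y (\<lambda>_. c)"
  using Cn_affine[OF assms nsD_0[OF normed_operators[OF assms(1,2)]]] by simp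

lemma Cn_add:
  assumes X: "normed_space X" and Y: "normed_space Y" and U: "U \<subseteq> vecs X"
    and f: "Cn n X U Y f" and g: "Cn n X U Y g"
  shows "Cn n X U Y (\<lambda>x. f x + g x)"
proof -
  obtain F G where F: "jet n X U Y f F" and G: "jet n X U Y g G" using f g by (auto simp: Cn_def)
  have "jet n X U Y (\<lambda>x. f x + g x) (\<lambda>k x. F k x + G k x)"
  proof (rule jetI[OF X Y U])
    fix x assume x: "x \<in> U"
    show "(F 0 x + G 0 x) [] = f x + g x" by (simp add: jetD(1)[OF F x] jetD(1)[OF G x])
    show "F k x + G k x \<in> vecs (multilinear_maps k X Y)" for k
      by (rule ml_lincomb(1)[OF X Y jetD(2)[OF F x] jetD(2)[OF G x]])
    fix k assume k: "k < n"
    show "taylor1 X U Y k (\<lambda>x. F k x + G k x) (F (Suc k) x + G (Suc k) x) x"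
      unfolding taylor1_def
    proof (intro allI impI)
      fix e :: real assume "e > 0"
      then have e: "e / 2 > 0" by simp
      obtain d1 where d1: "d1 > 0" "\<forall>y\<in>U. nrm X (y - x) < d1 \<longrightarrow> (\<forall>vs. tuple_in k X vs \<longrightarrow>
          nrm Y (F k y vs - F k x vs - F (Suc k) x ((y - x) # vs)) \<le> e / 2 * nrm X (y - x) * pnorm X vs)"
        using jet_taylor1[OF X Y U F x k] e unfolding taylor1_def by blast
      obtain d2 where d2: "d2 > 0" "\<forall>y\<in>U. nrm X (y - x) < d2 \<longrightarrow> (\<forall>vs. tuple_in k X vs \<longrightarrow>
          nrm Y (G k y vs - G k x vs - G (Suc k) x ((y - x) # vs)) \<le> e / 2 * nrm X (y - x) * pnorm X vs)"
        using jet_taylor1[OF X Y U G x k] e unfolding taylor1_def by blast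
      have "nrm Y ((F k y + G k y) vs - (F k x + G k x) vs - (F (Suc k) x + G (Suc k) x) ((y - x) # vs))
          \<le> e * nrm X (y - x) * pnorm X vs"
        if y: "y \<in> U" "nrm X (y - x) < min d1 d2" and vs: "tuple_in k X vs" for y vs
      proof -
        have yx: "tuple_in (Suc k) X ((y - x) # vs)" using x y U vs nsD_diff[OF X, of y x] by auto
        have m: "J k y vs - J k x vs - J (Suc k) x ((y - x) # vs) \<in> vecs Y" if J: "jet n X U Y j J" for j J
          by (intro nsD_diff[OF Y] ml_in[OF jetD(2)[OF J y(1)] vs] ml_in[OF jetD(2)[OF J x] vs]
              ml_in[OF jetD(2)[OF J x] yx])
        have "nrm Y ((F k y vs - F k x vs - F (Suc k) x ((y - x) # vs)) + (G k y vs - G k x vs - G (Suc k) x ((y - x) # vs)))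
            \<le> e / 2 * nrm X (y - x) * pnorm X vs + e / 2 * nrm X (y - x) * pnorm X vs"
          using d1 d2 y vs by (intro order_trans[OF nsD_tri[OF Y m[OF F] m[OF G]]] add_mono) auto
        then show ?thesis by (simp add: algebra_simps)
      qed
      then show "\<exists>d>0. \<forall>y\<in>U. nrm X (y - x) < d \<longrightarrow> (\<forall>vs. tuple_in k X vs \<longrightarrow>
          nrm Y ((F k y + G k y) vs - (F k x + G k x) vs - (F (Suc k) x + G (Suc k) x) ((y - x) # vs))
            \<le> e * nrm X (y - x) * pnorm X vs)"
        using d1 d2 by (intro exI[of _ "min d1 d2"]) auto
    qed
  qed
  then show ?thesis by (auto simp: Cn_def)
qed

subsection \<open>The Leibniz rule\<close>

definition bilin ::
    "'a::complex_vector nspace \<Rightarrow> 'b::complex_vector nspace \<Rightarrow> 'c::complex_vector nspace \<Rightarrow> ('a \<Rightarrow> 'b \<Rightarrow> 'c) \<Rightarrow> bool"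
  where "bilin A B C m \<longleftrightarrow> (\<forall>a\<in>vecs A. \<forall>b\<in>vecs B. m a b \<in> vecs C) \<and>
    (\<forall>b\<in>vecs B. linear_on (vecs A) (\<lambda>a. m a b)) \<and> (\<forall>a\<in>vecs A. linear_on (vecs B) (m a)) \<and>
    (\<exists>K\<ge>0. \<forall>a\<in>vecs A. \<forall>b\<in>vecs B. nrm C (m a b) \<le> K * nrm A a * nrm B b)"

text \<open>The index set of the Leibniz formula: all ways to distribute the directions of
  differentiation over two factors, with their order kept.\<close>

fun splits :: "'a list \<Rightarrow> ('a list \<times> 'a list) list"
  where "splits [] = [([], [])]"
  | "splits (h # vs) = map (\<lambda>(a, b). (h # a, b)) (splits vs) @ map (\<lambda>(a, b). (a, h # b)) (splits vs)"

lemma splits_props: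
  "(a, b) \<in> set (splits vs) \<Longrightarrow>
    set a \<subseteq> set vs \<and> set b \<subseteq> set vs \<and> length a + length b = length vs \<and> pnorm X a * pnorm X b = pnorm X vs"
proof (induction vs arbitrary: a b)
  case (Cons h vs)
  then consider a' where "a = h # a'" "(a', b) \<in> set (splits vs)" | b' where "b = h # b'" "(a, b') \<in> set (splits vs)"
    by auto
  then show ?case
  proof cases
    case 1
    then show ?thesis using Cons.IH[OF 1(2)] by (auto simp: mult.assoc)
  next
    case 2
    then show ?thesis using Cons.IH[OF 2(2)] by (auto simp: mult.left_commute)
  qed
qed simp

lemma length_splits: "length (splits vs) = 2 ^ length vs"
  by (induction vs) auto

definition leibniz :: "('a \<Rightarrow> 'b \<Rightarrow> 'c::comm_monoid_add) \<Rightarrow> ('v list \<Rightarrow> 'a) \<Rightarrow> ('v list \<Rightarrow> 'b) \<Rightarrow> 'v list \<Rightarrow> 'c"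
  where "leibniz m F G vs = (\<Sum>(a, b)\<leftarrow>splits vs. m (F a) (G b))"

lemma leibniz_Nil: "leibniz m F G [] = m (F []) (G [])"
  by (simp add: leibniz_def)

text \<open>The product rule: a new direction falls either on the first factor or on the second. As
  jets prepend new directions, this recursion is exactly what relates consecutive derivatives of a
  product.\<close>

lemma leibniz_Cons: "leibniz m F G (h # vs) = leibniz m (\<lambda>a. F (h # a)) G vs + leibniz m F (\<lambda>b. G (h # b)) vs"
  by (simp add: leibniz_def comp_def case_prod_unfold)

text \<open>Multilinearity for a function on lists of every length at once. The derivatives of all
  orders at a point form one such function, by taking the order to be the length of the list, and
  Leibniz sums then need not mention orders.\<close>

definition lin_family :: "'v::complex_vector nspace \<Rightarrow> 'w::complex_vector nspace \<Rightarrow> ('v list \<Rightarrow> 'w) \<Rightarrow> bool"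
  where "lin_family X Y F \<longleftrightarrow> (\<forall>vs. set vs \<subseteq> vecs X \<longrightarrow> F vs \<in> vecs Y) \<and>
    (\<forall>us ws. set us \<subseteq> vecs X \<and> set ws \<subseteq> vecs X \<longrightarrow> linear_on (vecs X) (\<lambda>v. F (us @ v # ws)))"

lemma lin_family_Cons: "lin_family X Y F \<Longrightarrow> v \<in> vecs X \<Longrightarrow> lin_family X Y (\<lambda>a. F (v # a))"
proof -
  assume F: "lin_family X Y F" and v: "v \<in> vecs X"
  have "linear_on (vecs X) (\<lambda>w. F (v # us @ w # ws))" if "set us \<subseteq> vecs X" "set ws \<subseteq> vecs X" for us ws
  proof -
    have "linear_on (vecs X) (\<lambda>w. F ((v # us) @ w # ws))"
      using F v that unfolding lin_family_def by (metis insert_subset list.simps(15))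
    then show ?thesis by simp
  qed
  moreover have "F (v # vs) \<in> vecs Y" if "set vs \<subseteq> vecs X" for vs
    using F v that unfolding lin_family_def by simp
  ultimately show ?thesis unfolding lin_family_def by blast
qed

lemma sum_list_add_cong: "(\<And>p. p \<in> set ps \<Longrightarrow> t p = r p + s p) \<Longrightarrow>
    (\<Sum>p\<leftarrow>ps. t p) = (\<Sum>p\<leftarrow>ps. r p) + (\<Sum>p\<leftarrow>ps. s p :: 'c::comm_monoid_add)"
  by (induction ps) (auto simp: ac_simps)

lemma sum_list_scale_cong: "(\<And>p. p \<in> set ps \<Longrightarrow> t p = c *\<^sub>C r p) \<Longrightarrow>
    (\<Sum>p\<leftarrow>ps. t p) = c *\<^sub>C (\<Sum>p\<leftarrow>ps. r p)"
  by (induction ps) (auto simp: scaleC_add_right)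

text \<open>Induction on the arguments in front of the varying one: \<open>leibniz_Cons\<close>
  absorbs each of them into \<open>F\<close> or \<open>G\<close> until the varying argument stands
  first.\<close>

lemma leibniz_linear:
  assumes m: "bilin A B C m" and X: "normed_space X"
    and F: "lin_family X A F" and G: "lin_family X B G" and "set us \<subseteq> vecs X" and ws: "set ws \<subseteq> vecs X"
  shows "linear_on (vecs X) (\<lambda>v. leibniz m F G (us @ v # ws))"
  using F G \<open>set us \<subseteq> vecs X\<close>
proof (induction us arbitrary: F G)
  case Nil
  have sub: "set a \<subseteq> vecs X" "set b \<subseteq> vecs X" if "(a, b) \<in> set (splits ws)" for a b
    using splits_props[OF that, of X] ws by auto
  have vals: "F a \<in> vecs A" "G b \<in> vecs B" "v \<in> vecs X \<Longrightarrow> F (v # a) \<in> vecs A" "v \<in> vecs X \<Longrightarrow> G (v # b) \<in> vecs B"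
    if "(a, b) \<in> set (splits ws)" for a b v
    using sub[OF that] Nil by (auto simp: lin_family_def)
  have linF: "linear_on (vecs X) (\<lambda>v. F (v # a))" if "set a \<subseteq> vecs X" for a
  proof -
    have "linear_on (vecs X) (\<lambda>v. F ([] @ v # a))"
      using Nil(1) that unfolding lin_family_def by (metis empty_set empty_subsetI)
    then show ?thesis by simp
  qed
  have linG: "linear_on (vecs X) (\<lambda>v. G (v # a))" if "set a \<subseteq> vecs X" for a
  proof -
    have "linear_on (vecs X) (\<lambda>v. G ([] @ v # a))"
      using Nil(2) that unfolding lin_family_def by (metis empty_set empty_subsetI)
    then show ?thesis by simp
  qed
  have m1: "linear_on (vecs A) (\<lambda>a. m a b)" if "b \<in> vecs B" for b using m that by (auto simp: bilin_def)
  have m2: "linear_on (vecs B) (m a)" if "a \<in> vecs A" for a using m that by (auto simp: bilin_def)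
  have lF: "F ((v + w) # a) = F (v # a) + F (w # a)" "F ((c *\<^sub>C v) # a) = c *\<^sub>C F (v # a)"
    if "(a, b) \<in> set (splits ws)" "v \<in> vecs X" "w \<in> vecs X" for a b v w c
    using linF[OF sub(1)[OF that(1)]] that(2,3) by (auto simp: linear_on_def)
  have lG: "G ((v + w) # b) = G (v # b) + G (w # b)" "G ((c *\<^sub>C v) # b) = c *\<^sub>C G (v # b)"
    if "(a, b) \<in> set (splits ws)" "v \<in> vecs X" "w \<in> vecs X" for a b v w c
    using linG[OF sub(2)[OF that(1)]] that(2,3) by (auto simp: linear_on_def)
  have tF: "m (F ((v + w) # a)) (G b) = m (F (v # a)) (G b) + m (F (w # a)) (G b)"
    "m (F ((c *\<^sub>C v) # a)) (G b) = c *\<^sub>C m (F (v # a)) (G b)"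
    if "(a, b) \<in> set (splits ws)" "v \<in> vecs X" "w \<in> vecs X" for a b v w c
    using m1[OF vals(2)[OF that(1)]] vals(3)[OF that(1,2)] vals(3)[OF that(1,3)]
    unfolding lF[OF that] linear_on_def by blast+
  have tG: "m (F a) (G ((v + w) # b)) = m (F a) (G (v # b)) + m (F a) (G (w # b))"
    "m (F a) (G ((c *\<^sub>C v) # b)) = c *\<^sub>C m (F a) (G (v # b))"
    if "(a, b) \<in> set (splits ws)" "v \<in> vecs X" "w \<in> vecs X" for a b v w c
    using m2[OF vals(1)[OF that(1)]] vals(4)[OF that(1,2)] vals(4)[OF that(1,3)]
    unfolding lG[OF that] linear_on_def by blast+
  have 1: "leibniz m (\<lambda>a. F ((v + w) # a)) G ws = leibniz m (\<lambda>a. F (v # a)) G ws + leibniz m (\<lambda>a. F (w # a)) G ws"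
    "leibniz m F (\<lambda>a. G ((v + w) # a)) ws = leibniz m F (\<lambda>a. G (v # a)) ws + leibniz m F (\<lambda>a. G (w # a)) ws"
    if "v \<in> vecs X" "w \<in> vecs X" for v w
    unfolding leibniz_def
    by (rule sum_list_add_cong, clarsimp, rule tF(1) tG(1), assumption, (rule that)+)+
  have 2: "leibniz m (\<lambda>a. F ((c *\<^sub>C v) # a)) G ws = c *\<^sub>C leibniz m (\<lambda>a. F (v # a)) G ws"
    "leibniz m F (\<lambda>a. G ((c *\<^sub>C v) # a)) ws = c *\<^sub>C leibniz m F (\<lambda>a. G (v # a)) ws"
    if "v \<in> vecs X" for c v
    unfolding leibniz_def
    by (rule sum_list_scale_cong, clarsimp, rule tF(2) tG(2), assumption, (rule that)+)+
  show ?case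
    by (auto simp: linear_on_def leibniz_Cons 1 2 scaleC_add_right ac_simps)
next
  case (Cons u us)
  have u: "u \<in> vecs X" and us: "set us \<subseteq> vecs X" using Cons.prems by auto
  have "linear_on (vecs X) (\<lambda>v. leibniz m (\<lambda>a. F (u # a)) G (us @ v # ws))"
    "linear_on (vecs X) (\<lambda>v. leibniz m F (\<lambda>b. G (u # b)) (us @ v # ws))"
    using Cons lin_family_Cons u us by blast+
  then show ?case by (auto simp: linear_on_def leibniz_Cons scaleC_add_right ac_simps)
qed

lemma jet_lin_family:
  assumes "normed_space Y" "jet n X U Y f D" "x \<in> U"
  shows "lin_family X Y (\<lambda>vs. D (length vs) x vs)"
  unfolding lin_family_def
proof (intro conjI allI impI)
  show "set vs \<subseteq> vecs X \<Longrightarrow> D (length vs) x vs \<in> vecs Y" for vs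
    using ml_in[OF jetD(2)[OF assms(2,3)]] by auto
  fix us ws assume "set us \<subseteq> vecs X \<and> set ws \<subseteq> vecs X"
  then show "linear_on (vecs X) (\<lambda>v. D (length (us @ v # ws)) x (us @ v # ws))"
    using ml_linear[OF jetD(2)[OF assms(2,3)], of us ws "length us + 1 + length ws"] by simp
qed

text \<open>A Leibniz sum mixes derivatives of different orders. It is estimated with one constant
  for all of them, and with one radius in \<open>jet_taylor_uniform\<close>.\<close>

lemma jet_bound:
  assumes X: "normed_space X" and Y: "normed_space Y" and D: "jet n X U Y f D" and x: "x \<in> U"
  shows "\<exists>K\<ge>0. \<forall>vs. set vs \<subseteq> vecs X \<longrightarrow> length vs \<le> k \<longrightarrow> nrm Y (D (length vs) x vs) \<le> K * pnorm X vs"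
proof (induction k)
  case 0
  have "nrm Y (D 0 x []) \<ge> 0" by (rule nsD_nonneg[OF Y ml_in[OF jetD(2)[OF D x]]]) simp
  then show ?case by (intro exI[of _ "nrm Y (D 0 x [])"]) auto
next
  case (Suc k)
  then obtain K where K: "K \<ge> 0" "\<And>vs. set vs \<subseteq> vecs X \<Longrightarrow> length vs \<le> k \<Longrightarrow> nrm Y (D (length vs) x vs) \<le> K * pnorm X vs"
    by blast
  let ?L = "nrm (multilinear_maps (Suc k) X Y) (D (Suc k) x)"
  have "nrm Y (D (length vs) x vs) \<le> max K ?L * pnorm X vs" if vs: "set vs \<subseteq> vecs X" "length vs \<le> Suc k" for vs
  proof (cases "length vs = Suc k")
    case True
    then have "nrm Y (D (length vs) x vs) \<le> ?L * pnorm X vs" using ml_bound[OF X Y jetD(2)[OF D x], where k = "Suc k" and vs = vs] vs by simp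
    also have "\<dots> \<le> max K ?L * pnorm X vs" using pnorm_nonneg[OF X vs(1)] by (intro mult_right_mono) auto
    finally show ?thesis .
  next
    case False
    then have "nrm Y (D (length vs) x vs) \<le> K * pnorm X vs" using K vs by simp
    also have "\<dots> \<le> max K ?L * pnorm X vs" using pnorm_nonneg[OF X vs(1)] by (intro mult_right_mono) auto
    finally show ?thesis .
  qed
  then show ?case using K(1) by (intro exI[of _ "max K ?L"]) auto
qed

lemma jet_taylor_uniform:
  assumes X: "normed_space X" and Y: "normed_space Y" and U: "U \<subseteq> vecs X" and D: "jet n X U Y f D"
    and x: "x \<in> U" and e: "e > 0" and k: "k < n"
  shows "\<exists>d>0. \<forall>y\<in>U. nrm X (y - x) < d \<longrightarrow> (\<forall>vs. set vs \<subseteq> vecs X \<longrightarrow> length vs \<le> k \<longrightarrow>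
     nrm Y (D (length vs) y vs - D (length vs) x vs - D (Suc (length vs)) x ((y - x) # vs)) \<le> e * nrm X (y - x) * pnorm X vs)"
  using k
proof (induction k)
  case 0
  then show ?case using jet_taylor1[OF X Y U D x 0] e unfolding taylor1_def by fastforce
next
  case (Suc k)
  then obtain d1 where d1: "d1 > 0" "\<forall>y\<in>U. nrm X (y - x) < d1 \<longrightarrow> (\<forall>vs. set vs \<subseteq> vecs X \<longrightarrow> length vs \<le> k \<longrightarrow>
     nrm Y (D (length vs) y vs - D (length vs) x vs - D (Suc (length vs)) x ((y - x) # vs)) \<le> e * nrm X (y - x) * pnorm X vs)"
    by auto
  obtain d2 where d2: "d2 > 0" "\<forall>y\<in>U. nrm X (y - x) < d2 \<longrightarrow> (\<forall>vs. tuple_in (Suc k) X vs \<longrightarrow>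
     nrm Y (D (Suc k) y vs - D (Suc k) x vs - D (Suc (Suc k)) x ((y - x) # vs)) \<le> e * nrm X (y - x) * pnorm X vs)"
    using jet_taylor1[OF X Y U D x Suc.prems] e unfolding taylor1_def by blast
  show ?case
  proof (intro exI[of _ "min d1 d2"] conjI ballI allI impI)
    fix y vs assume y: "y \<in> U" "nrm X (y - x) < min d1 d2" and vs: "set vs \<subseteq> vecs X" "length vs \<le> Suc k"
    show "nrm Y (D (length vs) y vs - D (length vs) x vs - D (Suc (length vs)) x ((y - x) # vs)) \<le> e * nrm X (y - x) * pnorm X vs"
      using d1(2) d2(2) y vs by (cases "length vs = Suc k") auto
  qed (use d1 d2 in auto)
qed

lemma Cn_bilin:
  assumes X: "normed_space X" and A: "normed_space A" and B: "normed_space B" and C: "normed_space C"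
    and U: "U \<subseteq> vecs X" and m: "bilin A B C m" and f: "Cn n X U A f" and g: "Cn n X U B g"
  shows "Cn n X U C (\<lambda>x. m (f x) (g x))"
proof -
  obtain F G where F: "jet n X U A f F" and G: "jet n X U B g G" using f g by (auto simp: Cn_def)
  let ?F = "\<lambda>x vs. F (length vs) x vs" and ?G = "\<lambda>x vs. G (length vs) x vs"
  obtain M where M: "M \<ge> 0" "\<And>a b. a \<in> vecs A \<Longrightarrow> b \<in> vecs B \<Longrightarrow> nrm C (m a b) \<le> M * nrm A a * nrm B b"
    using m by (auto simp: bilin_def)
  have mC: "m a b \<in> vecs C" if "a \<in> vecs A" "b \<in> vecs B" for a b using m that by (auto simp: bilin_def)
  have Fin: "?F x vs \<in> vecs A" and Gin: "?G x vs \<in> vecs B" if "x \<in> U" "set vs \<subseteq> vecs X" for x vs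
    using ml_in[OF jetD(2)[OF F that(1)]] ml_in[OF jetD(2)[OF G that(1)]] that(2) by auto
  define D where "D k x vs = (if tuple_in k X vs then leibniz m (?F x) (?G x) vs else 0)" for k x vs
  have sub: "set a \<subseteq> vecs X" "set b \<subseteq> vecs X" "length a + length b = length vs" "pnorm X a * pnorm X b = pnorm X vs"
    if "(a, b) \<in> set (splits vs)" "set vs \<subseteq> vecs X" for a b vs
    using splits_props[OF that(1), of X] that(2) by auto
  have "jet n X U C (\<lambda>x. m (f x) (g x)) D"
  proof (rule jetI[OF X C U])
    fix x assume x: "x \<in> U"
    then have xX: "x \<in> vecs X" using U by auto
    show "D 0 x [] = m (f x) (g x)" by (simp add: D_def leibniz_Nil jetD(1)[OF F x] jetD(1)[OF G x])
    show "D k x \<in> vecs (multilinear_maps k X C)" for k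
    proof -
      obtain KF where KF: "KF \<ge> 0" "\<And>vs. set vs \<subseteq> vecs X \<Longrightarrow> length vs \<le> k \<Longrightarrow> nrm A (?F x vs) \<le> KF * pnorm X vs"
        using jet_bound[OF X A F x] by blast
      obtain KG where KG: "KG \<ge> 0" "\<And>vs. set vs \<subseteq> vecs X \<Longrightarrow> length vs \<le> k \<Longrightarrow> nrm B (?G x vs) \<le> KG * pnorm X vs"
        using jet_bound[OF X B G x] by blast
      show ?thesis
      proof (rule mlI)
        fix vs assume vs: "tuple_in k X vs"
        show "D k x vs \<in> vecs C"
          using vs sub Fin[OF x] Gin[OF x] by (auto simp: D_def leibniz_def intro!: sum_list_vecs[OF C] mC)
        have "nrm C (m (?F x a) (?G x b)) \<le> M * KF * KG * pnorm X vs" if ab: "(a, b) \<in> set (splits vs)" for a b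
        proof -
          note s = sub[OF ab]
          have "nrm C (m (?F x a) (?G x b)) \<le> M * nrm A (?F x a) * nrm B (?G x b)"
            using s vs Fin[OF x] Gin[OF x] by (intro M) auto
          also have "\<dots> \<le> M * (KF * pnorm X a) * (KG * pnorm X b)"
            using s vs M(1) KF KG pnorm_nonneg[OF X] Fin[OF x] Gin[OF x]
            by (intro mult_mono mult_left_mono mult_nonneg_nonneg nsD_nonneg[OF B] nsD_nonneg[OF A]) auto
          also have "\<dots> = M * KF * KG * (pnorm X a * pnorm X b)" by simp
          also have "\<dots> = M * KF * KG * pnorm X vs" using s(4) vs by metis
          finally show ?thesis .
        qed
        then have "nrm C (leibniz m (?F x) (?G x) vs) \<le> real (length (splits vs)) * (M * KF * KG * pnorm X vs)"
          unfolding leibniz_def using sub vs Fin[OF x] Gin[OF x] by (intro nrm_sum_list[OF C]) (auto intro!: mC)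
        then show "nrm C (D k x vs) \<le> (2 ^ k * (M * KF * KG)) * pnorm X vs"
          using vs by (simp add: D_def length_splits mult.assoc)
      next
        fix us ws assume l: "length us + 1 + length ws = k" "set us \<subseteq> vecs X" "set ws \<subseteq> vecs X"
        have "linear_on (vecs X) (\<lambda>v. leibniz m (?F x) (?G x) (us @ v # ws))"
          by (rule leibniz_linear[OF m X jet_lin_family[OF A F x] jet_lin_family[OF B G x] l(2,3)])
        then show "linear_on (vecs X) (\<lambda>v. D k x (us @ v # ws))"
          using l nsD_add[OF X] nsD_scale[OF X] by (simp add: linear_on_def D_def)
      qed (auto simp: D_def)
    qed
    fix k assume k: "k < n"
    show "taylor1 X U C k (D k) (D (Suc k) x) x"
      unfolding taylor1_def
    proof (intro allI impI)
      fix e :: real assume e: "e > 0"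
      obtain KF where KF: "KF \<ge> 0" "\<And>vs. set vs \<subseteq> vecs X \<Longrightarrow> length vs \<le> Suc k \<Longrightarrow> nrm A (?F x vs) \<le> KF * pnorm X vs"
        using jet_bound[OF X A F x] by blast
      obtain KG where KG: "KG \<ge> 0" "\<And>vs. set vs \<subseteq> vecs X \<Longrightarrow> length vs \<le> Suc k \<Longrightarrow> nrm B (?G x vs) \<le> KG * pnorm X vs"
        using jet_bound[OF X B G x] by blast
      define K where "K = KF + KG"
      have K: "K \<ge> 0" "KF \<le> K" "KG \<le> K" using KF KG by (auto simp: K_def)
      define L where "L = 2 ^ k * M"
      have L: "L \<ge> 0" using M by (simp add: L_def)
      \<comment> \<open>\<open>L\<close> combines the number of Leibniz terms with the bound of
        \<open>m\<close>. The choice of \<open>r\<close> limits the two linear remainders together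
        to \<open>e / 2\<close>, and \<open>r \<le> 1\<close> keeps the increments of both factors
        below \<open>1 + K\<close> times the increment of the point.\<close>
      define r where "r = min 1 (e / (4 * L * K + 1))"
      have den: "4 * L * K + 1 > 0" using L K by (simp add: add_nonneg_pos)
      have r: "r > 0" "r \<le> 1" "L * (2 * r * K) \<le> e / 2"
      proof -
        show "r > 0" "r \<le> 1" using e den by (auto simp: r_def)
        have "r \<le> e / (4 * L * K + 1)" by (simp add: r_def)
        then have "r * (4 * L * K + 1) \<le> e" using den by (simp only: pos_le_divide_eq)
        then show "L * (2 * r * K) \<le> e / 2" using \<open>r > 0\<close> by (simp add: algebra_simps)
      qed
      obtain d1 where d1: "d1 > 0" "\<And>y vs. y\<in>U \<Longrightarrow> nrm X (y - x) < d1 \<Longrightarrow> set vs \<subseteq> vecs X \<Longrightarrow> length vs \<le> k \<Longrightarrow>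
          nrm A (F (length vs) y vs - F (length vs) x vs - F (Suc (length vs)) x ((y - x) # vs)) \<le> r * nrm X (y - x) * pnorm X vs"
        using jet_taylor_uniform[OF X A U F x r(1) k] by blast
      obtain d2 where d2: "d2 > 0" "\<And>y vs. y\<in>U \<Longrightarrow> nrm X (y - x) < d2 \<Longrightarrow> set vs \<subseteq> vecs X \<Longrightarrow> length vs \<le> k \<Longrightarrow>
          nrm B (G (length vs) y vs - G (length vs) x vs - G (Suc (length vs)) x ((y - x) # vs)) \<le> r * nrm X (y - x) * pnorm X vs"
        using jet_taylor_uniform[OF X B U G x r(1) k] by blast
      \<comment> \<open>The radius within which the product of the two increments, which is
        quadratic in \<open>y - x\<close>, contributes at most \<open>e / 2\<close>.\<close>
      define d3 where "d3 = e / (2 * L * (1 + K)\<^sup>2 + 1)"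
      have den3: "2 * L * (1 + K)\<^sup>2 + 1 > 0" using L by (simp add: add_nonneg_pos)
      have d3: "d3 > 0" "L * (1 + K)\<^sup>2 * d3 \<le> e / 2"
      proof -
        show "d3 > 0" using e den3 by (simp add: d3_def)
        have "(2 * L * (1 + K)\<^sup>2 + 1) * d3 = e" using den3 by (simp add: d3_def)
        then show "L * (1 + K)\<^sup>2 * d3 \<le> e / 2" using \<open>d3 > 0\<close> by (simp add: algebra_simps)
      qed
      have "nrm C (D k y vs - D k x vs - D (Suc k) x ((y - x) # vs)) \<le> e * nrm X (y - x) * pnorm X vs"
        if y: "y \<in> U" "nrm X (y - x) < min d1 (min d2 d3)" and vs: "tuple_in k X vs" for y vs
      proof -
        define h where "h = y - x"
        have h: "h \<in> vecs X" using y U nsD_diff[OF X _ xX] by (auto simp: h_def)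
        have hn: "0 \<le> nrm X h" by (rule nsD_nonneg[OF X h])
        define P where "P = pnorm X vs"
        have P: "P \<ge> 0" using vs pnorm_nonneg[OF X] by (simp add: P_def)
        define t where "t p = (case p of (a, b) \<Rightarrow> m (?F y a) (?G y b) - m (?F x a) (?G x b)
            - (m (?F x (h # a)) (?G x b) + m (?F x a) (?G x (h # b))))" for p
        have tb: "t (a, b) \<in> vecs C \<and> nrm C (t (a, b)) \<le> M * (2 * r * K + (1 + K)\<^sup>2 * nrm X h) * nrm X h * P"
          if ab: "(a, b) \<in> set (splits vs)" for a b
        proof -
          have s: "set a \<subseteq> vecs X" "set b \<subseteq> vecs X" "length a + length b = k" "pnorm X a * pnorm X b = P"
            using sub[OF ab] vs by (auto simp: P_def)
          have sh: "set (h # a) \<subseteq> vecs X" "set (h # b) \<subseteq> vecs X" using s h by auto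
          have pa: "pnorm X a \<ge> 0" "pnorm X b \<ge> 0" using pnorm_nonneg[OF X] s by auto
          define Fy Fx F1 Gy Gx G1 where defs: "Fy = ?F y a" "Fx = ?F x a" "F1 = ?F x (h # a)"
            "Gy = ?G y b" "Gx = ?G x b" "G1 = ?G x (h # b)"
          have iF: "Fy \<in> vecs A" "Fx \<in> vecs A" "F1 \<in> vecs A" unfolding defs by (intro Fin x y(1) s sh)+
          have iG: "Gy \<in> vecs B" "Gx \<in> vecs B" "G1 \<in> vecs B" unfolding defs by (intro Gin x y(1) s sh)+
          note i = nsD_diff[OF A iF(1,2)] nsD_diff[OF B iG(1,2)]
          note j = nsD_diff[OF A i(1) iF(3)] nsD_diff[OF B i(2) iG(3)]
          have bF: "nrm A (Fy - Fx - F1) \<le> r * nrm X h * pnorm X a"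
            unfolding defs using d1(2)[of y a] y s by (simp add: h_def)
          have bG: "nrm B (Gy - Gx - G1) \<le> r * nrm X h * pnorm X b"
            unfolding defs using d2(2)[of y b] y s by (simp add: h_def)
          have bFx: "nrm A Fx \<le> K * pnorm X a"
            unfolding defs using KF(2)[of a] s K(2) pa(1) by (meson le_SucI le_add1 mult_right_mono order_trans)
          have bGx: "nrm B Gx \<le> K * pnorm X b"
            unfolding defs using KG(2)[of b] s K(3) pa(2) by (meson le_SucI le_add2 mult_right_mono order_trans)
          have bF1: "nrm A F1 \<le> K * (nrm X h * pnorm X a)"
          proof -
            have "nrm A F1 \<le> KF * pnorm X (h # a)" unfolding defs using s by (intro KF(2) sh) auto
            also have "\<dots> \<le> K * (nrm X h * pnorm X a)" using K hn pa by (simp add: mult_right_mono)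
            finally show ?thesis .
          qed
          have bG1: "nrm B G1 \<le> K * (nrm X h * pnorm X b)"
          proof -
            have "nrm B G1 \<le> KG * pnorm X (h # b)" unfolding defs using s by (intro KG(2) sh) auto
            also have "\<dots> \<le> K * (nrm X h * pnorm X b)" using K hn pa by (simp add: mult_right_mono)
            finally show ?thesis .
          qed
          have bdF: "nrm A (Fy - Fx) \<le> (1 + K) * (nrm X h * pnorm X a)"
          proof -
            have "nrm A ((Fy - Fx - F1) + F1) \<le> r * nrm X h * pnorm X a + K * (nrm X h * pnorm X a)"
              using nsD_tri[OF A j(1) iF(3)] bF bF1 by linarith
            also have "\<dots> \<le> 1 * (nrm X h * pnorm X a) + K * (nrm X h * pnorm X a)"
              unfolding mult.assoc using r hn pa by (intro add_right_mono mult_right_mono) auto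
            finally show ?thesis by (simp add: algebra_simps)
          qed
          have bdG: "nrm B (Gy - Gx) \<le> (1 + K) * (nrm X h * pnorm X b)"
          proof -
            have "nrm B ((Gy - Gx - G1) + G1) \<le> r * nrm X h * pnorm X b + K * (nrm X h * pnorm X b)"
              using nsD_tri[OF B j(2) iG(3)] bG bG1 by linarith
            also have "\<dots> \<le> 1 * (nrm X h * pnorm X b) + K * (nrm X h * pnorm X b)"
              unfolding mult.assoc using r hn pa by (intro add_right_mono mult_right_mono) auto
            finally show ?thesis by (simp add: algebra_simps)
          qed
          have la: "m (a1 - a2) b1 = m a1 b1 - m a2 b1" if "a1 \<in> vecs A" "a2 \<in> vecs A" "b1 \<in> vecs B" for a1 a2 b1
          proof -
            have "m (a1 + (-1) *\<^sub>C a2) b1 = m a1 b1 + (-1) *\<^sub>C m a2 b1"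
              using m that nsD_scale[OF A that(2), of "-1"] unfolding bilin_def linear_on_def by metis
            then show ?thesis by simp
          qed
          have lb: "m a1 (b1 - b2) = m a1 b1 - m a1 b2" if "a1 \<in> vecs A" "b1 \<in> vecs B" "b2 \<in> vecs B" for a1 b1 b2
          proof -
            have "m a1 (b1 + (-1) *\<^sub>C b2) = m a1 b1 + (-1) *\<^sub>C m a1 b2"
              using m that nsD_scale[OF B that(3), of "-1"] unfolding bilin_def linear_on_def by metis
            then show ?thesis by simp
          qed
          \<comment> \<open>The usual splitting in the product rule: one Taylor remainder in each
            factor, and the product of the two increments.\<close>
          have eq: "t (a, b) = m (Fy - Fx - F1) Gx + m Fx (Gy - Gx - G1) + m (Fy - Fx) (Gy - Gx)"
            unfolding t_def prod.case defs[symmetric] using iF iG i j by (simp add: la lb)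
          have n1: "nrm C (m (Fy - Fx - F1) Gx) \<le> M * (r * nrm X h * pnorm X a) * (K * pnorm X b)"
            using M(1) bF bGx r hn pa K iG nsD_nonneg[OF B] nsD_nonneg[OF A j(1)]
            by (intro order_trans[OF M(2)[OF j(1) iG(2)]] mult_mono mult_left_mono mult_nonneg_nonneg) auto
          have n2: "nrm C (m Fx (Gy - Gx - G1)) \<le> M * (K * pnorm X a) * (r * nrm X h * pnorm X b)"
            using M(1) bG bFx r hn pa K iF nsD_nonneg[OF A] nsD_nonneg[OF B j(2)]
            by (intro order_trans[OF M(2)[OF iF(2) j(2)]] mult_mono mult_left_mono mult_nonneg_nonneg) auto
          have n3: "nrm C (m (Fy - Fx) (Gy - Gx)) \<le> M * ((1 + K) * (nrm X h * pnorm X a)) * ((1 + K) * (nrm X h * pnorm X b))"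
            using M(1) bdF bdG r hn pa K i nsD_nonneg[OF A i(1)] nsD_nonneg[OF B i(2)]
            by (intro order_trans[OF M(2)[OF i]] mult_mono mult_left_mono mult_nonneg_nonneg) auto
          have tC: "t (a, b) \<in> vecs C" unfolding eq using iF iG i j by (intro nsD_add[OF C] mC) auto
          have "nrm C (t (a, b)) \<le> M * (r * nrm X h * pnorm X a) * (K * pnorm X b)
              + M * (K * pnorm X a) * (r * nrm X h * pnorm X b)
              + M * ((1 + K) * (nrm X h * pnorm X a)) * ((1 + K) * (nrm X h * pnorm X b))"
            unfolding eq
            using n1 n2 n3 nsD_tri[OF C nsD_add[OF C mC[OF j(1) iG(2)] mC[OF iF(2) j(2)]] mC[OF i]]
              nsD_tri[OF C mC[OF j(1) iG(2)] mC[OF iF(2) j(2)]] by linarith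
          also have "\<dots> = M * (2 * r * K + (1 + K)\<^sup>2 * nrm X h) * nrm X h * (pnorm X a * pnorm X b)"
            by (simp add: power2_eq_square algebra_simps)
          finally show ?thesis using tC s(4) by simp
        qed
        have "D k y vs - D k x vs - D (Suc k) x (h # vs) = (\<Sum>p\<leftarrow>splits vs. t p)"
        proof -
          have "(\<Sum>p\<leftarrow>splits vs. t p) = leibniz m (?F y) (?G y) vs - leibniz m (?F x) (?G x) vs
              - (leibniz m (\<lambda>a. ?F x (h # a)) (?G x) vs + leibniz m (?F x) (\<lambda>b. ?G x (h # b)) vs)"
            unfolding t_def leibniz_def sum_list_addf[symmetric] sum_list_subtractf[symmetric]
            by (simp add: case_prod_unfold)
          then show ?thesis using vs h by (simp add: D_def leibniz_Cons)
        qed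
        also have "nrm C (\<Sum>p\<leftarrow>splits vs. t p) \<le> real (length (splits vs)) * (M * (2 * r * K + (1 + K)\<^sup>2 * nrm X h) * nrm X h * P)"
          using tb by (intro nrm_sum_list[OF C]) auto
        also have "\<dots> = (L * (2 * r * K) + L * (1 + K)\<^sup>2 * nrm X h) * (nrm X h * P)"
          using vs by (simp add: length_splits L_def algebra_simps)
        also have "\<dots> \<le> e * (nrm X h * P)"
        proof (rule mult_right_mono)
          have "L * (1 + K)\<^sup>2 * nrm X h \<le> L * (1 + K)\<^sup>2 * d3"
            using y L by (intro mult_left_mono mult_nonneg_nonneg) (auto simp: h_def)
          then show "L * (2 * r * K) + L * (1 + K)\<^sup>2 * nrm X h \<le> e" using r(3) d3(2) by linarith
          show "0 \<le> nrm X h * P" using hn P by simp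
        qed
        finally show ?thesis by (simp add: h_def P_def mult.assoc)
      qed
      then show "\<exists>d>0. \<forall>y\<in>U. nrm X (y - x) < d \<longrightarrow> (\<forall>vs. tuple_in k X vs \<longrightarrow>
          nrm C (D k y vs - D k x vs - D (Suc k) x ((y - x) # vs)) \<le> e * nrm X (y - x) * pnorm X vs)"
        using d1 d2 d3 by (intro exI[of _ "min d1 (min d2 d3)"]) auto
    qed
  qed
  then show ?thesis by (auto simp: Cn_def)
qed


subsection \<open>Smooth maps\<close>

lemma tuple_in_SucE:
  assumes "tuple_in (Suc k) X vs"
  obtains w l where "vs = w @ [l]" "tuple_in k X w" "l \<in> vecs X"
  using assms by (cases vs rule: rev_cases) auto

text \<open>Uncurrying the jet of the operator-valued derivative \<open>g\<close>. The argument fed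
  to the operator becomes the last one in the list, since the directions of later derivatives are
  prepended.\<close>

lemma Cn_Suc:
  assumes X: "normed_space X" and Y: "normed_space Y" and U: "U \<subseteq> vecs X"
    and f: "\<And>x. x \<in> U \<Longrightarrow> f x \<in> vecs Y" and g: "Cn n X U (operators X Y) g"
    and fg: "\<And>x. x \<in> U \<Longrightarrow> has_fderiv X U Y f (g x) x"
  shows "Cn (Suc n) X U Y f"
proof -
  let ?O = "operators X Y"
  note O = normed_operators[OF X Y]
  obtain G where G: "jet n X U ?O g G" using g by (auto simp: Cn_def)
  define D where "D k = (case k of 0 \<Rightarrow> (\<lambda>x vs. if vs = [] then f x else 0)
    | Suc j \<Rightarrow> (\<lambda>x vs. if tuple_in (Suc j) X vs then G j x (butlast vs) (last vs) else 0))" for k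
  have D0: "D 0 x vs = (if vs = [] then f x else 0)" for x vs by (simp add: D_def)
  have DS: "D (Suc j) x (w @ [l]) = G j x w l" if "tuple_in j X w" "l \<in> vecs X" for j x w l
    using that by (simp add: D_def)
  have "jet (Suc n) X U Y f D"
  proof (rule jetI[OF X Y U])
    fix x assume x: "x \<in> U"
    then have xX: "x \<in> vecs X" using U by auto
    show "D 0 x [] = f x" by (simp add: D0)
    show "D k x \<in> vecs (multilinear_maps k X Y)" for k
    proof (cases k)
      case 0
      have "D 0 x = (\<lambda>vs. if vs = [] then f x else 0)" by (rule ext) (simp add: D0)
      then show ?thesis using ml_0I[OF Y f[OF x]] 0 by simp
    next
      case (Suc j)
      note M = jetD(2)[OF G x, of j]
      show ?thesis unfolding Suc
      proof (rule mlI)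
        fix vs assume "tuple_in (Suc j) X vs"
        then obtain w l where w: "vs = w @ [l]" "tuple_in j X w" "l \<in> vecs X" by (rule tuple_in_SucE)
        show "D (Suc j) x vs \<in> vecs Y" unfolding w(1) DS[OF w(2,3)] by (rule op_in[OF ml_in[OF M w(2)] w(3)])
        have "nrm Y (G j x w l) \<le> nrm ?O (G j x w) * nrm X l" by (rule op_bound[OF X Y ml_in[OF M w(2)] w(3)])
        also have "\<dots> \<le> nrm (multilinear_maps j X ?O) (G j x) * pnorm X w * nrm X l"
          by (intro mult_right_mono ml_bound[OF X O M w(2)] nsD_nonneg[OF X w(3)])
        finally show "nrm Y (D (Suc j) x vs) \<le> nrm (multilinear_maps j X ?O) (G j x) * pnorm X vs"
          unfolding w(1) DS[OF w(2,3)] by simp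
      next
        fix us ws assume l: "length us + 1 + length ws = Suc j" "set us \<subseteq> vecs X" "set ws \<subseteq> vecs X"
        show "linear_on (vecs X) (\<lambda>v. D (Suc j) x (us @ v # ws))"
        proof (cases ws rule: rev_cases)
          case Nil
          then have "D (Suc j) x (us @ v # ws) = G j x us v" if "v \<in> vecs X" for v
            using DS[where j = j and w = us and l = v and x = x] l that by simp
          moreover have "G j x us \<in> vecs ?O" using ml_in[OF M, where vs = us] l Nil by simp
          ultimately show ?thesis
            using nsD_add[OF X] nsD_scale[OF X] by (simp add: linear_on_def op_add op_scale)
        next
          case (snoc ws' z)
          then have z: "z \<in> vecs X" and ws': "set ws' \<subseteq> vecs X" and len: "length us + 1 + length ws' = j" using l by auto
          have eq: "D (Suc j) x (us @ v # ws) = G j x (us @ v # ws') z" if "v \<in> vecs X" for v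
            using DS[where j = j and w = "us @ v # ws'" and l = z and x = x] l that z ws' len snoc by simp
          show ?thesis
            using ml_linear[OF M len l(2) ws'] nsD_add[OF X] nsD_scale[OF X]
            by (simp add: linear_on_def eq scaleC_fun_def)
        qed
      qed (auto simp: D_def)
    qed
    fix k assume k: "k < Suc n"
    show "taylor1 X U Y k (D k) (D (Suc k) x) x"
    proof (cases k)
      case 0
      have D1: "D (Suc 0) x [h] = g x h" if "h \<in> vecs X" for h
        using DS[where j = 0 and w = "[]" and l = h and x = x] that jetD(1)[OF G x] by simp
      have yx: "y - x \<in> vecs X" if "y \<in> U" for y using that U xX nsD_diff[OF X] by auto
      show ?thesis unfolding taylor1_def 0
      proof (intro allI impI)
        fix e :: real assume "e > 0"
        from has_fderivD(2)[OF fg[OF x] this] obtain d where "d > 0"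
          "\<forall>y\<in>U. nrm X (y - x) < d \<longrightarrow> nrm Y (f y - f x - g x (y - x)) \<le> e * nrm X (y - x)" by blast
        then show "\<exists>d>0. \<forall>y\<in>U. nrm X (y - x) < d \<longrightarrow> (\<forall>vs. tuple_in 0 X vs \<longrightarrow>
            nrm Y (D 0 y vs - D 0 x vs - D (Suc 0) x ((y - x) # vs)) \<le> e * nrm X (y - x) * pnorm X vs)"
          using D1 yx by (intro exI[of _ d]) (auto simp: D0)
      qed
    next
      case (Suc j)
      show ?thesis unfolding taylor1_def Suc
      proof (intro allI impI)
        fix e :: real assume e: "e > 0"
        obtain d where d: "d > 0" "\<And>y w. y \<in> U \<Longrightarrow> nrm X (y - x) < d \<Longrightarrow> tuple_in j X w \<Longrightarrow>
            nrm ?O (G j y w - G j x w - G (Suc j) x ((y - x) # w)) \<le> e * nrm X (y - x) * pnorm X w"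
          using jet_taylor1[OF X O U G x, of j] e k Suc unfolding taylor1_def by (metis Suc_less_eq)
        have "nrm Y (D (Suc j) y vs - D (Suc j) x vs - D (Suc (Suc j)) x ((y - x) # vs)) \<le> e * nrm X (y - x) * pnorm X vs"
          if y: "y \<in> U" "nrm X (y - x) < d" and vs: "tuple_in (Suc j) X vs" for y vs
        proof -
          obtain w l where w: "vs = w @ [l]" "tuple_in j X w" "l \<in> vecs X" using vs by (rule tuple_in_SucE)
          have yx: "y - x \<in> vecs X" using y U xX nsD_diff[OF X] by auto
          then have hw: "tuple_in (Suc j) X ((y - x) # w)" using w by auto
          have R: "G j y w - G j x w - G (Suc j) x ((y - x) # w) \<in> vecs ?O"
            by (intro nsD_diff[OF O] ml_in[OF jetD(2)[OF G y(1)] w(2)] ml_in[OF jetD(2)[OF G x] w(2)]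
                ml_in[OF jetD(2)[OF G x] hw])
          have "nrm Y ((G j y w - G j x w - G (Suc j) x ((y - x) # w)) l)
              \<le> nrm ?O (G j y w - G j x w - G (Suc j) x ((y - x) # w)) * nrm X l"
            by (rule op_bound[OF X Y R w(3)])
          also have "\<dots> \<le> e * nrm X (y - x) * pnorm X w * nrm X l"
            by (intro mult_right_mono d y w nsD_nonneg[OF X w(3)])
          finally show ?thesis
            using DS[OF w(2,3)] DS[OF hw w(3)] by (simp add: w(1) mult.assoc)
        qed
        then show "\<exists>d>0. \<forall>y\<in>U. nrm X (y - x) < d \<longrightarrow> (\<forall>vs. tuple_in (Suc j) X vs \<longrightarrow>
            nrm Y (D (Suc j) y vs - D (Suc j) x vs - D (Suc (Suc j)) x ((y - x) # vs)) \<le> e * nrm X (y - x) * pnorm X vs)"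
          using d(1) by blast
      qed
    qed
  qed
  then show ?thesis by (auto simp: Cn_def)
qed

text \<open>Needed to join the jets of different finite orders, which are chosen independently of
  each other.\<close>

lemma jet_unique:
  assumes X: "normed_space X" and Y: "normed_space Y" and U: "open_in X U"
    and D: "jet n X U Y f D" and E: "jet n' X U Y f E"
  shows "k \<le> n \<Longrightarrow> k \<le> n' \<Longrightarrow> x \<in> U \<Longrightarrow> D k x = E k x"
proof (induction k arbitrary: x)
  case 0
  show ?case
  proof
    fix vs show "D 0 x vs = E 0 x vs"
      using ml_outside[OF jetD(2)[OF D \<open>x \<in> U\<close>], where vs = vs and k = 0]
        ml_outside[OF jetD(2)[OF E \<open>x \<in> U\<close>], where vs = vs and k = 0]
        jetD(1)[OF D \<open>x \<in> U\<close>] jetD(1)[OF E \<open>x \<in> U\<close>] by (cases "vs = []") auto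
  qed
next
  case (Suc k)
  let ?M = "multilinear_maps k X Y"
  have d: "has_fderiv X U ?M (D k) (\<lambda>h vs. D (Suc k) x (h # vs)) x"
    and "has_fderiv X U ?M (E k) (\<lambda>h vs. E (Suc k) x (h # vs)) x"
    using D E Suc.prems by (auto simp: jet_def)
  then have e: "has_fderiv X U ?M (D k) (\<lambda>h vs. E (Suc k) x (h # vs)) x"
    using Suc unfolding has_fderiv_def by simp
  have "(\<lambda>h vs. D (Suc k) x (h # vs)) = (\<lambda>h vs. E (Suc k) x (h # vs))"
    by (rule has_fderiv_unique[OF X normed_ml[OF X Y] U Suc.prems(3) jetD(2)[OF D] d e])
  then have c: "D (Suc k) x (h # vs) = E (Suc k) x (h # vs)" for h vs by metis
  have "D (Suc k) x [] = 0" "E (Suc k) x [] = 0"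
    using ml_outside[OF jetD(2)[OF D Suc.prems(3)], where k = "Suc k" and vs = "[]"]
      ml_outside[OF jetD(2)[OF E Suc.prems(3)], where k = "Suc k" and vs = "[]"] by auto
  show ?case
  proof
    fix vs show "D (Suc k) x vs = E (Suc k) x vs" using c \<open>D (Suc k) x [] = 0\<close> \<open>E (Suc k) x [] = 0\<close> by (cases vs) auto
  qed
qed

lemma smooth_onI:
  assumes X: "normed_space X" and Y: "normed_space Y" and U: "open_in X U"
    and f: "\<And>n. Cn n X U Y f"
  shows "smooth_on X U Y f"
proof -
  obtain E where E: "\<And>n. jet n X U Y f (E n)" using f unfolding Cn_def by metis
  \<comment> \<open>\<open>Suc k\<close> is the least order of a jet whose \<open>k\<close>-th entry
    is known to be differentiable.\<close>
  define D where "D k = E (Suc k) k" for k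
  have "D 0 x [] = f x" "D k x \<in> vecs (multilinear_maps k X Y)"
    "has_fderiv X U (multilinear_maps k X Y) (D k) (\<lambda>h vs. D (Suc k) x (h # vs)) x" if x: "x \<in> U" for x k
  proof -
    show "D 0 x [] = f x" "D k x \<in> vecs (multilinear_maps k X Y)" using jetD[OF E x] by (auto simp: D_def)
    have "E (Suc k) (Suc k) x = E (Suc (Suc k)) (Suc k) x" by (rule jet_unique[OF X Y U E E _ _ x]) auto
    moreover have "has_fderiv X U (multilinear_maps k X Y) (E (Suc k) k) (\<lambda>h vs. E (Suc k) (Suc k) x (h # vs)) x"
      using E[of "Suc k"] x by (auto simp: jet_def)
    ultimately show "has_fderiv X U (multilinear_maps k X Y) (D k) (\<lambda>h vs. D (Suc k) x (h # vs)) x"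
      by (simp add: D_def)
  qed
  then show ?thesis unfolding smooth_on_def by blast
qed

section \<open>Composition, application, sandwiching and transposition of operators\<close>

lemma compose_lin_left:
  "(S + R) \<circ> T = (S \<circ> T) + (R \<circ> T)" "(c *\<^sub>C S) \<circ> T = c *\<^sub>C (S \<circ> T)"
  by (auto simp: fun_eq_iff scaleC_fun_def)

lemma compose_lin_right:
  assumes Y: "normed_space Y" and T: "T \<in> vecs (operators Y Z)" and S: "S \<in> vecs (operators X Y)"
  shows "R \<in> vecs (operators X Y) \<Longrightarrow> T \<circ> (S + R) = (T \<circ> S) + (T \<circ> R)"
    and "T \<circ> (c *\<^sub>C S) = c *\<^sub>C (T \<circ> S)"
proof -
  show "T \<circ> (S + R) = (T \<circ> S) + (T \<circ> R)" if R: "R \<in> vecs (operators X Y)"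
  proof
    fix x show "(T \<circ> (S + R)) x = ((T \<circ> S) + (T \<circ> R)) x"
      using op_add[OF T op_in[OF S] op_in[OF R], of x x] op_outside[OF S, of x] op_outside[OF R, of x]
        op_zero[OF Y T] by (cases "x \<in> vecs X") auto
  qed
  show "T \<circ> (c *\<^sub>C S) = c *\<^sub>C (T \<circ> S)"
  proof
    fix x show "(T \<circ> (c *\<^sub>C S)) x = (c *\<^sub>C (T \<circ> S)) x"
      using op_scale[OF T op_in[OF S], of x c] op_outside[OF S, of x] op_zero[OF Y T]
      by (cases "x \<in> vecs X") (auto simp: scaleC_fun_def)
  qed
qed

lemma bilin_compose:
  assumes X: "normed_space X" and Y: "normed_space Y" and Z: "normed_space Z"
  shows "bilin (operators Y Z) (operators X Y) (operators X Z) (\<circ>)"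
proof -
  have "\<exists>K\<ge>0. \<forall>T\<in>vecs (operators Y Z). \<forall>S\<in>vecs (operators X Y).
      nrm (operators X Z) (T \<circ> S) \<le> K * nrm (operators Y Z) T * nrm (operators X Y) S"
    using operators_compose(2)[OF X Y Z] by (intro exI[of _ 1]) auto
  then show ?thesis
    unfolding bilin_def linear_on_def
    using compose_lin_right[OF Y] operators_compose(1)[OF X Y Z] by (auto simp: compose_lin_left)
qed

lemma Cn_compose:
  assumes P: "normed_space P" and U: "U \<subseteq> vecs P"
    and X: "normed_space X" and Y: "normed_space Y" and Z: "normed_space Z"
    and "Cn n P U (operators Y Z) f" "Cn n P U (operators X Y) g"
  shows "Cn n P U (operators X Z) (\<lambda>x. f x \<circ> g x)"
  using Cn_bilin[OF P normed_operators[OF Y Z] normed_operators[OF X Y] normed_operators[OF X Z] U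
      bilin_compose[OF X Y Z]] assms(6,7) by blast

lemma bilin_apply:
  assumes Y: "normed_space Y" and Z: "normed_space Z"
  shows "bilin (operators Y Z) Y Z (\<lambda>T y. T y)"
proof -
  have "\<exists>K\<ge>0. \<forall>T\<in>vecs (operators Y Z). \<forall>y\<in>vecs Y. nrm Z (T y) \<le> K * nrm (operators Y Z) T * nrm Y y"
    using op_bound[OF Y Z] by (intro exI[of _ 1]) auto
  then show ?thesis
    unfolding bilin_def linear_on_def by (auto simp: op_in op_add op_scale scaleC_fun_def)
qed

lemma Cn_apply_linear:
  assumes P: "normed_space P" and U: "U \<subseteq> vecs P" and Y: "normed_space Y" and Z: "normed_space Z"
    and L: "L \<in> vecs (operators Y Z)" and f: "Cn n P U Y f"
  shows "Cn n P U Z (\<lambda>x. L (f x))"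
  by (rule Cn_bilin[OF P normed_operators[OF Y Z] Y Z U bilin_apply[OF Y Z]
        Cn_const[OF P normed_operators[OF Y Z] U L] f])

text \<open>The shape of the derivatives on the Grassmannian: composition with fixed operators on
  both sides.\<close>

definition sandwich :: "('a \<Rightarrow> 'b) set \<Rightarrow> ('b \<Rightarrow> 'c) \<Rightarrow> ('d \<Rightarrow> 'a) \<Rightarrow> ('a \<Rightarrow> 'b) \<Rightarrow> 'd \<Rightarrow> 'c::zero"
  where "sandwich D S T = zero_outside D (\<lambda>h. S \<circ> h \<circ> T)"

lemma sandwich_operator:
  assumes A: "normed_space A" and B: "normed_space B" and C: "normed_space C" and D: "normed_space D"
    and S: "S \<in> vecs (operators B C)" and T: "T \<in> vecs (operators D A)"
  shows "sandwich (vecs (operators A B)) S T \<in> vecs (operators (operators A B) (operators D C))"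
    and "nrm (operators (operators A B) (operators D C)) (sandwich (vecs (operators A B)) S T)
      \<le> nrm (operators B C) S * nrm (operators D A) T"
proof -
  let ?V = "vecs (operators A B)"
  note AB = normed_operators[OF A B]
  have eq: "sandwich ?V S T h = S \<circ> h \<circ> T" if "h \<in> ?V" for h using that by (simp add: sandwich_def zero_outside_def)
  have Sh: "S \<circ> h \<in> vecs (operators A C)" if "h \<in> ?V" for h by (rule operators_compose(1)[OF A B C S that])
  have b: "nrm (operators D C) (sandwich ?V S T h) \<le> (nrm (operators B C) S * nrm (operators D A) T) * nrm (operators A B) h"
    if h: "h \<in> ?V" for h
  proof -
    have "nrm (operators D C) (S \<circ> h \<circ> T) \<le> nrm (operators A C) (S \<circ> h) * nrm (operators D A) T"
      by (rule operators_compose(2)[OF D A C Sh[OF h] T])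
    also have "\<dots> \<le> nrm (operators B C) S * nrm (operators A B) h * nrm (operators D A) T"
      by (intro mult_right_mono operators_compose(2)[OF A B C S h] op_norm_nonneg[OF D A T])
    finally show ?thesis by (simp add: eq[OF h] ac_simps)
  qed
  show "sandwich ?V S T \<in> vecs (operators (operators A B) (operators D C))"
  proof (rule operatorsI[OF _ _ _ b])
    fix h k assume h: "h \<in> ?V" and k: "k \<in> ?V"
    show "sandwich ?V S T (h + k) = sandwich ?V S T h + sandwich ?V S T k"
      using eq[OF nsD_add[OF AB h k]] compose_lin_right(1)[OF B S h k]
      by (simp add: eq[OF h] eq[OF k] compose_lin_left)
  next
    fix c h assume h: "h \<in> ?V"
    show "sandwich ?V S T (c *\<^sub>C h) = c *\<^sub>C sandwich ?V S T h"
      using eq[OF nsD_scale[OF AB h]] compose_lin_right(2)[OF B S h]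
      by (simp add: eq[OF h] compose_lin_left)
  next
    fix h assume h: "h \<in> ?V"
    show "sandwich ?V S T h \<in> vecs (operators D C)"
      unfolding eq[OF h] by (rule operators_compose(1)[OF D A C Sh[OF h] T])
  qed (auto simp: sandwich_def zero_outside_def)
  show "nrm (operators (operators A B) (operators D C)) (sandwich ?V S T) \<le> nrm (operators B C) S * nrm (operators D A) T"
    using b by (intro op_norm_le[OF AB] mult_nonneg_nonneg op_norm_nonneg[OF B C S] op_norm_nonneg[OF D A T])
qed

lemma bilin_sandwich:
  assumes A: "normed_space A" and B: "normed_space B" and C: "normed_space C" and D: "normed_space D"
  shows "bilin (operators B C) (operators D A) (operators (operators A B) (operators D C))
    (sandwich (vecs (operators A B)))"
proof -
  let ?V = "vecs (operators A B)"
  have "\<exists>K\<ge>0. \<forall>S\<in>vecs (operators B C). \<forall>T\<in>vecs (operators D A).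
      nrm (operators (operators A B) (operators D C)) (sandwich ?V S T) \<le> K * nrm (operators B C) S * nrm (operators D A) T"
    using sandwich_operator(2)[OF assms] by (intro exI[of _ 1]) auto
  moreover have "sandwich ?V (S + R) T = sandwich ?V S T + sandwich ?V R T"
    "sandwich ?V (c *\<^sub>C S) T = c *\<^sub>C sandwich ?V S T" for S R T c
    by (auto simp: fun_eq_iff sandwich_def zero_outside_def scaleC_fun_def)
  moreover have "sandwich ?V S (T + R) = sandwich ?V S T + sandwich ?V S R"
    if "S \<in> vecs (operators B C)" "T \<in> vecs (operators D A)" "R \<in> vecs (operators D A)" for S T R
  proof
    fix h show "sandwich ?V S (T + R) h = (sandwich ?V S T + sandwich ?V S R) h"
      using compose_lin_right(1)[OF A operators_compose(1)[OF A B C that(1), of h] that(2,3)]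
      by (cases "h \<in> ?V") (auto simp: sandwich_def zero_outside_def)
  qed
  moreover have "sandwich ?V S (c *\<^sub>C T) = c *\<^sub>C sandwich ?V S T"
    if "S \<in> vecs (operators B C)" "T \<in> vecs (operators D A)" for S T c
  proof
    fix h show "sandwich ?V S (c *\<^sub>C T) h = (c *\<^sub>C sandwich ?V S T) h"
      using compose_lin_right(2)[OF A operators_compose(1)[OF A B C that(1), of h] that(2)]
      by (cases "h \<in> ?V") (auto simp: sandwich_def zero_outside_def scaleC_fun_def)
  qed
  ultimately show ?thesis
    unfolding bilin_def linear_on_def using sandwich_operator(1)[OF assms] by blast
qed

definition transposed :: "('b \<Rightarrow> complex) set \<Rightarrow> ('a \<Rightarrow> 'b) \<Rightarrow> ('b \<Rightarrow> complex) \<Rightarrow> 'a \<Rightarrow> complex"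
  where "transposed D T = zero_outside D (\<lambda>f. f \<circ> T)"

lemma transposed_operator:
  assumes A: "normed_space A" and B: "normed_space B" and T: "T \<in> vecs (operators A B)"
  shows "transposed (vecs (dual B)) T \<in> vecs (operators (dual B) (dual A))"
    and "nrm (operators (dual B) (dual A)) (transposed (vecs (dual B)) T) \<le> nrm (operators A B) T"
proof -
  have eq: "transposed (vecs (dual B)) T f = f \<circ> T" if "f \<in> vecs (dual B)" for f
    using that by (simp add: transposed_def zero_outside_def)
  note C = operators_compose[OF A B complex_normed _ T, folded dual_def]
  have b: "nrm (dual A) (transposed (vecs (dual B)) T f) \<le> nrm (operators A B) T * nrm (dual B) f"
    if "f \<in> vecs (dual B)" for f
    using C(2)[OF that] by (simp add: eq[OF that] mult.commute)
  then show "transposed (vecs (dual B)) T \<in> vecs (operators (dual B) (dual A))"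
  proof (intro operatorsI)
    fix f assume f: "f \<in> vecs (dual B)"
    show "transposed (vecs (dual B)) T f \<in> vecs (dual A)" unfolding eq[OF f] by (rule C(1)[OF f])
    show "transposed (vecs (dual B)) T (c *\<^sub>C f) = c *\<^sub>C transposed (vecs (dual B)) T f" for c
      by (simp add: eq[OF f] eq[OF nsD_scale[OF dual_normed[OF B] f]] compose_lin_left)
    fix g assume g: "g \<in> vecs (dual B)"
    show "transposed (vecs (dual B)) T (f + g) = transposed (vecs (dual B)) T f + transposed (vecs (dual B)) T g"
      by (simp add: eq[OF f] eq[OF g] eq[OF nsD_add[OF dual_normed[OF B] f g]] compose_lin_left)
  qed (auto simp: transposed_def zero_outside_def)
  show "nrm (operators (dual B) (dual A)) (transposed (vecs (dual B)) T) \<le> nrm (operators A B) T"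
    using b by (intro op_norm_le[OF dual_normed[OF B]] op_norm_nonneg[OF A B T])
qed

lemma Cn_transposed:
  assumes P: "normed_space P" and U: "U \<subseteq> vecs P" and A: "normed_space A" and B: "normed_space B"
    and f: "Cn n P U (operators A B) f"
  shows "Cn n P U (operators (dual B) (dual A)) (\<lambda>x. transposed (vecs (dual B)) (f x))"
proof -
  note AB = normed_operators[OF A B]
  note O = normed_operators[OF dual_normed[OF B] dual_normed[OF A]]
  \<comment> \<open>Transposition is linear and norm-decreasing in the operator, so it is one fixed
    bounded operator applied to \<open>f x\<close>. It is cut off outside its domain to be an
    element of \<open>operators\<close>.\<close>
  let ?L = "zero_outside (vecs (operators A B)) (transposed (vecs (dual B)))"
  have eq: "?L T = transposed (vecs (dual B)) T" if "T \<in> vecs (operators A B)" for T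
    using that by (simp add: zero_outside_def)
  have dop: "f \<in> vecs (operators B \<lparr>vecs = UNIV, nrm = cmod\<rparr>)" if "f \<in> vecs (dual B)" for f
    using that by (simp add: dual_def)
  have "?L \<in> vecs (operators (operators A B) (operators (dual B) (dual A)))"
  proof (rule operatorsI)
    fix T assume T: "T \<in> vecs (operators A B)"
    show "?L T \<in> vecs (operators (dual B) (dual A))" unfolding eq[OF T] by (rule transposed_operator[OF A B T])
    show "nrm (operators (dual B) (dual A)) (?L T) \<le> 1 * nrm (operators A B) T"
      using transposed_operator(2)[OF A B T] by (simp add: eq[OF T])
    show "?L (c *\<^sub>C T) = c *\<^sub>C ?L T" for c
    proof
      fix g show "?L (c *\<^sub>C T) g = (c *\<^sub>C ?L T) g"
        unfolding eq[OF T] eq[OF nsD_scale[OF AB T]]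
        using compose_lin_right(2)[OF B dop T, of g c]
        by (auto simp: transposed_def zero_outside_def scaleC_fun_def)
    qed
    fix S assume S: "S \<in> vecs (operators A B)"
    show "?L (T + S) = ?L T + ?L S"
    proof
      fix g show "?L (T + S) g = (?L T + ?L S) g"
        unfolding eq[OF T] eq[OF S] eq[OF nsD_add[OF AB T S]] plus_fun_apply
        using compose_lin_right(1)[OF B dop T S, of g]
        by (auto simp: transposed_def zero_outside_def fun_eq_iff)
    qed
  qed (auto simp: zero_outside_def)
  then have "Cn n P U (operators (dual B) (dual A)) (\<lambda>x. ?L (f x))"
    by (rule Cn_apply_linear[OF P U AB O _ f])
  then show ?thesis by (rule Cn_cong) (rule eq[OF Cn_in[OF f]])
qed


section \<open>The charts of the Grassmannian\<close>

lemma bounded_ops_bclin: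
  assumes V: "V \<in> Gr" and W: "W \<in> Gr" and A: "A \<in> vecs (bounded_ops V W)"
  shows "bclin (\<lambda>x. A (proj V x))"
proof (rule bclinI)
  note P = proj_in[OF V] and bP = bclin_proj[OF V]
  show "A (proj V (x + y)) = A (proj V x) + A (proj V y)" for x y
    using op_add[OF A, of "proj V x" "proj V y"] P by (simp add: bclin_add[OF bP])
  show "A (proj V (c *\<^sub>C x)) = c *\<^sub>C A (proj V x)" for c x
    using op_scale[OF A, of "proj V x"] P by (simp add: bclin_scaleC[OF bP])
  show "norm (A (proj V x)) \<le> nrm (bounded_ops V W) A * norm x" for x
    using op_bound[OF subspace_normed[OF V] subspace_normed[OF W] A, of "proj V x"] P
      mult_left_mono[OF norm_proj_le[OF V] op_norm_nonneg[OF subspace_normed[OF V] subspace_normed[OF W] A], of x]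
    by simp
qed

lemma bounded_opsI:
  assumes V: "V \<in> Gr" and T: "bclin T" and W: "\<And>x. x \<in> V \<Longrightarrow> T x \<in> W"
  shows "zero_outside V T \<in> vecs (bounded_ops V W)"
proof -
  obtain K where "\<And>x. norm (T x) \<le> K * norm x" using bclin_bound[OF T] by blast
  then show ?thesis
    by (intro operatorsI[where K = K])
      (auto simp: zero_outside_def W bclin_add[OF T] bclin_scaleC[OF T] GrD(2,3)[OF V])
qed

lemma bounded_ops_normed: "V \<in> Gr \<Longrightarrow> W \<in> Gr \<Longrightarrow> normed_space (bounded_ops V W)"
  by (intro normed_operators subspace_normed)

text \<open>The working form of \<open>W \<in> Gr_domain V\<close>, by \<open>Gr_domain_iff\<close>.
  The lower estimate says that the inverse of the projection from \<open>W\<close> to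
  \<open>V\<close> is bounded.\<close>

definition proj_iso :: "'h::complex_hilbert set \<Rightarrow> 'h set \<Rightarrow> bool"
  where "proj_iso V W \<longleftrightarrow> V \<in> Gr \<and> W \<in> Gr \<and> bij_betw (proj V) W V \<and> (\<exists>C\<ge>0. \<forall>y\<in>W. norm y \<le> C * norm (proj V y))"

text \<open>Projecting \<open>x\<close> to \<open>V\<close> first makes the inverse of the
  projection total: this is the oblique projection of the whole space onto \<open>W\<close> along
  \<open>orth V\<close>.\<close>

definition lift :: "'h::complex_hilbert set \<Rightarrow> 'h set \<Rightarrow> 'h \<Rightarrow> 'h"
  where "lift V W x = inv_into W (proj V) (proj V x)"

lemma lift_props:
  assumes "proj_iso V W"
  shows lift_in: "lift V W x \<in> W" and proj_lift: "proj V (lift V W x) = proj V x"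
    and lift_id: "y \<in> W \<Longrightarrow> lift V W y = y" and lift_proj: "lift V W (proj V x) = lift V W x"
    and bclin_lift: "bclin (lift V W)"
proof -
  have V: "V \<in> Gr" and W: "W \<in> Gr" and b: "bij_betw (proj V) W V" using assms by (auto simp: proj_iso_def)
  obtain C where C: "C \<ge> 0" "\<And>y. y \<in> W \<Longrightarrow> norm y \<le> C * norm (proj V y)" using assms by (auto simp: proj_iso_def)
  have im: "proj V x \<in> proj V ` W" for x using proj_in[OF V] b by (simp add: bij_betw_def)
  show l1: "lift V W x \<in> W" for x unfolding lift_def by (rule inv_into_into[OF im])
  show l2: "proj V (lift V W x) = proj V x" for x unfolding lift_def by (rule f_inv_into_f[OF im])
  show l3: "y \<in> W \<Longrightarrow> lift V W y = y" for y
    unfolding lift_def using b by (simp add: bij_betw_def inv_into_f_f)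
  show "lift V W (proj V x) = lift V W x" by (simp add: lift_def proj_id[OF V proj_in[OF V]])
  have uniq: "y = z" if "y \<in> W" "z \<in> W" "proj V y = proj V z" for y z
    using b that by (auto simp: bij_betw_def dest: inj_onD)
  note bP = bclin_proj[OF V]
  show "bclin (lift V W)"
  proof (rule bclinI)
    show "lift V W (x + y) = lift V W x + lift V W y" for x y
      by (rule uniq) (simp_all add: l1 l2 GrD(2)[OF W] bclin_add[OF bP])
    show "lift V W (c *\<^sub>C x) = c *\<^sub>C lift V W x" for c x
      by (rule uniq) (simp_all add: l1 l2 GrD(3)[OF W] bclin_scaleC[OF bP])
    show "norm (lift V W x) \<le> C * norm x" for x
      using C(2)[OF l1, of x] mult_left_mono[OF norm_proj_le[OF V] C(1), of x] by (simp add: l2)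
  qed
qed

text \<open>Write \<open>x = v + w\<close> with \<open>v\<close> in \<open>V\<close> and
  \<open>w\<close> in \<open>orth W\<close>. For \<open>y\<close> in \<open>W\<close> this gives
  \<open>cinner y x = cinner (proj V y) v\<close>, so the \<open>y\<close> with
  \<open>norm (proj V y) \<le> 1\<close> are pointwise bounded, hence bounded. The lower estimate
  makes the projected image of \<open>W\<close> closed, and a vector of \<open>V\<close> orthogonal
  to it lies in \<open>V \<inter> orth W = {0}\<close>. The converse constructs the decomposition
  from the bounded lift.\<close>

lemma Gr_domain_iff:
  assumes V: "V \<in> Gr"
  shows "W \<in> Gr_domain V \<longleftrightarrow> proj_iso V W"
proof
  assume "W \<in> Gr_domain V"
  then have W: "W \<in> Gr" and disj: "V \<inter> orth W = {0}" and sum: "{v + w | v w. v \<in> V \<and> w \<in> orth W} = UNIV"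
    by (auto simp: Gr_domain_def)
  have "\<exists>C. \<forall>y\<in>{y\<in>W. norm (proj V y) \<le> 1}. norm y \<le> C"
  proof (rule uniform_boundedness)
    fix x
    obtain v w where x: "x = v + w" "v \<in> V" "w \<in> orth W" using sum by blast
    have "cmod (cinner y x) \<le> norm v" if "y \<in> W" "norm (proj V y) \<le> 1" for y
    proof -
      have "cinner y x = cinner (proj V y) v"
        using orthD[OF x(3) that(1)] proj_cinner_left[OF V x(2)] by (simp add: x(1) cinner_add_right)
      then show ?thesis
        using cauchy_schwarz[of "proj V y" v] mult_right_mono[OF that(2) norm_ge_zero[of v]] by simp
    qed
    then show "\<exists>K. \<forall>y\<in>{y\<in>W. norm (proj V y) \<le> 1}. cmod (cinner y x) \<le> K" by blast
  qed
  then obtain C where C: "\<And>y. y \<in> W \<Longrightarrow> norm (proj V y) \<le> 1 \<Longrightarrow> norm y \<le> C" by blast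
  note bP = bclin_proj[OF V]
  have bound: "norm y \<le> \<bar>C\<bar> * norm (proj V y)" if y: "y \<in> W" for y
  proof (cases "proj V y = 0")
    case True
    \<comment> \<open>All multiples of \<open>y\<close> satisfy the same bound, which is possible
      only for \<open>y = 0\<close>.\<close>
    have "norm y * r \<le> C" if "r > 0" for r :: real
      using C[OF GrD(4)[OF W y, of r]] True that
      by (simp add: scaleR_conv_scaleC bclin_scaleC[OF bP] norm_scaleC mult.commute)
    then have "norm y = 0"
    proof -
      assume a: "\<And>r. r > 0 \<Longrightarrow> norm y * r \<le> C"
      have "\<not> norm y > 0"
      proof
        assume p: "norm y > 0"
        have "norm y * ((\<bar>C\<bar> + 1) / norm y) \<le> C" using p by (intro a) simp
        then show False using p by simp
      qed
      then show ?thesis by simp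
    qed
    then show ?thesis by simp
  next
    case False
    let ?r = "inverse (norm (proj V y))"
    have "norm (proj V (?r *\<^sub>R y)) \<le> 1"
      using False by (simp add: scaleR_conv_scaleC bclin_scaleC[OF bP] norm_scaleC norm_inverse)
    from C[OF GrD(4)[OF W y] this] have "norm y * ?r \<le> C" by (simp add: mult.commute)
    then have "norm y \<le> C * norm (proj V y)" using False by (simp add: field_simps)
    then show ?thesis using mult_right_mono[OF abs_ge_self[of C] norm_ge_zero[of "proj V y"]] by linarith
  qed
  have inj: "inj_on (proj V) W"
  proof (rule inj_onI)
    fix y z assume y: "y \<in> W" and z: "z \<in> W" and eq: "proj V y = proj V z"
    have "norm (y - z) \<le> \<bar>C\<bar> * norm (proj V (y - z))" by (rule bound[OF GrD(6)[OF W y z]])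
    then show "y = z" by (simp add: bclin_diff[OF bP] eq)
  qed
  let ?R = "proj V ` W"
  have "csubspace ?R" unfolding csubspace_def
  proof (intro conjI ballI allI)
    show "0 \<in> ?R" using GrD(1)[OF W] bclin_zero[OF bP] by force
    fix a assume "a \<in> ?R"
    then obtain y where y: "y \<in> W" "a = proj V y" by blast
    show "c *\<^sub>C a \<in> ?R" for c using GrD(3)[OF W y(1), of c] y(2) bclin_scaleC[OF bP, of c y] by force
    fix b assume "b \<in> ?R"
    then obtain z where z: "z \<in> W" "b = proj V z" by blast
    show "a + b \<in> ?R" using GrD(2)[OF W y(1) z(1)] y(2) z(2) bclin_add[OF bP, of y z] by force
  qed
  moreover have "closed ?R" unfolding closed_sequential_limits
  proof (intro allI impI)
    fix s l assume s: "(\<forall>n. s n \<in> ?R) \<and> s \<longlonglongrightarrow> l"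
    then have "\<exists>y. y \<in> W \<and> s n = proj V y" for n by blast
    then obtain y where y: "\<And>n. y n \<in> W" "\<And>n. s n = proj V (y n)" by metis
    have "Cauchy s" using s LIMSEQ_imp_Cauchy by blast
    have "Cauchy y"
    proof (rule metric_CauchyI)
      fix e :: real assume "e > 0"
      then have "e / (\<bar>C\<bar> + 1) > 0" by simp
      then obtain N where N: "\<And>m n. m \<ge> N \<Longrightarrow> n \<ge> N \<Longrightarrow> dist (s m) (s n) < e / (\<bar>C\<bar> + 1)"
        using \<open>Cauchy s\<close> unfolding Cauchy_def by blast
      have "dist (y m) (y n) < e" if "m \<ge> N" "n \<ge> N" for m n
      proof -
        have "norm (y m - y n) \<le> \<bar>C\<bar> * norm (s m - s n)"
          using bound[OF GrD(6)[OF W y(1) y(1)], of m n] by (simp add: y(2) bclin_diff[OF bP])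
        also have "\<dots> \<le> (\<bar>C\<bar> + 1) * norm (s m - s n)" by (intro mult_right_mono) auto
        also have "\<dots> < e" using N[OF that] by (simp add: dist_norm pos_less_divide_eq mult.commute)
        finally show ?thesis by (simp add: dist_norm)
      qed
      then show "\<exists>M. \<forall>m\<ge>M. \<forall>n\<ge>M. dist (y m) (y n) < e" by blast
    qed
    then obtain z where z: "y \<longlonglongrightarrow> z" using convergent_eq_Cauchy by blast
    have "z \<in> W" using z y(1) Gr_closed[OF W] by (auto simp: closed_sequential_limits)
    have "(\<lambda>n. proj V (y n)) \<longlonglongrightarrow> proj V z" by (rule bounded_linear.tendsto[OF bclin_bounded_linear[OF bP] z])
    then have "s \<longlonglongrightarrow> proj V z" by (simp add: y(2)[symmetric])
    then have "l = proj V z" using s LIMSEQ_unique by blast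
    then show "l \<in> ?R" using \<open>z \<in> W\<close> by blast
  qed
  ultimately have R: "?R \<in> Gr" by (simp add: Gr_def)
  have "?R = V"
  proof (rule Gr_eqI_zero[OF V R])
    show "?R \<subseteq> V" using proj_in[OF V] by blast
    fix v assume v: "v \<in> V" "v \<in> orth ?R"
    have "v \<in> orth W"
      by (rule orthI) (use orthD[OF v(2)] proj_cinner_left[OF V v(1)] in force)
    then show "v = 0" using v(1) disj by blast
  qed
  then show "proj_iso V W"
    unfolding proj_iso_def using V W inj bound by (auto simp: bij_betw_def intro!: exI[of _ "\<bar>C\<bar>"])
next
  assume g: "proj_iso V W"
  then have W: "W \<in> Gr" by (simp add: proj_iso_def)
  note E = lift_props[OF g]
  have "v = 0" if "v \<in> V" "v \<in> orth W" for v
  proof -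
    have "cinner v v = cinner v (lift V W v)"
      using proj_cinner[OF V that(1), of "lift V W v"] by (simp add: E(2) proj_id[OF V that(1)])
    also have "\<dots> = 0" by (rule orthD2[OF that(2) E(1)])
    finally show ?thesis using cinner_eq_norm[of v] by simp
  qed
  moreover have "\<exists>v w. x = v + w \<and> v \<in> V \<and> w \<in> orth W" for x
  proof -
    \<comment> \<open>The adjoint of the projection onto \<open>W\<close> along
      \<open>orth V\<close> is the projection onto \<open>V\<close> along \<open>orth W\<close>, so
      this is the \<open>V\<close>-component of \<open>x\<close>.\<close>
    define v where "v = adj (lift V W) x"
    have v: "cinner z v = cinner (lift V W z) x" for z by (simp add: v_def cinner_adj_right[OF E(5)])
    have "v \<in> orth (orth V)"
    proof (rule orthI)
      fix z assume "z \<in> orth V"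
      then have "lift V W z = 0" using E(4)[of z] proj_zero[OF V, of z] bclin_zero[OF E(5)] by simp
      then show "cinner z v = 0" by (simp add: v)
    qed
    then have "v \<in> V" by (simp add: orth_orth[OF V])
    moreover have "x - v \<in> orth W" by (rule orthI) (simp add: cinner.diff_right v E(3))
    ultimately show ?thesis by (intro exI[of _ v] exI[of _ "x - v"]) simp
  qed
  ultimately show "W \<in> Gr_domain V"
    using W GrD(1)[OF V] GrD(1)[OF orth_Gr] unfolding Gr_domain_def by blast
qed

lemma Gr_domain_Gr: "W \<in> Gr_domain V \<Longrightarrow> W \<in> Gr"
  by (simp add: Gr_domain_def)

lemma Gr_domain_self: "V \<in> Gr \<Longrightarrow> V \<in> Gr_domain V"
  unfolding Gr_domain_iff proj_iso_def
  by (auto simp: bij_betw_def inj_on_def proj_id image_def intro!: exI[of _ 1])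

text \<open>If the lift of \<open>x\<close> is \<open>v + w\<close> with \<open>v\<close> in
  \<open>V\<close> and \<open>w\<close> in \<open>orth W\<close>, then \<open>v\<close> projects to
  that lift in \<open>W\<close>, so \<open>v\<close> is a preimage of \<open>x\<close> under the
  compressed projection. Every preimage yields the same point of \<open>W\<close>, so the choice
  made by \<open>inv_into\<close> does not matter.\<close>

lemma Gr_chart_eq:
  assumes V: "V \<in> Gr" and W: "W \<in> Gr_domain V"
  shows "Gr_chart V W = zero_outside V (\<lambda>x. lift V W x - x)"
proof -
  have g: "proj_iso V W" using Gr_domain_iff[OF V] W by blast
  note E = lift_props[OF g] and WG = Gr_domain_Gr[OF W]
  let ?T = "proj V \<circ> proj W \<circ> proj V"
  have "(proj (orth V) \<circ> proj W \<circ> proj V) (inv_into V ?T x) = lift V W x - x" if x: "x \<in> V" for x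
  proof -
    obtain v w where vw: "lift V W x = v + w" "v \<in> V" "w \<in> orth W"
      using W unfolding Gr_domain_def by blast
    have "proj W v = lift V W x"
    proof (rule proj_eqI[OF WG E(1)])
      have "v - lift V W x = - w" by (simp add: vw(1))
      then show "v - lift V W x \<in> orth W" using GrD(5)[OF orth_Gr vw(3)] by simp
    qed
    then have "?T v = x" by (simp add: proj_id[OF V vw(2)] E(2) proj_id[OF V x])
    then have "x \<in> ?T ` V" using vw(2) by blast
    then have "?T (inv_into V ?T x) = x" by (rule f_inv_into_f)
    moreover define y where "y = proj W (proj V (inv_into V ?T x))"
    ultimately have "proj V y = x" "y \<in> W" using proj_in[OF WG] by auto
    then have "y = lift V W x" using E(3,4)[of y] by simp
    then show ?thesis using \<open>proj V y = x\<close> by (simp add: y_def[symmetric] proj_orth[OF V])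
  qed
  then show ?thesis unfolding Gr_chart_def zero_outside_def by auto
qed

section \<open>Graphs as values of the inverse charts\<close>

definition graph :: "'h::complex_hilbert set \<Rightarrow> ('h \<Rightarrow> 'h) \<Rightarrow> 'h set"
  where "graph V A = (\<lambda>x. x + A x) ` V"

lemma Gr_chart_in:
  assumes V: "V \<in> Gr" and W: "W \<in> Gr_domain V"
  shows "Gr_chart V W \<in> vecs (bounded_ops V (orth V))"
proof -
  have g: "proj_iso V W" using Gr_domain_iff[OF V] W by blast
  note E = lift_props[OF g]
  show ?thesis unfolding Gr_chart_eq[OF assms]
  proof (rule bounded_opsI[OF V bclin_minus_op[OF E(5) bclin_id]])
    fix x assume x: "x \<in> V"
    have "lift V W x - proj V (lift V W x) \<in> orth V" by (rule proj_diff_in[OF V])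
    then show "lift V W x - x \<in> orth V" by (simp add: E(2) proj_id[OF V x])
  qed
qed

lemma graph_Gr_chart:
  assumes V: "V \<in> Gr" and W: "W \<in> Gr_domain V"
  shows "graph V (Gr_chart V W) = W"
proof -
  have g: "proj_iso V W" using Gr_domain_iff[OF V] W by blast
  note E = lift_props[OF g]
  have "graph V (Gr_chart V W) = lift V W ` V"
    unfolding graph_def Gr_chart_eq[OF assms] by (rule image_cong) (auto simp: zero_outside_def)
  also have "\<dots> = W"
  proof (intro equalityI subsetI)
    fix y assume "y \<in> W"
    then have "y = lift V W (proj V y)" by (simp add: E(3,4))
    then show "y \<in> lift V W ` V" using proj_in[OF V] by blast
  qed (use E(1) in blast)
  finally show ?thesis .
qed

lemma graph_domain:
  assumes V: "V \<in> Gr" and A: "A \<in> vecs (bounded_ops V (orth V))"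
  shows "graph V A \<in> Gr_domain V" and "x \<in> V \<Longrightarrow> lift V (graph V A) x = x + A x"
    and "Gr_chart V (graph V A) = A"
proof -
  note bA = bounded_ops_bclin[OF V orth_Gr A] and bQ = bclin_proj[OF orth_Gr, of V]
  let ?W = "graph V A"
  have pr: "proj V (x + A x) = x" "proj (orth V) (x + A x) = A x" if x: "x \<in> V" for x
  proof -
    have Ax: "A x \<in> orth V" using op_in[OF A, of x] x by simp
    show "proj V (x + A x) = x" by (rule proj_eqI[OF V x]) (simp add: Ax)
    then show "proj (orth V) (x + A x) = A x" by (simp add: proj_orth[OF V])
  qed
  \<comment> \<open>As the zero set of a bounded complex-linear map, the graph is a closed
    subspace.\<close>
  have W: "?W = {y. proj (orth V) y - A (proj V y) = 0}"
  proof (intro equalityI subsetI)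
    fix y assume "y \<in> {y. proj (orth V) y - A (proj V y) = 0}"
    then have "y = proj V y + A (proj V y)" by (simp add: proj_orth[OF V] algebra_simps)
    then show "y \<in> ?W" unfolding graph_def using proj_in[OF V] by blast
  qed (auto simp: graph_def pr)
  have bZ: "bclin (\<lambda>y. proj (orth V) y - A (proj V y))" by (rule bclin_minus_op[OF bQ bA])
  have WG: "?W \<in> Gr"
    unfolding W Gr_def csubspace_def using closed_zeros_bclin[OF bZ]
    by (auto simp: bclin_zero[OF bA] bclin_zero[OF bQ] bclin_add[OF bA] bclin_add[OF bQ]
        bclin_scaleC[OF bA] bclin_scaleC[OF bQ])
  obtain K where K: "K \<ge> 0" "\<And>x. norm (A (proj V x)) \<le> K * norm x" using bclin_bound[OF bA] by blast
  have "bij_betw (proj V) ?W V"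
    unfolding bij_betw_def inj_on_def graph_def by (auto simp: pr image_image)
  moreover have "norm y \<le> (1 + K) * norm (proj V y)" if y: "y \<in> ?W" for y
  proof -
    obtain x where x: "x \<in> V" "y = x + A x" using y by (auto simp: graph_def)
    have "norm y \<le> norm x + norm (A (proj V x))" by (simp add: x proj_id[OF V] norm_triangle_ineq)
    then show ?thesis using K(2)[of x] pr(1)[OF x(1)] by (simp add: x(2) distrib_right)
  qed
  ultimately have g: "proj_iso V ?W" unfolding proj_iso_def using V WG K(1) by (auto intro!: exI[of _ "1 + K"])
  then show d: "?W \<in> Gr_domain V" by (simp add: Gr_domain_iff[OF V])
  show l: "lift V ?W x = x + A x" if "x \<in> V" for x
    using lift_proj[OF g, of "x + A x"] lift_id[OF g, of "x + A x"] pr(1)[OF that] that by (simp add: graph_def)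
  show "Gr_chart V ?W = A"
    unfolding Gr_chart_eq[OF V d] zero_outside_def using l op_outside[OF A] by auto
qed

lemma Gr_manifold_simps [simp]:
  "index Gr_manifold = Gr" "domain Gr_manifold = Gr_domain" "chart Gr_manifold = Gr_chart"
  "model Gr_manifold V = bounded_ops V (orth V)"
  by (simp_all add: Gr_manifold_def)

lemma Gr_chart_inj: "V \<in> Gr \<Longrightarrow> inj_on (Gr_chart V) (Gr_domain V)"
  by (rule inj_on_inverseI[where g = "graph V"]) (rule graph_Gr_chart)

lemma inv_chart_graph:
  assumes V: "V \<in> Gr" and A: "A \<in> vecs (bounded_ops V (orth V))"
  shows "inv_chart Gr_manifold V A = graph V A"
  unfolding inv_chart_def using inv_into_f_f[OF Gr_chart_inj[OF V] graph_domain(1)[OF V A]] graph_domain(3)[OF V A]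
  by simp

text \<open>The projection onto \<open>V\<^sup>\<bottom>\<close> along \<open>W\<close>.\<close>

definition along :: "'h::complex_hilbert set \<Rightarrow> 'h set \<Rightarrow> 'h \<Rightarrow> 'h"
  where "along V W z = z - lift V W z"

lemma along_props:
  assumes "proj_iso V W"
  shows along_in: "along V W z \<in> orth V" and along_zero: "z \<in> W \<Longrightarrow> along V W z = 0"
    and bclin_along: "bclin (along V W)"
proof -
  have V: "V \<in> Gr" using assms by (simp add: proj_iso_def)
  note E = lift_props[OF assms]
  have "along V W z - proj V (along V W z) = along V W z"
    by (simp add: along_def bclin_diff[OF bclin_proj[OF V]] E(2))
  then show "along V W z \<in> orth V" using proj_diff_in[OF V, of "along V W z"] by simp
  show "z \<in> W \<Longrightarrow> along V W z = 0" by (simp add: along_def E(3))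
  show "bclin (along V W)" unfolding along_def by (rule bclin_minus_op[OF bclin_id E(5)])
qed

text \<open>This identity contains the derivatives of all transition maps: with \<open>S = graph V A\<close> and
  \<open>R = graph V B\<close>, it expresses the increment of \<open>V'\<close>-coordinates by the increment \<open>B - A\<close>.\<close>

lemma lift_increment:
  assumes S: "proj_iso V' (graph V A)" and R: "proj_iso V' (graph V B)" and V: "V \<in> Gr"
    and A: "A \<in> vecs (bounded_ops V (orth V))" and B: "B \<in> vecs (bounded_ops V (orth V))"
  shows "lift V' (graph V B) x - lift V' (graph V A) x
    = along V' (graph V A) ((B - A) (proj V (lift V' (graph V B) x)))"
proof -
  let ?S = "graph V A" and ?R = "graph V B"
  define u where "u = proj V (lift V' ?R x)"
  have uV: "u \<in> V" by (simp add: u_def proj_in[OF V])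
  have gR: "proj_iso V ?R" using graph_domain(1)[OF V B] Gr_domain_iff[OF V] by blast
  have "lift V' ?R x = lift V ?R u"
    unfolding u_def lift_proj[OF gR] by (rule lift_id[OF gR lift_in[OF R], symmetric])
  then have eq: "lift V' ?R x = (u + A u) + (B - A) u" using graph_domain(2)[OF V B uV] by simp
  have "along V' ?S (lift V' ?R x) = along V' ?S (u + A u) + along V' ?S ((B - A) u)"
    unfolding eq by (rule bclin_add[OF bclin_along[OF S]])
  also have "along V' ?S (u + A u) = 0"
    by (rule along_zero[OF S]) (use uV in \<open>auto simp: graph_def\<close>)
  finally have "along V' ?S (lift V' ?R x) = along V' ?S ((B - A) u)" by simp
  moreover have "lift V' ?S (lift V' ?R x) = lift V' ?S x"
    using lift_proj[OF S, of "lift V' ?R x"] lift_proj[OF S, of x] by (simp add: proj_lift[OF R])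
  ultimately show ?thesis by (simp add: along_def u_def)
qed


subsection \<open>Smoothness of the transition maps\<close>

text \<open>Replacing \<open>G B\<close> by \<open>G A\<close> in the exact increment of
  \<open>F\<close> leaves \<open>S \<circ> (B - A) \<circ> (G B - G A)\<close>. By the second
  identity the difference of the \<open>G\<close> is at most \<open>r * t\<close> times the norm of
  \<open>G B\<close>; for \<open>r * t \<le> 1 / 2\<close> it can be absorbed, so \<open>G B\<close>
  has at most twice the norm of \<open>G A\<close> and the remainder is quadratic in
  \<open>B - A\<close>.\<close>

lemma increment_has_fderiv:
  assumes E1: "normed_space E1" and E2: "normed_space E2" and C: "normed_space C" and D: "normed_space D"
    and Om: "Om \<subseteq> vecs (operators E1 E2)" and A: "A \<in> Om"
    and S: "S \<in> vecs (operators E2 C)" and R: "R \<in> vecs (operators E2 E1)"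
    and G: "\<And>B. B \<in> Om \<Longrightarrow> G B \<in> vecs (operators D E1)"
    and F: "\<And>B. B \<in> Om \<Longrightarrow> F B - F A = S \<circ> (B - A) \<circ> G B"
    and dG: "\<And>B. B \<in> Om \<Longrightarrow> G B - G A = R \<circ> (B - A) \<circ> G B"
  shows "has_fderiv (operators E1 E2) Om (operators D C) F (sandwich (vecs (operators E1 E2)) S (G A)) A"
  unfolding has_fderiv_def
proof (intro conjI allI impI)
  let ?P = "operators E1 E2" and ?nG = "nrm (operators D E1)"
  note P = normed_operators[OF E1 E2] and DE = normed_operators[OF D E1]
  define s where "s = nrm (operators E2 C) S"
  define r where "r = nrm (operators E2 E1) R"
  have s: "s \<ge> 0" and r: "r \<ge> 0" by (auto simp: s_def r_def intro: op_norm_nonneg S R C E1 E2)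
  show "sandwich (vecs ?P) S (G A) \<in> vecs (operators ?P (operators D C))"
    by (rule sandwich_operator(1)[OF E1 E2 C D S G[OF A]])
  fix e :: real assume e: "e > 0"
  define g where "g = ?nG (G A)"
  have g: "g \<ge> 0" unfolding g_def by (rule op_norm_nonneg[OF D E1 G[OF A]])
  \<comment> \<open>The first term ensures \<open>r * t \<le> 1 / 2\<close> for the absorption, the
    second \<open>2 * s * r * g * t \<le> e\<close> for the quadratic remainder.\<close>
  define d where "d = min (1 / (2 * r + 1)) (e / (2 * s * r * g + 1))"
  have pos: "2 * r + 1 > 0" "2 * s * r * g + 1 > 0" using s r g by (auto intro: add_nonneg_pos)
  have d: "d > 0" using e pos by (simp add: d_def)
  have "nrm (operators D C) (F B - F A - sandwich (vecs ?P) S (G A) (B - A)) \<le> e * nrm ?P (B - A)"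
    if B: "B \<in> Om" and small: "nrm ?P (B - A) < d" for B
  proof -
    define h where "h = B - A"
    have h: "h \<in> vecs ?P" unfolding h_def using Om A B by (intro nsD_diff[OF P]) auto
    define t where "t = nrm ?P h"
    have t: "t \<ge> 0" "t < d" using nsD_nonneg[OF P h] small by (auto simp: t_def h_def)
    have Rh: "R \<circ> h \<in> vecs (operators E1 E1)" "nrm (operators E1 E1) (R \<circ> h) \<le> r * t"
      using operators_compose[OF E1 E2 E1 R h] by (auto simp: r_def t_def)
    have dGn: "?nG (G B - G A) \<le> r * t * ?nG (G B)"
      unfolding dG[OF B] h_def[symmetric]
      using operators_compose(2)[OF D E1 E1 Rh(1) G[OF B]]
        mult_right_mono[OF Rh(2) op_norm_nonneg[OF D E1 G[OF B]]] by linarith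
    have "t < 1 / (2 * r + 1)" using t by (simp add: d_def)
    then have "t * (2 * r + 1) < 1" using pos by (simp add: pos_less_divide_eq)
    then have rt: "r * t \<le> 1 / 2" using t by (simp add: algebra_simps)
    have "?nG (G B) \<le> ?nG (G B - G A) + g"
      using nsD_tri[OF DE nsD_diff[OF DE G[OF B] G[OF A]] G[OF A]] by (simp add: g_def)
    also have "?nG (G B - G A) \<le> 1 / 2 * ?nG (G B)"
      using dGn mult_right_mono[OF rt op_norm_nonneg[OF D E1 G[OF B]]] by linarith
    finally have GB: "?nG (G B) \<le> 2 * g" by simp
    have "F B - F A - sandwich (vecs ?P) S (G A) h = (S \<circ> h) \<circ> (G B - G A)"
    proof
      fix x
      have Sh: "S \<circ> h \<in> vecs (operators E1 C)" by (rule operators_compose(1)[OF E1 E2 C S h])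
      have "(S \<circ> h) (G B x - G A x) = (S \<circ> h) (G B x) - (S \<circ> h) (G A x)"
      proof (cases "x \<in> vecs D")
        case True
        then show ?thesis by (intro op_diff[OF E1 Sh] op_in[OF G[OF B]] op_in[OF G[OF A]])
      next
        case False
        then show ?thesis using op_outside[OF G[OF B]] op_outside[OF G[OF A]] op_zero[OF E1 Sh] by simp
      qed
      then show "(F B - F A - sandwich (vecs ?P) S (G A) h) x = ((S \<circ> h) \<circ> (G B - G A)) x"
        using h fun_cong[OF F[OF B], of x] by (simp add: h_def[symmetric] sandwich_def zero_outside_def)
    qed
    moreover have "nrm (operators D C) ((S \<circ> h) \<circ> (G B - G A)) \<le> (s * t) * (r * t * (2 * g))"
    proof -
      have Sh: "S \<circ> h \<in> vecs (operators E1 C)" "nrm (operators E1 C) (S \<circ> h) \<le> s * t"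
        using operators_compose[OF E1 E2 C S h] by (auto simp: s_def t_def)
      have "?nG (G B - G A) \<le> r * t * (2 * g)"
        using dGn mult_left_mono[OF GB, of "r * t"] r t by (smt (verit) mult_nonneg_nonneg)
      then show ?thesis
        using operators_compose(2)[OF D E1 C Sh(1) nsD_diff[OF DE G[OF B] G[OF A]]]
          mult_mono[OF Sh(2) _ mult_nonneg_nonneg[OF s t(1)] op_norm_nonneg[OF D E1 nsD_diff[OF DE G[OF B] G[OF A]]]]
        by (meson order_trans)
    qed
    moreover have "(s * t) * (r * t * (2 * g)) \<le> e * t"
    proof -
      have "t \<le> e / (2 * s * r * g + 1)" using t by (simp add: d_def)
      then have "t * (2 * s * r * g + 1) \<le> e" using pos by (simp add: pos_le_divide_eq)
      then have "t * (2 * s * r * g) \<le> e" using t by (simp add: algebra_simps)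
      then have "t * (2 * s * r * g) * t \<le> e * t" using t by (intro mult_right_mono)
      then show ?thesis by (simp add: ac_simps)
    qed
    ultimately show ?thesis by (simp add: h_def[symmetric] t_def[symmetric])
  qed
  then show "\<exists>d>0. \<forall>B\<in>Om. nrm ?P (B - A) < d \<longrightarrow>
      nrm (operators D C) (F B - F A - sandwich (vecs ?P) S (G A) (B - A)) \<le> e * nrm ?P (B - A)"
    using d by blast
qed

section \<open>Overlaps of chart domains and their openness\<close>

abbreviation Hom :: "'h::complex_hilbert set \<Rightarrow> ('h \<Rightarrow> 'h) nspace"
  where "Hom V \<equiv> bounded_ops V (orth V)"

lemma Hom_normed: "V \<in> Gr \<Longrightarrow> normed_space (Hom V)"
  by (rule bounded_ops_normed[OF _ orth_Gr])

lemma Hom_banach: "V \<in> Gr \<Longrightarrow> banach_space (Hom V)"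
  by (intro banach_operators subspace_normed subspace_banach orth_Gr)

definition overlap :: "'h::complex_hilbert set \<Rightarrow> 'h set set \<Rightarrow> ('h \<Rightarrow> 'h) set"
  where "overlap V S = {A \<in> vecs (Hom V). graph V A \<in> S}"

lemma chart_image:
  assumes V: "V \<in> Gr"
  shows "Gr_chart V ` (S \<inter> Gr_domain V) = overlap V S" "Gr_chart V ` (Gr_domain V \<inter> S) = overlap V S"
proof -
  have "Gr_chart V ` (Gr_domain V \<inter> S) = overlap V S"
  proof (intro equalityI subsetI)
    fix A assume "A \<in> overlap V S"
    then show "A \<in> Gr_chart V ` (Gr_domain V \<inter> S)"
      using graph_domain[OF V, of A] by (force simp: overlap_def image_def)
  qed (auto simp: overlap_def Gr_chart_in[OF V] graph_Gr_chart[OF V])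
  then show "Gr_chart V ` (S \<inter> Gr_domain V) = overlap V S" "Gr_chart V ` (Gr_domain V \<inter> S) = overlap V S"
    by (simp_all add: Int_commute)
qed

lemma overlap_iso: "V' \<in> Gr \<Longrightarrow> A \<in> overlap V (Gr_domain V') \<Longrightarrow> proj_iso V' (graph V A)"
  using Gr_domain_iff by (auto simp: overlap_def)

lemma graph_mem: "y \<in> graph V A \<Longrightarrow> V \<in> Gr \<Longrightarrow> A \<in> vecs (Hom V) \<Longrightarrow> y = proj V y + A (proj V y)"
  using graph_domain(1)[of V A] graph_domain(2)[of V A "proj V y"] lift_id[of V "graph V A" y] lift_proj[of V "graph V A" y]
    Gr_domain_iff[of V "graph V A"] proj_in[of V y] by simp

text \<open>A perturbation argument in the coordinate \<open>u\<close> of \<open>V\<close>: for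
  \<open>B\<close> near \<open>A\<close>, projecting \<open>u + B u\<close> to \<open>V'\<close> and
  applying the inverse \<open>G\<close> belonging to \<open>A\<close> gives \<open>u + T u\<close>
  with \<open>T\<close> of norm at most one half. This yields the lower estimate, hence injectivity,
  and surjectivity by a fixed point.\<close>

lemma overlap_open:
  assumes V: "V \<in> Gr" and V': "V' \<in> Gr"
  shows "open_in (Hom V) (overlap V (Gr_domain V'))"
  unfolding open_in_def
proof (intro conjI ballI)
  show "overlap V (Gr_domain V') \<subseteq> vecs (Hom V)" by (auto simp: overlap_def)
  fix A assume AO: "A \<in> overlap V (Gr_domain V')"
  then have A: "A \<in> vecs (Hom V)" by (auto simp: overlap_def)
  let ?S = "graph V A"
  note S = overlap_iso[OF V' AO]
  \<comment> \<open>Inverse to the map sending \<open>u\<close> in \<open>V\<close> to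
    \<open>proj V' (u + A u)\<close>; only \<open>G1\<close> and injectivity on \<open>V'\<close>
    (\<open>G2\<close>) are established, and they suffice.\<close>
  define G where "G x = proj V (lift V' ?S x)" for x
  have bG: "bclin G" unfolding G_def by (rule bclin_compose[OF bclin_proj[OF V] bclin_lift[OF S]])
  have G1: "G (proj V' (u + A u)) = u" if u: "u \<in> V" for u
  proof -
    have m: "u + A u \<in> ?S" using u by (auto simp: graph_def)
    have Au: "A u \<in> orth V" using op_in[OF A, of u] u by simp
    have "proj V (u + A u) = u" by (rule proj_eqI[OF V u]) (simp add: Au)
    then show ?thesis by (simp add: G_def lift_proj[OF S] lift_id[OF S m])
  qed
  have G2: "z = x" if "G z = G x" "z \<in> V'" "x \<in> V'" for z x
  proof -
    have l: "lift V' ?S w = G w + A (G w)" for w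
      unfolding G_def by (rule graph_mem[OF lift_in[OF S, of w] V A])
    have "lift V' ?S z = lift V' ?S x" by (simp only: l[of z] l[of x] that(1))
    then have "proj V' z = proj V' x"       using trans[OF sym[OF proj_lift[OF S, of z]]] proj_lift[OF S, of x] by metis
    then show ?thesis by (simp only: proj_id[OF V' that(2)] proj_id[OF V' that(3)])
  qed
  obtain K where K: "K \<ge> 0" "\<And>x. norm (G x) \<le> K * norm x" using bclin_bound[OF bG] by blast
  define d where "d = 1 / (2 * K + 1)"
  have d: "d > 0" using K by (simp add: d_def)
  have "B \<in> overlap V (Gr_domain V')" if B: "B \<in> vecs (Hom V)" and small: "nrm (Hom V) (B - A) < d" for B
  proof -
    let ?R = "graph V B"
    define h where "h = B - A"
    have hL: "h \<in> vecs (Hom V)" unfolding h_def by (rule nsD_diff[OF Hom_normed[OF V] B A])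
    have hn: "norm (h u) \<le> d * norm u" if u: "u \<in> V" for u
    proof -
      have "norm (h u) \<le> nrm (Hom V) h * norm u"
        using op_bound[OF subspace_normed[OF V] subspace_normed[OF orth_Gr] hL, of u] u by simp
      also have "\<dots> \<le> d * norm u" using small by (intro mult_right_mono) (auto simp: h_def)
      finally show ?thesis .
    qed
    define T where "T u = G (proj V' (h u))" for u
    have Tn: "norm (T u) \<le> 1 / 2 * norm u" if u: "u \<in> V" for u
    proof -
      have "norm (T u) \<le> K * norm (proj V' (h u))" unfolding T_def by (rule K(2))
      also have "\<dots> \<le> K * (d * norm u)"
        using hn[OF u] norm_proj_le[OF V', of "h u"] K(1) by (intro mult_left_mono) auto
      also have "\<dots> = (K * d) * norm u" by simp
      also have "\<dots> \<le> 1 / 2 * norm u" using K(1) by (intro mult_right_mono) (auto simp: d_def field_simps)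
      finally show ?thesis .
    qed
    have TV: "T u \<in> V" for u by (simp add: T_def G_def proj_in[OF V])
    have Tdiff: "T u - T v = T (u - v)" if "u \<in> V" "v \<in> V" for u v
      using op_diff[OF subspace_normed[OF V] hL, of u v] that
      by (simp add: T_def bclin_diff[OF bG] bclin_diff[OF bclin_proj[OF V']])
    have Bu: "proj V' (u + B u) = proj V' (u + A u) + proj V' (h u)" for u
      unfolding bclin_add[OF bclin_proj[OF V'], symmetric] by (simp add: h_def)
    obtain KB where KB: "KB \<ge> 0" "\<And>x. norm (B (proj V x)) \<le> KB * norm x"
      using bclin_bound[OF bounded_ops_bclin[OF V orth_Gr B]] by blast
    have bound: "norm y \<le> ((1 + KB) * (2 * K)) * norm (proj V' y)" if y: "y \<in> ?R" for y
    proof -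
      obtain u where u: "u \<in> V" "y = u + B u" using y by (auto simp: graph_def)
      have "G (proj V' y) = u + T u" by (simp add: u(2) Bu bclin_add[OF bG] G1[OF u(1)] T_def)
      then have "norm u \<le> norm (G (proj V' y)) + norm (T u)"
        using norm_triangle_ineq4[of "G (proj V' y)" "T u"] by simp
      then have a: "norm u \<le> 2 * K * norm (proj V' y)" using Tn[OF u(1)] K(2)[of "proj V' y"] by simp
      have b: "norm y \<le> (1 + KB) * norm u"
        using norm_triangle_ineq[of u "B u"] KB(2)[of u] by (simp add: u proj_id[OF V u(1)] distrib_right)
      show ?thesis using order_trans[OF b mult_left_mono[OF a]] KB(1) by (simp add: mult.assoc)
    qed
    have RD: "?R \<in> Gr" using graph_domain(1)[OF V B] Gr_domain_Gr by blast
    have inj: "inj_on (proj V') ?R"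
    proof (rule inj_onI)
      fix y z assume y: "y \<in> ?R" and z: "z \<in> ?R" and eq: "proj V' y = proj V' z"
      have "norm (y - z) \<le> ((1 + KB) * (2 * K)) * norm (proj V' (y - z))" by (rule bound[OF GrD(6)[OF RD y z]])
      then show "y = z" by (simp add: bclin_diff[OF bclin_proj[OF V']] eq)
    qed
    have "x \<in> proj V' ` ?R" if x: "x \<in> V'" for x
    proof -
      \<comment> \<open>The fixed point solves \<open>u + T u = G x\<close>. Then
        \<open>u + B u\<close> and \<open>x\<close> have the same image under \<open>G\<close> after
        projection to \<open>V'\<close>, and \<open>G\<close> is injective there.\<close>
      have "\<exists>!u. u \<in> V \<and> G x - T u = u"
      proof (rule Banach_fix[of V "1/2"])
        show "complete V" using Gr_closed[OF V] by (simp add: complete_eq_closed)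
        show "V \<noteq> {}" using GrD(1)[OF V] by blast
        show "(\<lambda>u. G x - T u) ` V \<subseteq> V" using TV GrD(6)[OF V] by (auto simp: G_def proj_in[OF V])
        show "\<And>u v. u \<in> V \<Longrightarrow> v \<in> V \<Longrightarrow> dist (G x - T u) (G x - T v) \<le> 1/2 * dist u v"
        proof -
          fix u v assume uv: "u \<in> V" "v \<in> V"
          have "norm (T v - T u) \<le> 1/2 * norm (v - u)"
            unfolding Tdiff[OF uv(2,1)] using uv by (intro Tn GrD(6)[OF V]) auto
          then show "dist (G x - T u) (G x - T v) \<le> 1/2 * dist u v"
            by (simp add: dist_norm norm_minus_commute)
        qed
      qed auto
      then obtain u where u: "u \<in> V" "G x - T u = u" by blast
      have "G (proj V' (u + B u)) = u + T u" by (simp add: Bu bclin_add[OF bG] G1[OF u(1)] T_def)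
      also have "\<dots> = G x" using u(2) by (simp add: diff_eq_eq)
      finally have "proj V' (u + B u) = x" by (rule G2[OF _ proj_in[OF V'] x])
      then show ?thesis using u(1) by (force simp: graph_def)
    qed
    then have "bij_betw (proj V') ?R V'" using inj proj_in[OF V'] by (auto simp: bij_betw_def)
    then have "proj_iso V' ?R"
      unfolding proj_iso_def using V' RD bound KB(1) K(1) by (auto intro!: exI[of _ "(1 + KB) * (2 * K)"])
    then show ?thesis using B Gr_domain_iff[OF V'] by (simp add: overlap_def)
  qed
  then show "\<exists>e>0. \<forall>B\<in>vecs (Hom V). nrm (Hom V) (B - A) < e \<longrightarrow> B \<in> overlap V (Gr_domain V')" using d by blast
qed

section \<open>Smooth dependence of lifts and derivatives on the point\<close>

definition lift_op :: "'h::complex_hilbert set \<Rightarrow> 'h set \<Rightarrow> 'h \<Rightarrow> 'h"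
  where "lift_op V W = zero_outside V (lift V W)"

definition along_op :: "'h::complex_hilbert set \<Rightarrow> 'h set \<Rightarrow> 'h set \<Rightarrow> 'h \<Rightarrow> 'h"
  where "along_op V V' W = zero_outside (orth V) (along V' W)"

lemma proj_operator: "V \<in> Gr \<Longrightarrow> proj V \<in> vecs (bounded_ops UNIV V)"
  using bounded_opsI[OF UNIV_Gr bclin_proj, of V V] by (simp add: zero_outside_def proj_in)

lemma lift_operator: "proj_iso V W \<Longrightarrow> lift_op V W \<in> vecs (bounded_ops V UNIV)"
  unfolding lift_op_def by (rule bounded_opsI) (auto simp: bclin_lift proj_iso_def)

lemma along_operator: "proj_iso V' W \<Longrightarrow> along_op V V' W \<in> vecs (bounded_ops (orth V) (orth V'))"
  unfolding along_op_def by (rule bounded_opsI[OF orth_Gr]) (auto simp: bclin_along along_in)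

lemma proj_lift_operator:
  assumes "V1 \<in> Gr" "proj_iso V2 W"
  shows "proj V1 \<circ> lift_op V2 W \<in> vecs (bounded_ops V2 V1)"
proof -
  have "V2 \<in> Gr" using assms by (simp add: proj_iso_def)
  then show ?thesis
    by (intro operators_compose(1)[where Y = "subspace_nspace UNIV"] subspace_normed UNIV_Gr assms
        proj_operator lift_operator)
qed

lemma bclin_neg: "bclin T \<Longrightarrow> bclin (\<lambda>x. - T x)"
  using bclin_minus_op[of "\<lambda>_. 0" T] by (simp add: bclin_def)

text \<open>The induction on the order is run for the \<open>V\<close>-component \<open>G\<close> of
  the lift, whose derivative is bilinear in \<open>G A\<close> and \<open>G A\<close>: an
  \<open>n\<close>-jet of \<open>G\<close> therefore gives a jet of its derivative. The whole lift
  is recovered as \<open>(I + L A) \<circ> G A\<close>, because a point of the graph is determined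
  by its \<open>V\<close>-component.\<close>

lemma Cn_lift:
  assumes V: "V \<in> Gr" and V': "V' \<in> Gr"
  shows "Cn n (Hom V) (overlap V (Gr_domain V')) (bounded_ops V' UNIV) (\<lambda>A. lift_op V' (graph V A))"
proof -
  let ?O = "overlap V (Gr_domain V')"
  note X = Hom_normed[OF V] and nV = subspace_normed[OF V] and nV' = subspace_normed[OF V']
    and nQ = subspace_normed[OF orth_Gr[of V]] and nH = subspace_normed[OF UNIV_Gr]
  have sub: "?O \<subseteq> vecs (Hom V)" by (auto simp: overlap_def)
  define G where "G A = proj V \<circ> lift_op V' (graph V A)" for A
  \<comment> \<open>On \<open>orth V\<close> the \<open>V\<close>-component of
    \<open>along V' (graph V A)\<close> is that of minus the lift, since \<open>proj V\<close> kills
    the identity part. Composition with \<open>N\<close> thus expresses the left factor of the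
    derivative by \<open>G A\<close> itself.\<close>
  define N where "N = zero_outside (orth V) (\<lambda>z. - proj V' z)"
  have N: "N \<in> vecs (bounded_ops (orth V) V')"
    unfolding N_def by (rule bounded_opsI[OF orth_Gr bclin_neg[OF bclin_proj[OF V']]]) (simp add: GrD(5)[OF V' proj_in[OF V']])
  have Gin: "G A \<in> vecs (bounded_ops V' V)" if "A \<in> ?O" for A
    unfolding G_def by (rule proj_lift_operator[OF V overlap_iso[OF V' that]])
  have G0: "G A x = 0" if "x \<notin> V'" for A x
    using that bclin_zero[OF bclin_proj[OF V]] by (simp add: G_def lift_op_def zero_outside_def)
  have GN: "(G A \<circ> N) z = proj V (along V' (graph V A) z)" if A: "A \<in> ?O" and z: "z \<in> orth V" for A z
  proof -
    note S = overlap_iso[OF V' A]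
    have "G A (- proj V' z) = proj V (lift V' (graph V A) (- proj V' z))"
      using GrD(5)[OF V' proj_in[OF V']] by (simp add: G_def lift_op_def zero_outside_def)
    also have "\<dots> = - proj V (lift V' (graph V A) z)"
      by (simp add: bclin_minus[OF bclin_lift[OF S]] bclin_minus[OF bclin_proj[OF V]] lift_proj[OF S])
    finally show ?thesis using z by (simp add: N_def zero_outside_def along_def bclin_diff[OF bclin_proj[OF V]] proj_zero[OF V z])
  qed
  have inc: "G B - G A = G A \<circ> N \<circ> (B - A) \<circ> G B" if A: "A \<in> ?O" and B: "B \<in> ?O" for A B
  proof
    fix x
    note S = overlap_iso[OF V' A] and R = overlap_iso[OF V' B]
    have AB: "A \<in> vecs (Hom V)" "B \<in> vecs (Hom V)" using A B sub by auto
    have h: "B - A \<in> vecs (Hom V)" by (rule nsD_diff[OF X AB(2,1)])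
    show "(G B - G A) x = (G A \<circ> N \<circ> (B - A) \<circ> G B) x"
    proof (cases "x \<in> V'")
      case True
      have Gx: "G B x = proj V (lift V' (graph V B) x)" "G A x = proj V (lift V' (graph V A) x)"
        using True by (auto simp: G_def lift_op_def zero_outside_def)
      have "(B - A) (G B x) \<in> orth V" using op_in[OF h, of "G B x"] by (simp add: Gx proj_in[OF V])
      from GN[OF A this] show ?thesis
        using lift_increment[OF S R V AB, of x]
        by (simp add: Gx bclin_diff[OF bclin_proj[OF V], symmetric])
    next
      case False
      then show ?thesis using op_zero[OF nV h] op_zero[OF nQ N] op_zero[OF nV' Gin[OF A]] by (simp add: G0)
    qed
  qed
  have dG: "has_fderiv (Hom V) ?O (bounded_ops V' V) G (sandwich (vecs (Hom V)) (G A \<circ> N) (G A)) A" if A: "A \<in> ?O" for A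
    by (rule increment_has_fderiv[OF nV nQ nV nV' sub A _ _ Gin inc[OF A] inc[OF A]])
      (rule operators_compose(1)[OF nQ nV' nV Gin[OF A] N])+
  have CG: "Cn n (Hom V) ?O (bounded_ops V' V) G"
  proof (induction n)
    case 0
    show ?case by (rule Cn_0[OF normed_operators[OF nV' nV] Gin])
  next
    case (Suc n)
    have "Cn n (Hom V) ?O (bounded_ops (orth V) V) (\<lambda>A. G A \<circ> N)"
      by (rule Cn_compose[OF X sub nQ nV' nV Suc Cn_const[OF X normed_operators[OF nQ nV'] sub N]])
    then have c: "Cn n (Hom V) ?O (operators (Hom V) (bounded_ops V' V)) (\<lambda>A. sandwich (vecs (Hom V)) (G A \<circ> N) (G A))"
      by (rule Cn_bilin[OF X normed_operators[OF nQ nV] normed_operators[OF nV' nV]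
            normed_operators[OF X normed_operators[OF nV' nV]] sub bilin_sandwich[OF nV nQ nV nV'] _ Suc])
    show ?case
    proof (rule Cn_Suc[where f = G and g = "\<lambda>A. sandwich (vecs (Hom V)) (G A \<circ> N) (G A)",
          OF X normed_operators[OF nV' nV] sub])
      fix A assume A: "A \<in> ?O"
      show "G A \<in> vecs (bounded_ops V' V)" by (rule Gin[OF A])
      show "has_fderiv (Hom V) ?O (bounded_ops V' V) G (sandwich (vecs (Hom V)) (G A \<circ> N) (G A)) A" by (rule dG[OF A])
    qed (rule c)
  qed
  define I where "I = zero_outside V (\<lambda>x. x)"
  define L where "L = zero_outside (vecs (Hom V)) (\<lambda>A. A)"
  have I: "I \<in> vecs (bounded_ops V UNIV)" unfolding I_def by (rule bounded_opsI[OF V bclin_id]) simp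
  have incl: "A \<in> vecs (bounded_ops V UNIV)" if A: "A \<in> vecs (Hom V)" for A
    by (rule operatorsI[where K = "nrm (Hom V) A"])
      (use op_add[OF A] op_scale[OF A] op_outside[OF A] op_bound[OF nV nQ A] in auto)
  have L: "L \<in> vecs (operators (Hom V) (bounded_ops V UNIV))"
    by (rule operatorsI[where K = 1])
      (use incl nsD_add[OF X] nsD_scale[OF X] in \<open>auto simp: L_def zero_outside_def operators_nrm\<close>)
  have "Cn n (Hom V) ?O (bounded_ops V' UNIV) (\<lambda>A. (I + L A) \<circ> G A)"
    by (rule Cn_compose[OF X sub nV' nV nH Cn_affine[OF X normed_operators[OF nV nH] sub I L] CG])
  then show ?thesis
  proof (rule Cn_cong)
    fix A assume A: "A \<in> ?O"
    then have AX: "A \<in> vecs (Hom V)" using sub by auto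
    show "(I + L A) \<circ> G A = lift_op V' (graph V A)"
    proof
      fix x show "((I + L A) \<circ> G A) x = lift_op V' (graph V A) x"
        using graph_mem[OF lift_in[OF overlap_iso[OF V' A], of x] V AX] proj_in[OF V] AX
          op_zero[OF nV AX] G0[of x A] GrD(1)[OF V]
        by (cases "x \<in> V'") (auto simp: I_def L_def G_def lift_op_def zero_outside_def)
    qed
  qed
qed

text \<open>The derivative at \<open>W\<close> of the transition map from \<open>V1\<close> to \<open>V2\<close>.\<close>

definition der :: "'h::complex_hilbert set \<Rightarrow> 'h set \<Rightarrow> 'h set \<Rightarrow> ('h \<Rightarrow> 'h) \<Rightarrow> 'h \<Rightarrow> 'h"
  where "der V1 V2 W = sandwich (vecs (Hom V1)) (along_op V1 V2 W) (proj V1 \<circ> lift_op V2 W)"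

lemma der_operator:
  assumes "V1 \<in> Gr" "proj_iso V2 W"
  shows "der V1 V2 W \<in> vecs (operators (Hom V1) (Hom V2))"
proof -
  have "V2 \<in> Gr" using assms by (simp add: proj_iso_def)
  then show ?thesis unfolding der_def
    by (intro sandwich_operator(1) subspace_normed orth_Gr assms along_operator proj_lift_operator)
qed

lemma der_apply:
  assumes "h \<in> vecs (Hom V1)" "V1 \<in> Gr" "x \<in> V2"
  shows "der V1 V2 W h x = along V2 W (h (proj V1 (lift V2 W x)))"
proof -
  have "h (proj V1 (lift V2 W x)) \<in> orth V1" using op_in[OF assms(1)] by (simp add: proj_in[OF assms(2)])
  then show ?thesis using assms by (simp add: der_def sandwich_def zero_outside_def along_op_def lift_op_def)
qed

lemma Cn_der:
  assumes V: "V \<in> Gr" and V1: "V1 \<in> Gr" and V2: "V2 \<in> Gr"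
  shows "Cn n (Hom V) (overlap V (Gr_domain V2)) (operators (Hom V1) (Hom V2)) (\<lambda>A. der V1 V2 (graph V A))"
proof -
  let ?O = "overlap V (Gr_domain V2)"
  note X = Hom_normed[OF V] and nV1 = subspace_normed[OF V1] and nV2 = subspace_normed[OF V2]
    and nQ1 = subspace_normed[OF orth_Gr[of V1]] and nQ2 = subspace_normed[OF orth_Gr[of V2]]
    and nH = subspace_normed[OF UNIV_Gr]
  have sub: "?O \<subseteq> vecs (Hom V)" by (auto simp: overlap_def)
  note lift = Cn_lift[OF V V2, of n]
  \<comment> \<open>\<open>lift_op V2\<close> is defined on \<open>V2\<close> only, so the oblique
    projection \<open>along\<close> is written as the identity plus the lift of
    \<open>- proj V2 z\<close>.\<close>
  define N where "N = zero_outside (orth V1) (\<lambda>z. - proj V2 z)"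
  have N: "N \<in> vecs (bounded_ops (orth V1) V2)"
    unfolding N_def by (rule bounded_opsI[OF orth_Gr bclin_neg[OF bclin_proj[OF V2]]]) (simp add: GrD(5)[OF V2 proj_in[OF V2]])
  define I where "I = zero_outside (orth V1) (\<lambda>x. x)"
  have I: "I \<in> vecs (bounded_ops (orth V1) UNIV)" unfolding I_def by (rule bounded_opsI[OF orth_Gr bclin_id]) simp
  have "Cn n (Hom V) ?O (bounded_ops (orth V1) UNIV) (\<lambda>A. lift_op V2 (graph V A) \<circ> N)"
    by (rule Cn_compose[OF X sub nQ1 nV2 nH lift Cn_const[OF X normed_operators[OF nQ1 nV2] sub N]])
  then have "Cn n (Hom V) ?O (bounded_ops (orth V1) UNIV) (\<lambda>A. I + (lift_op V2 (graph V A) \<circ> N))"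
    by (rule Cn_add[OF X normed_operators[OF nQ1 nH] sub Cn_const[OF X normed_operators[OF nQ1 nH] sub I]])
  \<comment> \<open>The values already lie in \<open>orth V2\<close>; composing with the projection
    records this in the codomain.\<close>
  then have "Cn n (Hom V) ?O (bounded_ops (orth V1) (orth V2)) (\<lambda>A. proj (orth V2) \<circ> (I + (lift_op V2 (graph V A) \<circ> N)))"
    by (rule Cn_compose[OF X sub nQ1 nH nQ2 Cn_const[OF X normed_operators[OF nH nQ2] sub proj_operator[OF orth_Gr]]])
  then have al: "Cn n (Hom V) ?O (bounded_ops (orth V1) (orth V2)) (\<lambda>A. along_op V1 V2 (graph V A))"
  proof (rule Cn_cong)
    fix A assume A: "A \<in> ?O"
    note S = overlap_iso[OF V2 A]
    show "proj (orth V2) \<circ> (I + (lift_op V2 (graph V A) \<circ> N)) = along_op V1 V2 (graph V A)"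
    proof
      fix z
      have "along V2 (graph V A) z = z + lift V2 (graph V A) (- proj V2 z)"
        by (simp add: along_def bclin_minus[OF bclin_lift[OF S]] lift_proj[OF S])
      moreover have "- proj V2 z \<in> V2" by (rule GrD(5)[OF V2 proj_in[OF V2]])
      ultimately show "(proj (orth V2) \<circ> (I + (lift_op V2 (graph V A) \<circ> N))) z = along_op V1 V2 (graph V A) z"
        using proj_id[OF orth_Gr along_in[OF S, of z]] bclin_zero[OF bclin_lift[OF S]] bclin_zero[OF bclin_proj[OF orth_Gr]]
        by (cases "z \<in> orth V1") (auto simp: I_def N_def along_op_def lift_op_def zero_outside_def)
    qed
  qed
  have pl: "Cn n (Hom V) ?O (bounded_ops V2 V1) (\<lambda>A. proj V1 \<circ> lift_op V2 (graph V A))"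
    by (rule Cn_compose[OF X sub nV2 nH nV1 Cn_const[OF X normed_operators[OF nH nV1] sub proj_operator[OF V1]] lift])
  show ?thesis unfolding der_def
    by (rule Cn_bilin[OF X normed_operators[OF nQ1 nQ2] normed_operators[OF nV2 nV1]
          normed_operators[OF Hom_normed[OF V1] Hom_normed[OF V2]] sub bilin_sandwich[OF nV1 nQ1 nQ2 nV2] al pl])
qed

section \<open>The transition maps and the manifold structure\<close>

lemma transition_eq:
  assumes V: "V \<in> Gr" and A: "A \<in> vecs (Hom V)"
  shows "transition Gr_manifold V V' A = Gr_chart V' (graph V A)"
  by (simp add: transition_def inv_chart_graph[OF V A])

lemma Cn_chart:
  assumes V: "V \<in> Gr" and V': "V' \<in> Gr"
  shows "Cn n (Hom V) (overlap V (Gr_domain V')) (Hom V') (transition Gr_manifold V V')"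
proof -
  let ?O = "overlap V (Gr_domain V')"
  note X = Hom_normed[OF V] and nV' = subspace_normed[OF V'] and nQ = subspace_normed[OF orth_Gr[of V']]
    and nH = subspace_normed[OF UNIV_Gr]
  have sub: "?O \<subseteq> vecs (Hom V)" by (auto simp: overlap_def)
  have "Cn n (Hom V) ?O (Hom V') (\<lambda>A. proj (orth V') \<circ> lift_op V' (graph V A))"
    by (rule Cn_compose[OF X sub nV' nH nQ Cn_const[OF X normed_operators[OF nH nQ] sub proj_operator[OF orth_Gr]] Cn_lift[OF V V']])
  then show ?thesis
  proof (rule Cn_cong)
    fix A assume A: "A \<in> ?O"
    note S = overlap_iso[OF V' A]
    have D: "graph V A \<in> Gr_domain V'" using A by (simp add: overlap_def)
    have "proj (orth V') \<circ> lift_op V' (graph V A) = Gr_chart V' (graph V A)"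
      unfolding Gr_chart_eq[OF V' D]
    proof
      fix x show "(proj (orth V') \<circ> lift_op V' (graph V A)) x = zero_outside V' (\<lambda>x. lift V' (graph V A) x - x) x"
        using proj_lift[OF S, of x] bclin_zero[OF bclin_proj[OF V']]
        by (cases "x \<in> V'") (auto simp: lift_op_def zero_outside_def proj_orth[OF V'] proj_id[OF V'])
    qed
    then show "proj (orth V') \<circ> lift_op V' (graph V A) = transition Gr_manifold V V' A"
      using transition_eq[OF V] A sub by auto
  qed
qed

text \<open>A chart is the lift minus a fixed identity, so its increments are those of the lift,
  which \<open>lift_increment\<close> gives exactly; the operator \<open>R\<close> is the
  \<open>V\<close>-component of the same identity.\<close>

lemma transition_has_fderiv:
  assumes V: "V \<in> Gr" and V': "V' \<in> Gr" and A: "A \<in> overlap V (Gr_domain V')"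
  shows "has_fderiv (Hom V) (overlap V (Gr_domain V')) (Hom V') (transition Gr_manifold V V') (der V V' (graph V A)) A"
proof -
  let ?O = "overlap V (Gr_domain V')"
  note X = Hom_normed[OF V] and nV = subspace_normed[OF V] and nV' = subspace_normed[OF V']
    and nQ = subspace_normed[OF orth_Gr[of V]] and nQ' = subspace_normed[OF orth_Gr[of V']]
  have sub: "?O \<subseteq> vecs (Hom V)" by (auto simp: overlap_def)
  note S = overlap_iso[OF V' A]
  let ?a = "along_op V V' (graph V A)"
  define R where "R = zero_outside (orth V) (\<lambda>z. proj V (along V' (graph V A) z))"
  have R: "R \<in> vecs (bounded_ops (orth V) V)"
    unfolding R_def by (rule bounded_opsI[OF orth_Gr bclin_compose[OF bclin_proj[OF V] bclin_along[OF S]]]) (rule proj_in[OF V])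
  have incr: "lift V' (graph V B) x - lift V' (graph V A) x = ?a ((B - A) (proj V (lift V' (graph V B) x)))"
    "R ((B - A) (proj V (lift V' (graph V B) x))) = proj V (lift V' (graph V B) x) - proj V (lift V' (graph V A) x)"
    if B: "B \<in> ?O" for B x
  proof -
    have AB: "A \<in> vecs (Hom V)" "B \<in> vecs (Hom V)" using A B sub by auto
    have "(B - A) (proj V (lift V' (graph V B) x)) \<in> orth V"
      using op_in[OF nsD_diff[OF X AB(2,1)]] by (simp add: proj_in[OF V])
    then show "lift V' (graph V B) x - lift V' (graph V A) x = ?a ((B - A) (proj V (lift V' (graph V B) x)))"
      "R ((B - A) (proj V (lift V' (graph V B) x))) = proj V (lift V' (graph V B) x) - proj V (lift V' (graph V A) x)"
      using lift_increment[OF S overlap_iso[OF V' B] V AB, of x]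
      by (simp_all add: along_op_def R_def zero_outside_def bclin_diff[OF bclin_proj[OF V], symmetric])
  qed
  have z: "?a 0 = 0" "R 0 = 0" using op_zero[OF nQ along_operator[OF S]] op_zero[OF nQ R] by auto
  have z': "(B - A) 0 = 0" if B: "B \<in> ?O" for B
  proof -
    have "A \<in> vecs (Hom V)" "B \<in> vecs (Hom V)" using A B sub by auto
    then show ?thesis using op_zero[OF nV] by (metis diff_self minus_apply)
  qed
  have p0: "proj V 0 = 0" by (rule bclin_zero[OF bclin_proj[OF V]])
  show ?thesis unfolding der_def
  proof (rule increment_has_fderiv[where G = "\<lambda>B. proj V \<circ> lift_op V' (graph V B)" and R = R, OF nV nQ nQ' nV' sub A along_operator[OF S] R])
    fix B assume B: "B \<in> ?O"
    then have BX: "B \<in> vecs (Hom V)" and AX: "A \<in> vecs (Hom V)" using A sub by auto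
    have D: "graph V A \<in> Gr_domain V'" "graph V B \<in> Gr_domain V'" using A B by (auto simp: overlap_def)
    show "proj V \<circ> lift_op V' (graph V B) \<in> vecs (bounded_ops V' V)"
      by (rule proj_lift_operator[OF V overlap_iso[OF V' B]])
    show "transition Gr_manifold V V' B - transition Gr_manifold V V' A = ?a \<circ> (B - A) \<circ> (proj V \<circ> lift_op V' (graph V B))"
      unfolding transition_eq[OF V BX] transition_eq[OF V AX] Gr_chart_eq[OF V' D(1)] Gr_chart_eq[OF V' D(2)]
    proof
      fix x show "(zero_outside V' (\<lambda>x. lift V' (graph V B) x - x) - zero_outside V' (\<lambda>x. lift V' (graph V A) x - x)) x
          = (?a \<circ> (B - A) \<circ> (proj V \<circ> lift_op V' (graph V B))) x"
        using incr(1)[OF B, of x] z z'[OF B] p0 by (cases "x \<in> V'") (auto simp: zero_outside_def lift_op_def)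
    qed
    show "(proj V \<circ> lift_op V' (graph V B)) - (proj V \<circ> lift_op V' (graph V A)) = R \<circ> (B - A) \<circ> (proj V \<circ> lift_op V' (graph V B))"
    proof
      fix x show "((proj V \<circ> lift_op V' (graph V B)) - (proj V \<circ> lift_op V' (graph V A))) x
          = (R \<circ> (B - A) \<circ> (proj V \<circ> lift_op V' (graph V B))) x"
        using incr(2)[OF B, of x] z z'[OF B] p0 by (cases "x \<in> V'") (auto simp: zero_outside_def lift_op_def)
    qed
  qed
qed

lemma Gr_banach_manifold: "banach_manifold (Gr_manifold :: ('h::complex_hilbert set, 'h set, 'h \<Rightarrow> 'h) manifold)"
  unfolding banach_manifold_def
proof (intro conjI ballI)
  fix V :: "'h set" assume "V \<in> index Gr_manifold"
  then have V: "V \<in> Gr" by simp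
  show "banach_space (model Gr_manifold V)" using Hom_banach[OF V] by simp
  show "inj_on (chart Gr_manifold V) (domain Gr_manifold V)" using Gr_chart_inj[OF V] by simp
  fix V' :: "'h set" assume "V' \<in> index Gr_manifold"
  then have V': "V' \<in> Gr" by simp
  have eq: "chart Gr_manifold V ` (domain Gr_manifold V \<inter> domain Gr_manifold V') = overlap V (Gr_domain V')"
    using chart_image(2)[OF V] by simp
  show "open_in (model Gr_manifold V) (chart Gr_manifold V ` (domain Gr_manifold V \<inter> domain Gr_manifold V'))"
    unfolding eq using overlap_open[OF V V'] by simp
  show "smooth_on (model Gr_manifold V) (chart Gr_manifold V ` (domain Gr_manifold V \<inter> domain Gr_manifold V'))
      (model Gr_manifold V') (transition Gr_manifold V V')"
    unfolding eq using smooth_onI[OF Hom_normed[OF V] Hom_normed[OF V'] overlap_open[OF V V'] Cn_chart[OF V V']] by simp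
qed


section \<open>Trace-class operators\<close>

subsection \<open>Square roots of positive operators\<close>

text \<open>The Taylor coefficients at 0 of the function sending \<open>t\<close> to the square root
  of \<open>1 - t\<close>; the root of \<open>A\<close> arises by substituting \<open>1 - A\<close>
  for \<open>t\<close>.\<close>

definition sqrt_coeff :: "nat \<Rightarrow> real"
  where "sqrt_coeff n = (-1) ^ n * ((1/2) gchoose n)"

lemma sqrt_coeff_Suc: "real (Suc n) * sqrt_coeff (Suc n) = (real n - 1/2) * sqrt_coeff n"
proof -
  have "real (Suc n) * ((1/2) gchoose (Suc n)) = (1/2 - real n) * ((1/2::real) gchoose n)"
    using gbinomial_mult_1[of "1/2::real" n] by (simp add: algebra_simps)
  then have "(-1) ^ Suc n * (real (Suc n) * ((1/2) gchoose (Suc n))) = (-1) ^ Suc n * ((1/2 - real n) * ((1/2::real) gchoose n))"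
    by simp
  then show ?thesis by (simp add: sqrt_coeff_def algebra_simps)
qed

lemma sqrt_coeff_0: "sqrt_coeff 0 = 1"
  by (simp add: sqrt_coeff_def)

lemma sqrt_coeff_neg: "sqrt_coeff (Suc n) < 0"
proof (induction n)
  case 0
  then show ?case using sqrt_coeff_Suc[of 0] by (simp add: sqrt_coeff_0)
next
  case (Suc n)
  have "real (Suc (Suc n)) * sqrt_coeff (Suc (Suc n)) < 0"
    unfolding sqrt_coeff_Suc[of "Suc n"] using Suc by (intro mult_pos_neg) auto
  then show ?case by (simp add: mult_less_0_iff)
qed

text \<open>A telescoping form of the partial sums, which shows that they are positive. As all
  coefficients but the first are negative, the series converges absolutely even at
  \<open>t = 1\<close>, as is needed for an operator of norm one.\<close>

lemma sqrt_coeff_sum: "(\<Sum>k\<le>n. sqrt_coeff k) = - 2 * (real (Suc n) * sqrt_coeff (Suc n))"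
proof (induction n)
  case 0
  then show ?case unfolding sqrt_coeff_Suc by (simp add: sqrt_coeff_0)
next
  case (Suc n)
  then show ?case unfolding sqrt_coeff_Suc[of "Suc n"] by (simp add: algebra_simps)
qed

lemma sqrt_coeff_abs_sum: "(\<Sum>k\<in>{1..n}. \<bar>sqrt_coeff k\<bar>) \<le> 1"
proof -
  have "(\<Sum>k\<in>{1..n}. \<bar>sqrt_coeff k\<bar>) = (\<Sum>k\<in>{1..n}. - sqrt_coeff k)"
  proof (rule sum.cong)
    fix k assume "k \<in> {1..n}"
    then obtain j where "k = Suc j" by (cases k) auto
    then show "\<bar>sqrt_coeff k\<bar> = - sqrt_coeff k" using sqrt_coeff_neg[of j] by simp
  qed simp
  also have "\<dots> = 1 - (\<Sum>k\<le>n. sqrt_coeff k)"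
    by (simp add: sum_negf atMost_atLeast0 sum.atLeast_Suc_atMost sqrt_coeff_0)
  also have "\<dots> \<le> 1"
    using sqrt_coeff_neg[of n] unfolding sqrt_coeff_sum by (simp add: mult_nonneg_nonpos)
  finally show ?thesis .
qed

lemma sqrt_coeff_summable: "summable (\<lambda>n. \<bar>sqrt_coeff n\<bar>)"
  and sqrt_coeff_suminf: "(\<Sum>n. \<bar>sqrt_coeff (Suc n)\<bar>) \<le> 1"
proof -
  have b: "(\<Sum>k<n. \<bar>sqrt_coeff (Suc k)\<bar>) \<le> 1" for n
    using sqrt_coeff_abs_sum[of n] by (simp add: sum.atLeast1_atMost_eq)
  then have s: "summable (\<lambda>n. \<bar>sqrt_coeff (Suc n)\<bar>)"
    by (intro bounded_imp_summable[of _ 1]) (simp_all only: abs_ge_zero flip: lessThan_Suc_atMost)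
  then show "summable (\<lambda>n. \<bar>sqrt_coeff n\<bar>)" by (subst (asm) summable_Suc_iff)
  show "(\<Sum>n. \<bar>sqrt_coeff (Suc n)\<bar>) \<le> 1" by (rule suminf_le_const[OF s b])
qed

text \<open>The Cauchy square of the series is \<open>1 - t\<close>: Vandermonde's convolution adds
  the two exponents one half to 1.\<close>

lemma sqrt_coeff_square: "(\<Sum>i\<le>n. sqrt_coeff i * sqrt_coeff (n - i)) = (if n = 0 then 1 else if n = 1 then - 1 else 0)"
proof -
  have "(\<Sum>i\<le>n. sqrt_coeff i * sqrt_coeff (n - i)) = (\<Sum>i\<le>n. (-1) ^ n * (((1/2) gchoose i) * ((1/2) gchoose (n - i))))"
  proof (rule sum.cong)
    fix i assume "i \<in> {..n}"
    then have "(-1::real) ^ n = (-1) ^ i * (-1) ^ (n - i)" by (simp flip: power_add)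
    then show "sqrt_coeff i * sqrt_coeff (n - i) = (-1) ^ n * (((1/2) gchoose i) * ((1/2) gchoose (n - i)))"
      by (simp add: sqrt_coeff_def)
  qed simp
  also have "\<dots> = (-1) ^ n * ((1::real) gchoose n)"
    using gbinomial_Vandermonde[of "1/2::real" "1/2" n] by (simp add: sum_distrib_left[symmetric] atMost_atLeast0)
  also have "(1::real) gchoose n = real (1 choose n)" using binomial_gbinomial[of 1 n, where 'a = real] by simp
  finally show ?thesis by (cases n rule: nat.exhaust; cases "n = 1") auto
qed

lemma scaleC_scaleR_commute: "c *\<^sub>C r *\<^sub>R x = r *\<^sub>R c *\<^sub>C x"
  by (simp add: scaleR_conv_scaleC scaleC_scaleC mult.commute)

lemma bounded_linear_scaleC: "bounded_linear (\<lambda>y::'h::complex_hilbert. c *\<^sub>C y)"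
  by (rule bounded_linear_intro[where K = "cmod c"]) (auto simp: scaleC_add_right scaleC_scaleR_commute norm_scaleC mult.commute)

definition positive_op :: "('h::complex_hilbert \<Rightarrow> 'h) \<Rightarrow> bool"
  where "positive_op A \<longleftrightarrow> bclin A \<and> (\<forall>x. cinner x (A x) \<in> \<real>\<^sub>\<ge>\<^sub>0)"

text \<open>Polarization: the difference \<open>B\<close> of the two forms vanishes on the diagonal,
  and evaluating it at \<open>x + y\<close> and \<open>x + \<i> *\<^sub>C y\<close> shows that it
  vanishes everywhere.\<close>

lemma selfadjointI:
  assumes A: "bclin A" and real: "\<And>x. Im (cinner x (A x)) = 0"
  shows "cinner (A x) y = cinner x (A y)"
proof -
  define B where "B x y = cinner x (A y) - cinner (A x) y" for x y
  have B0: "B x x = 0" for x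
    using real[of x] cinner_commute[of "A x" x] by (simp add: B_def complex_eq_iff)
  have "B (x + y) (x + y) = B x x + B x y + B y x + B y y"
    by (simp add: B_def bclin_add[OF A] cinner_add_left cinner_add_right)
  then have 1: "B x y + B y x = 0" by (simp add: B0)
  have "B (x + \<i> *\<^sub>C y) (x + \<i> *\<^sub>C y) = B x x + \<i> * B x y - \<i> * B y x + B y y"
    by (simp add: B_def bclin_add[OF A] bclin_scaleC[OF A] cinner_add_left cinner_add_right
        cinner_scaleC_left cinner_scaleC_right algebra_simps)
  then have "\<i> * (B x y - B y x) = 0" by (simp add: B0 algebra_simps)
  then have "B x y = 0" using 1 by simp
  then show ?thesis by (simp add: B_def)
qed

lemma positive_selfadjoint: "positive_op A \<Longrightarrow> cinner (A x) y = cinner x (A y)"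
  by (rule selfadjointI) (auto simp: positive_op_def complex_nonneg_Reals_iff)

text \<open>The root is the binomial series in \<open>C = 1 - A\<close>. Its partial sums are
  polynomials in \<open>A\<close>, so it preserves every closed subspace that \<open>A\<close>
  preserves; this makes it possible to restrict the root to \<open>V\<close> later.\<close>

lemma sqrt_contraction_exists:
  fixes A :: "'h::complex_hilbert \<Rightarrow> 'h"
  assumes A: "positive_op A" and A1: "\<And>x. norm (A x) \<le> norm x"
  shows "\<exists>R. positive_op R \<and> (\<forall>x. R (R x) = A x) \<and> (\<forall>M\<in>Gr. A ` M \<subseteq> M \<longrightarrow> R ` M \<subseteq> M)"
proof -
  have bA: "bclin A" using A by (simp add: positive_op_def)
  have pos: "cinner x (A x) \<in> \<real>\<^sub>\<ge>\<^sub>0" for x using A by (simp add: positive_op_def)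
  then have re: "Re (cinner x (A x)) \<ge> 0" and im: "Im (cinner x (A x)) = 0" for x
    by (simp_all add: complex_nonneg_Reals_iff)
  define C where "C x = x - A x" for x
  have bC: "bclin C" unfolding C_def by (rule bclin_minus_op[OF bclin_id bA])
  \<comment> \<open>Positivity at \<open>x - A x\<close> together with
    \<open>norm (A (A x)) \<le> norm (A x)\<close> gives that the square of
    \<open>norm (A x)\<close> is at most \<open>Re (cinner x (A x))\<close>, which is what the
    expansion of the square of \<open>norm (C x)\<close> requires.\<close>
  have C1: "norm (C x) \<le> norm x" for x
  proof -
    have "Re (cinner (x - A x) (A (x - A x))) = Re (cinner x (A x)) - 2 * (norm (A x))\<^sup>2 + Re (cinner (A x) (A (A x)))"
      by (simp add: bclin_diff[OF bA] cinner.diff_left cinner.diff_right cinner_eq_norm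
          positive_selfadjoint[OF A, of x "A x", symmetric])
    moreover have "Re (cinner (A x) (A (A x))) \<le> (norm (A x))\<^sup>2"
      using Re_cinner_le[of "A x" "A (A x)"] mult_left_mono[OF A1[of "A x"] norm_ge_zero[of "A x"]]
      by (simp add: power2_eq_square)
    ultimately have "(norm (A x))\<^sup>2 \<le> Re (cinner x (A x))" using re[of "x - A x"] by linarith
    then have "(norm (C x))\<^sup>2 \<le> (norm x)\<^sup>2" using re[of x] by (simp add: C_def norm_diff_square)
    then show ?thesis by (rule power2_le_imp_le) simp
  qed
  define u where "u n x = (C ^^ n) x" for n x
  have u0: "u 0 x = x" and uS: "u (Suc n) x = C (u n x)" for n x by (simp_all add: u_def)
  have uadd: "u n (u m x) = u (n + m) x" for n m x by (simp add: u_def funpow_add)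
  have un: "norm (u n x) \<le> norm x" for n x by (induction n) (auto simp: u0 uS intro: order_trans[OF C1])
  have bu: "bclin (u n)" for n
  proof (induction n)
    case 0
    then show ?case using bclin_id by (simp add: u0)
  next
    case (Suc n)
    then show ?case using bclin_compose[OF bC Suc] by (simp add: uS)
  qed
  define a where "a = sqrt_coeff"
  have asum: "summable (\<lambda>n. \<bar>a n\<bar>)" using sqrt_coeff_summable by (simp add: a_def)
  have snorm: "summable (\<lambda>n. norm (a n *\<^sub>R u n x))" for x
    by (rule summable_comparison_test[OF _ summable_mult2[OF asum, of "norm x"]])
      (auto intro!: exI[of _ 0] mult_left_mono un)
  then have s: "summable (\<lambda>n. a n *\<^sub>R u n x)" for x by (rule summable_norm_cancel)
  define R where "R x = (\<Sum>n. a n *\<^sub>R u n x)" for x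
  have sums: "(\<lambda>n. a n *\<^sub>R u n x) sums R x" for x unfolding R_def by (rule summable_sums[OF s])
  have bR: "bclin R"
  proof (rule bclinI)
    show "R (x + y) = R x + R y" for x y
      using sums_add[OF sums[of x] sums[of y]] sums[of "x + y"]
      by (intro sums_unique2[OF sums]) (simp add: bclin_add[OF bu] scaleR_add_right)
    show "R (c *\<^sub>C x) = c *\<^sub>C R x" for c x
    proof (rule sums_unique2[OF sums])
      from bounded_linear.sums[OF bounded_linear_scaleC sums[of x], of c]
      show "(\<lambda>n. a n *\<^sub>R u n (c *\<^sub>C x)) sums (c *\<^sub>C R x)"
        by (simp add: bclin_scaleC[OF bu] scaleR_conv_scaleC scaleC_scaleC mult.commute)
    qed
    show "norm (R x) \<le> (\<Sum>n. \<bar>a n\<bar>) * norm x" for x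
    proof -
      have "norm (R x) \<le> (\<Sum>n. norm (a n *\<^sub>R u n x))" unfolding R_def by (rule summable_norm[OF snorm])
      also have "\<dots> \<le> (\<Sum>n. \<bar>a n\<bar> * norm x)"
        by (rule suminf_le[OF _ snorm summable_mult2[OF asum]]) (auto intro!: mult_left_mono un)
      also have "\<dots> = (\<Sum>n. \<bar>a n\<bar>) * norm x" by (rule suminf_mult2[OF asum, symmetric])
      finally show ?thesis .
    qed
  qed
  \<comment> \<open>A Cauchy product: absolute summability of the double series allows it to be
    summed along the diagonals \<open>n + m = k\<close>, where only the terms for 0 and 1
    survive.\<close>
  have RR: "R (R x) = A x" for x
  proof -
    define f where "f n m = (a n * a m) *\<^sub>R u (n + m) x" for n m
    have aon: "(\<lambda>n. \<bar>a n\<bar>) summable_on UNIV" using asum by (simp add: summable_on_UNIV_nonneg_real_iff)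
    have "(\<lambda>p. norm (case p of (n, m) \<Rightarrow> (\<bar>a n\<bar> * \<bar>a m\<bar>) * norm x)) summable_on UNIV \<times> UNIV"
      unfolding Infinite_Sum.abs_summable_on_Sigma_iff
      using aon by (auto simp: abs_mult infsum_cmult_right' infsum_cmult_left' mult.assoc
          intro!: summable_on_cmult_right summable_on_cmult_left)
    then have "(\<lambda>(n, m). (\<bar>a n\<bar> * \<bar>a m\<bar>) * norm x) summable_on UNIV \<times> UNIV" by (rule abs_summable_summable)
    then have "(\<lambda>p. norm (case p of (n, m) \<Rightarrow> f n m)) summable_on UNIV \<times> UNIV"
      by (rule Infinite_Sum.abs_summable_on_comparison_test')
        (auto simp: f_def abs_mult intro!: mult_left_mono un)
    then have fs: "(\<lambda>(n, m). f n m) summable_on UNIV \<times> UNIV" by (rule abs_summable_summable)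
    have hsum: "((\<lambda>n. a n *\<^sub>R u n y) has_sum R y) UNIV" for y by (rule norm_summable_imp_has_sum[OF snorm sums])
    have inner: "(\<Sum>\<^sub>\<infinity>m. f n m) = a n *\<^sub>R u n (R x)" for n
    proof -
      have "((\<lambda>m. u n (a m *\<^sub>R u m x)) has_sum u n (R x)) UNIV"
        by (rule has_sum_bounded_linear[OF bclin_bounded_linear[OF bu] hsum])
      then have "((\<lambda>m. a n *\<^sub>R u n (a m *\<^sub>R u m x)) has_sum a n *\<^sub>R u n (R x)) UNIV"
        by (rule has_sum_bounded_linear[OF bounded_linear_scaleR_right])
      then show ?thesis
        by (intro infsumI) (simp add: f_def uadd scaleR_conv_scaleC bclin_scaleC[OF bu] scaleC_scaleC)
    qed
    have "R (R x) = (\<Sum>\<^sub>\<infinity>n. \<Sum>\<^sub>\<infinity>m. f n m)" using infsumI[OF hsum[of "R x"]] by (simp add: inner)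
    also have "\<dots> = (\<Sum>\<^sub>\<infinity>(n, m)\<in>UNIV \<times> UNIV. f n m)" by (rule infsum_Sigma'_banach[OF fs])
    also have "\<dots> = (\<Sum>\<^sub>\<infinity>(k, i)\<in>Sigma UNIV (\<lambda>k. {..k}). f i (k - i))"
      by (rule infsum_reindex_bij_witness[of _ "\<lambda>(k, i). (i, k - i)" "\<lambda>(n, m). (n + m, n)"]) auto
    also have "\<dots> = (\<Sum>\<^sub>\<infinity>k. \<Sum>\<^sub>\<infinity>i\<in>{..k}. f i (k - i))"
    proof (rule infsum_Sigma'_banach[symmetric])
      have "(\<lambda>(k, i). f i (k - i)) summable_on Sigma UNIV (\<lambda>k. {..k})
          \<longleftrightarrow> (\<lambda>(n, m). f n m) summable_on UNIV \<times> UNIV"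
        by (rule summable_on_reindex_bij_witness[of _ "\<lambda>(n, m). (n + m, n)" "\<lambda>(k, i). (i, k - i)"]) auto
      then show "(\<lambda>(k, i). f i (k - i)) summable_on Sigma UNIV (\<lambda>k. {..k})" using fs by blast
    qed
    also have "\<dots> = (\<Sum>\<^sub>\<infinity>k. (if k = 0 then 1 else if k = 1 then - 1 else 0) *\<^sub>R u k x)"
    proof (rule infsum_cong)
      fix k
      have "(\<Sum>\<^sub>\<infinity>i\<in>{..k}. f i (k - i)) = (\<Sum>i\<le>k. a i * a (k - i)) *\<^sub>R u k x"
        by (simp add: f_def scaleR_sum_left)
      then show "(\<Sum>\<^sub>\<infinity>i\<in>{..k}. f i (k - i)) = (if k = 0 then 1 else if k = 1 then - 1 else 0) *\<^sub>R u k x"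
        by (simp add: a_def sqrt_coeff_square)
    qed
    also have "\<dots> = u 0 x - u 1 x"
      by (rule infsumI, rule has_sum_finite_neutralI[of "{0, 1}"]) auto
    also have "\<dots> = A x" by (simp add: u0 uS C_def)
    finally show ?thesis .
  qed
  have cu: "Im (cinner x (u n x)) = 0" for n x
  proof -
    have Csa: "cinner (C x) y = cinner x (C y)" for x y
      by (simp add: C_def cinner.diff_left cinner.diff_right positive_selfadjoint[OF A])
    have usa: "cinner (u n x) y = cinner x (u n y)" for x y
    proof (induction n arbitrary: x y)
      case (Suc n)
      then show ?case using uadd[of n 1 y] uadd[of 1 n y] by (simp add: uS u0 Csa)
    qed (simp add: u0)
    show ?thesis using usa[of x x] cinner_commute[of "u n x" x] by (simp add: complex_eq_iff)
  qed
  have csums: "(\<lambda>n. a n *\<^sub>R cinner x (u n x)) sums cinner x (R x)" for x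
    using bounded_linear.sums[OF cinner.bounded_linear_right sums[of x], of x] by (simp add: cinner_scaleR_right)
  have "cinner x (R x) \<in> \<real>\<^sub>\<ge>\<^sub>0" for x
  proof -
    have "(\<lambda>n. a n * Im (cinner x (u n x))) sums Im (cinner x (R x))"
      using bounded_linear.sums[OF bounded_linear_Im csums[of x]] by simp
    then have i: "Im (cinner x (R x)) = 0" using sums_unique2[OF _ sums_zero] by (simp add: cu)
    have r: "(\<lambda>n. a n * Re (cinner x (u n x))) sums Re (cinner x (R x))"
      using bounded_linear.sums[OF bounded_linear_Re csums[of x]] by simp
    then have t: "(\<lambda>n. a (Suc n) * Re (cinner x (u (Suc n) x))) sums (Re (cinner x (R x)) - a 0 * Re (cinner x (u 0 x)))"
      using sums_Suc_iff[of "\<lambda>n. a n * Re (cinner x (u n x))" "Re (cinner x (R x)) - a 0 * Re (cinner x (u 0 x))"]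
      by simp
    \<comment> \<open>The leading term contributes the square of \<open>norm x\<close>. The others
      are bounded below using that the absolute values of their coefficients sum to at most 1, so
      the total is nonnegative.\<close>
    have low: "- (\<bar>a (Suc n)\<bar> * (norm x)\<^sup>2) \<le> a (Suc n) * Re (cinner x (u (Suc n) x))" for n
    proof -
      have "\<bar>Re (cinner x (u (Suc n) x))\<bar> \<le> (norm x)\<^sup>2"
        using abs_Re_le_cmod[of "cinner x (u (Suc n) x)"] cauchy_schwarz[of x "u (Suc n) x"]
          mult_left_mono[OF un[of "Suc n" x] norm_ge_zero[of x]] by (simp add: power2_eq_square)
      then have "\<bar>a (Suc n) * Re (cinner x (u (Suc n) x))\<bar> \<le> \<bar>a (Suc n)\<bar> * (norm x)\<^sup>2"
        by (simp add: abs_mult mult_left_mono)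
      then show ?thesis by linarith
    qed
    have asS: "summable (\<lambda>n. \<bar>a (Suc n)\<bar>)" using asum by (subst summable_Suc_iff)
    have "(\<lambda>n. - (\<bar>a (Suc n)\<bar> * (norm x)\<^sup>2)) sums - ((\<Sum>n. \<bar>a (Suc n)\<bar>) * (norm x)\<^sup>2)"
      by (intro sums_minus sums_mult2 summable_sums asS)
    from sums_le[OF low this t] have "- ((\<Sum>n. \<bar>a (Suc n)\<bar>) * (norm x)\<^sup>2) \<le> Re (cinner x (R x)) - (norm x)\<^sup>2"
      by (simp add: a_def sqrt_coeff_0 u0 cinner_eq_norm)
    moreover have "(\<Sum>n. \<bar>a (Suc n)\<bar>) * (norm x)\<^sup>2 \<le> 1 * (norm x)\<^sup>2"
      using sqrt_coeff_suminf by (intro mult_right_mono) (auto simp: a_def)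
    ultimately show ?thesis using i by (simp add: complex_nonneg_Reals_iff)
  qed
  moreover have "R ` M \<subseteq> M" if M: "M \<in> Gr" "A ` M \<subseteq> M" for M
  proof (rule image_subsetI)
    fix x assume x: "x \<in> M"
    have "u n x \<in> M" for n
    proof (induction n)
      case (Suc n)
      then show ?case using M(2) GrD(6)[OF M(1)] by (auto simp: uS C_def)
    qed (simp add: u0 x)
    then have p: "(\<Sum>n<k. a n *\<^sub>R u n x) \<in> M" for k
      by (intro csubspace_sum[OF Gr_csubspace[OF M(1)]] GrD(4)[OF M(1)])
    show "R x \<in> M" by (rule closed_sequentially[OF Gr_closed[OF M(1)] p sums[of x, unfolded sums_def]])
  qed
  ultimately show ?thesis using RR bR unfolding positive_op_def by blast
qed

lemma sqrt_exists:
  fixes A :: "'h::complex_hilbert \<Rightarrow> 'h"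
  assumes A: "positive_op A"
  obtains R where "positive_op R" "\<And>x. R (R x) = A x" "\<And>M. M \<in> Gr \<Longrightarrow> A ` M \<subseteq> M \<Longrightarrow> R ` M \<subseteq> M"
proof -
  have bA: "bclin A" using A by (simp add: positive_op_def)
  obtain K where K: "K \<ge> 0" "\<And>x. norm (A x) \<le> K * norm x" using bclin_bound[OF bA] by blast
  \<comment> \<open>Dividing by \<open>K + 1\<close> makes \<open>A\<close> a contraction, and the
    summand 1 keeps the divisor positive when \<open>K = 0\<close>; the root is scaled back by
    \<open>c\<close>.\<close>
  define c where "c = sqrt (K + 1)"
  have c: "c > 0" "c * c = K + 1" using K by (auto simp: c_def)
  have bsc: "bclin (\<lambda>x. r *\<^sub>R T x)" if "bclin T" for r and T :: "'h \<Rightarrow> 'h"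
    using that unfolding bclin_def
    by (auto simp: scaleC_scaleR_commute intro: bounded_linear_const_scaleR)
  have psc: "positive_op (\<lambda>x. r *\<^sub>R T x)" if T: "positive_op T" and r: "r \<ge> 0" for r and T :: "'h \<Rightarrow> 'h"
    using T r bsc[of T r] unfolding positive_op_def by (auto simp: cinner_scaleR_right complex_nonneg_Reals_iff)
  define A' where "A' x = inverse (K + 1) *\<^sub>R A x" for x
  have "norm (A' x) \<le> norm x" for x
  proof -
    have "norm (A x) \<le> (K + 1) * norm x" using K(2)[of x] by (simp add: distrib_right) (smt (verit) norm_ge_zero)
    then show ?thesis using K(1) by (simp add: A'_def field_simps)
  qed
  then obtain R where R: "positive_op R" "\<And>x. R (R x) = A' x" "\<And>M. M \<in> Gr \<Longrightarrow> A' ` M \<subseteq> M \<Longrightarrow> R ` M \<subseteq> M"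
    using sqrt_contraction_exists[of A'] psc[OF A, of "inverse (K + 1)"] K(1) unfolding A'_def by auto
  have bR: "bclin R" using R(1) by (simp add: positive_op_def)
  show ?thesis
  proof (rule that[of "\<lambda>x. c *\<^sub>R R x"])
    show "positive_op (\<lambda>x. c *\<^sub>R R x)" using psc[OF R(1)] c by simp
    show "c *\<^sub>R R (c *\<^sub>R R x) = A x" for x
    proof -
      have "c * (c * inverse (K + 1)) = 1" using c K(1) by (simp add: mult.assoc[symmetric])
      then show ?thesis
        by (simp add: linear_scale[OF bounded_linear.linear[OF bclin_bounded_linear[OF bR]]] R(2) A'_def)
    qed
    show "(\<lambda>x. c *\<^sub>R R x) ` M \<subseteq> M" if "M \<in> Gr" "A ` M \<subseteq> M" for M
      using R(3)[OF that(1)] that GrD(4)[OF that(1)] by (auto simp: A'_def)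
  qed
qed

subsection \<open>Polar decomposition\<close>

lemma closure_range_Gr: "bclin S \<Longrightarrow> closure (range S) \<in> Gr"
proof -
  assume S: "bclin S"
  have "x + y \<in> closure (range S)" if xy: "x \<in> closure (range S)" "y \<in> closure (range S)" for x y
  proof -
    obtain s t where st: "\<And>n. s n \<in> range S" "s \<longlonglongrightarrow> x" "\<And>n. t n \<in> range S" "t \<longlonglongrightarrow> y"
      using xy by (auto simp: closure_sequential)
    have "s n + t n \<in> range S" for n using st(1)[of n] st(3)[of n] by (auto simp: bclin_add[OF S, symmetric])
    then show ?thesis
      unfolding closure_sequential using tendsto_add[OF st(2,4)] by (intro exI[of _ "\<lambda>n. s n + t n"]) auto
  qed
  moreover have "c *\<^sub>C x \<in> closure (range S)" if x: "x \<in> closure (range S)" for c x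
  proof -
    obtain s where st: "\<And>n. s n \<in> range S" "s \<longlonglongrightarrow> x" using x by (auto simp: closure_sequential)
    have "c *\<^sub>C s n \<in> range S" for n using st(1)[of n] by (auto simp: bclin_scaleC[OF S, symmetric])
    moreover have "(\<lambda>n. c *\<^sub>C s n) \<longlonglongrightarrow> c *\<^sub>C x"
      by (rule bounded_linear.tendsto[OF bounded_linear_scaleC st(2)])
    ultimately show ?thesis unfolding closure_sequential by (intro exI[of _ "\<lambda>n. c *\<^sub>C s n"]) auto
  qed
  moreover have "0 \<in> closure (range S)" using bclin_zero[OF S] closure_subset by (metis rangeI subsetD)
  ultimately show ?thesis by (auto simp: Gr_def csubspace_def)
qed

text \<open>Equality of the norms makes the assignment of \<open>T x\<close> to \<open>S x\<close>
  well defined and isometric on the range of \<open>S\<close>. It extends to the closure by uniform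
  continuity and by zero to the orthogonal complement.\<close>

lemma polar:
  fixes S T :: "'h::complex_hilbert \<Rightarrow> 'h"
  assumes S: "bclin S" and T: "bclin T" and ST: "\<And>x. norm (T x) = norm (S x)"
  obtains Q where "bclin Q" "\<And>x. norm (Q x) \<le> norm x" "\<And>x. Q (S x) = T x" "\<And>x. x \<in> orth (closure (range S)) \<Longrightarrow> Q x = 0"
proof -
  let ?M = "closure (range S)"
  have M: "?M \<in> Gr" by (rule closure_range_Gr[OF S])
  define f where "f y = T (inv S y)" for y
  have fS: "f (S x) = T x" for x
  proof -
    have "S (inv S (S x)) = S x" by (simp add: f_inv_into_f)
    then have "norm (T (inv S (S x) - x)) = 0" by (simp add: ST bclin_diff[OF S])
    then show ?thesis by (simp add: f_def bclin_diff[OF T])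
  qed
  have fdist: "dist (f y) (f z) = dist y z" if "y \<in> range S" "z \<in> range S" for y z
    using that ST by (auto simp: fS dist_norm bclin_diff[OF S, symmetric] bclin_diff[OF T, symmetric])
  have "uniformly_continuous_on (range S) f"
    unfolding uniformly_continuous_on_def using fdist by auto
  then obtain g where gu: "uniformly_continuous_on ?M g" and gf: "\<And>x. x \<in> range S \<Longrightarrow> f x = g x"
    using uniformly_continuous_on_extension_on_closure by metis
  have gc: "continuous_on ?M g" by (rule uniformly_continuous_imp_continuous[OF gu])
  have gS: "g (S x) = T x" for x using gf[of "S x"] fS by simp
  have lim: "(\<lambda>n. T (r n)) \<longlonglongrightarrow> g y" if "(\<lambda>n. S (r n)) \<longlonglongrightarrow> y" "y \<in> ?M" for r y
  proof -
    have "(\<lambda>n. g (S (r n))) \<longlonglongrightarrow> g y"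
      by (rule continuous_on_tendsto_compose[OF gc that])
        (auto intro!: always_eventually subsetD[OF closure_subset])
    then show ?thesis by (simp add: gS)
  qed
  have seq: "\<exists>r. (\<lambda>n. S (r n)) \<longlonglongrightarrow> y" if y: "y \<in> ?M" for y
  proof -
    obtain s where s: "\<And>n. s n \<in> range S" "s \<longlonglongrightarrow> y" using y unfolding closure_sequential by blast
    then have "\<exists>x. s n = S x" for n by blast
    then obtain r where "\<And>n. s n = S (r n)" by metis
    then have "s = (\<lambda>n. S (r n))" by auto
    then show ?thesis using s(2) by blast
  qed
  have gadd: "g (y + z) = g y + g z" if y: "y \<in> ?M" and z: "z \<in> ?M" for y z
  proof -
    obtain r q where rq: "(\<lambda>n. S (r n)) \<longlonglongrightarrow> y" "(\<lambda>n. S (q n)) \<longlonglongrightarrow> z" using seq y z by blast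
    have "(\<lambda>n. S (r n + q n)) \<longlonglongrightarrow> y + z" using tendsto_add[OF rq] by (simp add: bclin_add[OF S])
    from lim[OF this GrD(2)[OF M y z]] have "(\<lambda>n. T (r n) + T (q n)) \<longlonglongrightarrow> g (y + z)" by (simp add: bclin_add[OF T])
    then show ?thesis using tendsto_add[OF lim[OF rq(1) y] lim[OF rq(2) z]] by (rule LIMSEQ_unique)
  qed
  have gscale: "g (c *\<^sub>C y) = c *\<^sub>C g y" if y: "y \<in> ?M" for c y
  proof -
    obtain r where r: "(\<lambda>n. S (r n)) \<longlonglongrightarrow> y" using seq y by blast
    have "(\<lambda>n. S (c *\<^sub>C r n)) \<longlonglongrightarrow> c *\<^sub>C y" using bounded_linear.tendsto[OF bounded_linear_scaleC r] by (simp add: bclin_scaleC[OF S])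
    from lim[OF this GrD(3)[OF M y]] have "(\<lambda>n. c *\<^sub>C T (r n)) \<longlonglongrightarrow> g (c *\<^sub>C y)" by (simp add: bclin_scaleC[OF T])
    then show ?thesis using bounded_linear.tendsto[OF bounded_linear_scaleC lim[OF r y]] by (rule LIMSEQ_unique)
  qed
  have gnorm: "norm (g y) = norm y" if y: "y \<in> ?M" for y
  proof -
    obtain r where r: "(\<lambda>n. S (r n)) \<longlonglongrightarrow> y" using seq y by blast
    have "(\<lambda>n. norm (S (r n))) \<longlonglongrightarrow> norm (g y)" using tendsto_norm[OF lim[OF r y]] by (simp add: ST)
    then show ?thesis using tendsto_norm[OF r] by (rule LIMSEQ_unique)
  qed
  define Q where "Q x = g (proj ?M x)" for x
  note P = proj_in[OF M] and bP = bclin_proj[OF M]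
  have Qn: "norm (Q x) \<le> norm x" for x unfolding Q_def using gnorm[OF P] norm_proj_le[OF M] by simp
  have bQ: "bclin Q"
    by (rule bclinI[where K = 1]) (simp_all add: Q_def bclin_add[OF bP] bclin_scaleC[OF bP] gadd[OF P P] gscale[OF P] Qn[unfolded Q_def])
  show ?thesis
  proof (rule that[of Q, OF bQ Qn])
    show "Q (S x) = T x" for x
    proof -
      have "S x \<in> ?M" by (rule subsetD[OF closure_subset]) simp
      then show ?thesis by (simp add: Q_def proj_id[OF M] gS)
    qed
    show "Q x = 0" if "x \<in> orth ?M" for x using gnorm[OF GrD(1)[OF M]] by (simp add: Q_def proj_zero[OF M that])
  qed
qed


subsection \<open>Nuclear representations\<close>

definition contraction :: "('h::complex_hilbert \<Rightarrow> 'h) \<Rightarrow> bool"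
  where "contraction Q \<longleftrightarrow> bclin Q \<and> (\<forall>x. norm (Q x) \<le> norm x)"

text \<open>The square root is taken of the positive operator obtained from the extension
  \<open>T'\<close> of \<open>T\<close> by zero. That operator takes its values in \<open>V\<close>,
  so its root restricts to \<open>V\<close>.\<close>

lemma absolute_value_exists:
  assumes V: "V \<in> Gr" and W: "W \<in> Gr" and T: "T \<in> vecs (bounded_ops V W)"
  shows "\<exists>S. is_absolute_value V T S"
proof -
  define T' where "T' x = T (proj V x)" for x
  have bT: "bclin T'" unfolding T'_def by (rule bounded_ops_bclin[OF V W T])
  have TT: "T' x = T x" if "x \<in> V" for x using that by (simp add: T'_def proj_id[OF V])
  define A where "A x = adj T' (T' x)" for x
  have cA: "cinner y (A x) = cinner (T' y) (T' x)" for x y by (simp add: A_def cinner_adj_right[OF bT])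
  have "positive_op A"
    unfolding positive_op_def cA using bclin_compose[OF bclin_adj[OF bT] bT]
    by (simp add: A_def[abs_def] cinner_self complex_nonneg_Reals_iff flip: of_real_power)
  then obtain R where R: "positive_op R" "\<And>x. R (R x) = A x" "\<And>M. M \<in> Gr \<Longrightarrow> A ` M \<subseteq> M \<Longrightarrow> R ` M \<subseteq> M"
    using sqrt_exists by metis
  have "A x \<in> orth (orth V)" for x
  proof (rule orthI)
    fix z assume "z \<in> orth V"
    then have "T' z = 0" using op_zero[OF subspace_normed[OF V] T] by (simp add: T'_def proj_zero[OF V])
    then show "cinner z (A x) = 0" by (simp add: cA)
  qed
  then have "A ` V \<subseteq> V" by (auto simp: orth_orth[OF V])
  then have RV: "R x \<in> V" if "x \<in> V" for x using R(3)[OF V] that by blast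
  have bR: "bclin R" using R(1) by (simp add: positive_op_def)
  have "is_absolute_value V T (zero_outside V R)"
    unfolding is_absolute_value_def
  proof (intro conjI ballI)
    show "zero_outside V R \<in> vecs (bounded_ops V V)" by (rule bounded_opsI[OF V bR RV])
    show "cinner x (zero_outside V R x) \<in> \<real>\<^sub>\<ge>\<^sub>0" if "x \<in> V" for x
      using R(1) that by (simp add: zero_outside_def positive_op_def)
    show "cinner y (zero_outside V R (zero_outside V R x)) = cinner (T y) (T x)" if "x \<in> V" "y \<in> V" for x y
      using that RV by (simp add: zero_outside_def R(2) cA TT)
  qed
  then show ?thesis by blast
qed

text \<open>The third conclusion says that the adjoint of \<open>Q\<close> carries \<open>T\<close>
  back to \<open>S\<close>. Through it, sums of \<open>cinner e (S e)\<close> become pairings of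
  \<open>T\<close> with a contraction, as \<open>trace_class_of_bound\<close> needs.\<close>

lemma absolute_value_polar:
  assumes V: "V \<in> Gr" and W: "W \<in> Gr" and T: "T \<in> vecs (bounded_ops V W)" and S: "is_absolute_value V T S"
  obtains Q where "contraction Q" "\<And>x. x \<in> V \<Longrightarrow> Q (S x) = T x"
    "\<And>x y. y \<in> V \<Longrightarrow> cinner (Q x) (T y) = cinner x (S y)" "positive_op (\<lambda>x. S (proj V x))"
proof -
  have Sop: "S \<in> vecs (bounded_ops V V)" and pos: "\<And>x. x \<in> V \<Longrightarrow> cinner x (S x) \<in> \<real>\<^sub>\<ge>\<^sub>0"
    and sq: "\<And>x y. x \<in> V \<Longrightarrow> y \<in> V \<Longrightarrow> cinner y (S (S x)) = cinner (T y) (T x)"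
    using S by (auto simp: is_absolute_value_def)
  have SV: "S x \<in> V" if "x \<in> V" for x using op_in[OF Sop] that by simp
  define S' where "S' x = S (proj V x)" for x
  define T' where "T' x = T (proj V x)" for x
  have bS: "bclin S'" unfolding S'_def by (rule bounded_ops_bclin[OF V V Sop])
  have bT: "bclin T'" unfolding T'_def by (rule bounded_ops_bclin[OF V W T])
  have SS: "S' x = S x" "T' x = T x" if "x \<in> V" for x using that by (simp_all add: S'_def T'_def proj_id[OF V])
  have S'V: "S' x \<in> V" for x by (simp add: S'_def SV proj_in[OF V])
  have "cinner x (S' x) = cinner (proj V x) (S (proj V x))" for x
    using proj_cinner_left[OF V S'V[of x]] by (simp add: S'_def)
  then have pS: "positive_op S'" unfolding positive_op_def using bS pos proj_in[OF V] by simp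
  have inner: "cinner (T' x) (T' y) = cinner (S' x) (S' y)" for x y
  proof -
    have "cinner (T' x) (T' y) = cinner (proj V x) (S (S (proj V y)))" using sq proj_in[OF V] by (simp add: T'_def)
    also have "\<dots> = cinner (proj V x) (S' (S' y))" using SS(1)[OF S'V[of y]] by (simp add: S'_def[of y])
    also have "\<dots> = cinner (S' (proj V x)) (S' y)" by (rule positive_selfadjoint[OF pS, symmetric])
    also have "S' (proj V x) = S' x" by (simp add: S'_def proj_id[OF V proj_in[OF V]])
    finally show ?thesis .
  qed
  have "norm (T' x) = norm (S' x)" for x
    using inner[of x x] by (metis cinner_eq_norm norm_ge_zero power2_eq_iff_nonneg)
  from polar[OF bS bT this] obtain Q where Q: "bclin Q" "\<And>x. norm (Q x) \<le> norm x" "\<And>x. Q (S' x) = T' x"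
    "\<And>x. x \<in> orth (closure (range S')) \<Longrightarrow> Q x = 0" by metis
  let ?M = "closure (range S')"
  have M: "?M \<in> Gr" by (rule closure_range_Gr[OF bS])
  \<comment> \<open>True on the range of \<open>S'\<close> since both factors have equal inner
    products, on its closure by continuity, and on the complement because both sides vanish.\<close>
  have key: "cinner (Q x) (T' y) = cinner x (S' y)" for x y
  proof -
    have "closed {x. cinner (Q x) (T' y) = cinner x (S' y)}"
      by (intro closed_Collect_eq linear_continuous_on cinner.bounded_linear_left
          bounded_linear_compose[OF cinner.bounded_linear_left bclin_bounded_linear[OF Q(1)]])
    moreover have "range S' \<subseteq> {x. cinner (Q x) (T' y) = cinner x (S' y)}" using Q(3) inner by auto
    ultimately have "?M \<subseteq> {x. cinner (Q x) (T' y) = cinner x (S' y)}" by (rule closure_minimal[rotated])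
    then have 1: "cinner (Q (proj ?M x)) (T' y) = cinner (proj ?M x) (S' y)" using proj_in[OF M] by blast
    have "S' y \<in> ?M" by (rule subsetD[OF closure_subset]) simp
    then have "cinner (x - proj ?M x) (S' y) = 0" by (rule orthD2[OF proj_diff_in[OF M]])
    moreover have "Q (x - proj ?M x) = 0" by (rule Q(4)[OF proj_diff_in[OF M]])
    ultimately show ?thesis using 1 by (simp add: bclin_diff[OF Q(1)] cinner.diff_left)
  qed
  show ?thesis
  proof (rule that)
    show "contraction Q" using Q by (simp add: contraction_def)
    show "Q (S x) = T x" if "x \<in> V" for x using Q(3)[of x] SS[OF that] by simp
    show "cinner (Q x) (T y) = cinner x (S y)" if "y \<in> V" for x y using key[of x y] SS[OF that] by simp
    show "positive_op (\<lambda>x. S (proj V x))" using pS by (simp add: S'_def[abs_def])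
  qed
qed

definition nuclear_rep ::
    "'h::complex_hilbert set \<Rightarrow> 'h set \<Rightarrow> ('h \<Rightarrow> 'h) \<Rightarrow> 'h set \<Rightarrow> ('h \<Rightarrow> 'h) \<Rightarrow> ('h \<Rightarrow> 'h) \<Rightarrow> bool"
  where "nuclear_rep V W T I a b \<longleftrightarrow> (\<forall>i\<in>I. a i \<in> V \<and> b i \<in> W) \<and>
    (\<lambda>i. norm (a i) * norm (b i)) summable_on I \<and>
    (\<forall>x\<in>V. ((\<lambda>i. cinner (a i) x *\<^sub>C b i) has_sum T x) I)"

text \<open>Split \<open>S\<close> as \<open>R R\<close> and expand \<open>R x\<close> in the basis:
  \<open>T x = Q (R (R x))\<close> becomes the sum of the
  \<open>cinner (R e) x *\<^sub>C Q (R e)\<close>. One root in each factor makes the product of the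
  norms at most the square of \<open>norm (R e)\<close>, which is
  \<open>cinner e (S e)\<close>.\<close>

lemma nuclear_of_absolute_value:
  assumes V: "V \<in> Gr" and W: "W \<in> Gr" and T: "T \<in> vecs (bounded_ops V W)" and S: "is_absolute_value V T S"
    and B: "orthonormal_basis V B" and sm: "(\<lambda>e. Re (cinner e (S e))) summable_on B"
  shows "\<exists>a b. nuclear_rep V W T B a b \<and>
    (\<Sum>\<^sub>\<infinity>e\<in>B. norm (a e) * norm (b e)) \<le> (\<Sum>\<^sub>\<infinity>e\<in>B. Re (cinner e (S e)))"
proof -
  obtain Q where Q: "contraction Q" "\<And>x. x \<in> V \<Longrightarrow> Q (S x) = T x" and pS: "positive_op (\<lambda>x. S (proj V x))"
    using absolute_value_polar[OF V W T S] by metis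
  obtain R where R: "positive_op R" "\<And>x. R (R x) = S (proj V x)"
    "\<And>M. M \<in> Gr \<Longrightarrow> (\<lambda>x. S (proj V x)) ` M \<subseteq> M \<Longrightarrow> R ` M \<subseteq> M"
    using sqrt_exists[OF pS] by metis
  have bR: "bclin R" and bQ: "bclin Q" using R(1) Q(1) by (auto simp: positive_op_def contraction_def)
  have "S \<in> vecs (bounded_ops V V)" using S by (simp add: is_absolute_value_def)
  then have "(\<lambda>x. S (proj V x)) ` V \<subseteq> V" using op_in proj_in[OF V] by fastforce
  then have RV: "R x \<in> V" if "x \<in> V" for x using R(3)[OF V] that by blast
  have BV: "e \<in> V" if "e \<in> B" for e using orthonormal_basisD(1)[OF B] that by blast
  \<comment> \<open>Projecting puts every term into \<open>W\<close> and does not change the sum, as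
    \<open>T x\<close> lies in \<open>W\<close>.\<close>
  define b where "b e = proj W (Q (R e))" for e
  have bn: "norm (R e) * norm (b e) \<le> Re (cinner e (S e))" if e: "e \<in> B" for e
  proof -
    have "norm (b e) \<le> norm (R e)"
      unfolding b_def using norm_proj_le[OF W] Q(1) by (metis contraction_def order_trans)
    then have "norm (R e) * norm (b e) \<le> (norm (R e))\<^sup>2" by (simp add: power2_eq_square mult_left_mono)
    also have "\<dots> = Re (cinner e (R (R e)))"
      using positive_selfadjoint[OF R(1), of e "R e"] cinner_eq_norm[of "R e"] by simp
    also have "\<dots> = Re (cinner e (S e))" by (simp add: R(2) proj_id[OF V BV[OF e]])
    finally show ?thesis .
  qed
  have sm2: "(\<lambda>e. norm (R e) * norm (b e)) summable_on B"
    by (rule summable_on_comparison_test[OF sm bn]) auto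
  show ?thesis
    unfolding nuclear_rep_def
  proof (rule exI[of _ R], rule exI[of _ b], intro conjI ballI)
    show "R e \<in> V" "b e \<in> W" if "e \<in> B" for e using RV BV that by (simp_all add: b_def proj_in[OF W])
    show "(\<lambda>e. norm (R e) * norm (b e)) summable_on B" by (rule sm2)
    show "(\<Sum>\<^sub>\<infinity>e\<in>B. norm (R e) * norm (b e)) \<le> (\<Sum>\<^sub>\<infinity>e\<in>B. Re (cinner e (S e)))" by (rule infsum_mono[OF sm2 sm bn])
    show "((\<lambda>e. cinner (R e) x *\<^sub>C b e) has_sum T x) B" if x: "x \<in> V" for x
    proof -
      have bb: "bclin (\<lambda>z. proj W (Q (R z)))" by (intro bclin_compose[OF bclin_proj[OF W]] bclin_compose[OF bQ bR])
      have "((\<lambda>e. proj W (Q (R (cinner e (R x) *\<^sub>C e)))) has_sum proj W (Q (R (R x)))) B"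
        by (rule has_sum_bounded_linear[OF bclin_bounded_linear[OF bb] basis_expansion[OF V B RV[OF x]]])
      moreover have "proj W (Q (R (R x))) = T x"
        using op_in[OF T, of x] x by (simp add: R(2) proj_id[OF V x] Q(2)[OF x] proj_id[OF W])
      ultimately show ?thesis by (simp add: bclin_scaleC[OF bb] b_def positive_selfadjoint[OF R(1)])
    qed
  qed
qed

text \<open>The trace norm by duality: when \<open>Q\<close> is the polar factor, the tested sum is
  a partial sum of the trace of the absolute value, so \<open>C\<close> bounds all partial sums over
  a basis.\<close>

lemma trace_class_of_bound:
  assumes V: "V \<in> Gr" and W: "W \<in> Gr" and T: "T \<in> vecs (bounded_ops V W)"
    and C: "\<And>F Q. finite F \<Longrightarrow> orthonormal F \<Longrightarrow> F \<subseteq> V \<Longrightarrow> contraction Q \<Longrightarrow> Re (\<Sum>e\<in>F. cinner (Q e) (T e)) \<le> C"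
  shows "T \<in> trace_class V W \<and> (\<exists>I a b. nuclear_rep V W T I a b \<and> (\<Sum>\<^sub>\<infinity>i\<in>I. norm (a i) * norm (b i)) \<le> C)"
proof -
  obtain S where S: "is_absolute_value V T S" using absolute_value_exists[OF V W T] by blast
  obtain B where B: "orthonormal_basis V B" using orthonormal_basis_exists[OF V] by blast
  obtain Q where Q: "contraction Q" "\<And>x y. y \<in> V \<Longrightarrow> cinner (Q x) (T y) = cinner x (S y)"
    using absolute_value_polar[OF V W T S] by metis
  have BV: "e \<in> V" if "e \<in> B" for e using orthonormal_basisD(1)[OF B] that by blast
  have pos: "cinner e (S e) \<in> \<real>\<^sub>\<ge>\<^sub>0" if "e \<in> B" for e using S BV[OF that] by (simp add: is_absolute_value_def)
  have fin: "(\<Sum>e\<in>F. Re (cinner e (S e))) \<le> C" if F: "finite F" "F \<subseteq> B" for F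
  proof -
    have "(\<Sum>e\<in>F. Re (cinner e (S e))) = Re (\<Sum>e\<in>F. cinner (Q e) (T e))"
      unfolding Re_sum by (rule sum.cong) (use F BV Q(2) in auto)
    also have "\<dots> \<le> C"
      using F BV by (intro C Q(1) orthonormal_subset[OF orthonormal_basisD(2)[OF B]]) auto
    finally show ?thesis .
  qed
  have sm: "(\<lambda>e. Re (cinner e (S e))) summable_on B"
  proof (rule nonneg_bdd_above_summable_on)
    show "0 \<le> Re (cinner e (S e))" if "e \<in> B" for e using pos[OF that] by (simp add: complex_nonneg_Reals_iff)
    show "bdd_above (sum (\<lambda>e. Re (cinner e (S e))) ` {F. F \<subseteq> B \<and> finite F})"
      using fin by (auto intro!: bdd_aboveI[of _ C])
  qed
  have "(\<lambda>e. complex_of_real (Re (cinner e (S e)))) summable_on B" by (rule summable_on_of_real[OF sm])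
  moreover have "complex_of_real (Re (cinner e (S e))) = cinner e (S e)" if "e \<in> B" for e
    using pos[OF that] by (simp add: complex_nonneg_Reals_iff complex_eq_iff)
  ultimately have "(\<lambda>e. cinner e (S e)) summable_on B" using summable_on_cong by (metis (no_types, lifting))
  then have tc: "T \<in> trace_class V W" unfolding trace_class_def using T S B by blast
  have "(\<Sum>\<^sub>\<infinity>e\<in>B. Re (cinner e (S e))) \<le> C" by (rule infsum_le_finite_sums[OF sm fin])
  then show ?thesis using tc nuclear_of_absolute_value[OF V W T S B sm] order_trans by blast
qed

lemma trace_class_nuclear:
  assumes V: "V \<in> Gr" and W: "W \<in> Gr" and T: "T \<in> trace_class V W"
  shows "\<exists>I a b. nuclear_rep V W T I a b"
proof -
  obtain S B where T': "T \<in> vecs (bounded_ops V W)" and S: "is_absolute_value V T S" and B: "orthonormal_basis V B"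
    and sm: "(\<lambda>e. cinner e (S e)) summable_on B"
    using T by (auto simp: trace_class_def)
  show ?thesis using nuclear_of_absolute_value[OF V W T' S B summable_on_Re[OF sm]] by blast
qed

subsection \<open>Nuclear functionals on the model spaces\<close>

text \<open>The indices are vectors because the series found by
  \<open>nuclear_of_absolute_value\<close> run over an orthonormal basis; a single term is indexed
  by \<open>{0}\<close>, as in \<open>elementary\<close>.\<close>

definition nuclear :: "'h::complex_hilbert set \<Rightarrow> 'h set \<Rightarrow> ('h \<Rightarrow> 'h) \<Rightarrow> ('h \<Rightarrow> 'h) \<Rightarrow> bool"
  where "nuclear V I a b \<longleftrightarrow> (\<forall>i\<in>I. a i \<in> orth V \<and> b i \<in> V) \<and> (\<lambda>i. norm (a i) * norm (b i)) summable_on I"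

definition nuclear_functional :: "'h::complex_hilbert set \<Rightarrow> 'h set \<Rightarrow> ('h \<Rightarrow> 'h) \<Rightarrow> ('h \<Rightarrow> 'h) \<Rightarrow> ('h \<Rightarrow> 'h) \<Rightarrow> complex"
  where "nuclear_functional V I a b = zero_outside (vecs (Hom V)) (\<lambda>A. \<Sum>\<^sub>\<infinity>i\<in>I. cinner (a i) (A (b i)))"

definition predual :: "'h::complex_hilbert set \<Rightarrow> (('h \<Rightarrow> 'h) \<Rightarrow> complex) set"
  where "predual V = {nuclear_functional V I a b | I a b. nuclear V I a b}"

text \<open>The operator written \<open>|y><x|\<close> in Dirac notation; it is linear in
  \<open>y\<close> and antilinear in \<open>x\<close>.\<close>

definition rank1 :: "'h::complex_hilbert set \<Rightarrow> 'h \<Rightarrow> 'h \<Rightarrow> 'h \<Rightarrow> 'h"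
  where "rank1 V y x = zero_outside V (\<lambda>z. cinner x z *\<^sub>C y)"

definition trace_functional :: "'h::complex_hilbert set \<Rightarrow> ('h \<Rightarrow> 'h) \<Rightarrow> ('h \<Rightarrow> 'h) \<Rightarrow> complex"
  where "trace_functional V \<mu> = zero_outside (vecs (Hom V)) (\<lambda>A. op_trace V (\<mu> \<circ> A))"

lemma Hom_bound: "V \<in> Gr \<Longrightarrow> A \<in> vecs (Hom V) \<Longrightarrow> x \<in> V \<Longrightarrow> norm (A x) \<le> nrm (Hom V) A * norm x"
  using op_bound[OF subspace_normed subspace_normed[OF orth_Gr], of V A V x] by simp

lemma Hom_in: "A \<in> vecs (Hom V) \<Longrightarrow> x \<in> V \<Longrightarrow> A x \<in> orth V"
  using op_in[of A "subspace_nspace V" "subspace_nspace (orth V)" x] by simp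

lemma bclin_rank1: "bclin (\<lambda>z. cinner x z *\<^sub>C y)"
proof (rule bclinI)
  show "norm (cinner x z *\<^sub>C y) \<le> norm x * norm y * norm z" for z
    using mult_right_mono[OF cauchy_schwarz[of x z] norm_ge_zero[of y]] by (simp add: norm_scaleC ac_simps)
qed (simp_all add: cinner_add_right cinner_scaleC_right scaleC_add_left scaleC_scaleC)

lemma rank1_in: "V \<in> Gr \<Longrightarrow> y \<in> orth V \<Longrightarrow> rank1 V y x \<in> vecs (Hom V)"
  unfolding rank1_def by (rule bounded_opsI[OF _ bclin_rank1]) (auto intro: GrD(3)[OF orth_Gr])

lemma rank1_norm:
  assumes V: "V \<in> Gr"
  shows "nrm (Hom V) (rank1 V y x) \<le> norm x * norm y"
proof (rule op_norm_le[OF subspace_normed[OF V]])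
  show "nrm (subspace_nspace (orth V)) (rank1 V y x z) \<le> norm x * norm y * nrm (subspace_nspace V) z"
    if "z \<in> vecs (subspace_nspace V)" for z
    using mult_right_mono[OF cauchy_schwarz[of x z] norm_ge_zero[of y]] that
    by (simp add: rank1_def zero_outside_def norm_scaleC ac_simps)
qed simp

lemma dual_bound: "normed_space X \<Longrightarrow> f \<in> vecs (dual X) \<Longrightarrow> x \<in> vecs X \<Longrightarrow> cmod (f x) \<le> nrm (dual X) f * nrm X x"
  using op_bound[OF _ complex_normed, of X f x] by (simp add: dual_def)

lemma dual_norm_le: "normed_space X \<Longrightarrow> K \<ge> 0 \<Longrightarrow> (\<And>x. x \<in> vecs X \<Longrightarrow> cmod (f x) \<le> K * nrm X x) \<Longrightarrow> nrm (dual X) f \<le> K"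
  unfolding dual_def by (rule op_norm_le) auto

lemma dualI:
  assumes "\<And>x y. x \<in> vecs X \<Longrightarrow> y \<in> vecs X \<Longrightarrow> f (x + y) = f x + f y"
    "\<And>c x. x \<in> vecs X \<Longrightarrow> f (c *\<^sub>C x) = c * f x"
    "\<And>x. x \<in> vecs X \<Longrightarrow> cmod (f x) \<le> K * nrm X x" "\<And>x. x \<notin> vecs X \<Longrightarrow> f x = 0"
  shows "f \<in> vecs (dual X)"
  unfolding dual_def using assms by (intro operatorsI) auto

lemma dualD:
  assumes "f \<in> vecs (dual X)"
  shows dual_add: "x \<in> vecs X \<Longrightarrow> y \<in> vecs X \<Longrightarrow> f (x + y) = f x + f y"
    and dual_scale: "x \<in> vecs X \<Longrightarrow> f (c *\<^sub>C x) = c * f x"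
    and dual_outside: "x \<notin> vecs X \<Longrightarrow> f x = 0"
  using assms op_add[of f X] op_scale[of f X] op_outside[of f X] unfolding dual_def by fastforce+

lemma nuclear_props:
  assumes V: "V \<in> Gr" and n: "nuclear V I a b" and A: "A \<in> vecs (Hom V)"
  shows "((\<lambda>i. cinner (a i) (A (b i))) has_sum nuclear_functional V I a b A) I"
    and "cmod (nuclear_functional V I a b A) \<le> (\<Sum>\<^sub>\<infinity>i\<in>I. norm (a i) * norm (b i)) * nrm (Hom V) A"
proof -
  have ab: "a i \<in> orth V" "b i \<in> V" if "i \<in> I" for i using n that by (auto simp: nuclear_def)
  have s: "(\<lambda>i. norm (a i) * norm (b i) * nrm (Hom V) A) summable_on I"
    using n by (intro summable_on_cmult_left) (simp add: nuclear_def)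
  have b: "cmod (cinner (a i) (A (b i))) \<le> norm (a i) * norm (b i) * nrm (Hom V) A" if "i \<in> I" for i
    using cauchy_schwarz[of "a i" "A (b i)"] mult_left_mono[OF Hom_bound[OF V A ab(2)[OF that]] norm_ge_zero[of "a i"]]
    by (simp add: ac_simps)
  have s1: "(\<lambda>i. cmod (cinner (a i) (A (b i)))) summable_on I"
    by (rule Infinite_Sum.abs_summable_on_comparison_test'[OF s b])
  then have s2: "(\<lambda>i. cinner (a i) (A (b i))) summable_on I" by (rule abs_summable_summable)
  then show "((\<lambda>i. cinner (a i) (A (b i))) has_sum nuclear_functional V I a b A) I"
    using A by (simp add: nuclear_functional_def zero_outside_def)
  have "cmod (\<Sum>\<^sub>\<infinity>i\<in>I. cinner (a i) (A (b i))) \<le> (\<Sum>\<^sub>\<infinity>i\<in>I. cmod (cinner (a i) (A (b i))))"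
    by (rule norm_infsum_bound[OF s1])
  also have "\<dots> \<le> (\<Sum>\<^sub>\<infinity>i\<in>I. norm (a i) * norm (b i) * nrm (Hom V) A)" by (rule infsum_mono[OF s1 s b])
  also have "\<dots> = (\<Sum>\<^sub>\<infinity>i\<in>I. norm (a i) * norm (b i)) * nrm (Hom V) A" by (rule infsum_cmult_left')
  finally show "cmod (nuclear_functional V I a b A) \<le> (\<Sum>\<^sub>\<infinity>i\<in>I. norm (a i) * norm (b i)) * nrm (Hom V) A"
    using A by (simp add: nuclear_functional_def zero_outside_def)
qed

lemma nuclear_dual:
  assumes V: "V \<in> Gr" and n: "nuclear V I a b"
  shows "nuclear_functional V I a b \<in> vecs (dual (Hom V))"
proof (rule dualI)
  note X = Hom_normed[OF V]
  fix A assume A: "A \<in> vecs (Hom V)"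
  have b: "b i \<in> V" if "i \<in> I" for i using n that by (auto simp: nuclear_def)
  show "nuclear_functional V I a b (A + A') = nuclear_functional V I a b A + nuclear_functional V I a b A'"
    if A': "A' \<in> vecs (Hom V)" for A'
    using has_sum_unique[OF nuclear_props(1)[OF V n nsD_add[OF X A A']]]
      has_sum_add[OF nuclear_props(1)[OF V n A] nuclear_props(1)[OF V n A']] by (simp add: cinner_add_right)
  show "nuclear_functional V I a b (c *\<^sub>C A) = c * nuclear_functional V I a b A" for c
    using has_sum_unique[OF nuclear_props(1)[OF V n nsD_scale[OF X A]]]
      has_sum_cmult_right[OF nuclear_props(1)[OF V n A], of c] by (simp add: scaleC_fun_def cinner_scaleC_right)
  show "cmod (nuclear_functional V I a b A) \<le> (\<Sum>\<^sub>\<infinity>i\<in>I. norm (a i) * norm (b i)) * nrm (Hom V) A"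
    by (rule nuclear_props(2)[OF V n A])
qed (simp add: nuclear_functional_def zero_outside_def)

lemma nuclear_rank1:
  assumes V: "V \<in> Gr" and n: "nuclear V I a b" and y: "y \<in> orth V"
  shows "((\<lambda>i. cinner (a i) y * cinner x (b i)) has_sum nuclear_functional V I a b (rank1 V y x)) I"
proof -
  have eq: "cinner (a i) (rank1 V y x (b i)) = cinner (a i) y * cinner x (b i)" if "i \<in> I" for i
    using n that by (simp add: nuclear_def rank1_def zero_outside_def cinner_scaleC_right mult.commute)
  have "((\<lambda>i. cinner (a i) (rank1 V y x (b i))) has_sum s) I \<longleftrightarrow> ((\<lambda>i. cinner (a i) y * cinner x (b i)) has_sum s) I" for s
    by (rule has_sum_cong) (rule eq)
  then show ?thesis using nuclear_props(1)[OF V n rank1_in[OF V y, of x]] by simp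
qed

text \<open>Fubini for the double series \<open>\<Sum>i. \<Sum>e. \<langle>a i, A e\<rangle> \<langle>e, b i\<rangle>\<close>.\<close>

lemma nuclear_trace:
  assumes V: "V \<in> Gr" and n: "nuclear V I a b" and B: "orthonormal_basis V B" and A: "A \<in> vecs (Hom V)"
  shows "((\<lambda>e. nuclear_functional V I a b (rank1 V (A e) e)) has_sum nuclear_functional V I a b A) B"
proof -
  have ab: "a i \<in> orth V" "b i \<in> V" if "i \<in> I" for i using n that by (auto simp: nuclear_def)
  have BV: "e \<in> V" if "e \<in> B" for e using orthonormal_basisD(1)[OF B] that by blast
  note on = orthonormal_basisD(2)[OF B]
  define A' where "A' x = A (proj V x)" for x
  have bA: "bclin A'" unfolding A'_def by (rule bounded_ops_bclin[OF V orth_Gr A])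
  have AA: "A' x = A x" if "x \<in> V" for x using that by (simp add: A'_def proj_id[OF V])
  have An: "nrm (Hom V) A \<ge> 0" by (rule nsD_nonneg[OF Hom_normed[OF V] A])
  \<comment> \<open>Moving \<open>A\<close> to the other side exhibits each row of the double series
    as products of Fourier coefficients of \<open>c i\<close> and \<open>b i\<close>, which Bessel's
    inequality bounds by the product of their norms.\<close>
  define c where "c i = adj A' (a i)" for i
  have c: "cinner (c i) e = cinner (a i) (A e)" if "e \<in> V" for i e using that by (simp add: c_def cinner_adj_left[OF bA] AA)
  have cn: "norm (c i) \<le> nrm (Hom V) A * norm (a i)" for i
  proof (rule norm_leI_cinner)
    fix z :: 'a assume z: "norm z \<le> 1"
    have "norm (A' z) \<le> nrm (Hom V) A * norm (proj V z)" unfolding A'_def by (rule Hom_bound[OF V A proj_in[OF V]])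
    also have "\<dots> \<le> nrm (Hom V) A * 1"
      by (intro mult_left_mono An order_trans[OF norm_proj_le[OF V] z])
    finally have "norm (A' z) * norm (a i) \<le> nrm (Hom V) A * norm (a i)" by (intro mult_right_mono) auto
    then show "cmod (cinner z (c i)) \<le> nrm (Hom V) A * norm (a i)"
      using cauchy_schwarz[of "A' z" "a i"] by (simp add: c_def cinner_adj_right[OF bA])
  qed
  define f where "f i e = cinner (c i) e * cinner e (b i)" for i e
  have inner: "(\<lambda>e. cmod (f i e)) summable_on B \<and> (\<Sum>\<^sub>\<infinity>e\<in>B. cmod (f i e)) \<le> nrm (Hom V) A * (norm (a i) * norm (b i))"
    if i: "i \<in> I" for i
  proof -
    have fin: "(\<Sum>e\<in>F. cmod (f i e)) \<le> nrm (Hom V) A * (norm (a i) * norm (b i))" if F: "finite F" "F \<subseteq> B" for F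
    proof -
      have "(\<Sum>e\<in>F. cmod (f i e)) = (\<Sum>e\<in>F. cmod (cinner e (c i)) * cmod (cinner e (b i)))"
        unfolding f_def norm_mult by (intro sum.cong refl) (metis cinner_commute complex_mod_cnj)
      also have "\<dots> \<le> norm (c i) * norm (b i)" by (rule bessel_product[OF orthonormal_subset[OF on F(2)] F(1)])
      also have "\<dots> \<le> nrm (Hom V) A * norm (a i) * norm (b i)" by (intro mult_right_mono cn) auto
      finally show ?thesis by (simp add: mult.assoc)
    qed
    have s: "(\<lambda>e. cmod (f i e)) summable_on B"
      by (rule nonneg_bdd_above_summable_on) (use fin in \<open>auto intro!: bdd_aboveI[of _ "nrm (Hom V) A * (norm (a i) * norm (b i))"]\<close>)
    then show ?thesis using infsum_le_finite_sums[OF s fin] by blast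
  qed
  have "(\<lambda>p. cmod (case p of (i, e) \<Rightarrow> f i e)) summable_on I \<times> B"
    unfolding Infinite_Sum.abs_summable_on_Sigma_iff
  proof (intro conjI ballI)
    show "(\<lambda>e. cmod (case (i, e) of (i, e) \<Rightarrow> f i e)) summable_on B" if "i \<in> I" for i using inner[OF that] by simp
    have s: "(\<lambda>i. nrm (Hom V) A * (norm (a i) * norm (b i))) summable_on I"
      using n by (intro summable_on_cmult_right) (simp add: nuclear_def)
    show "(\<lambda>i. norm (\<Sum>\<^sub>\<infinity>e\<in>B. cmod (case (i, e) of (i, e) \<Rightarrow> f i e))) summable_on I"
      by (rule Infinite_Sum.abs_summable_on_comparison_test'[OF s]) (use inner in \<open>auto simp: infsum_nonneg\<close>)
  qed
  then have fs: "(\<lambda>(i, e). f i e) summable_on I \<times> B" by (rule abs_summable_summable)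
  have row: "((\<lambda>e. f i e) has_sum cinner (a i) (A (b i))) B" if i: "i \<in> I" for i
    using parseval[OF V B ab(2)[OF i], of "c i"] by (simp add: f_def c[OF ab(2)[OF i]])
  have "((\<lambda>(i, e). f i e) has_sum nuclear_functional V I a b A) (I \<times> B)"
    by (rule has_sum_SigmaI[OF _ nuclear_props(1)[OF V n A] fs]) (use row in simp)
  then have sw: "((\<lambda>(e, i). f i e) has_sum nuclear_functional V I a b A) (B \<times> I)"
    by (subst (asm) has_sum_swap) (simp add: case_prod_unfold)
  have col: "((\<lambda>i. f i e) has_sum nuclear_functional V I a b (rank1 V (A e) e)) I" if e: "e \<in> B" for e
    using nuclear_rank1[OF V n Hom_in[OF A BV[OF e]], of e] by (simp add: f_def c[OF BV[OF e]])
  show ?thesis by (rule has_sum_SigmaD[OF sw]) (use col in simp)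
qed


subsection \<open>The predual of the model spaces\<close>

lemma predualE:
  assumes "\<phi> \<in> predual V"
  obtains I a b where "nuclear V I a b" "\<phi> = nuclear_functional V I a b"
  using assms by (auto simp: predual_def)

lemma predual_dual: "V \<in> Gr \<Longrightarrow> \<phi> \<in> predual V \<Longrightarrow> \<phi> \<in> vecs (dual (Hom V))"
  by (auto elim: predualE intro: nuclear_dual)

lemma rank1_lin:
  assumes "V \<in> Gr"
  shows "rank1 V (y + y') x = rank1 V y x + rank1 V y' x" "rank1 V y (x + x') = rank1 V y x + rank1 V y x'"
    "rank1 V (c *\<^sub>C y) x = c *\<^sub>C rank1 V y x" "rank1 V y (c *\<^sub>C x) = cnj c *\<^sub>C rank1 V y x"
  by (auto simp: rank1_def zero_outside_def fun_eq_iff scaleC_fun_def scaleC_add_right scaleC_add_left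
      scaleC_scaleC cinner_add_left cinner_scaleC_left mult.commute)

text \<open>The bound on the nuclear part comes from testing \<open>\<phi>\<close> against the finite rank contractions
  \<open>\<Sum>e\<in>F. rank1 e (Q e)\<close>.\<close>

lemma nuclear_part:
  assumes V: "V \<in> Gr" and \<phi>: "\<phi> \<in> vecs (dual (Hom V))" and K: "K \<ge> 0"
    and bound: "\<And>A. A \<in> vecs (Hom V) \<Longrightarrow> cmod (\<phi> A) \<le> K * nrm (Hom V) A"
  shows "\<exists>\<mu> I a b. \<mu> \<in> trace_class (orth V) V \<and> nuclear V I a b \<and>
    (\<Sum>\<^sub>\<infinity>i\<in>I. norm (a i) * norm (b i)) \<le> K \<and>
    (\<forall>x\<in>V. \<forall>y\<in>orth V. cinner x (\<mu> y) = \<phi> (rank1 V y x)) \<and>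
    (\<forall>x\<in>V. \<forall>y\<in>orth V. nuclear_functional V I a b (rank1 V y x) = \<phi> (rank1 V y x))"
proof -
  note X = Hom_normed[OF V] and bP = bclin_proj[OF V] and bQ = bclin_proj[OF orth_Gr[of V]]
  have r1: "rank1 V (proj (orth V) y) x \<in> vecs (Hom V)" for x y by (rule rank1_in[OF V proj_in[OF orth_Gr]])
  \<comment> \<open>The projections extend the form from \<open>V\<close> and \<open>orth V\<close>
    to the whole space, where the Riesz argument applies.\<close>
  define g where "g x y = \<phi> (rank1 V (proj (orth V) y) (proj V x))" for x y
  have gb: "cmod (g x y) \<le> K * norm x * norm y" for x y
  proof -
    have "cmod (g x y) \<le> K * (norm (proj V x) * norm (proj (orth V) y))"
      unfolding g_def by (rule order_trans[OF bound[OF r1] mult_left_mono[OF rank1_norm[OF V] K]])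
    also have "\<dots> \<le> K * (norm x * norm y)"
      by (intro mult_left_mono mult_mono norm_proj_le V orth_Gr K) auto
    finally show ?thesis by simp
  qed
  have "\<exists>M. bclin M \<and> (\<forall>x y. cinner x (M y) = g x y) \<and> (\<forall>y. norm (M y) \<le> K * norm y)"
    by (rule riesz_sesquilinear[OF _ _ _ _ gb K])
      (simp_all add: g_def bclin_add[OF bP] bclin_add[OF bQ] bclin_scaleC[OF bP] bclin_scaleC[OF bQ]
        rank1_lin[OF V] dual_add[OF \<phi> r1 r1] dual_scale[OF \<phi> r1])
  then obtain M where bM: "bclin M" and M: "\<And>x y. cinner x (M y) = g x y" by blast
  have MV: "M y \<in> V" for y
  proof -
    have "M y \<in> orth (orth V)"
    proof (rule orthI)
      fix x assume "x \<in> orth V"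
      then have "rank1 V (proj (orth V) y) (proj V x) = 0" by (auto simp: proj_zero[OF V] rank1_def zero_outside_def)
      then have "g x y = \<phi> (0 *\<^sub>C 0)" by (simp add: g_def)
      also have "\<dots> = 0" using dual_scale[OF \<phi> nsD_0[OF X], of 0] by simp
      finally show "cinner x (M y) = 0" by (simp add: M)
    qed
    then show ?thesis by (simp add: orth_orth[OF V])
  qed
  define \<mu> where "\<mu> = zero_outside (orth V) M"
  have \<mu>: "\<mu> \<in> vecs (bounded_ops (orth V) V)" unfolding \<mu>_def by (rule bounded_opsI[OF orth_Gr bM MV])
  have \<mu>c: "cinner x (\<mu> y) = \<phi> (rank1 V y x)" if "x \<in> V" "y \<in> orth V" for x y
    using that by (simp add: \<mu>_def zero_outside_def M g_def proj_id[OF V] proj_id[OF orth_Gr])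
  have "Re (\<Sum>e\<in>F. cinner (Q e) (\<mu> e)) \<le> K"
    if F: "finite F" "orthonormal F" "F \<subseteq> orth V" and Q: "contraction Q" for F Q
  proof -
    have bQ: "bclin Q" and Qn: "norm (Q x) \<le> norm x" for x using Q by (auto simp: contraction_def)
    define A where "A = (\<Sum>e\<in>F. rank1 V e (proj V (Q e)))"
    have r: "rank1 V e (proj V (Q e)) \<in> vecs (Hom V)" if "e \<in> F" for e using rank1_in[OF V] F(3) that by blast
    have Ain: "A \<in> vecs (Hom V)" unfolding A_def by (rule csubspace_sum[OF nsD_sub[OF X] r])
    have Az: "A z = (\<Sum>e\<in>F. cinner (Q e) z *\<^sub>C e)" if z: "z \<in> V" for z
    proof -
      have "A z = (\<Sum>e\<in>F. rank1 V e (proj V (Q e)) z)"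
        unfolding A_def using F(1) by (induction F) auto
      then show ?thesis using z by (simp add: rank1_def zero_outside_def proj_cinner_left[OF V])
    qed
    have "nrm (Hom V) A \<le> 1"
    proof (rule op_norm_le[OF subspace_normed[OF V]])
      fix z assume "z \<in> vecs (subspace_nspace V)"
      then have z: "z \<in> V" by simp
      \<comment> \<open>On \<open>V\<close>, \<open>A\<close> is the adjoint of \<open>Q\<close>
        followed by the projection onto the span of \<open>F\<close>. The square of
        \<open>norm w\<close> equals \<open>cinner (Q w) z\<close>, hence
        \<open>norm w \<le> norm z\<close>.\<close>
      define w where "w = (\<Sum>e\<in>F. cinner (Q e) z *\<^sub>C e)"
      have "cinner (Q w) z = (\<Sum>e\<in>F. cnj (cinner (Q e) z) * cinner (Q e) z)"
        by (simp add: w_def bclin_sum[OF bQ] bclin_scaleC[OF bQ] cinner.sum_left cinner_scaleC_left)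
      also have "\<dots> = complex_of_real ((norm w)\<^sup>2)"
        unfolding w_def norm_on_sum[OF F(2,1)] of_real_sum by (simp add: complex_norm_square mult.commute del: of_real_power)
      finally have "(norm w)\<^sup>2 \<le> norm (Q w) * norm z" using Re_cinner_le[of "Q w" z] by simp
      also have "\<dots> \<le> norm w * norm z" by (intro mult_right_mono Qn) simp
      finally have "norm w \<le> norm z" by (cases "norm w = 0") (auto simp: power2_eq_square)
      then show "nrm (subspace_nspace (orth V)) (A z) \<le> 1 * nrm (subspace_nspace V) z" by (simp add: Az[OF z] w_def)
    qed simp
    then have KA: "K * nrm (Hom V) A \<le> K" using K mult_left_mono[of "nrm (Hom V) A" 1 K] by simp
    have "\<phi> (\<Sum>e\<in>G. rank1 V e (proj V (Q e))) = (\<Sum>e\<in>G. cinner (Q e) (\<mu> e))" if "finite G" "G \<subseteq> F" for G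
      using that
    proof (induction G)
      case empty
      have "\<phi> 0 = 0" using dual_scale[OF \<phi> nsD_0[OF X], of 0] by simp
      then show ?case by (simp only: sum.empty)
    next
      case (insert e G)
      have e: "e \<in> orth V" "e \<in> F" using insert F(3) by auto
      have "(\<Sum>e\<in>G. rank1 V e (proj V (Q e))) \<in> vecs (Hom V)"
        using insert.prems by (intro csubspace_sum[OF nsD_sub[OF X]] r) auto
      then have 1: "\<phi> (\<Sum>e\<in>insert e G. rank1 V e (proj V (Q e)))
          = \<phi> (rank1 V e (proj V (Q e))) + \<phi> (\<Sum>e\<in>G. rank1 V e (proj V (Q e)))"
        using insert dual_add[OF \<phi> r[OF e(2)]] by simp
      have "\<mu> e \<in> V" using op_in[OF \<mu>] e(1) by simp
      then have 2: "\<phi> (rank1 V e (proj V (Q e))) = cinner (Q e) (\<mu> e)"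
        by (simp only: \<mu>c[OF proj_in[OF V] e(1), symmetric] proj_cinner_left[OF V])
      have 3: "\<phi> (\<Sum>e\<in>G. rank1 V e (proj V (Q e))) = (\<Sum>e\<in>G. cinner (Q e) (\<mu> e))"
        using insert by blast
      show ?case unfolding 1 2 3 by (simp add: insert.hyps)
    qed
    from this[OF F(1) order_refl] have "(\<Sum>e\<in>F. cinner (Q e) (\<mu> e)) = \<phi> A" by (simp add: A_def)
    then show ?thesis using bound[OF Ain] KA complex_Re_le_cmod[of "\<phi> A"] by simp
  qed
  from trace_class_of_bound[OF orth_Gr V \<mu> this]
  obtain I a b where tc: "\<mu> \<in> trace_class (orth V) V" and rep: "nuclear_rep (orth V) V \<mu> I a b"
    and C: "(\<Sum>\<^sub>\<infinity>i\<in>I. norm (a i) * norm (b i)) \<le> K" by blast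
  have n: "nuclear V I a b" using rep by (auto simp: nuclear_def nuclear_rep_def)
  have "nuclear_functional V I a b (rank1 V y x) = \<phi> (rank1 V y x)" if x: "x \<in> V" and y: "y \<in> orth V" for x y
  proof -
    have "((\<lambda>i. cinner (a i) y *\<^sub>C b i) has_sum \<mu> y) I" using rep y by (simp add: nuclear_rep_def)
    from has_sum_bounded_linear[OF cinner.bounded_linear_right this, of x]
    have "((\<lambda>i. cinner (a i) y * cinner x (b i)) has_sum \<phi> (rank1 V y x)) I"
      by (simp add: cinner_scaleC_right \<mu>c[OF x y])
    with nuclear_rank1[OF V n y] show ?thesis by (rule has_sum_unique)
  qed
  then show ?thesis using tc n C \<mu>c by blast
qed

text \<open>Membership in the predual is a linear condition, given a basis: the functional is recovered
  from its values on operators of rank one.\<close>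

lemma predual_iff:
  assumes V: "V \<in> Gr" and B: "orthonormal_basis V B"
  shows "\<phi> \<in> predual V \<longleftrightarrow> \<phi> \<in> vecs (dual (Hom V)) \<and>
    (\<forall>A\<in>vecs (Hom V). ((\<lambda>e. \<phi> (rank1 V (A e) e)) has_sum \<phi> A) B)"
proof
  assume "\<phi> \<in> predual V"
  then show "\<phi> \<in> vecs (dual (Hom V)) \<and> (\<forall>A\<in>vecs (Hom V). ((\<lambda>e. \<phi> (rank1 V (A e) e)) has_sum \<phi> A) B)"
    using predual_dual[OF V] nuclear_trace[OF V _ B] by (auto elim!: predualE)
next
  assume R: "\<phi> \<in> vecs (dual (Hom V)) \<and> (\<forall>A\<in>vecs (Hom V). ((\<lambda>e. \<phi> (rank1 V (A e) e)) has_sum \<phi> A) B)"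
  then have \<phi>: "\<phi> \<in> vecs (dual (Hom V))" by blast
  note X = Hom_normed[OF V]
  have BV: "e \<in> V" if "e \<in> B" for e using orthonormal_basisD(1)[OF B] that by blast
  obtain \<mu> I a b where n: "nuclear V I a b"
    and r: "\<And>x y. x \<in> V \<Longrightarrow> y \<in> orth V \<Longrightarrow> nuclear_functional V I a b (rank1 V y x) = \<phi> (rank1 V y x)"
    using nuclear_part[OF V \<phi> nsD_nonneg[OF dual_normed[OF X] \<phi>] dual_bound[OF X \<phi>]] by blast
  have "nuclear_functional V I a b A = \<phi> A" for A
  proof (cases "A \<in> vecs (Hom V)")
    case True
    have "((\<lambda>e. nuclear_functional V I a b (rank1 V (A e) e)) has_sum s) B
        \<longleftrightarrow> ((\<lambda>e. \<phi> (rank1 V (A e) e)) has_sum s) B" for s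
      by (rule has_sum_cong) (rule r[OF BV Hom_in[OF True BV]])
    then show ?thesis using nuclear_trace[OF V n B True] R True has_sum_unique by blast
  next
    case False
    then show ?thesis using dual_outside[OF \<phi> False] by (simp add: nuclear_functional_def zero_outside_def)
  qed
  then have "\<phi> = nuclear_functional V I a b" by auto
  then show "\<phi> \<in> predual V" using n by (auto simp: predual_def)
qed

lemma predual_csubspace:
  assumes V: "V \<in> Gr"
  shows "csubspace (predual V)"
proof -
  obtain B where B: "orthonormal_basis V B" using orthonormal_basis_exists[OF V] by blast
  note D = dual_normed[OF Hom_normed[OF V]]
  note iff = predual_iff[OF V B]
  have "0 \<in> predual V" unfolding iff using nsD_0[OF D] by simp
  moreover have "\<phi> + \<psi> \<in> predual V" if "\<phi> \<in> predual V" "\<psi> \<in> predual V" for \<phi> \<psi>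
    using that nsD_add[OF D, of \<phi> \<psi>] unfolding iff by (auto intro!: has_sum_add)
  moreover have "c *\<^sub>C \<phi> \<in> predual V" if "\<phi> \<in> predual V" for c \<phi>
  proof -
    have "((\<lambda>e. (c *\<^sub>C \<phi>) (rank1 V (A e) e)) has_sum (c *\<^sub>C \<phi>) A) B" if "A \<in> vecs (Hom V)" for A
      using \<open>\<phi> \<in> predual V\<close> that unfolding iff by (auto simp: scaleC_fun_def intro!: has_sum_cmult_right)
    then show ?thesis using that nsD_scale[OF D, of \<phi> c] unfolding iff by blast
  qed
  ultimately show ?thesis unfolding csubspace_def by blast
qed

text \<open>The summation in \<open>predual_iff\<close> recovers either functional from its values
  on operators of rank one. This is what separates the predual from functionals that vanish on all
  such operators.\<close>

lemma predual_eqI: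
  assumes V: "V \<in> Gr" and "\<phi> \<in> predual V" "\<psi> \<in> predual V"
    and r: "\<And>x y. x \<in> V \<Longrightarrow> y \<in> orth V \<Longrightarrow> \<phi> (rank1 V y x) = \<psi> (rank1 V y x)"
  shows "\<phi> = \<psi>"
proof
  obtain B where B: "orthonormal_basis V B" using orthonormal_basis_exists[OF V] by blast
  have BV: "e \<in> V" if "e \<in> B" for e using orthonormal_basisD(1)[OF B] that by blast
  fix A show "\<phi> A = \<psi> A"
  proof (cases "A \<in> vecs (Hom V)")
    case True
    have "((\<lambda>e. \<phi> (rank1 V (A e) e)) has_sum s) B \<longleftrightarrow> ((\<lambda>e. \<psi> (rank1 V (A e) e)) has_sum s) B" for s
      by (rule has_sum_cong) (rule r[OF BV Hom_in[OF True BV]])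
    then show ?thesis
      using assms(2,3) True has_sum_unique unfolding predual_iff[OF V B] by blast
  next
    case False
    then show ?thesis using dual_outside predual_dual[OF V] assms(2,3) by metis
  qed
qed

text \<open>Passing from \<open>\<phi>\<close> to the nuclear functional \<open>\<phi>'\<close> with
  the same values on rank one operators is norm-decreasing and fixes the predual. Hence
  \<open>\<phi>' - \<psi>\<close> is no larger than \<open>\<phi> - \<psi>\<close> for
  \<open>\<psi>\<close> in the predual, and \<open>\<phi> - \<phi>'\<close> is at most twice as
  large. The ball around \<open>\<phi>\<close> of half the norm of \<open>\<phi> - \<phi>'\<close>
  misses the predual.\<close>

lemma predual_closed:
  assumes V: "V \<in> Gr"
  shows "closed_subspace (dual (Hom V)) (predual V)"
  unfolding closed_subspace_def open_in_def
proof (intro conjI ballI)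
  note X = Hom_normed[OF V] and D = dual_normed[OF Hom_normed[OF V]]
  show "predual V \<subseteq> vecs (dual (Hom V))" using predual_dual[OF V] by blast
  show "csubspace (predual V)" by (rule predual_csubspace[OF V])
  fix \<phi> assume "\<phi> \<in> vecs (dual (Hom V)) - predual V"
  then have \<phi>: "\<phi> \<in> vecs (dual (Hom V))" and notin: "\<phi> \<notin> predual V" by auto
  obtain \<mu> I a b where n: "nuclear V I a b"
    and r: "\<And>x y. x \<in> V \<Longrightarrow> y \<in> orth V \<Longrightarrow> nuclear_functional V I a b (rank1 V y x) = \<phi> (rank1 V y x)"
    using nuclear_part[OF V \<phi> nsD_nonneg[OF D \<phi>] dual_bound[OF X \<phi>]] by blast
  define \<phi>' where "\<phi>' = nuclear_functional V I a b"
  have \<phi>': "\<phi>' \<in> predual V" using n by (auto simp: \<phi>'_def predual_def)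
  note \<phi>'D = predual_dual[OF V \<phi>']
  have dist: "nrm (dual (Hom V)) (\<phi> - \<phi>') \<le> 2 * nrm (dual (Hom V)) (\<phi> - \<psi>)" if \<psi>: "\<psi> \<in> predual V" for \<psi>
  proof -
    note \<psi>D = predual_dual[OF V \<psi>]
    have d: "\<phi> - \<psi> \<in> vecs (dual (Hom V))" by (rule nsD_diff[OF D \<phi> \<psi>D])
    let ?k = "nrm (dual (Hom V)) (\<phi> - \<psi>)"
    have k: "?k \<ge> 0" by (rule nsD_nonneg[OF D d])
    obtain \<mu>2 I2 a2 b2 where n2: "nuclear V I2 a2 b2" and C: "(\<Sum>\<^sub>\<infinity>i\<in>I2. norm (a2 i) * norm (b2 i)) \<le> ?k"
      and r2: "\<And>x y. x \<in> V \<Longrightarrow> y \<in> orth V \<Longrightarrow> nuclear_functional V I2 a2 b2 (rank1 V y x) = (\<phi> - \<psi>) (rank1 V y x)"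
      using nuclear_part[OF V d k dual_bound[OF X d]] by blast
    have eq: "nuclear_functional V I2 a2 b2 = \<phi>' - \<psi>"
    proof (rule predual_eqI[OF V])
      show "nuclear_functional V I2 a2 b2 \<in> predual V" using n2 by (auto simp: predual_def)
      show "\<phi>' - \<psi> \<in> predual V" by (rule csubspaceD(6)[OF predual_csubspace[OF V] \<phi>' \<psi>])
    qed (simp add: r2 r \<phi>'_def)
    have "nrm (dual (Hom V)) (\<phi>' - \<psi>) \<le> ?k"
    proof (rule dual_norm_le[OF X k])
      fix A assume A: "A \<in> vecs (Hom V)"
      show "cmod ((\<phi>' - \<psi>) A) \<le> ?k * nrm (Hom V) A"
        using nuclear_props(2)[OF V n2 A] mult_right_mono[OF C nsD_nonneg[OF X A]] by (simp only: eq)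
    qed
    then show ?thesis
      using nrm_tri_diff[OF D d nsD_diff[OF D \<phi>'D \<psi>D]] by simp
  qed
  have ne: "\<phi> - \<phi>' \<noteq> 0" using notin \<phi>' by auto
  have dD: "\<phi> - \<phi>' \<in> vecs (dual (Hom V))" by (rule nsD_diff[OF D \<phi> \<phi>'D])
  have pos: "nrm (dual (Hom V)) (\<phi> - \<phi>') > 0"
    using nsD_nonneg[OF D dD] nsD_zero_iff[OF D dD] ne by linarith
  have "\<psi> \<in> vecs (dual (Hom V)) - predual V"
    if \<psi>: "\<psi> \<in> vecs (dual (Hom V))" and "nrm (dual (Hom V)) (\<psi> - \<phi>) < nrm (dual (Hom V)) (\<phi> - \<phi>') / 2" for \<psi>
    using dist[of \<psi>] that nrm_minus_commute[OF D \<psi> \<phi>] by auto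
  then show "\<exists>e>0. \<forall>\<psi>\<in>vecs (dual (Hom V)). nrm (dual (Hom V)) (\<psi> - \<phi>) < e \<longrightarrow> \<psi> \<in> vecs (dual (Hom V)) - predual V"
    using pos by (intro exI[of _ "nrm (dual (Hom V)) (\<phi> - \<phi>') / 2"]) auto
qed auto

text \<open>\<open>\<mu>\<close> and \<open>\<phi>\<close> correspond if
  \<open>cinner x (\<mu> y)\<close> is the value of \<open>\<phi>\<close> at
  \<open>rank1 V y x\<close>. The trace of \<open>\<mu> \<circ> A\<close> is then literally the
  series by which \<open>predual_iff\<close> recovers \<open>\<phi> A\<close>.\<close>

lemma predual_trace:
  assumes V: "V \<in> Gr"
  shows "predual V = trace_functional V ` trace_class (orth V) V"
proof -
  note X = Hom_normed[OF V]
  \<comment> \<open>The very basis that \<open>op_trace\<close> chooses; \<open>predual_iff\<close>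
    holds for any basis, so also for this one.\<close>
  define B where "B = (SOME B. orthonormal_basis V B)"
  have B: "orthonormal_basis V B" unfolding B_def using someI_ex[OF orthonormal_basis_exists[OF V]] .
  have BV: "e \<in> V" if "e \<in> B" for e using orthonormal_basisD(1)[OF B] that by blast
  have tr: "trace_functional V \<mu> = \<phi>"
    if \<phi>: "\<phi> \<in> predual V" and c: "\<And>x y. x \<in> V \<Longrightarrow> y \<in> orth V \<Longrightarrow> cinner x (\<mu> y) = \<phi> (rank1 V y x)" for \<mu> \<phi>
  proof
    fix A show "trace_functional V \<mu> A = \<phi> A"
    proof (cases "A \<in> vecs (Hom V)")
      case True
      have "((\<lambda>e. cinner e ((\<mu> \<circ> A) e)) has_sum s) B \<longleftrightarrow> ((\<lambda>e. \<phi> (rank1 V (A e) e)) has_sum s) B" for s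
        by (rule has_sum_cong) (simp add: c[OF BV Hom_in[OF True BV]])
      then have "op_trace V (\<mu> \<circ> A) = \<phi> A"
        unfolding op_trace_def B_def[symmetric] using \<phi> True predual_iff[OF V B] by (intro infsumI) blast
      then show ?thesis using True by (simp add: trace_functional_def zero_outside_def)
    next
      case False
      then show ?thesis using dual_outside[OF predual_dual[OF V \<phi>] False]
        by (simp add: trace_functional_def zero_outside_def)
    qed
  qed
  show ?thesis
  proof (intro equalityI subsetI)
    fix \<phi> assume \<phi>: "\<phi> \<in> predual V"
    note \<phi>D = predual_dual[OF V \<phi>]
    obtain \<mu> I a b where "\<mu> \<in> trace_class (orth V) V"
      "\<And>x y. x \<in> V \<Longrightarrow> y \<in> orth V \<Longrightarrow> cinner x (\<mu> y) = \<phi> (rank1 V y x)"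
      using nuclear_part[OF V \<phi>D nsD_nonneg[OF dual_normed[OF X] \<phi>D] dual_bound[OF X \<phi>D]] by blast
    then show "\<phi> \<in> trace_functional V ` trace_class (orth V) V" using tr[OF \<phi>] by blast
  next
    fix \<phi> assume "\<phi> \<in> trace_functional V ` trace_class (orth V) V"
    then obtain \<mu> where \<mu>: "\<mu> \<in> trace_class (orth V) V" "\<phi> = trace_functional V \<mu>" by blast
    obtain I a b where rep: "nuclear_rep (orth V) V \<mu> I a b" using trace_class_nuclear[OF orth_Gr V \<mu>(1)] by blast
    have n: "nuclear V I a b" using rep by (auto simp: nuclear_def nuclear_rep_def)
    then have p: "nuclear_functional V I a b \<in> predual V" by (auto simp: predual_def)
    have "cinner x (\<mu> y) = nuclear_functional V I a b (rank1 V y x)" if x: "x \<in> V" and y: "y \<in> orth V" for x y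
    proof -
      have "((\<lambda>i. cinner (a i) y *\<^sub>C b i) has_sum \<mu> y) I" using rep y by (simp add: nuclear_rep_def)
      from has_sum_bounded_linear[OF cinner.bounded_linear_right this, of x]
      have "((\<lambda>i. cinner (a i) y * cinner x (b i)) has_sum cinner x (\<mu> y)) I" by (simp add: cinner_scaleC_right)
      then show ?thesis using nuclear_rank1[OF V n y] by (rule has_sum_unique)
    qed
    from tr[OF p this] show "\<phi> \<in> predual V" using p \<mu>(2) by simp
  qed
qed

subsection \<open>Duality\<close>

definition elementary :: "'h::complex_hilbert set \<Rightarrow> 'h \<Rightarrow> 'h \<Rightarrow> ('h \<Rightarrow> 'h) \<Rightarrow> complex"
  where "elementary V a b = nuclear_functional V {0} (\<lambda>_. a) (\<lambda>_. b)"

lemma elementary_apply: "A \<in> vecs (Hom V) \<Longrightarrow> elementary V a b A = cinner a (A b)"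
  and elementary_outside: "A \<notin> vecs (Hom V) \<Longrightarrow> elementary V a b A = 0"
  by (simp_all add: elementary_def nuclear_functional_def zero_outside_def)

lemma elementary_predual: "a \<in> orth V \<Longrightarrow> b \<in> V \<Longrightarrow> elementary V a b \<in> predual V"
  unfolding elementary_def predual_def nuclear_def by force

lemma elementary_norm:
  assumes V: "V \<in> Gr" and b: "b \<in> V"
  shows "nrm (dual (Hom V)) (elementary V a b) \<le> norm a * norm b"
proof (rule dual_norm_le[OF Hom_normed[OF V]])
  fix A assume A: "A \<in> vecs (Hom V)"
  have "cmod (cinner a (A b)) \<le> norm a * (nrm (Hom V) A * norm b)"
    by (rule order_trans[OF cauchy_schwarz mult_left_mono[OF Hom_bound[OF V A b]]]) simp
  then show "cmod (elementary V a b A) \<le> norm a * norm b * nrm (Hom V) A"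
    by (simp add: elementary_apply[OF A] ac_simps)
qed simp

lemma elementary_lin:
  assumes V: "V \<in> Gr" and b: "b \<in> V" "b' \<in> V"
  shows "elementary V (a + a') b = elementary V a b + elementary V a' b"
    and "elementary V a (b + b') = elementary V a b + elementary V a b'"
    and "elementary V (c *\<^sub>C a) b = cnj c *\<^sub>C elementary V a b"
    and "elementary V a (c *\<^sub>C b) = c *\<^sub>C elementary V a b"
proof -
  have lin: "A (b + b') = A b + A b'" "A (c *\<^sub>C b) = c *\<^sub>C A b" if "A \<in> vecs (Hom V)" for A
    using op_add[OF that, of b b'] op_scale[OF that, of b c] b by simp_all
  show "elementary V (a + a') b = elementary V a b + elementary V a' b"
    "elementary V a (b + b') = elementary V a b + elementary V a b'"
    "elementary V (c *\<^sub>C a) b = cnj c *\<^sub>C elementary V a b" "elementary V a (c *\<^sub>C b) = c *\<^sub>C elementary V a b"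
    by (rule ext; case_tac "x \<in> vecs (Hom V)";
        simp add: elementary_apply elementary_outside lin cinner_add_left cinner_add_right
          cinner_scaleC_left cinner_scaleC_right scaleC_fun_def)+
qed

text \<open>The operator found on elementary functionals represents \<open>F\<close> on the whole
  predual because finite partial sums of a nuclear series approximate the functional in dual norm,
  with error at most the tail of the norm series, and \<open>F\<close> is bounded.\<close>

lemma predual_bidual:
  assumes V: "V \<in> Gr" and F: "F \<in> vecs (dual (restrict_nspace (dual (Hom V)) (predual V)))"
  obtains A where "A \<in> vecs (Hom V)" "\<And>\<phi>. \<phi> \<in> predual V \<Longrightarrow> F \<phi> = \<phi> A"
proof -
  note X = Hom_normed[OF V] and D = dual_normed[OF Hom_normed[OF V]] and bP = bclin_proj[OF V]
    and bQ = bclin_proj[OF orth_Gr[of V]]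
  have Fadd: "F (\<phi> + \<psi>) = F \<phi> + F \<psi>" if "\<phi> \<in> predual V" "\<psi> \<in> predual V" for \<phi> \<psi>
    using dual_add[OF F, of \<phi> \<psi>] that by (simp add: restrict_nspace_def)
  have Fscale: "F (c *\<^sub>C \<phi>) = c * F \<phi>" if "\<phi> \<in> predual V" for c \<phi>
    using dual_scale[OF F, of \<phi> c] that by (simp add: restrict_nspace_def)
  obtain K' where K': "\<And>\<phi>. \<phi> \<in> predual V \<Longrightarrow> cmod (F \<phi>) \<le> K' * nrm (dual (Hom V)) \<phi>"
    using op_bdd[OF F[unfolded dual_def[of "restrict_nspace (dual (Hom V)) (predual V)"]]]
    by (auto simp: restrict_nspace_def)
  define K where "K = \<bar>K'\<bar>"
  have K: "K \<ge> 0" by (simp add: K_def)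
  have Fb: "cmod (F \<phi>) \<le> K * nrm (dual (Hom V)) \<phi>" if "\<phi> \<in> predual V" for \<phi>
    using K'[OF that] mult_right_mono[OF abs_ge_self[of K'] nsD_nonneg[OF D predual_dual[OF V that]]]
    by (simp add: K_def)
  have el: "elementary V (proj (orth V) a) (proj V b) \<in> predual V" for a b
    by (rule elementary_predual[OF proj_in[OF orth_Gr] proj_in[OF V]])
  define g where "g a b = F (elementary V (proj (orth V) a) (proj V b))" for a b
  have gb: "cmod (g a b) \<le> K * norm a * norm b" for a b
  proof -
    have "cmod (g a b) \<le> K * (norm (proj (orth V) a) * norm (proj V b))"
      unfolding g_def by (rule order_trans[OF Fb[OF el] mult_left_mono[OF elementary_norm[OF V proj_in[OF V]] K]])
    also have "\<dots> \<le> K * (norm a * norm b)" by (intro mult_left_mono mult_mono norm_proj_le V orth_Gr K) auto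
    finally show ?thesis by simp
  qed
  have "\<exists>M. bclin M \<and> (\<forall>a b. cinner a (M b) = g a b) \<and> (\<forall>b. norm (M b) \<le> K * norm b)"
    by (rule riesz_sesquilinear[OF _ _ _ _ gb K])
      (simp_all add: g_def bclin_add[OF bP] bclin_add[OF bQ] bclin_scaleC[OF bP] bclin_scaleC[OF bQ]
        elementary_lin[OF V proj_in[OF V] proj_in[OF V]] Fadd[OF el el] Fscale[OF el])
  then obtain M where bM: "bclin M" and M: "\<And>a b. cinner a (M b) = g a b" by blast
  have MV: "M b \<in> orth V" for b
  proof (rule orthI)
    fix a assume a: "a \<in> V"
    \<comment> \<open>Zero is written as a multiple so that the scaling rules of
      \<open>elementary\<close> and of \<open>F\<close> apply.\<close>
    have z: "proj (orth V) a = 0 *\<^sub>C 0" using proj_orth[OF V, of a] proj_id[OF V a] by simp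
    have "g a b = 0"
      unfolding g_def z elementary_lin(3)[OF V proj_in[OF V, of b] proj_in[OF V, of b]]
      using Fscale[of "elementary V 0 (proj V b)" 0] elementary_predual[OF GrD(1)[OF orth_Gr] proj_in[OF V]] by simp
    then show "cinner a (M b) = 0" by (simp add: M)
  qed
  define A where "A = zero_outside V M"
  have A: "A \<in> vecs (Hom V)" unfolding A_def by (rule bounded_opsI[OF V bM MV])
  have FA: "F (elementary V a b) = cinner a (A b)" if "a \<in> orth V" "b \<in> V" for a b
    using that by (simp add: A_def zero_outside_def M g_def proj_id[OF V] proj_id[OF orth_Gr])
  have "F \<phi> = \<phi> A" if \<phi>: "\<phi> \<in> predual V" for \<phi>
  proof -
    obtain I a b where n: "nuclear V I a b" and eq: "\<phi> = nuclear_functional V I a b" using \<phi> by (rule predualE)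
    have ab: "a i \<in> orth V" "b i \<in> V" if "i \<in> I" for i using n that by (auto simp: nuclear_def)
    have "((\<lambda>i. cinner (a i) (A (b i))) has_sum F \<phi>) I"
      unfolding has_sum_def tendsto_iff eventually_finite_subsets_at_top
    proof (intro allI impI)
      fix e :: real assume e: "e > 0"
      have s: "(\<lambda>i. norm (a i) * norm (b i)) summable_on I" using n by (simp add: nuclear_def)
      have "e / (K + 1) > 0" using e K by simp
      then have "eventually (\<lambda>G. dist (\<Sum>i\<in>G. norm (a i) * norm (b i)) (\<Sum>\<^sub>\<infinity>i\<in>I. norm (a i) * norm (b i)) < e / (K + 1)) (finite_subsets_at_top I)"
        using has_sum_infsum[OF s] unfolding has_sum_def tendsto_iff by blast
      then obtain G0 where G0: "finite G0" "G0 \<subseteq> I" "\<forall>G. finite G \<and> G0 \<subseteq> G \<and> G \<subseteq> I \<longrightarrow>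
          dist (\<Sum>i\<in>G. norm (a i) * norm (b i)) (\<Sum>\<^sub>\<infinity>i\<in>I. norm (a i) * norm (b i)) < e / (K + 1)"
        unfolding eventually_finite_subsets_at_top by (elim exE conjE) (rule that)
      have "dist (\<Sum>i\<in>G. cinner (a i) (A (b i))) (F \<phi>) < e" if G: "finite G" "G0 \<subseteq> G" "G \<subseteq> I" for G
      proof -
        let ?\<psi> = "\<Sum>i\<in>G. elementary V (a i) (b i)" and ?t = "\<Sum>\<^sub>\<infinity>i\<in>I - G. norm (a i) * norm (b i)"
        have \<psi>: "?\<psi> \<in> predual V"
          using G ab by (intro csubspace_sum[OF predual_csubspace[OF V]] elementary_predual) auto
        have n': "nuclear V (I - G) a b"
          using n summable_on_subset[of _ I "I - G"] by (auto simp: nuclear_def intro: summable_on_subset_banach)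
        have diff: "\<phi> - ?\<psi> = nuclear_functional V (I - G) a b"
        proof
          fix A' show "(\<phi> - ?\<psi>) A' = nuclear_functional V (I - G) a b A'"
          proof (cases "A' \<in> vecs (Hom V)")
            case True
            have "((\<lambda>i. cinner (a i) (A' (b i))) has_sum (\<Sum>i\<in>G. cinner (a i) (A' (b i))) + nuclear_functional V (I - G) a b A') (G \<union> (I - G))"
              by (rule has_sum_Un_disjoint[OF has_sum_finite[OF G(1)] nuclear_props(1)[OF V n' True]]) auto
            moreover have "G \<union> (I - G) = I" using G(3) by blast
            ultimately have "\<phi> A' = (\<Sum>i\<in>G. cinner (a i) (A' (b i))) + nuclear_functional V (I - G) a b A'"
              using has_sum_unique[OF nuclear_props(1)[OF V n True]] eq by simp
            moreover have "?\<psi> A' = (\<Sum>i\<in>G. cinner (a i) (A' (b i)))"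
              using G(1) by (induction G) (auto simp: elementary_apply[OF True])
            ultimately show ?thesis by simp
          next
            case False
            have "?\<psi> A' = 0" by (rule dual_outside[OF predual_dual[OF V \<psi>] False])
            then show ?thesis using dual_outside[OF predual_dual[OF V \<phi>] False] False
              by (simp add: nuclear_functional_def zero_outside_def)
          qed
        qed
        have pd: "\<phi> - ?\<psi> \<in> predual V" by (rule csubspaceD(6)[OF predual_csubspace[OF V] \<phi> \<psi>])
        have t: "?t = (\<Sum>\<^sub>\<infinity>i\<in>I. norm (a i) * norm (b i)) - (\<Sum>i\<in>G. norm (a i) * norm (b i))"
        proof -
          have "((\<lambda>i. norm (a i) * norm (b i)) has_sum (\<Sum>i\<in>G. norm (a i) * norm (b i)) + ?t) (G \<union> (I - G))"
            using n' by (intro has_sum_Un_disjoint has_sum_finite G has_sum_infsum) (auto simp: nuclear_def)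
          moreover have "G \<union> (I - G) = I" using G(3) by blast
          ultimately show ?thesis using infsumI by fastforce
        qed
        have t0: "?t \<ge> 0" by (rule infsum_nonneg) simp
        have "dist (\<Sum>i\<in>G. norm (a i) * norm (b i)) (\<Sum>\<^sub>\<infinity>i\<in>I. norm (a i) * norm (b i)) < e / (K + 1)"
          using G0(3) G by blast
        then have tl: "?t < e / (K + 1)" using t t0 by (simp add: dist_real_def)
        have "nrm (dual (Hom V)) (\<phi> - ?\<psi>) \<le> ?t"
          unfolding diff by (rule dual_norm_le[OF X t0 nuclear_props(2)[OF V n']])
        then have "cmod (F (\<phi> - ?\<psi>)) \<le> K * ?t" using Fb[OF pd] K mult_left_mono order_trans by blast
        also have "\<dots> \<le> (K + 1) * ?t" using t0 by (intro mult_right_mono) auto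
        also have "\<dots> < e" using tl K by (simp add: pos_less_divide_eq mult.commute)
        finally have 1: "cmod (F (\<phi> - ?\<psi>)) < e" .
        have "F (\<phi> - ?\<psi> + ?\<psi>) = F (\<phi> - ?\<psi>) + F ?\<psi>" by (rule Fadd[OF pd \<psi>])
        moreover have "F (\<Sum>i\<in>H. elementary V (a i) (b i)) = (\<Sum>i\<in>H. cinner (a i) (A (b i)))" if "finite H" "H \<subseteq> G" for H
          using that
        proof (induction H)
          case empty
          have "F 0 = 0" using Fscale[OF \<phi>, of 0] by simp
          then show ?case by (simp only: sum.empty)
        next
          case (insert i H)
          have i: "i \<in> I" "H \<subseteq> I" using insert G(3) by auto
          have "(\<Sum>i\<in>H. elementary V (a i) (b i)) \<in> predual V"
            using ab i by (intro csubspace_sum[OF predual_csubspace[OF V]] elementary_predual) auto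
          note 1 = Fadd[OF elementary_predual[OF ab[OF i(1)]] this]
          have 2: "F (\<Sum>i\<in>H. elementary V (a i) (b i)) = (\<Sum>i\<in>H. cinner (a i) (A (b i)))"
            using insert by blast
          show ?case
            unfolding sum.insert[OF insert.hyps(1,2)] 1 2 FA[OF ab[OF i(1)]] by (rule refl)
        qed
        ultimately show ?thesis using 1 G(1) by (simp add: dist_norm norm_minus_commute)
      qed
      then show "\<exists>X. finite X \<and> X \<subseteq> I \<and> (\<forall>Y. finite Y \<and> X \<subseteq> Y \<and> Y \<subseteq> I \<longrightarrow>
          dist (\<Sum>i\<in>Y. cinner (a i) (A (b i))) (F \<phi>) < e)"
        using G0(1,2) by blast
    qed
    then show ?thesis using nuclear_props(1)[OF V n A] has_sum_unique eq by blast
  qed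
  then show ?thesis using that[OF A] by blast
qed

text \<open>The predual is norming: its elementary functionals already detect the operator norm.
  This gives the lower estimate for the evaluation map.\<close>

lemma norm_le_elementary:
  assumes V: "V \<in> Gr" and A: "A \<in> vecs (Hom V)" and K: "K \<ge> 0"
    and b: "\<And>\<phi>. \<phi> \<in> predual V \<Longrightarrow> cmod (\<phi> A) \<le> K * nrm (dual (Hom V)) \<phi>"
  shows "nrm (Hom V) A \<le> K"
proof (rule op_norm_le[OF subspace_normed[OF V] K])
  fix z assume "z \<in> vecs (subspace_nspace V)"
  then have z: "z \<in> V" by simp
  have "norm (A z) \<le> K * norm z"
  proof (rule norm_leI_cinner)
    fix y :: 'a assume y: "norm y \<le> 1"
    let ?y = "proj (orth V) y"
    have p: "elementary V ?y z \<in> predual V" by (rule elementary_predual[OF proj_in[OF orth_Gr] z])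
    have "cmod (cinner ?y (A z)) \<le> K * (norm ?y * norm z)"
      using b[OF p] mult_left_mono[OF elementary_norm[OF V z, of ?y] K] by (simp add: elementary_apply[OF A])
    also have "\<dots> \<le> K * (1 * norm z)"
      by (intro mult_left_mono mult_right_mono K order_trans[OF norm_proj_le[OF orth_Gr] y]) auto
    finally show "cmod (cinner y (A z)) \<le> K * norm z"
      by (simp add: proj_cinner_left[OF orth_Gr Hom_in[OF A z]])
  qed
  then show "nrm (subspace_nspace (orth V)) (A z) \<le> K * nrm (subspace_nspace V) z" by simp
qed


section \<open>The precotangent bundle\<close>

abbreviation TV :: "'h::complex_hilbert set \<Rightarrow> ('h set \<Rightarrow> 'h \<Rightarrow> 'h) set"
  where "TV U \<equiv> tangent_vectors Gr_manifold U"

abbreviation TS :: "'h::complex_hilbert set \<Rightarrow> 'h set \<Rightarrow> ('h set \<Rightarrow> 'h \<Rightarrow> 'h) nspace"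
  where "TS V U \<equiv> tangent_space Gr_manifold V U"

abbreviation around :: "'h::complex_hilbert set \<Rightarrow> 'h set set"
  where "around U \<equiv> charts_at Gr_manifold U"

lemma around_iff: "V \<in> around U \<longleftrightarrow> proj_iso V U"
  using Gr_domain_iff by (auto simp: charts_at_def proj_iso_def)

lemma aroundD: "V \<in> around U \<Longrightarrow> V \<in> Gr" "V \<in> around U \<Longrightarrow> proj_iso V U" "V \<in> around U \<Longrightarrow> U \<in> Gr_domain V"
  by (simp add: charts_at_def, simp add: around_iff, simp add: charts_at_def)

lemma around_self: "U \<in> Gr \<Longrightarrow> U \<in> around U"
  by (simp add: charts_at_def Gr_domain_self)

lemma points_Gr: "points Gr_manifold = Gr"
  using Gr_domain_self Gr_domain_Gr by (auto simp: points_def)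

lemma der_in: "V1 \<in> Gr \<Longrightarrow> V2 \<in> around U \<Longrightarrow> h \<in> vecs (Hom V1) \<Longrightarrow> der V1 V2 U h \<in> vecs (Hom V2)"
  by (rule op_in[OF der_operator[OF _ aroundD(2)]])

text \<open>The chain rule, read off from the formula for \<open>der\<close>. All lifts go to the
  same \<open>U\<close>, so projecting a point of \<open>U\<close> to \<open>V2\<close> and lifting
  again returns it; and \<open>along V2\<close> changes a vector by an element of \<open>U\<close>,
  which \<open>along V3\<close> kills.\<close>

lemma der_cocycle:
  assumes V1: "V1 \<in> Gr" and V2: "V2 \<in> around U" and V3: "V3 \<in> around U" and h: "h \<in> vecs (Hom V1)"
  shows "der V2 V3 U (der V1 V2 U h) = der V1 V3 U h"
proof (rule op_vecs_cong)
  show "der V2 V3 U (der V1 V2 U h) \<in> vecs (Hom V3)" by (rule der_in[OF aroundD(1)[OF V2] V3 der_in[OF V1 V2 h]])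
  show "der V1 V3 U h \<in> vecs (Hom V3)" by (rule der_in[OF V1 V3 h])
  fix x assume "x \<in> vecs (subspace_nspace V3)"
  then have x: "x \<in> V3" by simp
  note i2 = aroundD(2)[OF V2] and i3 = aroundD(2)[OF V3]
  define w where "w = lift V3 U x"
  have w: "lift V2 U (proj V2 w) = w" by (simp add: lift_proj[OF i2] lift_id[OF i2 lift_in[OF i3]] w_def)
  define z where "z = h (proj V1 w)"
  have "der V2 V3 U (der V1 V2 U h) x = along V3 U (der V1 V2 U h (proj V2 w))"
    unfolding w_def by (rule der_apply[OF der_in[OF V1 V2 h] aroundD(1)[OF V2] x])
  also have "der V1 V2 U h (proj V2 w) = along V2 U z"
    using der_apply[OF h V1 proj_in[OF aroundD(1)[OF V2], of w], of U] by (simp add: w z_def)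
  also have "along V3 U (along V2 U z) = along V3 U z"
    using along_zero[OF i3 lift_in[OF i2, of z]] by (simp add: along_def[of V2] bclin_diff[OF bclin_along[OF i3]])
  also have "\<dots> = der V1 V3 U h x" unfolding z_def w_def by (rule der_apply[OF h V1 x, symmetric])
  finally show "der V2 V3 U (der V1 V2 U h) x = der V1 V3 U h x" .
qed

lemma der_self:
  assumes V: "V \<in> around U" and h: "h \<in> vecs (Hom V)"
  shows "der V V U h = h"
proof (rule op_vecs_cong[OF der_in[OF aroundD(1)[OF V] V h] h])
  fix x assume "x \<in> vecs (subspace_nspace V)"
  then have x: "x \<in> V" by simp
  note VG = aroundD(1)[OF V] and i = aroundD(2)[OF V]
  have "lift V U (h x) = lift V U 0" using lift_proj[OF i, of "h x"] by (simp add: proj_zero[OF VG Hom_in[OF h x]])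
  then have "along V U (h x) = h x" by (simp add: along_def bclin_zero[OF bclin_lift[OF i]])
  then show "der V V U h x = h x" using der_apply[OF h VG x, of U] by (simp add: proj_lift[OF i] proj_id[OF VG x])
qed

text \<open>The derivative that \<open>tangent_vectors\<close> merely asserts to exist is
  \<open>der\<close>, by the explicit computation and by uniqueness on the open overlap.\<close>

lemma TV_iff:
  "\<xi> \<in> TV U \<longleftrightarrow> (\<forall>V. V \<notin> around U \<longrightarrow> \<xi> V = 0) \<and> (\<forall>V\<in>around U. \<xi> V \<in> vecs (Hom V)) \<and>
    (\<forall>V\<in>around U. \<forall>V'\<in>around U. \<xi> V' = der V V' U (\<xi> V))"
proof -
  have "(\<exists>T. has_fderiv (Hom V) (Gr_chart V ` (Gr_domain V \<inter> Gr_domain V')) (Hom V')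
      (transition Gr_manifold V V') T (Gr_chart V U) \<and> w = T v) \<longleftrightarrow> w = der V V' U v"
    if V: "V \<in> around U" and V': "V' \<in> around U" for V V' v w
  proof -
    note VG = aroundD(1)[OF V] and VG' = aroundD(1)[OF V'] and D = aroundD(3)[OF V]
    have A: "Gr_chart V U \<in> overlap V (Gr_domain V')"
      using Gr_chart_in[OF VG D] graph_Gr_chart[OF VG D] aroundD(3)[OF V'] by (simp add: overlap_def)
    have d: "has_fderiv (Hom V) (overlap V (Gr_domain V')) (Hom V') (transition Gr_manifold V V') (der V V' U) (Gr_chart V U)"
      using transition_has_fderiv[OF VG VG' A] by (simp add: graph_Gr_chart[OF VG D])
    have "T = der V V' U"
      if "has_fderiv (Hom V) (overlap V (Gr_domain V')) (Hom V') (transition Gr_manifold V V') T (Gr_chart V U)" for T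
      by (rule has_fderiv_unique[OF Hom_normed[OF VG] Hom_normed[OF VG'] overlap_open[OF VG VG'] A
            Cn_in[OF Cn_chart[OF VG VG', of 0]] that d])
    then show ?thesis using d unfolding chart_image(2)[OF VG] by blast
  qed
  then show ?thesis unfolding tangent_vectors_def by simp
qed

text \<open>The inverse of the tangent map of the chart \<open>V\<close> at \<open>U\<close>; the
  cocycle identity makes the components in different charts compatible.\<close>

definition tangent_of :: "'h::complex_hilbert set \<Rightarrow> 'h set \<Rightarrow> ('h \<Rightarrow> 'h) \<Rightarrow> 'h set \<Rightarrow> 'h \<Rightarrow> 'h"
  where "tangent_of V U h = (\<lambda>V'. if V' \<in> around U then der V V' U h else 0)"

lemma tangent_of_in: "V \<in> around U \<Longrightarrow> h \<in> vecs (Hom V) \<Longrightarrow> tangent_of V U h \<in> TV U"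
  unfolding TV_iff
proof (intro conjI ballI allI impI)
  assume V: "V \<in> around U" and h: "h \<in> vecs (Hom V)"
  note VG = aroundD(1)[OF V]
  show "tangent_of V U h V' \<in> vecs (Hom V')" if V': "V' \<in> around U" for V'
    using der_in[OF VG V' h] V' by (simp add: tangent_of_def)
  show "tangent_of V U h V2 = der V1 V2 U (tangent_of V U h V1)" if "V1 \<in> around U" "V2 \<in> around U" for V1 V2
    using der_cocycle[OF VG that h] that by (simp add: tangent_of_def)
qed (simp add: tangent_of_def)

lemma tangent_of_chart: "V \<in> around U \<Longrightarrow> h \<in> vecs (Hom V) \<Longrightarrow> tangent_of V U h V = h"
  by (simp add: tangent_of_def der_self)

lemma TV_in: "\<xi> \<in> TV U \<Longrightarrow> V \<in> around U \<Longrightarrow> \<xi> V \<in> vecs (Hom V)"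
  and TV_der: "\<xi> \<in> TV U \<Longrightarrow> V \<in> around U \<Longrightarrow> V' \<in> around U \<Longrightarrow> \<xi> V' = der V V' U (\<xi> V)"
  and TV_outside: "\<xi> \<in> TV U \<Longrightarrow> V \<notin> around U \<Longrightarrow> \<xi> V = 0"
  unfolding TV_iff by blast+

lemma tangent_of_TV: "V \<in> around U \<Longrightarrow> \<xi> \<in> TV U \<Longrightarrow> tangent_of V U (\<xi> V) = \<xi>"
proof
  fix V' assume V: "V \<in> around U" and \<xi>: "\<xi> \<in> TV U"
  show "tangent_of V U (\<xi> V) V' = \<xi> V'"
    using TV_der[OF \<xi> V, of V'] TV_outside[OF \<xi>, of V'] unfolding tangent_of_def by (cases "V' \<in> around U") simp_all
qed

lemma TV_csubspace: "csubspace (TV U)"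
  unfolding csubspace_def
proof (intro conjI ballI allI)
  have lin: "der V V' U (h + k) = der V V' U h + der V V' U k" "der V V' U (c *\<^sub>C h) = c *\<^sub>C der V V' U h"
    if "V \<in> around U" "V' \<in> around U" "h \<in> vecs (Hom V)" "k \<in> vecs (Hom V)" for V V' h k c
    using op_add[OF der_operator[OF aroundD(1)[OF that(1)] aroundD(2)[OF that(2)]]]
      op_scale[OF der_operator[OF aroundD(1)[OF that(1)] aroundD(2)[OF that(2)]]] that(3,4) by auto
  have zero: "der V V' U 0 = 0" if "V \<in> around U" "V' \<in> around U" for V V'
    using op_zero[OF Hom_normed[OF aroundD(1)[OF that(1)]] der_operator[OF aroundD(1)[OF that(1)] aroundD(2)[OF that(2)]]] .
  show "0 \<in> TV U"
    unfolding TV_iff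
  proof (intro conjI ballI allI impI)
    fix V assume V: "V \<in> around U"
    show "(0 :: 'a set \<Rightarrow> 'a \<Rightarrow> 'a) V \<in> vecs (Hom V)" using nsD_0[OF Hom_normed[OF aroundD(1)[OF V]]] by simp
    show "(0 :: 'a set \<Rightarrow> 'a \<Rightarrow> 'a) V' = der V V' U ((0 :: 'a set \<Rightarrow> 'a \<Rightarrow> 'a) V)" if "V' \<in> around U" for V'
      using zero[OF V that] by simp
  qed simp
  fix \<xi> assume \<xi>: "\<xi> \<in> TV U"
  show "\<xi> + \<eta> \<in> TV U" if \<eta>: "\<eta> \<in> TV U" for \<eta>
    unfolding TV_iff
  proof (intro conjI ballI allI impI)
    fix V V' assume V: "V \<in> around U" and V': "V' \<in> around U"
    show "(\<xi> + \<eta>) V' = der V V' U ((\<xi> + \<eta>) V)"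
      unfolding plus_fun_apply lin(1)[OF V V' TV_in[OF \<xi> V] TV_in[OF \<eta> V]]
      by (simp only: TV_der[OF \<xi> V V'] TV_der[OF \<eta> V V'])
  next
    fix V assume V: "V \<in> around U"
    show "(\<xi> + \<eta>) V \<in> vecs (Hom V)"
      unfolding plus_fun_apply[of \<xi> \<eta> V] by (rule nsD_add[OF Hom_normed[OF aroundD(1)[OF V]] TV_in[OF \<xi> V] TV_in[OF \<eta> V]])
  next
    fix V assume "V \<notin> around U"
    then show "(\<xi> + \<eta>) V = 0" using TV_outside[OF \<xi>] TV_outside[OF \<eta>] by (simp add: fun_eq_iff)
  qed
  show "c *\<^sub>C \<xi> \<in> TV U" for c
    unfolding TV_iff
  proof (intro conjI ballI allI impI)
    fix V V' assume V: "V \<in> around U" and V': "V' \<in> around U"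
    have e: "(c *\<^sub>C \<xi>) W = c *\<^sub>C \<xi> W" for W by (simp add: scaleC_fun_def)
    show "(c *\<^sub>C \<xi>) V' = der V V' U ((c *\<^sub>C \<xi>) V)"
      unfolding e lin(2)[OF V V' TV_in[OF \<xi> V] TV_in[OF \<xi> V]] by (simp only: TV_der[OF \<xi> V V'])
  next
    fix V assume V: "V \<in> around U"
    have "c *\<^sub>C \<xi> V \<in> vecs (Hom V)" by (rule nsD_scale[OF Hom_normed[OF aroundD(1)[OF V]] TV_in[OF \<xi> V]])
    then show "(c *\<^sub>C \<xi>) V \<in> vecs (Hom V)" by (simp add: scaleC_fun_def)
  next
    fix V assume "V \<notin> around U"
    then show "(c *\<^sub>C \<xi>) V = 0" using TV_outside[OF \<xi>] by (simp add: scaleC_fun_def fun_eq_iff)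
  qed
qed

lemma TS_simps [simp]: "vecs (TS V U) = TV U" "nrm (TS V U) \<xi> = nrm (Hom V) (\<xi> V)"
  by (simp_all add: tangent_space_def tangent_chart_def)

lemma scaleC_fun_apply: "(c *\<^sub>C f) x = c *\<^sub>C f x"
  by (simp add: scaleC_fun_def)

lemma TS_normed:
  assumes V: "V \<in> around U"
  shows "normed_space (TS V U)"
  unfolding normed_space_def
proof (intro conjI ballI allI)
  note X = Hom_normed[OF aroundD(1)[OF V]]
  show "csubspace (vecs (TS V U))" using TV_csubspace by simp
  fix \<xi> assume "\<xi> \<in> vecs (TS V U)"
  then have \<xi>: "\<xi> \<in> TV U" by simp
  note h = TV_in[OF \<xi> V]
  show "0 \<le> nrm (TS V U) \<xi>" using nsD_nonneg[OF X h] by simp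
  show "nrm (TS V U) \<xi> = 0 \<longleftrightarrow> \<xi> = 0"
  proof
    assume "nrm (TS V U) \<xi> = 0"
    then have "\<xi> V = (0 :: 'a set \<Rightarrow> 'a \<Rightarrow> 'a) V" using nsD_zero_iff[OF X h] by simp
    then have "tangent_of V U (\<xi> V) = tangent_of V U ((0 :: 'a set \<Rightarrow> 'a \<Rightarrow> 'a) V)" by (rule arg_cong)
    then show "\<xi> = 0" unfolding tangent_of_TV[OF V \<xi>] tangent_of_TV[OF V csubspaceD(1)[OF TV_csubspace]] .
  qed (simp add: nsD_nrm0[OF X])
  show "nrm (TS V U) (c *\<^sub>C \<xi>) = cmod c * nrm (TS V U) \<xi>" for c
    using nsD_nscale[OF X h] by (simp add: scaleC_fun_apply)
  fix \<eta> assume "\<eta> \<in> vecs (TS V U)"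
  then show "nrm (TS V U) (\<xi> + \<eta>) \<le> nrm (TS V U) \<xi> + nrm (TS V U) \<eta>"
    using nsD_tri[OF X h TV_in[OF _ V]] by simp
qed

subsection \<open>The cotangent bundle\<close>

text \<open>\<open>pull\<close> transports a functional on the model space to the tangent space by
  the tangent map of the chart. Its inverse \<open>push\<close> is the fibrewise trivialization of
  the cotangent bundle, by \<open>triv_push\<close>.\<close>

definition pull :: "'h::complex_hilbert set \<Rightarrow> 'h set \<Rightarrow> (('h \<Rightarrow> 'h) \<Rightarrow> complex) \<Rightarrow> ('h set \<Rightarrow> 'h \<Rightarrow> 'h) \<Rightarrow> complex"
  where "pull V U \<phi> = zero_outside (TV U) (\<lambda>\<xi>. \<phi> (\<xi> V))"

definition push :: "'h::complex_hilbert set \<Rightarrow> 'h set \<Rightarrow> (('h set \<Rightarrow> 'h \<Rightarrow> 'h) \<Rightarrow> complex) \<Rightarrow> ('h \<Rightarrow> 'h) \<Rightarrow> complex"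
  where "push V U f = zero_outside (vecs (Hom V)) (\<lambda>h. f (tangent_of V U h))"

lemma pull_apply: "\<xi> \<in> TV U \<Longrightarrow> pull V U \<phi> \<xi> = \<phi> (\<xi> V)"
  by (simp add: pull_def zero_outside_def)

lemma push_apply: "h \<in> vecs (Hom V) \<Longrightarrow> push V U f h = f (tangent_of V U h)"
  by (simp add: push_def zero_outside_def)

lemma pull_lin: "pull V U (\<phi> + \<psi>) = pull V U \<phi> + pull V U \<psi>" "pull V U (c *\<^sub>C \<phi>) = c *\<^sub>C pull V U \<phi>"
proof -
  show "pull V U (\<phi> + \<psi>) = pull V U \<phi> + pull V U \<psi>"
  proof
    fix \<xi> show "pull V U (\<phi> + \<psi>) \<xi> = (pull V U \<phi> + pull V U \<psi>) \<xi>"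
      unfolding plus_fun_apply pull_def zero_outside_def by (cases "\<xi> \<in> TV U") simp_all
  qed
  show "pull V U (c *\<^sub>C \<phi>) = c *\<^sub>C pull V U \<phi>"
  proof
    fix \<xi> show "pull V U (c *\<^sub>C \<phi>) \<xi> = (c *\<^sub>C pull V U \<phi>) \<xi>"
      unfolding scaleC_fun_apply pull_def zero_outside_def by (cases "\<xi> \<in> TV U") simp_all
  qed
qed

lemma push_lin: "push V U (f + g) = push V U f + push V U g" "push V U (c *\<^sub>C f) = c *\<^sub>C push V U f"
proof -
  show "push V U (f + g) = push V U f + push V U g"
  proof
    fix h show "push V U (f + g) h = (push V U f + push V U g) h"
      unfolding plus_fun_apply push_def zero_outside_def by (cases "h \<in> vecs (Hom V)") simp_all
  qed
  show "push V U (c *\<^sub>C f) = c *\<^sub>C push V U f"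
  proof
    fix h show "push V U (c *\<^sub>C f) h = (c *\<^sub>C push V U f) h"
      unfolding scaleC_fun_apply push_def zero_outside_def by (cases "h \<in> vecs (Hom V)") simp_all
  qed
qed

lemma pull_dual:
  assumes V: "V \<in> around U" and \<phi>: "\<phi> \<in> vecs (dual (Hom V))"
  shows "pull V U \<phi> \<in> vecs (dual (TS V U))" and "nrm (dual (TS V U)) (pull V U \<phi>) \<le> nrm (dual (Hom V)) \<phi>"
proof -
  note X = Hom_normed[OF aroundD(1)[OF V]]
  have b: "cmod (pull V U \<phi> \<xi>) \<le> nrm (dual (Hom V)) \<phi> * nrm (TS V U) \<xi>" if "\<xi> \<in> vecs (TS V U)" for \<xi>
    using that dual_bound[OF X \<phi> TV_in[OF _ V]] by (simp add: pull_apply)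
  show "pull V U \<phi> \<in> vecs (dual (TS V U))"
  proof (rule dualI[OF _ _ b])
    fix \<xi> assume "\<xi> \<in> vecs (TS V U)"
    then have \<xi>: "\<xi> \<in> TV U" by simp
    show "pull V U \<phi> (c *\<^sub>C \<xi>) = c * pull V U \<phi> \<xi>" for c
      using csubspaceD(3)[OF TV_csubspace \<xi>] dual_scale[OF \<phi> TV_in[OF \<xi> V]]
      by (simp add: pull_apply[OF \<xi>] pull_apply scaleC_fun_apply)
    fix \<eta> assume "\<eta> \<in> vecs (TS V U)"
    then have \<eta>: "\<eta> \<in> TV U" by simp
    show "pull V U \<phi> (\<xi> + \<eta>) = pull V U \<phi> \<xi> + pull V U \<phi> \<eta>"
      using csubspaceD(2)[OF TV_csubspace \<xi> \<eta>] dual_add[OF \<phi> TV_in[OF \<xi> V] TV_in[OF \<eta> V]]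
      by (simp add: pull_apply[OF \<xi>] pull_apply[OF \<eta>] pull_apply)
  qed (simp_all add: pull_def zero_outside_def)
  show "nrm (dual (TS V U)) (pull V U \<phi>) \<le> nrm (dual (Hom V)) \<phi>"
    using b by (rule dual_norm_le[OF TS_normed[OF V] nsD_nonneg[OF dual_normed[OF X] \<phi>]])
qed

lemma tangent_of_lin:
  assumes V: "V \<in> around U" and h: "h \<in> vecs (Hom V)"
  shows "k \<in> vecs (Hom V) \<Longrightarrow> tangent_of V U (h + k) = tangent_of V U h + tangent_of V U k"
    and "tangent_of V U (c *\<^sub>C h) = c *\<^sub>C tangent_of V U h"
proof -
  note D = der_operator[OF aroundD(1)[OF V] aroundD(2)]
  show "tangent_of V U (h + k) = tangent_of V U h + tangent_of V U k" if "k \<in> vecs (Hom V)"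
    using op_add[OF D h that] by (auto simp: tangent_of_def fun_eq_iff)
  show "tangent_of V U (c *\<^sub>C h) = c *\<^sub>C tangent_of V U h"
    using op_scale[OF D h] by (auto simp: tangent_of_def fun_eq_iff scaleC_fun_apply)
qed

lemma push_dual:
  assumes V: "V \<in> around U" and f: "f \<in> vecs (dual (TS V U))"
  shows "push V U f \<in> vecs (dual (Hom V))"
proof (rule dualI[where K = "nrm (dual (TS V U)) f"])
  note X = Hom_normed[OF aroundD(1)[OF V]]
  fix h assume h: "h \<in> vecs (Hom V)"
  have t: "tangent_of V U h \<in> vecs (TS V U)" using tangent_of_in[OF V h] by simp
  show "push V U f (c *\<^sub>C h) = c * push V U f h" for c
    using dual_scale[OF f t] nsD_scale[OF X h] by (simp add: push_apply h tangent_of_lin(2)[OF V h])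
  show "cmod (push V U f h) \<le> nrm (dual (TS V U)) f * nrm (Hom V) h"
    using dual_bound[OF TS_normed[OF V] f t] by (simp add: push_apply h tangent_of_chart[OF V h])
  fix k assume k: "k \<in> vecs (Hom V)"
  have t': "tangent_of V U k \<in> vecs (TS V U)" using tangent_of_in[OF V k] by simp
  show "push V U f (h + k) = push V U f h + push V U f k"
    using dual_add[OF f t t'] nsD_add[OF X h k] by (simp add: push_apply h k tangent_of_lin(1)[OF V h k])
qed (simp add: push_def zero_outside_def)

lemma push_pull:
  assumes V: "V \<in> around U" and \<phi>: "\<phi> \<in> vecs (dual (Hom V))"
  shows "push V U (pull V U \<phi>) = \<phi>"
proof
  fix h show "push V U (pull V U \<phi>) h = \<phi> h"
  proof (cases "h \<in> vecs (Hom V)")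
    case True
    have "push V U (pull V U \<phi>) h = pull V U \<phi> (tangent_of V U h)" by (rule push_apply[OF True])
    also have "\<dots> = \<phi> (tangent_of V U h V)" by (rule pull_apply[OF tangent_of_in[OF V True]])
    finally show ?thesis unfolding tangent_of_chart[OF V True] .
  next
    case False
    then show ?thesis unfolding push_def zero_outside_def using dual_outside[OF \<phi> False] by simp
  qed
qed

lemma pull_push:
  assumes V: "V \<in> around U" and f: "f \<in> vecs (dual (TS V U))"
  shows "pull V U (push V U f) = f"
proof
  fix \<xi> show "pull V U (push V U f) \<xi> = f \<xi>"
  proof (cases "\<xi> \<in> TV U")
    case True
    have "pull V U (push V U f) \<xi> = push V U f (\<xi> V)" by (rule pull_apply[OF True])
    also have "\<dots> = f (tangent_of V U (\<xi> V))" by (rule push_apply[OF TV_in[OF True V]])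
    finally show ?thesis unfolding tangent_of_TV[OF V True] .
  next
    case False
    then have "f \<xi> = 0" using dual_outside[OF f, of \<xi>] by (simp only: TS_simps not_False_eq_True)
    then show ?thesis unfolding pull_def zero_outside_def using False by simp
  qed
qed

lemma der_dual:
  assumes V: "V \<in> Gr" and V': "V' \<in> around U" and \<phi>: "\<phi> \<in> vecs (dual (Hom V'))"
  shows "\<phi> \<circ> der V V' U \<in> vecs (dual (Hom V))"
  using \<phi> unfolding dual_def
  by (rule operators_compose(1)[OF Hom_normed[OF V] Hom_normed[OF aroundD(1)[OF V']] complex_normed _ der_operator[OF V aroundD(2)[OF V']]])

lemma pull_change:
  assumes V: "V \<in> around U" and V': "V' \<in> around U"
  shows "pull V' U \<phi> = pull V U (\<phi> \<circ> der V V' U)"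
proof
  fix \<xi> show "pull V' U \<phi> \<xi> = pull V U (\<phi> \<circ> der V V' U) \<xi>"
    using TV_der[OF _ V V', of \<xi>] unfolding pull_def zero_outside_def o_apply by (cases "\<xi> \<in> TV U") simp_all
qed

text \<open>The derivatives between charts are bounded, so the norms that two charts induce on the
  tangent space admit the same bounded functionals. The union in \<open>cotangent_vectors\<close>
  therefore reduces to one dual space.\<close>

lemma dual_TS_subset:
  assumes V: "V \<in> around U" and V': "V' \<in> around U"
  shows "vecs (dual (TS V' U)) \<subseteq> vecs (dual (TS V U))"
proof
  fix f assume f: "f \<in> vecs (dual (TS V' U))"
  have "f = pull V U (push V' U f \<circ> der V V' U)" using pull_push[OF V' f] unfolding pull_change[OF V V'] by (rule sym)
  moreover have "pull V U (push V' U f \<circ> der V V' U) \<in> vecs (dual (TS V U))"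
    by (rule pull_dual(1)[OF V der_dual[OF aroundD(1)[OF V] V' push_dual[OF V' f]]])
  ultimately show "f \<in> vecs (dual (TS V U))" by (simp only:)
qed

lemma cotangent_vectors_eq: "V \<in> around U \<Longrightarrow> cotangent_vectors Gr_manifold U = vecs (dual (TS V U))"
  unfolding cotangent_vectors_def using dual_TS_subset by (intro equalityI UN_least UN_upper) auto

lemma cotangent_bundle_simps [simp]:
  "fibre (cotangent_bundle Gr_manifold) U = cotangent_vectors Gr_manifold U"
  "bindex (cotangent_bundle Gr_manifold) = Gr" "bdomain (cotangent_bundle Gr_manifold) = Gr_domain"
  "bmodel (cotangent_bundle Gr_manifold) V = dual (Hom V)"
  by (simp_all add: cotangent_bundle_def)

lemma triv_push:
  assumes V: "V \<in> around U"
  shows "triv (cotangent_bundle Gr_manifold) V U = push V U"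
proof -
  have "inv_into (TV U) (tangent_chart V) h = tangent_of V U h" if h: "h \<in> vecs (Hom V)" for h
  proof (rule inv_into_f_eq)
    show "inj_on (tangent_chart V) (TV U)"
      using tangent_of_TV[OF V] by (intro inj_onI) (metis tangent_chart_def)
  qed (use tangent_of_in[OF V h] tangent_of_chart[OF V h] in \<open>simp_all add: tangent_chart_def\<close>)
  then show ?thesis by (intro ext) (simp add: cotangent_bundle_def push_def zero_outside_def)
qed

lemma push_bij:
  assumes V: "V \<in> around U"
  shows "bij_betw (push V U) (cotangent_vectors Gr_manifold U) (vecs (dual (Hom V)))"
  unfolding cotangent_vectors_eq[OF V]
  by (rule bij_betw_byWitness[where f' = "pull V U"])
    (use push_pull[OF V] pull_push[OF V] pull_dual(1)[OF V] push_dual[OF V] in auto)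

text \<open>Covectors transform contravariantly: going from the chart \<open>V\<close> to
  \<open>V'\<close> means composing with the derivative in the opposite direction, from
  \<open>V'\<close> to \<open>V\<close>.\<close>

lemma fibre_transition_eq:
  assumes V: "V \<in> around U" and V': "V' \<in> around U"
  shows "fibre_transition (cotangent_vectors Gr_manifold U) (dual (Hom V)) (push V U) (push V' U)
    = transposed (vecs (dual (Hom V))) (der V' V U)"
proof
  fix \<phi>
  show "fibre_transition (cotangent_vectors Gr_manifold U) (dual (Hom V)) (push V U) (push V' U) \<phi>
    = transposed (vecs (dual (Hom V))) (der V' V U) \<phi>"
  proof (cases "\<phi> \<in> vecs (dual (Hom V))")
    case True
    have "inv_into (cotangent_vectors Gr_manifold U) (push V U) \<phi> = pull V U \<phi>"
      using push_bij[OF V] pull_dual(1)[OF V True] push_pull[OF V True]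
      by (intro inv_into_f_eq) (auto simp: bij_betw_def cotangent_vectors_eq[OF V])
    moreover have "push V' U (pull V U \<phi>) = \<phi> \<circ> der V' V U"
      unfolding pull_change[OF V' V] by (rule push_pull[OF V' der_dual[OF aroundD(1)[OF V'] V True]])
    ultimately show ?thesis using True by (simp add: fibre_transition_def transposed_def zero_outside_def)
  qed (simp add: fibre_transition_def transposed_def zero_outside_def)
qed

lemma open_in_Int: "open_in X S \<Longrightarrow> open_in X T \<Longrightarrow> open_in X (S \<inter> T)"
  unfolding open_in_def
proof (intro conjI ballI)
  assume S: "S \<subseteq> vecs X \<and> (\<forall>x\<in>S. \<exists>e>0. \<forall>y\<in>vecs X. nrm X (y - x) < e \<longrightarrow> y \<in> S)"
    and T: "T \<subseteq> vecs X \<and> (\<forall>x\<in>T. \<exists>e>0. \<forall>y\<in>vecs X. nrm X (y - x) < e \<longrightarrow> y \<in> T)"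
  then show "S \<inter> T \<subseteq> vecs X" by blast
  fix x assume "x \<in> S \<inter> T"
  then obtain e1 e2 where "e1 > 0" "\<forall>y\<in>vecs X. nrm X (y - x) < e1 \<longrightarrow> y \<in> S"
    "e2 > 0" "\<forall>y\<in>vecs X. nrm X (y - x) < e2 \<longrightarrow> y \<in> T" using S T by blast
  then show "\<exists>e>0. \<forall>y\<in>vecs X. nrm X (y - x) < e \<longrightarrow> y \<in> S \<inter> T"
    by (intro exI[of _ "min e1 e2"]) auto
qed

lemma Cn_subset:
  assumes "Cn n X U Y f" "U' \<subseteq> U"
  shows "Cn n X U' Y f"
proof -
  obtain D where D: "jet n X U Y f D" using assms(1) by (auto simp: Cn_def)
  have "has_fderiv X U' Z F T x" if "has_fderiv X U Z F T x" for Z :: "('a list \<Rightarrow> 'b) nspace" and F T x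
    using that assms(2) unfolding has_fderiv_def by (meson subsetD)
  then have "jet n X U' Y f D" using D assms(2) unfolding jet_def by blast
  then show ?thesis by (auto simp: Cn_def)
qed

text \<open>The set \<open>S\<close> is tied to the intersection by an equation because
  \<open>local_trivialization\<close> has the two domains in one fixed order while the transition is
  needed in both directions.\<close>

lemma fibre_transition_smooth:
  fixes V1 V2 :: "'h::complex_hilbert set"
  assumes V1: "V1 \<in> Gr" and V2: "V2 \<in> Gr" and S: "S = Gr_domain V1 \<inter> Gr_domain V2"
  shows "smooth_map Gr_manifold S (operators (dual (Hom V1)) (dual (Hom V2)))
    (\<lambda>q. fibre_transition (cotangent_vectors Gr_manifold q) (dual (Hom V1))
      (triv (cotangent_bundle Gr_manifold) V1 q) (triv (cotangent_bundle Gr_manifold) V2 q))"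
  unfolding smooth_map_def Gr_manifold_simps
proof (intro ballI)
  fix V :: "'h set" assume V: "V \<in> Gr"
  let ?O = "overlap V (Gr_domain V1) \<inter> overlap V (Gr_domain V2)"
  let ?Y = "operators (dual (Hom V1)) (dual (Hom V2))"
  let ?f = "\<lambda>q. fibre_transition (cotangent_vectors Gr_manifold q) (dual (Hom V1))
      (triv (cotangent_bundle Gr_manifold) V1 q) (triv (cotangent_bundle Gr_manifold) V2 q)"
  note X = Hom_normed[OF V]
  have O: "Gr_chart V ` (S \<inter> Gr_domain V) = ?O"
    unfolding S chart_image(1)[OF V] by (auto simp: overlap_def)
  have op: "open_in (Hom V) ?O" by (intro open_in_Int overlap_open V V1 V2)
  have sub: "overlap V (Gr_domain V1) \<subseteq> vecs (Hom V)" by (auto simp: overlap_def)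
  have "Cn n (Hom V) ?O ?Y (\<lambda>A. ?f (inv_chart Gr_manifold V A))" for n
  proof (rule Cn_cong)
    show "Cn n (Hom V) ?O ?Y (\<lambda>A. transposed (vecs (dual (Hom V1))) (der V2 V1 (graph V A)))"
      by (rule Cn_subset[OF Cn_transposed[OF X sub Hom_normed[OF V2] Hom_normed[OF V1] Cn_der[OF V V2 V1]]]) blast
    fix A assume A: "A \<in> ?O"
    then have "A \<in> vecs (Hom V)" "V1 \<in> around (graph V A)" "V2 \<in> around (graph V A)"
      using V1 V2 by (auto simp: overlap_def charts_at_def)
    then show "transposed (vecs (dual (Hom V1))) (der V2 V1 (graph V A)) = ?f (inv_chart Gr_manifold V A)"
      by (simp add: inv_chart_graph[OF V] triv_push fibre_transition_eq)
  qed
  then show "smooth_on (Hom V) (Gr_chart V ` (S \<inter> Gr_domain V)) ?Y (\<lambda>A. ?f (inv_chart Gr_manifold V A))"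
    unfolding O
    by (intro smooth_onI[OF X _ op] normed_operators dual_normed Hom_normed V1 V2)
qed

lemma Gr_domain_open: "V \<in> Gr \<Longrightarrow> manifold_open Gr_manifold (Gr_domain V)"
  unfolding manifold_open_def using Gr_domain_Gr by (auto simp: points_Gr chart_image(1) overlap_open)

lemma cotangent_trivialization:
  assumes V: "V \<in> Gr"
  shows "local_trivialization Gr_manifold (cotangent_bundle Gr_manifold) (Gr_domain V) (dual (Hom V))
    (triv (cotangent_bundle Gr_manifold) V)"
  unfolding local_trivialization_def cotangent_bundle_simps
proof (intro conjI ballI)
  show "manifold_open Gr_manifold (Gr_domain V)" by (rule Gr_domain_open[OF V])
  show "banach_space (dual (Hom V))" by (rule dual_banach[OF Hom_normed[OF V]])
  show "bij_betw (triv (cotangent_bundle Gr_manifold) V U) (cotangent_vectors Gr_manifold U) (vecs (dual (Hom V)))"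
    "linear_on (cotangent_vectors Gr_manifold U) (triv (cotangent_bundle Gr_manifold) V U)"
    if "U \<in> Gr_domain V" for U
  proof -
    have a: "V \<in> around U" using V that by (simp add: charts_at_def)
    show "bij_betw (triv (cotangent_bundle Gr_manifold) V U) (cotangent_vectors Gr_manifold U) (vecs (dual (Hom V)))"
      unfolding triv_push[OF a] by (rule push_bij[OF a])
    show "linear_on (cotangent_vectors Gr_manifold U) (triv (cotangent_bundle Gr_manifold) V U)"
      unfolding triv_push[OF a] linear_on_def by (simp add: push_lin)
  qed
  fix W :: "'a set" assume W: "W \<in> Gr"
  show "smooth_map Gr_manifold (Gr_domain V \<inter> Gr_domain W) (operators (dual (Hom W)) (dual (Hom V)))
     (\<lambda>q. fibre_transition (cotangent_vectors Gr_manifold q) (dual (Hom W))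
       (triv (cotangent_bundle Gr_manifold) W q) (triv (cotangent_bundle Gr_manifold) V q))"
    by (rule fibre_transition_smooth[OF W V]) blast
  show "smooth_map Gr_manifold (Gr_domain V \<inter> Gr_domain W) (operators (dual (Hom V)) (dual (Hom W)))
     (\<lambda>q. fibre_transition (cotangent_vectors Gr_manifold q) (dual (Hom V))
       (triv (cotangent_bundle Gr_manifold) V q) (triv (cotangent_bundle Gr_manifold) W q))"
    by (rule fibre_transition_smooth[OF V W]) blast
qed

lemma cotangent_bundle_Gr:
  "banach_vector_bundle (Gr_manifold :: ('h::complex_hilbert set, 'h set, 'h \<Rightarrow> 'h) manifold) (cotangent_bundle Gr_manifold)"
  unfolding banach_vector_bundle_def cotangent_bundle_simps points_Gr
proof (intro conjI ballI)
  show "csubspace (cotangent_vectors Gr_manifold U)" if "U \<in> Gr" for U :: "'h set"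
    unfolding cotangent_vectors_eq[OF around_self[OF that]]
    by (rule nsD_sub[OF dual_normed[OF TS_normed[OF around_self[OF that]]]])
  show "(\<Union>V\<in>Gr. Gr_domain V) = (Gr :: 'h set set)" using points_Gr by (simp add: points_def)
qed (rule Gr_banach_manifold, rule cotangent_trivialization)

subsection \<open>The fibres of the precotangent bundle\<close>

lemma predual_change:
  assumes V: "V \<in> around U" and V': "V' \<in> around U" and \<phi>: "\<phi> \<in> predual V'"
  shows "\<phi> \<circ> der V V' U \<in> predual V"
proof -
  note VG = aroundD(1)[OF V] and VG' = aroundD(1)[OF V'] and i' = aroundD(2)[OF V']
  obtain I a b where n: "nuclear V' I a b" and eq: "\<phi> = nuclear_functional V' I a b" using \<phi> by (rule predualE)
  have ab: "a i \<in> orth V'" "b i \<in> V'" if "i \<in> I" for i using n that by (auto simp: nuclear_def)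
  \<comment> \<open>The adjoint acts on the whole space and may leave \<open>orth V\<close>.
    Projecting back does not change the functional, since the vectors it is paired with lie in
    \<open>orth V\<close>.\<close>
  define a' where "a' i = proj (orth V) (adj (along V' U) (a i))" for i
  define b' where "b' i = proj V (lift V' U (b i))" for i
  note bal = bclin_along[OF i'] and bad = bclin_adj[OF bclin_along[OF i']] and bl = bclin_lift[OF i']
  obtain K where K: "K \<ge> 0" "\<And>x. norm (adj (along V' U) x) \<le> K * norm x" using bclin_bound[OF bad] by blast
  obtain L where L: "L \<ge> 0" "\<And>x. norm (lift V' U x) \<le> L * norm x" using bclin_bound[OF bl] by blast
  have bd: "norm (a' i) * norm (b' i) \<le> (K * L) * (norm (a i) * norm (b i))" for i
  proof -
    have "norm (a' i) * norm (b' i) \<le> (K * norm (a i)) * (L * norm (b i))"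
      unfolding a'_def b'_def using K L
      by (intro mult_mono order_trans[OF norm_proj_le[OF orth_Gr] K(2)] order_trans[OF norm_proj_le[OF VG] L(2)]) auto
    then show ?thesis by (simp add: ac_simps)
  qed
  have "(\<lambda>i. (K * L) * (norm (a i) * norm (b i))) summable_on I"
    using n by (intro summable_on_cmult_right) (simp add: nuclear_def)
  then have "(\<lambda>i. norm (a' i) * norm (b' i)) summable_on I"
    by (rule summable_on_comparison_test) (use bd in auto)
  then have n': "nuclear V I a' b'" by (simp add: nuclear_def a'_def b'_def proj_in[OF orth_Gr] proj_in[OF VG])
  have "(\<phi> \<circ> der V V' U) h = nuclear_functional V I a' b' h" for h
  proof (cases "h \<in> vecs (Hom V)")
    case True
    have "cinner (a i) (der V V' U h (b i)) = cinner (a' i) (h (b' i))" if i: "i \<in> I" for i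
    proof -
      have hb: "h (b' i) \<in> orth V" by (rule Hom_in[OF True]) (simp add: b'_def proj_in[OF VG])
      have "cinner (a i) (der V V' U h (b i)) = cinner (a i) (along V' U (h (b' i)))"
        by (simp add: der_apply[OF True VG ab(2)[OF i]] b'_def)
      also have "\<dots> = cinner (adj (along V' U) (a i)) (h (b' i))" by (simp add: cinner_adj_left[OF bal])
      also have "\<dots> = cinner (a' i) (h (b' i))" by (simp add: a'_def proj_cinner_left[OF orth_Gr hb])
      finally show ?thesis .
    qed
    then show ?thesis
      using True der_in[OF VG V' True] by (simp add: eq nuclear_functional_def zero_outside_def cong: infsum_cong)
  next
    case False
    have "der V V' U h = 0" using op_outside[OF der_operator[OF VG i'] False] .
    then show ?thesis
      using False op_zero[OF Hom_normed[OF VG'], of \<phi>] predual_dual[OF VG' \<phi>]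
      by (simp add: nuclear_functional_def zero_outside_def dual_def)
  qed
  then have "\<phi> \<circ> der V V' U = nuclear_functional V I a' b'" by (rule ext)
  then show ?thesis using n' by (auto simp: predual_def)
qed

lemma pull_predual_eq:
  assumes V: "V \<in> around U" and V': "V' \<in> around U"
  shows "pull V U ` predual V = pull V' U ` predual V'"
proof (intro equalityI image_subsetI)
  fix \<phi> assume "\<phi> \<in> predual V"
  then show "pull V U \<phi> \<in> pull V' U ` predual V'"
    unfolding pull_change[OF V' V] by (intro imageI predual_change[OF V' V])
next
  fix \<phi> assume "\<phi> \<in> predual V'"
  then show "pull V' U \<phi> \<in> pull V U ` predual V"
    unfolding pull_change[OF V V'] by (intro imageI predual_change[OF V V'])
qed

section \<open>The evaluation map is an isomorphism\<close>

lemma normed_restrict: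
  "normed_space X \<Longrightarrow> csubspace Z \<Longrightarrow> Z \<subseteq> vecs X \<Longrightarrow> normed_space (restrict_nspace X Z)"
  unfolding normed_space_def restrict_nspace_def by (simp add: subset_iff)

lemma inv_into_linear_on:
  assumes b: "bij_betw T V W" and l: "linear_on V T" and V: "csubspace V"
  shows "linear_on W (inv_into V T)"
proof -
  have i: "inv_into V T y \<in> V" "T (inv_into V T y) = y" if "y \<in> W" for y
    using b that by (auto simp: bij_betw_def inv_into_into f_inv_into_f)
  have u: "inv_into V T (T x) = x" if "x \<in> V" for x using b that by (simp add: bij_betw_def)
  have "inv_into V T (x + y) = inv_into V T x + inv_into V T y" if "x \<in> W" "y \<in> W" for x y
    using u[OF csubspaceD(2)[OF V i(1)[OF that(1)] i(1)[OF that(2)]]] l i that by (simp add: linear_on_def)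
  moreover have "inv_into V T (c *\<^sub>C x) = c *\<^sub>C inv_into V T x" if "x \<in> W" for c x
    using u[OF csubspaceD(3)[OF V i(1)[OF that]], of c] l i that by (simp add: linear_on_def)
  ultimately show ?thesis by (simp add: linear_on_def)
qed

text \<open>Evaluation is isometric for the norm of the chart: the upper estimate is the definition
  of the dual norm, the lower one says that the predual is norming. Surjectivity is the bidual
  statement carried over from the model space.\<close>

lemma evaluation_iso:
  assumes V: "V \<in> around U" and P: "P = pull V U ` predual V"
  shows "banach_iso (TS V U) (dual (restrict_nspace (dual (TS V U)) P)) (evaluation P)"
proof -
  note VG = aroundD(1)[OF V] and X = Hom_normed[OF aroundD(1)[OF V]] and T = TS_normed[OF V]
    and D = dual_normed[OF TS_normed[OF V]]
  have PD: "P \<subseteq> vecs (dual (TS V U))" unfolding P using pull_dual(1)[OF V] predual_dual[OF VG] by blast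
  have Psub: "csubspace P"
    unfolding csubspace_def P
  proof (intro conjI ballI allI)
    have "pull V U 0 = 0" by (auto simp: pull_def zero_outside_def)
    then show "0 \<in> pull V U ` predual V" using csubspaceD(1)[OF predual_csubspace[OF VG]] by force
  qed (auto simp: pull_lin[symmetric] intro!: imageI csubspaceD(2,3)[OF predual_csubspace[OF VG]])
  let ?R = "restrict_nspace (dual (TS V U)) P"
  have R: "normed_space ?R" by (rule normed_restrict[OF D Psub PD])
  have Rs: "vecs ?R = P" "nrm ?R = nrm (dual (TS V U))" by (simp_all add: restrict_nspace_def)
  have ev: "evaluation P \<xi> f = f \<xi>" if "f \<in> P" for \<xi> f using that by (simp add: evaluation_def zero_outside_def)
  have evo: "evaluation P \<xi> f = 0" if "f \<notin> P" for \<xi> f using that by (simp add: evaluation_def zero_outside_def)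
  have fb: "cmod (f \<xi>) \<le> nrm (TS V U) \<xi> * nrm (dual (TS V U)) f" if "f \<in> P" "\<xi> \<in> TV U" for f \<xi>
    using dual_bound[OF T, of f \<xi>] PD that by (auto simp: mult.commute)
  have evD: "evaluation P \<xi> \<in> vecs (dual ?R)" if \<xi>: "\<xi> \<in> TV U" for \<xi>
    by (rule dualI[where K = "nrm (TS V U) \<xi>"])
      (use fb[OF _ \<xi>] csubspaceD(2,3)[OF Psub] in \<open>auto simp: Rs ev evo scaleC_fun_apply\<close>)
  have lin: "linear_on (TV U) (evaluation P)"
    unfolding linear_on_def
  proof (intro conjI ballI allI ext)
    fix \<xi> \<eta> f assume \<xi>: "\<xi> \<in> TV U" and \<eta>: "\<eta> \<in> TV U"
    show "evaluation P (\<xi> + \<eta>) f = (evaluation P \<xi> + evaluation P \<eta>) f"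
      using dual_add[of f "TS V U" \<xi> \<eta>] PD \<xi> \<eta> by (cases "f \<in> P") (auto simp: ev evo)
  next
    fix c \<xi> f assume \<xi>: "\<xi> \<in> TV U"
    show "evaluation P (c *\<^sub>C \<xi>) f = (c *\<^sub>C evaluation P \<xi>) f"
      using dual_scale[of f "TS V U" \<xi> c] PD \<xi> by (cases "f \<in> P") (auto simp: ev evo scaleC_fun_apply)
  qed
  have low: "nrm (TS V U) \<xi> \<le> nrm (dual ?R) (evaluation P \<xi>)" if \<xi>: "\<xi> \<in> TV U" for \<xi>
    unfolding TS_simps
  proof (rule norm_le_elementary[OF VG TV_in[OF \<xi> V] nsD_nonneg[OF dual_normed[OF R] evD[OF \<xi>]]])
    fix \<phi> assume \<phi>: "\<phi> \<in> predual V"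
    have p: "pull V U \<phi> \<in> P" using \<phi> by (auto simp: P)
    have "cmod (evaluation P \<xi> (pull V U \<phi>)) \<le> nrm (dual ?R) (evaluation P \<xi>) * nrm ?R (pull V U \<phi>)"
      using p by (intro dual_bound[OF R evD[OF \<xi>]]) (simp add: Rs)
    also have "\<dots> \<le> nrm (dual ?R) (evaluation P \<xi>) * nrm (dual (Hom V)) \<phi>"
      unfolding Rs by (intro mult_left_mono pull_dual(2)[OF V predual_dual[OF VG \<phi>]] nsD_nonneg[OF dual_normed[OF R] evD[OF \<xi>]])
    finally show "cmod (\<phi> (\<xi> V)) \<le> nrm (dual ?R) (evaluation P \<xi>) * nrm (dual (Hom V)) \<phi>"
      by (simp add: ev[OF p] pull_apply[OF \<xi>])
  qed
  have inj: "inj_on (evaluation P) (TV U)"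
  proof (rule inj_onI)
    fix \<xi> \<eta> assume \<xi>: "\<xi> \<in> TV U" and \<eta>: "\<eta> \<in> TV U" and eq: "evaluation P \<xi> = evaluation P \<eta>"
    have d: "\<xi> - \<eta> \<in> TV U" by (rule csubspaceD(6)[OF TV_csubspace \<xi> \<eta>])
    have "evaluation P ((\<xi> - \<eta>) + \<eta>) = evaluation P (\<xi> - \<eta>) + evaluation P \<eta>"
      using lin d \<eta> unfolding linear_on_def by blast
    then have "evaluation P (\<xi> - \<eta>) = 0" using eq by simp
    then have "nrm (TS V U) (\<xi> - \<eta>) \<le> 0" using low[OF d] nsD_nrm0[OF dual_normed[OF R]] by simp
    moreover have "\<xi> - \<eta> \<in> vecs (TS V U)" using d by simp
    ultimately have "\<xi> - \<eta> = 0" using nsD_nonneg[OF T] nsD_zero_iff[OF T] by (metis order_antisym)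
    then show "\<xi> = \<eta>" by simp
  qed
  have surj: "\<exists>\<xi>\<in>TV U. evaluation P \<xi> = F" if F: "F \<in> vecs (dual ?R)" for F
  proof -
    let ?Q = "restrict_nspace (dual (Hom V)) (predual V)"
    have Qs: "vecs ?Q = predual V" "nrm ?Q = nrm (dual (Hom V))" by (simp_all add: restrict_nspace_def)
    \<comment> \<open>The functional \<open>F\<close> transported to the model space, where
      \<open>predual_bidual\<close> represents it by an operator \<open>A\<close>; the tangent
      vector with coordinate \<open>A\<close> is then the preimage of \<open>F\<close>.\<close>
    define G where "G = zero_outside (predual V) (\<lambda>\<phi>. F (pull V U \<phi>))"
    have p: "pull V U \<phi> \<in> vecs ?R" if "\<phi> \<in> predual V" for \<phi> using that by (auto simp: P restrict_nspace_def)
    have Gb: "cmod (G \<phi>) \<le> nrm (dual ?R) F * nrm ?Q \<phi>" if "\<phi> \<in> vecs ?Q" for \<phi>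
    proof -
      have \<phi>: "\<phi> \<in> predual V" using that by (simp add: Qs)
      have "cmod (F (pull V U \<phi>)) \<le> nrm (dual ?R) F * nrm ?R (pull V U \<phi>)" by (rule dual_bound[OF R F p[OF \<phi>]])
      also have "\<dots> \<le> nrm (dual ?R) F * nrm (dual (Hom V)) \<phi>"
        unfolding Rs by (intro mult_left_mono pull_dual(2)[OF V predual_dual[OF VG \<phi>]] nsD_nonneg[OF dual_normed[OF R] F])
      finally show ?thesis using \<phi> by (simp add: G_def zero_outside_def Qs)
    qed
    have "G \<in> vecs (dual ?Q)"
    proof (rule dualI[OF _ _ Gb])
      fix \<phi> assume "\<phi> \<in> vecs ?Q"
      then have \<phi>: "\<phi> \<in> predual V" by (simp add: Qs)
      show "G (c *\<^sub>C \<phi>) = c * G \<phi>" for c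
        using csubspaceD(3)[OF predual_csubspace[OF VG] \<phi>] dual_scale[OF F p[OF \<phi>]] \<phi>
        by (simp add: G_def zero_outside_def pull_lin)
      fix \<psi> assume "\<psi> \<in> vecs ?Q"
      then have \<psi>: "\<psi> \<in> predual V" by (simp add: Qs)
      show "G (\<phi> + \<psi>) = G \<phi> + G \<psi>"
        using csubspaceD(2)[OF predual_csubspace[OF VG] \<phi> \<psi>] dual_add[OF F p[OF \<phi>] p[OF \<psi>]] \<phi> \<psi>
        by (simp add: G_def zero_outside_def pull_lin)
    qed (simp_all add: Qs G_def zero_outside_def)
    then obtain A where A: "A \<in> vecs (Hom V)" and GA: "\<And>\<phi>. \<phi> \<in> predual V \<Longrightarrow> G \<phi> = \<phi> A"
      using predual_bidual[OF VG] by metis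
    have \<xi>: "tangent_of V U A \<in> TV U" by (rule tangent_of_in[OF V A])
    have "evaluation P (tangent_of V U A) f = F f" for f
    proof (cases "f \<in> P")
      case True
      then obtain \<phi> where \<phi>: "\<phi> \<in> predual V" "f = pull V U \<phi>" by (auto simp: P)
      have "f (tangent_of V U A) = \<phi> A" by (simp add: \<phi>(2) pull_apply[OF \<xi>] tangent_of_chart[OF V A])
      also have "\<dots> = F f" using GA[OF \<phi>(1)] \<phi> by (simp add: G_def zero_outside_def)
      finally show ?thesis by (simp add: ev[OF True])
    next
      case False
      then show ?thesis using dual_outside[OF F, of f] by (simp add: evo Rs)
    qed
    then show ?thesis using \<xi> by blast
  qed
  have bij: "bij_betw (evaluation P) (TV U) (vecs (dual ?R))"
    unfolding bij_betw_def using inj evD surj by blast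
  have "nrm (dual ?R) (evaluation P \<xi>) \<le> 1 * nrm (TS V U) \<xi>" if \<xi>: "\<xi> \<in> TV U" for \<xi>
  proof -
    have "nrm (dual ?R) (evaluation P \<xi>) \<le> nrm (TS V U) \<xi>"
    proof (rule dual_norm_le[OF R])
      show "0 \<le> nrm (TS V U) \<xi>" using nsD_nonneg[OF T, of \<xi>] \<xi> by simp
      show "cmod (evaluation P \<xi> f) \<le> nrm (TS V U) \<xi> * nrm ?R f" if "f \<in> vecs ?R" for f
        using fb[of f \<xi>] that \<xi> by (simp only: Rs ev)
    qed
    then show ?thesis by simp
  qed
  then have b1: "bounded_linear_map (TS V U) (dual ?R) (evaluation P)"
    unfolding bounded_linear_map_def using lin evD by (auto intro!: exI[of _ 1])
  have inv: "inv_into (TV U) (evaluation P) F \<in> TV U" "evaluation P (inv_into (TV U) (evaluation P) F) = F"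
    if "F \<in> vecs (dual ?R)" for F
    using bij that by (auto simp: bij_betw_def inv_into_into f_inv_into_f)
  have "nrm (TS V U) (inv_into (TV U) (evaluation P) F) \<le> 1 * nrm (dual ?R) F" if "F \<in> vecs (dual ?R)" for F
    using low[OF inv(1)[OF that]] inv(2)[OF that] by simp
  then have "bounded_linear_map (dual ?R) (TS V U) (inv_into (vecs (TS V U)) (evaluation P))"
    unfolding bounded_linear_map_def TS_simps(1) using inv(1) inv_into_linear_on[OF bij lin TV_csubspace] by blast
  then show ?thesis unfolding banach_iso_def using bij b1 by simp
qed

theorem theorem2:
  assumes separable: "\<exists>D :: 'h::complex_hilbert set. countable D \<and> closure D = UNIV"
  shows "\<exists>S :: ('h set \<times> (('h set \<Rightarrow> 'h \<Rightarrow> 'h) \<Rightarrow> complex)) set.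
    precotangent_bundle Gr_manifold S \<and>
    (\<forall>V\<in>Gr. \<forall>U\<in>Gr_domain V.
      S `` {U} =
        {zero_outside (tangent_vectors Gr_manifold U)
           (\<lambda>\<xi>. op_trace V (\<mu> \<circ> tangent_chart V \<xi>)) | \<mu>. \<mu> \<in> trace_class (orth V) V})"
proof -
  \<comment> \<open>The fibre over \<open>U\<close> is defined in the chart centred at
    \<open>U\<close> itself, which avoids a choice; by \<open>fib\<close> every other chart around
    \<open>U\<close> gives the same fibre.\<close>
  define S :: "('h set \<times> (('h set \<Rightarrow> 'h \<Rightarrow> 'h) \<Rightarrow> complex)) set"
    where "S = {(U, f). U \<in> Gr \<and> f \<in> pull U U ` predual U}"
  have fib: "S `` {U} = pull V U ` predual V" if V: "V \<in> around U" for U V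
  proof -
    have "U \<in> Gr" using Gr_domain_Gr aroundD(3)[OF V] by blast
    then show ?thesis using pull_predual_eq[OF around_self V] by (auto simp: S_def)
  qed
  have sub: "banach_subbundle Gr_manifold (cotangent_bundle Gr_manifold) S"
    unfolding banach_subbundle_def points_Gr
  proof (intro conjI ballI)
    show "banach_vector_bundle (Gr_manifold :: ('h set, 'h set, 'h \<Rightarrow> 'h) manifold) (cotangent_bundle Gr_manifold)"
      by (rule cotangent_bundle_Gr)
    have "f \<in> cotangent_vectors Gr_manifold U" if U: "U \<in> Gr" and f: "f \<in> pull U U ` predual U" for U and f :: "('h set \<Rightarrow> 'h \<Rightarrow> 'h) \<Rightarrow> complex"
      unfolding cotangent_vectors_eq[OF around_self[OF U]]
      using f pull_dual(1)[OF around_self[OF U] predual_dual[OF U]] by blast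
    then show "S \<subseteq> total_space Gr_manifold (cotangent_bundle Gr_manifold)"
      by (auto simp: S_def total_space_def points_Gr)
    fix p :: "'h set" assume p: "p \<in> Gr"
    \<comment> \<open>Because the fibres do not depend on the chart, the trivialization by the
      single chart \<open>p\<close> sends all of them over its domain to the same subspace.\<close>
    have "triv (cotangent_bundle Gr_manifold) p q ` (S `` {q}) = predual p" if q: "q \<in> Gr_domain p" for q
    proof -
      have a: "p \<in> around q" using p q by (simp add: charts_at_def)
      have "push p q (pull p q \<phi>) = \<phi>" if "\<phi> \<in> predual p" for \<phi> by (rule push_pull[OF a predual_dual[OF p that]])
      then show ?thesis unfolding triv_push[OF a] fib[OF a] image_image by simp
    qed
    then show "\<exists>U Y \<psi> Z. p \<in> U \<and> local_trivialization Gr_manifold (cotangent_bundle Gr_manifold) U Y \<psi> \<and>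
        closed_subspace Y Z \<and> (\<forall>q\<in>U. \<psi> q ` (S `` {q}) = Z)"
      using Gr_domain_self[OF p] cotangent_trivialization[OF p] predual_closed[OF p] by blast
  qed
  have "precotangent_bundle Gr_manifold S"
    unfolding precotangent_bundle_def using sub evaluation_iso fib by blast
  moreover have "S `` {U} =
        {zero_outside (tangent_vectors Gr_manifold U)
           (\<lambda>\<xi>. op_trace V (\<mu> \<circ> tangent_chart V \<xi>)) | \<mu>. \<mu> \<in> trace_class (orth V) V}"
    if V: "V \<in> Gr" and U: "U \<in> Gr_domain V" for V U
  proof -
    have a: "V \<in> around U" using V U by (simp add: charts_at_def)
    have "pull V U (trace_functional V \<mu>) = zero_outside (TV U) (\<lambda>\<xi>. op_trace V (\<mu> \<circ> tangent_chart V \<xi>))" for \<mu>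
    proof
      fix \<xi> show "pull V U (trace_functional V \<mu>) \<xi> = zero_outside (TV U) (\<lambda>\<xi>. op_trace V (\<mu> \<circ> tangent_chart V \<xi>)) \<xi>"
        using TV_in[OF _ a, of \<xi>]
        by (cases "\<xi> \<in> TV U") (simp_all add: pull_def zero_outside_def trace_functional_def tangent_chart_def)
    qed
    then show ?thesis unfolding fib[OF a] predual_trace[OF V] by (auto simp: image_image)
  qed
  ultimately show ?thesis by blast
qed

end
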